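(* Let $d\geq 3$ be a constant, let $q$ be a prime power and $n$ a positive integer. Let $f, g\in \mathbb{F}_q[x_1, \dots, x_n]$ be polynomials of degree at most $d$ (respectively, homogeneous polynomials of degree exactly $d$). There exists an algorithm running in time $q^{O(n)}$ that decides whether $f$ and $g$ are isomorphic, correctly for all but at most a $\frac{1}{q^{\Omega(n)}}$ fraction of $f$ (where $f$ is drawn uniformly at random as described in the context). Furthermore, if $f$ and $g$ are isomorphic, then this algorithm also computes an invertible matrix $A\in\mathrm{GL}(n,\mathbb{F}_q)$ which sends $f$ to $g$.
   Context: For $A=(a_{i,j})\in\mathrm{GL}(n,\mathbb{F}_q)$ and $f\in\mathbb{F}_q[x_1,\dots,x_n]$, define $f\circ A := f(\sum_{j=1}^n a_{1,j}x_j, \dots, \sum_{j=1}^n a_{n,j}x_j)$. Two polynomials $f,g$ are isomorphic if there exists $A\in\mathrm{GL}(n,\mathbb{F}_q)$ with $f=g\circ A$. Polynomials are given to the algorithm as the list of coefficients of their monomials. A random polynomial of degree $\leq d$ (resp. homogeneous of degree $d$) is one whose coefficients of all monomials of degree $\leq d$ (resp. exactly $d$) are drawn independently and uniformly from $\mathbb{F}_q$; the fraction in the claim is with respect to this distribution on $f$, with $g$ arbitrary. *)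

theory Defs
  imports
    "HOL-Probability.Product_PMF"
    "HOL-Library.Landau_Symbols"
    "HOL-Algebra.Indexed_Polynomials"
begin

section \<open>Multivariate polynomials and linear substitution\<close>

text \<open>
  As in \<^theory>\<open>HOL-Algebra.Indexed_Polynomials\<close>, a monomial is a multiset of variables and a
  polynomial is its coefficient function. That theory has addition and multiplication by a single
  variable only; \<open>mpoly_ring\<close> adds the full (convolution) product.
\<close>

definition mpoly_ring :: "('a, 'm) ring_scheme \<Rightarrow> 'v set \<Rightarrow> ('v multiset \<Rightarrow> 'a) ring" where
  "mpoly_ring R V =
    \<lparr>carrier = ring.indexed_pset R V (carrier R),
     mult = (\<lambda>p r m. \<Oplus>\<^bsub>R\<^esub>a\<in>{a. a \<subseteq># m}. p a \<otimes>\<^bsub>R\<^esub> r (m - a)),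
     one = ring.indexed_const R \<one>\<^bsub>R\<^esub>,
     zero = ring.indexed_const R \<zero>\<^bsub>R\<^esub>,
     add = ring.indexed_padd R\<rparr>"

text \<open>
  Here and below \<open>D\<close> is the set of admissible degrees: \<open>{..d}\<close> gives the polynomials of degree at
  most \<open>d\<close>, and \<open>{d}\<close> the homogeneous ones of degree \<open>d\<close> (with the zero polynomial).
\<close>

definition polys :: "('a, 'm) ring_scheme \<Rightarrow> nat \<Rightarrow> nat set \<Rightarrow> (nat multiset \<Rightarrow> 'a) set" where
  "polys R n D = {p \<in> carrier (mpoly_ring R {..<n}). \<forall>m. p m \<noteq> \<zero>\<^bsub>R\<^esub> \<longrightarrow> size m \<in> D}"

definition monomials :: "nat \<Rightarrow> nat set \<Rightarrow> nat multiset set" where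
  "monomials n D = {m. set_mset m \<subseteq> {..<n} \<and> size m \<in> D}"

definition random_poly ::
    "('a, 'm) ring_scheme \<Rightarrow> nat \<Rightarrow> nat set \<Rightarrow> (nat multiset \<Rightarrow> 'a) pmf" where
  "random_poly R n D = Pi_pmf (monomials n D) \<zero>\<^bsub>R\<^esub> (\<lambda>_. pmf_of_set (carrier R))"

definition GL :: "nat \<Rightarrow> ('a, 'm) ring_scheme \<Rightarrow> (nat \<Rightarrow> nat \<Rightarrow> 'a) set" where
  "GL n R = {A. (\<forall>i<n. \<forall>j<n. A i j \<in> carrier R) \<and>
     (\<exists>B. (\<forall>i<n. \<forall>j<n. B i j \<in> carrier R) \<and>
       (\<forall>i<n. \<forall>j<n.
          (\<Oplus>\<^bsub>R\<^esub>k\<in>{..<n}. A i k \<otimes>\<^bsub>R\<^esub> B k j) = (if i = j then \<one>\<^bsub>R\<^esub> else \<zero>\<^bsub>R\<^esub>) \<and>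
          (\<Oplus>\<^bsub>R\<^esub>k\<in>{..<n}. B i k \<otimes>\<^bsub>R\<^esub> A k j) = (if i = j then \<one>\<^bsub>R\<^esub> else \<zero>\<^bsub>R\<^esub>)))}"

definition linear_form ::
    "('a, 'm) ring_scheme \<Rightarrow> nat \<Rightarrow> (nat \<Rightarrow> 'a) \<Rightarrow> (nat multiset \<Rightarrow> 'a)" where
  "linear_form R n a =
     (let P = mpoly_ring R {..<n} in
      \<Oplus>\<^bsub>P\<^esub>j\<in>{..<n}. ring.indexed_const R (a j) \<otimes>\<^bsub>P\<^esub> ring.indexed_var R j)"

definition lin_subst ::
    "('a, 'm) ring_scheme \<Rightarrow> nat \<Rightarrow> (nat multiset \<Rightarrow> 'a) \<Rightarrow> (nat \<Rightarrow> nat \<Rightarrow> 'a)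
      \<Rightarrow> (nat multiset \<Rightarrow> 'a)" where
  "lin_subst R n g A =
     (let P = mpoly_ring R {..<n} in
      \<Oplus>\<^bsub>P\<^esub>m\<in>{m. g m \<noteq> \<zero>\<^bsub>R\<^esub>}.
        ring.indexed_const R (g m) \<otimes>\<^bsub>P\<^esub>
        (\<Otimes>\<^bsub>P\<^esub>i\<in>{..<n}. linear_form R n (A i) [^]\<^bsub>P\<^esub> count m i))"

definition poly_iso ::
    "('a, 'm) ring_scheme \<Rightarrow> nat \<Rightarrow> (nat multiset \<Rightarrow> 'a) \<Rightarrow> (nat multiset \<Rightarrow> 'a) \<Rightarrow> bool" where
  "poly_iso R n f g \<longleftrightarrow> (\<exists>A\<in>GL n R. f = lin_subst R n g A)"


section \<open>Machine model\<close>

text \<open>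
  A random access machine in structured form: finitely many arrays of natural numbers (a scalar is
  an array used at index 0 only), addition, truncated subtraction, indirect addressing. The cost is
  one unit per executed command or test. There is deliberately no multiplication: with
  addition and subtraction only, unit-cost time is polynomially related to Turing machine time,
  whereas unit-cost multiplication would produce numbers of exponential length.
\<close>

type_synonym vname = string
type_synonym state = "vname \<Rightarrow> nat \<Rightarrow> nat"

datatype aexp = N nat | Cell vname aexp | Plus aexp aexp | Minus aexp aexp

fun aval :: "aexp \<Rightarrow> state \<Rightarrow> nat" where
  "aval (N k) s = k"
| "aval (Cell x a) s = s x (aval a s)"
| "aval (Plus a b) s = aval a s + aval b s"
| "aval (Minus a b) s = aval a s - aval b s"

datatype com =
    Skip
  | Assign vname aexp aexp
  | Seq com com
  | Cond aexp com com
  | While aexp com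

text \<open>
  \<open>exec c s t s'\<close>: started in state \<open>s\<close>, the program \<open>c\<close> halts after \<open>t\<close> steps in state \<open>s'\<close>.
  \<open>Assign x a b\<close> is \<open>x[a] := b\<close>; a test succeeds if its value is nonzero.
\<close>

inductive exec :: "com \<Rightarrow> state \<Rightarrow> nat \<Rightarrow> state \<Rightarrow> bool" where
  Skip: "exec Skip s 1 s"
| Assign: "exec (Assign x a b) s 1 (s(x := (s x)(aval a s := aval b s)))"
| Seq: "exec c1 s1 t1 s2 \<Longrightarrow> exec c2 s2 t2 s3 \<Longrightarrow> exec (Seq c1 c2) s1 (t1 + t2) s3"
| CondTrue: "aval b s \<noteq> 0 \<Longrightarrow> exec c1 s t s' \<Longrightarrow> exec (Cond b c1 c2) s (1 + t) s'"
| CondFalse: "aval b s = 0 \<Longrightarrow> exec c2 s t s' \<Longrightarrow> exec (Cond b c1 c2) s (1 + t) s'"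
| WhileFalse: "aval b s = 0 \<Longrightarrow> exec (While b c) s 1 s"
| WhileTrue: "aval b s1 \<noteq> 0 \<Longrightarrow> exec c s1 t1 s2 \<Longrightarrow> exec (While b c) s2 t2 s3 \<Longrightarrow>
    exec (While b c) s1 (1 + t1 + t2) s3"

lemma exec_deterministic:
  "exec c s t s' \<Longrightarrow> exec c s u s'' \<Longrightarrow> u = t \<and> s'' = s'"
proof (induction arbitrary: u s'' rule: exec.induct)
  case (Skip s)
  then show ?case by cases simp
next
  case (Assign x a b s)
  then show ?case by cases simp
next
  case (Seq c1 s1 t1 s2 c2 t2 s3)
  from Seq.prems obtain t1' s2' t2' where
    "exec c1 s1 t1' s2'" "exec c2 s2' t2' s''" "u = t1' + t2'"
    by cases blast
  with Seq.IH show ?case by blast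
next
  case (CondTrue b s c1 t s' c2)
  from CondTrue.prems CondTrue.hyps(1) obtain t' where "exec c1 s t' s''" "u = 1 + t'"
    by cases blast+
  with CondTrue.IH show ?case by blast
next
  case (CondFalse b s c2 t s' c1)
  from CondFalse.prems CondFalse.hyps(1) obtain t' where "exec c2 s t' s''" "u = 1 + t'"
    by cases blast+
  with CondFalse.IH show ?case by blast
next
  case (WhileFalse b s c)
  from WhileFalse.prems WhileFalse.hyps show ?case by cases blast+
next
  case (WhileTrue b s1 c t1 s2 t2 s3)
  from WhileTrue.prems WhileTrue.hyps(1) obtain t1' s2' t2' where
    "exec c s1 t1' s2'" "exec (While b c) s2' t2' s''" "u = 1 + t1' + t2'"
    by cases blast+
  with WhileTrue.IH show ?case by blast
qed


section \<open>Input and output encoding\<close>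

text \<open>The monomials of degree \<open>k\<close> in the variables \<open>0, \<dots>, n - 1\<close>, in a fixed order.\<close>

fun degree_monos :: "nat \<Rightarrow> nat \<Rightarrow> nat multiset list" where
  "degree_monos 0 k = (if k = 0 then [{#}] else [])"
| "degree_monos (Suc n) k =
     concat (map (\<lambda>e. map (\<lambda>m. m + replicate_mset e n) (degree_monos n (k - e))) [0..<Suc k])"

lemma set_degree_monos: "set (degree_monos n k) = {m. set_mset m \<subseteq> {..<n} \<and> size m = k}"
proof (induction n arbitrary: k)
  case (Suc n)
  show ?case
  proof (intro equalityI subsetI)
    fix m assume "m \<in> set (degree_monos (Suc n) k)"
    then obtain e m' where "e \<le> k" "m' \<in> set (degree_monos n (k - e))"
      "m = m' + replicate_mset e n"
      by (auto simp del: upt_Suc simp: less_Suc_eq_le)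
    then show "m \<in> {m. set_mset m \<subseteq> {..<Suc n} \<and> size m = k}"
      using Suc by (auto simp: subset_iff split: if_splits)
  next
    fix m assume m: "m \<in> {m. set_mset m \<subseteq> {..<Suc n} \<and> size m = k}"
    define m' where "m' = filter_mset (\<lambda>x. x \<noteq> n) m"
    have split: "m = m' + replicate_mset (count m n) n"
      unfolding m'_def by (rule multiset_eqI) auto
    have "size m = size m' + count m n"
      by (subst split) simp
    then have le: "count m n \<le> k" and sz: "size m' = k - count m n"
      using m by auto
    have "set_mset m' \<subseteq> {..<n}"
      using m by (auto simp: m'_def less_Suc_eq)
    with sz have "m' \<in> set (degree_monos n (k - count m n))"
      using Suc by auto
    with split le show "m \<in> set (degree_monos (Suc n) k)"
      by (auto simp del: upt_Suc intro!: bexI[of _ "count m n"])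
  qed
qed auto

lemma distinct_degree_monos: "distinct (degree_monos n k)"
proof (induction n arbitrary: k)
  case (Suc n)
  let ?L = "\<lambda>e. map (\<lambda>m. m + replicate_mset e n) (degree_monos n (k - e))"
  have cnt: "count m n = e" if "m \<in> set (?L e)" for m e
    using that by (auto simp: set_degree_monos count_eq_zero_iff)
  have "distinct (concat (map ?L xs))" if "distinct xs" for xs
    using that
  proof (induction xs)
    case (Cons e xs)
    have "distinct (?L e)"
      using Suc by (simp add: distinct_map inj_on_def)
    moreover have "set (?L e) \<inter> set (concat (map ?L xs)) = {}"
    proof (rule ccontr)
      assume "set (?L e) \<inter> set (concat (map ?L xs)) \<noteq> {}"
      then obtain m e' where "m \<in> set (?L e)" "e' \<in> set xs" "m \<in> set (?L e')"
        by auto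
      then show False using cnt Cons.prems by (metis distinct.simps(2))
    qed
    ultimately show ?case using Cons by simp
  qed simp
  then show ?case
    by (simp only: degree_monos.simps distinct_upt)
qed auto

definition monomial_list :: "nat \<Rightarrow> nat set \<Rightarrow> nat multiset list" where
  "monomial_list n D = concat (map (degree_monos n) (sorted_list_of_set D))"

lemma set_monomial_list: "finite D \<Longrightarrow> set (monomial_list n D) = monomials n D"
  by (auto simp: monomial_list_def monomials_def set_degree_monos)

lemma distinct_monomial_list: "distinct (monomial_list n D)"
proof -
  have "distinct (concat (map (degree_monos n) xs))" if "distinct xs" for xs
    using that by (induction xs) (auto simp: distinct_degree_monos set_degree_monos)
  then show ?thesis by (simp add: monomial_list_def)
qed

definition scalar :: "nat \<Rightarrow> nat \<Rightarrow> nat" where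
  "scalar k = (\<lambda>i. if i = 0 then k else 0)"

definition array :: "nat list \<Rightarrow> nat \<Rightarrow> nat" where
  "array xs = (\<lambda>i. if i < length xs then xs ! i else 0)"

text \<open>
  The elements of the field \<open>F\<close> are the numbers below \<open>q\<close>; its operations are given by tables.
\<close>

definition input_state ::
    "nat ring \<Rightarrow> nat \<Rightarrow> nat \<Rightarrow> nat set \<Rightarrow> (nat multiset \<Rightarrow> nat) \<Rightarrow> (nat multiset \<Rightarrow> nat) \<Rightarrow> state" where
  "input_state F q n D f g = (\<lambda>_ _. 0)
     (''q'' := scalar q,
      ''n'' := scalar n,
      ''zero'' := scalar \<zero>\<^bsub>F\<^esub>,
      ''one'' := scalar \<one>\<^bsub>F\<^esub>,
      ''add'' := array [a \<oplus>\<^bsub>F\<^esub> b. a \<leftarrow> [0..<q], b \<leftarrow> [0..<q]],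
      ''mul'' := array [a \<otimes>\<^bsub>F\<^esub> b. a \<leftarrow> [0..<q], b \<leftarrow> [0..<q]],
      ''f'' := array (map f (monomial_list n D)),
      ''g'' := array (map g (monomial_list n D)))"

definition output_iso :: "state \<Rightarrow> bool" where
  "output_iso s \<longleftrightarrow> s ''iso'' 0 \<noteq> 0"

definition output_matrix :: "nat \<Rightarrow> state \<Rightarrow> nat \<Rightarrow> nat \<Rightarrow> nat" where
  "output_matrix n s = (\<lambda>i j. s ''A'' (i * n + j))"

definition halts_within ::
    "com \<Rightarrow> nat ring \<Rightarrow> nat \<Rightarrow> nat \<Rightarrow> nat set \<Rightarrow> (nat multiset \<Rightarrow> nat) \<Rightarrow> (nat multiset \<Rightarrow> nat)
      \<Rightarrow> real \<Rightarrow> bool" where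
  "halts_within c F q n D f g b \<longleftrightarrow>
     (\<exists>t s. exec c (input_state F q n D f g) t s \<and> real t \<le> b)"

definition answers_correctly ::
    "com \<Rightarrow> nat ring \<Rightarrow> nat \<Rightarrow> nat \<Rightarrow> nat set \<Rightarrow> (nat multiset \<Rightarrow> nat) \<Rightarrow> (nat multiset \<Rightarrow> nat)
      \<Rightarrow> bool" where
  "answers_correctly c F q n D f g \<longleftrightarrow>
     (\<exists>t s. exec c (input_state F q n D f g) t s \<and>
        (output_iso s \<longleftrightarrow> poly_iso F n f g) \<and>
        (poly_iso F n f g \<longrightarrow>
           output_matrix n s \<in> GL n F \<and> f = lin_subst F n g (output_matrix n s)))"

end

theory Submission
  imports Defs
begin

text \<open>
  Put \<open>s = 80 (d - 2)\<close>. For \<open>i < 80\<close>, the derivatives of a polynomial \<open>f\<close> with respect to the \<open>d - 2\<close>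
  variables of the \<open>i\<close>-th block and to two further variables give a symmetric matrix \<open>F i\<close>. For all but
  a fraction \<open>1 / q ^ n\<close> of the polynomials \<open>f\<close> these matrices expand: there are no subspaces \<open>U\<close>, \<open>U'\<close>
  such that every \<open>F i\<close> maps \<open>U\<close> into \<open>U'\<close>, where \<open>U\<close> has at least \<open>q ^ (2 s)\<close> elements, \<open>U'\<close> is not
  larger than \<open>U\<close> and has dimension at most \<open>n / 2\<close>. Expansion forces the linear system \<open>F i A = C F i\<close>
  to have at most \<open>q ^ (10 n s)\<close> solutions \<open>(A, C)\<close>, because either the kernel or the image of \<open>A\<close> is
  small.

  If \<open>f\<close> arises from \<open>g\<close> by the substitution \<open>A\<close>, then \<open>F i = A\<^sup>T (G i) A\<close>, where \<open>G i\<close> consists of the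
  derivatives of \<open>g\<close> in the directions of the columns of \<open>A\<close> belonging to the \<open>i\<close>-th block. The algorithm
  guesses the first \<open>s\<close> columns of \<open>A\<close>, which determine all \<open>G i\<close>, solves the linear system
  \<open>G i A = C F i\<close> by elimination, and tries its solutions. For expanding \<open>f\<close> there are at most
  \<open>q ^ (10 n s)\<close> of them, since the true \<open>A\<close> turns the system into the previous one. Every candidate is
  verified, so that only the completeness of the search depends on \<open>f\<close>.
\<close>

section \<open>Linear algebra over a finite field\<close>

text \<open>Polarization multiplies a coefficient by the factorials in \<open>cfac\<close>, which
  may vanish in the field. The randomness is therefore drawn only from monomials consisting of one
  block and two distinct variables outside all blocks, where \<open>cfac\<close> is 1; as d >= 3,
  blocks are nonempty and different blocks use different coefficients. Giving up the block variables
  costs s dimensions, hence expansion is demanded from dimension 2 s on. The number 80 is chosen to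
  beat a union bound: a violation is witnessed by k positions, k vectors and a subspace of dimension
  below 5 k, at most q ^ (n + 6 k n) choices, and each choice determines at least 80 k n / 8
  coefficients from the others. Expansion says nothing once U' exceeds half the dimension; this
  suffices because dim im A + dim ker A = n, so that one of the two has dimension at most n / 2.
  Since expansion concerns f alone, one exceptional set of f serves all g. The machine lacks
  multiplication, so programs are obtained from a calculus of expressions whose values and running
  times are polynomial in a size parameter; with this size equal to q ^ n, polynomial means q ^
  O(n).\<close>

lemma card_eq_fibers:
  assumes "finite U" "\<And>x. x \<in> U \<Longrightarrow> card {y \<in> U. \<phi> y = \<phi> x} = k"
  shows "card U = card (\<phi> ` U) * k"
proof -
  have "card U = (\<Sum>y\<in>\<phi> ` U. \<Sum>x\<in>{x \<in> U. \<phi> x = y}. 1)"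
    using sum.image_gen[OF assms(1), of "\<lambda>_. 1::nat" \<phi>] by simp
  also have "\<dots> = (\<Sum>y\<in>\<phi> ` U. k)" using assms(2) by (intro sum.cong) auto
  finally show ?thesis by simp
qed

lemma card_le_fibers:
  assumes "finite U" "\<And>x. x \<in> U \<Longrightarrow> card {y \<in> U. \<phi> y = \<phi> x} \<le> k"
  shows "card U \<le> card (\<phi> ` U) * k"
proof -
  have "card U = (\<Sum>y\<in>\<phi> ` U. \<Sum>x\<in>{x \<in> U. \<phi> x = y}. 1)"
    using sum.image_gen[OF assms(1), of "\<lambda>_. 1::nat" \<phi>] by simp
  also have "\<dots> \<le> (\<Sum>y\<in>\<phi> ` U. k)" using assms(2) by (intro sum_mono) auto
  finally show ?thesis by simp
qed

lemma (in abelian_monoid) finsum_swap: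
  assumes "finite A" "finite B" "\<And>i j. i \<in> A \<Longrightarrow> j \<in> B \<Longrightarrow> f i j \<in> carrier G"
  shows "(\<Oplus>i\<in>A. \<Oplus>j\<in>B. f i j) = (\<Oplus>j\<in>B. \<Oplus>i\<in>A. f i j)"
  using assms(1,3)
proof (induction A)
  case empty
  then show ?case by (simp add: finsum_zero)
next
  case (insert a A)
  have "(\<Oplus>i\<in>insert a A. \<Oplus>j\<in>B. f i j) = (\<Oplus>j\<in>B. f a j) \<oplus> (\<Oplus>j\<in>B. \<Oplus>i\<in>A. f i j)"
    using insert by (subst finsum_insert) (auto intro!: finsum_closed)
  also have "\<dots> = (\<Oplus>j\<in>B. f a j \<oplus> (\<Oplus>i\<in>A. f i j))"
    using insert by (subst finsum_addf) (auto intro!: finsum_closed)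
  also have "\<dots> = (\<Oplus>j\<in>B. \<Oplus>i\<in>insert a A. f i j)"
    using insert by (intro finsum_cong') (auto intro!: finsum_closed simp: finsum_insert Pi_def)
  finally show ?case .
qed

section \<open>Coordinate spaces over a finite field: subspaces, rank and nullity by
  counting\<close>

locale fin_field = field R for R (structure) +
  assumes fin: "finite (carrier R)"
begin

abbreviation q :: nat where "q \<equiv> card (carrier R)"

lemma q_ge_2: "2 \<le> q"
proof -
  have "card {\<zero>, \<one>} \<le> q" by (rule card_mono[OF fin]) auto
  then show ?thesis by simp
qed

lemma q_pow_pos [simp]: "0 < q ^ k" using q_ge_2 by simp

text \<open>Vectors are extensional functions, so that \<open>V n\<close> is finite and its elements
  are equal once they agree below n.\<close>

definition V :: "nat \<Rightarrow> (nat \<Rightarrow> 'a) set" where "V n = {..<n} \<rightarrow>\<^sub>E carrier R"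

text \<open>The single operation x + a y covers sums, scaling and, with a = -1, differences; closure
  under it defines subspaces.\<close>

definition vlin :: "nat \<Rightarrow> (nat \<Rightarrow> 'a) \<Rightarrow> 'a \<Rightarrow> (nat \<Rightarrow> 'a) \<Rightarrow> nat \<Rightarrow> 'a" where
  "vlin n x a y = (\<lambda>i\<in>{..<n}. x i \<oplus> a \<otimes> y i)"

definition vz :: "nat \<Rightarrow> nat \<Rightarrow> 'a" where "vz n = (\<lambda>i\<in>{..<n}. \<zero>)"

definition subsp :: "nat \<Rightarrow> (nat \<Rightarrow> 'a) set \<Rightarrow> bool" where
  "subsp n U \<longleftrightarrow> U \<subseteq> V n \<and> vz n \<in> U \<and> (\<forall>x\<in>U. \<forall>y\<in>U. \<forall>a\<in>carrier R. vlin n x a y \<in> U)"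

lemma V_mem: "x \<in> V n \<Longrightarrow> i < n \<Longrightarrow> x i \<in> carrier R"
  by (auto simp: V_def)

lemma V_eqI: "x \<in> V n \<Longrightarrow> y \<in> V n \<Longrightarrow> (\<And>i. i < n \<Longrightarrow> x i = y i) \<Longrightarrow> x = y"
  unfolding V_def by (rule PiE_ext) auto

lemma restrict_V: "(\<And>i. i < n \<Longrightarrow> h i \<in> carrier R) \<Longrightarrow> (\<lambda>i\<in>{..<n}. h i) \<in> V n"
  by (auto simp: V_def)

lemma finite_V [simp]: "finite (V n)"
  unfolding V_def using fin by (intro finite_PiE) auto

lemma card_V: "card (V n) = q ^ n"
  unfolding V_def by (simp add: card_PiE)

lemma vz_V [simp]: "vz n \<in> V n"
  by (auto simp: V_def vz_def)

lemma vlin_V: "x \<in> V n \<Longrightarrow> y \<in> V n \<Longrightarrow> a \<in> carrier R \<Longrightarrow> vlin n x a y \<in> V n"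
  by (auto simp: V_def vlin_def)

lemma vlin_apply [simp]: "i < n \<Longrightarrow> vlin n x a y i = x i \<oplus> a \<otimes> y i"
  by (simp add: vlin_def)

lemma vz_apply [simp]: "i < n \<Longrightarrow> vz n i = \<zero>"
  by (simp add: vz_def)

lemma subsp_V: "subsp n (V n)"
  by (simp add: subsp_def vlin_V)

lemma subspD:
  assumes "subsp n U"
  shows "U \<subseteq> V n" "vz n \<in> U" "\<And>x y a. x \<in> U \<Longrightarrow> y \<in> U \<Longrightarrow> a \<in> carrier R \<Longrightarrow> vlin n x a y \<in> U"
    "\<And>x i. x \<in> U \<Longrightarrow> i < n \<Longrightarrow> x i \<in> carrier R" "finite U"
  using assms V_mem finite_subset[OF _ finite_V] by (auto simp: subsp_def)

lemma minus_one_mult: "y \<in> carrier R \<Longrightarrow> \<ominus> \<one> \<otimes> y = \<ominus> y"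
  by (simp add: l_minus)

lemma sub_add_cancel:
  assumes "x \<in> carrier R" "y \<in> carrier R"
  shows "(x \<oplus> \<ominus> \<one> \<otimes> y) \<oplus> y = x" "(x \<oplus> y) \<oplus> \<ominus> \<one> \<otimes> y = x"
  using assms by (simp_all add: minus_one_mult a_assoc l_neg r_neg)

lemma sub_self: "x \<in> carrier R \<Longrightarrow> x \<oplus> \<ominus> \<one> \<otimes> x = \<zero>"
  by (simp add: minus_one_mult r_neg)

lemma eq_iff_sub: "x \<in> carrier R \<Longrightarrow> y \<in> carrier R \<Longrightarrow> x = y \<longleftrightarrow> x \<oplus> \<ominus> \<one> \<otimes> y = \<zero>"
  using r_right_minus_eq[of x y] by (simp add: minus_one_mult minus_eq)

lemma vlin_cancel:
  assumes "x \<in> V n" "y \<in> V n"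
  shows "vlin n (vlin n x (\<ominus> \<one>) y) \<one> y = x" "vlin n (vlin n x \<one> y) (\<ominus> \<one>) y = x"
  using assms by (auto intro!: V_eqI[of _ n] vlin_V simp: sub_add_cancel V_mem)

lemma V_eq_iff_sub:
  assumes "x \<in> V n" "y \<in> V n"
  shows "x = y \<longleftrightarrow> vlin n x (\<ominus> \<one>) y = vz n"
proof
  assume "vlin n x (\<ominus> \<one>) y = vz n"
  then have "x i \<oplus> \<ominus> \<one> \<otimes> y i = \<zero>" if "i < n" for i
    using that by (metis vlin_apply vz_apply)
  then show "x = y"
    using eq_iff_sub[OF V_mem[OF assms(1)] V_mem[OF assms(2)]] by (intro V_eqI[OF assms]) blast
next
  assume "x = y"
  then show "vlin n x (\<ominus> \<one>) y = vz n"
    using assms by (intro V_eqI[of _ n]) (auto intro!: vlin_V simp: V_mem sub_self)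
qed

text \<open>The fibres of \<open>\<phi>\<close> are translates of K. Only this is required of
  \<open>\<phi>\<close>, so that the lemma applies alike to matrices, to the pairing with a fixed
  vector and to reading off one coordinate.\<close>

lemma card_kernel_image:
  assumes U: "subsp n U" and \<phi>: "\<And>x y. x \<in> U \<Longrightarrow> y \<in> U \<Longrightarrow> \<phi> x = \<phi> y \<longleftrightarrow> vlin n x (\<ominus> \<one>) y \<in> K"
    and K: "K \<subseteq> U"
  shows "card U = card (\<phi> ` U) * card K"
proof (rule card_eq_fibers)
  show "finite U" by (rule subspD(5)[OF U])
  fix x assume x: "x \<in> U"
  note UV = subspD(1)[OF U]
  have "bij_betw (\<lambda>y. vlin n y (\<ominus> \<one>) x) {y \<in> U. \<phi> y = \<phi> x} K"
  proof (rule bij_betw_byWitness[where f' = "\<lambda>k. vlin n k \<one> x"])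
    show "\<forall>a\<in>{y \<in> U. \<phi> y = \<phi> x}. vlin n (vlin n a (\<ominus> \<one>) x) \<one> x = a"
      using x UV by (auto intro!: vlin_cancel)
    show "\<forall>a'\<in>K. vlin n (vlin n a' \<one> x) (\<ominus> \<one>) x = a'"
      using x UV K by (auto intro!: vlin_cancel)
    show "(\<lambda>y. vlin n y (\<ominus> \<one>) x) ` {y \<in> U. \<phi> y = \<phi> x} \<subseteq> K"
      using \<phi> x by auto
    show "(\<lambda>k. vlin n k \<one> x) ` K \<subseteq> {y \<in> U. \<phi> y = \<phi> x}"
    proof clarify
      fix k assume k: "k \<in> K"
      have "vlin n k \<one> x \<in> U" using k K x by (intro subspD(3)[OF U]) auto
      moreover have "vlin n (vlin n k \<one> x) (\<ominus> \<one>) x = k" using k K x UV by (intro vlin_cancel) auto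
      ultimately show "vlin n k \<one> x \<in> U \<and> \<phi> (vlin n k \<one> x) = \<phi> x" using \<phi> x k by auto
    qed
  qed
  then show "card {y \<in> U. \<phi> y = \<phi> x} = card K" by (rule bij_betw_same_card)
qed

definition mat :: "nat \<Rightarrow> (nat \<Rightarrow> nat \<Rightarrow> 'a) \<Rightarrow> bool" where
  "mat n A \<longleftrightarrow> (\<forall>i<n. \<forall>j<n. A i j \<in> carrier R)"

definition mv :: "nat \<Rightarrow> (nat \<Rightarrow> nat \<Rightarrow> 'a) \<Rightarrow> (nat \<Rightarrow> 'a) \<Rightarrow> nat \<Rightarrow> 'a" where
  "mv n A x = (\<lambda>i\<in>{..<n}. \<Oplus>j\<in>{..<n}. A i j \<otimes> x j)"

abbreviation (input) tr :: "(nat \<Rightarrow> nat \<Rightarrow> 'a) \<Rightarrow> nat \<Rightarrow> nat \<Rightarrow> 'a" where "tr A \<equiv> \<lambda>i j. A j i"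

lemma matD: "mat n A \<Longrightarrow> i < n \<Longrightarrow> j < n \<Longrightarrow> A i j \<in> carrier R"
  by (simp add: mat_def)

lemma mat_tr: "mat n A \<Longrightarrow> mat n (tr A)"
  by (simp add: mat_def)

lemma mv_apply: "i < n \<Longrightarrow> mv n A x i = (\<Oplus>j\<in>{..<n}. A i j \<otimes> x j)"
  by (simp add: mv_def)

lemma mv_V: "mat n A \<Longrightarrow> x \<in> V n \<Longrightarrow> mv n A x \<in> V n"
  unfolding mv_def by (rule restrict_V) (auto intro!: finsum_closed simp: matD V_mem)

lemma finsum_lin:
  assumes "finite A" "\<And>i. i \<in> A \<Longrightarrow> g i \<in> carrier R" "\<And>i. i \<in> A \<Longrightarrow> h i \<in> carrier R" "a \<in> carrier R"
  shows "(\<Oplus>i\<in>A. g i \<oplus> a \<otimes> h i) = (\<Oplus>i\<in>A. g i) \<oplus> a \<otimes> (\<Oplus>i\<in>A. h i)"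
  using assms by (subst finsum_addf) (auto simp: finsum_rdistr Pi_def)

lemma mv_vlin:
  assumes "mat n A" "x \<in> V n" "y \<in> V n" "a \<in> carrier R"
  shows "mv n A (vlin n x a y) = vlin n (mv n A x) a (mv n A y)"
proof (rule V_eqI[of _ n])
  show "mv n A (vlin n x a y) \<in> V n" "vlin n (mv n A x) a (mv n A y) \<in> V n"
    using assms by (simp_all add: mv_V vlin_V)
  fix i assume i: "i < n"
  have "(\<Oplus>j\<in>{..<n}. A i j \<otimes> vlin n x a y j) = (\<Oplus>j\<in>{..<n}. A i j \<otimes> x j \<oplus> a \<otimes> (A i j \<otimes> y j))"
    using assms i by (intro finsum_cong') (auto simp: matD V_mem r_distr m_lcomm)
  also have "\<dots> = (\<Oplus>j\<in>{..<n}. A i j \<otimes> x j) \<oplus> a \<otimes> (\<Oplus>j\<in>{..<n}. A i j \<otimes> y j)"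
    using assms i by (intro finsum_lin) (auto simp: matD V_mem)
  finally show "mv n A (vlin n x a y) i = vlin n (mv n A x) a (mv n A y) i"
    using i by (simp add: mv_apply)
qed

lemma mv_vz: "mat n A \<Longrightarrow> mv n A (vz n) = vz n"
  by (rule V_eqI[of _ n]) (auto simp: mv_V mv_apply matD finsum_zero cong: finsum_cong)

definition ker :: "nat \<Rightarrow> (nat \<Rightarrow> nat \<Rightarrow> 'a) \<Rightarrow> (nat \<Rightarrow> 'a) set" where
  "ker n A = {x \<in> V n. mv n A x = vz n}"

definition im :: "nat \<Rightarrow> (nat \<Rightarrow> nat \<Rightarrow> 'a) \<Rightarrow> (nat \<Rightarrow> 'a) set" where
  "im n A = mv n A ` V n"

lemma vlin_vz: "a \<in> carrier R \<Longrightarrow> vlin n (vz n) a (vz n) = vz n"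
  by (rule V_eqI[of _ n]) (auto simp: vlin_V)

lemma subsp_ker: "mat n A \<Longrightarrow> subsp n (ker n A)"
  by (auto simp: subsp_def ker_def mv_vz mv_vlin vlin_V vlin_vz)

lemma subsp_im:
  assumes "mat n A" shows "subsp n (im n A)"
  unfolding subsp_def
proof (intro conjI ballI)
  show "im n A \<subseteq> V n" using assms by (auto simp: im_def mv_V)
  show "vz n \<in> im n A" unfolding im_def using mv_vz[OF assms] vz_V by (metis imageI)
  fix x y a assume "x \<in> im n A" "y \<in> im n A" and a: "a \<in> carrier R"
  then obtain x' y' where "x' \<in> V n" "y' \<in> V n" "x = mv n A x'" "y = mv n A y'" by (auto simp: im_def)
  then show "vlin n x a y \<in> im n A"
    using mv_vlin[OF assms _ _ a] vlin_V a unfolding im_def by (metis imageI)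
qed

lemma card_im_ker: assumes A: "mat n A" shows "card (im n A) * card (ker n A) = q ^ n"
proof -
  have "card (V n) = card (mv n A ` V n) * card (ker n A)"
  proof (rule card_kernel_image[OF subsp_V])
    fix x y assume "x \<in> V n" "y \<in> V n"
    then show "mv n A x = mv n A y \<longleftrightarrow> vlin n x (\<ominus> \<one>) y \<in> ker n A"
      using V_eq_iff_sub[OF mv_V[OF A] mv_V[OF A], of x y] by (simp add: ker_def vlin_V mv_vlin[OF A])
  qed (auto simp: ker_def)
  then show ?thesis by (simp add: im_def card_V)
qed

definition dot :: "nat \<Rightarrow> (nat \<Rightarrow> 'a) \<Rightarrow> (nat \<Rightarrow> 'a) \<Rightarrow> 'a" where
  "dot n y x = (\<Oplus>i\<in>{..<n}. y i \<otimes> x i)"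

lemma dot_closed: "x \<in> V n \<Longrightarrow> y \<in> V n \<Longrightarrow> dot n y x \<in> carrier R"
  unfolding dot_def by (auto intro!: finsum_closed simp: V_mem)

lemma dot_mv_tr:
  assumes "mat n A" "x \<in> V n" "y \<in> V n"
  shows "dot n y (mv n A x) = dot n x (mv n (tr A) y)"
proof -
  have "dot n y (mv n A x) = (\<Oplus>i\<in>{..<n}. \<Oplus>j\<in>{..<n}. y i \<otimes> (A i j \<otimes> x j))"
    unfolding dot_def using assms
    by (intro finsum_cong') (auto simp: mv_apply finsum_rdistr V_mem matD Pi_def intro!: finsum_closed)
  also have "\<dots> = (\<Oplus>j\<in>{..<n}. \<Oplus>i\<in>{..<n}. y i \<otimes> (A i j \<otimes> x j))"
    using assms by (intro finsum_swap) (auto simp: V_mem matD)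
  also have "\<dots> = (\<Oplus>j\<in>{..<n}. x j \<otimes> (\<Oplus>i\<in>{..<n}. A i j \<otimes> y i))"
  proof (rule finsum_cong')
    fix j assume j: "j \<in> {..<n}"
    then have "x j \<otimes> (\<Oplus>i\<in>{..<n}. A i j \<otimes> y i) = (\<Oplus>i\<in>{..<n}. x j \<otimes> (A i j \<otimes> y i))"
      using assms by (intro finsum_rdistr) (auto simp: V_mem matD)
    also have "\<dots> = (\<Oplus>i\<in>{..<n}. y i \<otimes> (A i j \<otimes> x j))"
      using assms j by (intro finsum_cong') (auto simp: V_mem matD m_ac)
    finally show "(\<Oplus>i\<in>{..<n}. y i \<otimes> (A i j \<otimes> x j)) = x j \<otimes> (\<Oplus>i\<in>{..<n}. A i j \<otimes> y i)" ..
  qed (use assms in \<open>auto intro!: finsum_closed simp: V_mem matD\<close>)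
  also have "\<dots> = dot n x (mv n (tr A) y)"
    unfolding dot_def using assms by (intro finsum_cong') (auto simp: mv_apply V_mem matD intro!: finsum_closed)
  finally show ?thesis .
qed

text \<open>The pairing with v is either zero or onto the field, and in the second case its kernel
  has q ^ (n - 1) elements. The factor q on the left avoids this exponent.\<close>

lemma card_dot_zero:
  assumes v: "v \<in> V n"
  shows "q * card {y \<in> V n. dot n y v = \<zero>} = (if v = vz n then q else 1) * q ^ n"
proof (cases "v = vz n")
  case True
  have "dot n y v = \<zero>" if "y \<in> V n" for y
    unfolding dot_def True using that by (simp add: V_mem finsum_zero cong: finsum_cong)
  then have "{y \<in> V n. dot n y v = \<zero>} = V n" by auto
  then show ?thesis using True by (simp add: card_V)
next
  case False
  then obtain i where i: "i < n" "v i \<noteq> \<zero>" using v V_eqI[OF v vz_V] by auto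
  have lin: "dot n (vlin n x (\<ominus> \<one>) y) v = dot n x v \<oplus> \<ominus> \<one> \<otimes> dot n y v" if "x \<in> V n" "y \<in> V n" for x y
  proof -
    have "dot n (vlin n x (\<ominus> \<one>) y) v = (\<Oplus>i\<in>{..<n}. x i \<otimes> v i \<oplus> \<ominus> \<one> \<otimes> (y i \<otimes> v i))"
      unfolding dot_def using that v by (intro finsum_cong') (auto simp: V_mem l_distr m_assoc)
    also have "\<dots> = dot n x v \<oplus> \<ominus> \<one> \<otimes> dot n y v"
      unfolding dot_def using that v by (intro finsum_lin) (auto simp: V_mem)
    finally show ?thesis .
  qed
  have "card (V n) = card ((\<lambda>y. dot n y v) ` V n) * card {y \<in> V n. dot n y v = \<zero>}"
  proof (rule card_kernel_image[OF subsp_V])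
    fix x y assume "x \<in> V n" "y \<in> V n"
    then show "dot n x v = dot n y v \<longleftrightarrow> vlin n x (\<ominus> \<one>) y \<in> {y \<in> V n. dot n y v = \<zero>}"
      using eq_iff_sub[OF dot_closed dot_closed, of v n x v n y] v by (simp add: lin vlin_V)
  qed auto
  moreover have "(\<lambda>y. dot n y v) ` V n = carrier R"
  proof (intro equalityI subsetI)
    fix a assume a: "a \<in> carrier R"
    \<comment> \<open>A multiple of the i-th unit vector; as v i is invertible, its pairing with v
      is the prescribed a.\<close>
    define y where "y = (\<lambda>j\<in>{..<n}. if i = j then a \<otimes> inv v i else \<zero>)"
    have vi: "v i \<in> Units R" using i v field_Units V_mem by auto
    have yV: "y \<in> V n" unfolding y_def using a vi by (intro restrict_V) auto
    have "dot n y v = (\<Oplus>j\<in>{..<n}. if i = j then a \<otimes> inv v j \<otimes> v j else \<zero>)"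
      unfolding dot_def y_def using a v vi by (intro finsum_cong') (auto simp: V_mem)
    also have "\<dots> = a \<otimes> inv v i \<otimes> v i"
      using finsum_singleton[of i "{..<n}" "\<lambda>_. a \<otimes> inv v i \<otimes> v i"] i a vi v
      by (simp add: V_mem cong: if_cong)
    also have "\<dots> = a" using a vi by (simp add: m_assoc Units_l_inv Units_closed)
    finally show "a \<in> (\<lambda>y. dot n y v) ` V n" using yV by (metis imageI)
  qed (use v in \<open>auto simp: dot_closed\<close>)
  ultimately show ?thesis using False by (simp add: card_V)
qed

text \<open>Row rank equals column rank, by double counting: the number of pairs (x, y) with y^T A x
  = 0 is the same for A and its transpose, and it is a strictly increasing function of the size of
  the kernel.\<close>

lemma card_ker_tr:
  assumes A: "mat n A" shows "card (ker n (tr A)) = card (ker n A)"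
proof -
  have count: "q * card {(x, y) \<in> V n \<times> V n. dot n y (mv n A x) = \<zero>} = card (ker n A) * (q * q ^ n) + (q ^ n - card (ker n A)) * q ^ n"
    if A: "mat n A" for A
  proof -
    have eq: "{(x, y) \<in> V n \<times> V n. dot n y (mv n A x) = \<zero>} = (SIGMA x:V n. {y \<in> V n. dot n y (mv n A x) = \<zero>})"
      by auto
    have "q * card {(x, y) \<in> V n \<times> V n. dot n y (mv n A x) = \<zero>} =
        (\<Sum>x\<in>V n. q * card {y \<in> V n. dot n y (mv n A x) = \<zero>})"
      unfolding eq by (subst card_SigmaI) (auto simp: sum_distrib_left)
    also have "\<dots> = (\<Sum>x\<in>V n. (if mv n A x = vz n then q else 1) * q ^ n)"
      by (intro sum.cong refl card_dot_zero mv_V A)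
    also have "\<dots> = (\<Sum>x\<in>ker n A \<union> (V n - ker n A). (if mv n A x = vz n then q else 1) * q ^ n)"
      by (intro sum.cong) (auto simp: ker_def)
    also have "\<dots> = (\<Sum>x\<in>ker n A. (if mv n A x = vz n then q else 1) * q ^ n) + (\<Sum>x\<in>V n - ker n A. (if mv n A x = vz n then q else 1) * q ^ n)"
      by (rule sum.union_disjoint) (auto simp: ker_def)
    also have "\<dots> = (\<Sum>x\<in>ker n A. q * q ^ n) + (\<Sum>x\<in>V n - ker n A. q ^ n)"
      by (intro arg_cong2[where f = "(+)"] sum.cong) (auto simp: ker_def)
    also have "\<dots> = card (ker n A) * (q * q ^ n) + (q ^ n - card (ker n A)) * q ^ n"
      by (simp add: card_Diff_subset ker_def card_V)
    finally show ?thesis .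
  qed
  have "card {(x, y) \<in> V n \<times> V n. dot n y (mv n A x) = \<zero>} = card {(x, y) \<in> V n \<times> V n. dot n y (mv n (tr A) x) = \<zero>}"
    by (rule bij_betw_same_card[of "\<lambda>(x, y). (y, x)"], rule bij_betw_byWitness[where f' = "\<lambda>(x, y). (y, x)"])
       (use dot_mv_tr[OF A] in auto)
  then have eq: "card (ker n A) * (q * q ^ n) + (q ^ n - card (ker n A)) * q ^ n =
      card (ker n (tr A)) * (q * q ^ n) + (q ^ n - card (ker n (tr A))) * q ^ n"
    using count[OF A] count[OF mat_tr[OF A]] by simp
  have le: "card (ker n B) \<le> q ^ n" for B
    using card_mono[of "V n" "ker n B"] by (auto simp: ker_def card_V)
  \<comment> \<open>A vector in the kernel admits q ^ n partners, any other vector only the q-th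
    part, so enlarging the kernel increases the count; both sides carry a common factor q.\<close>
  have strict: "a * (q * q ^ n) + (q ^ n - a) * q ^ n < b * (q * q ^ n) + (q ^ n - b) * q ^ n" if "a < b" "b \<le> q ^ n" for a b
  proof -
    have "a * q + (q ^ n - a) < b * q + (q ^ n - b)"
    proof -
      define c where "c = b - a"
      have c: "b = a + c" "c > 0" using that(1) by (simp_all add: c_def)
      have "c * 2 \<le> c * q" using q_ge_2 by simp
      moreover have "b * q = a * q + c * q" using c by (simp add: add_mult_distrib)
      ultimately show ?thesis using c that(2) by linarith
    qed
    from mult_strict_right_mono[OF this q_pow_pos]
    have "(a * q + (q ^ n - a)) * q ^ n < (b * q + (q ^ n - b)) * q ^ n" .
    then show ?thesis by (simp only: add_mult_distrib mult.assoc)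
  qed
  show ?thesis
  proof (cases "card (ker n (tr A))" "card (ker n A)" rule: linorder_cases)
    case less
    show ?thesis using strict[OF less le] eq by linarith
  next
    case greater
    show ?thesis using strict[OF greater le] eq by linarith
  qed
qed

lemma card_im_tr:
  assumes A: "mat n A" shows "card (im n (tr A)) = card (im n A)"
proof -
  have "card (im n (tr A)) * card (ker n A) = card (im n A) * card (ker n A)"
    using card_im_ker[OF A] card_im_ker[OF mat_tr[OF A]] card_ker_tr[OF A] by simp
  moreover have "card (ker n A) \<noteq> 0"
  proof
    assume "card (ker n A) = 0"
    then have "q ^ n = 0" using card_im_ker[OF A] by simp
    then show False using q_pow_pos[of n] by simp
  qed
  ultimately show ?thesis by simp
qed

end

section \<open>Leading positions as a substitute for bases\<close>

context fin_field
begin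

text \<open>The leading position is the largest index with a nonzero entry; \<open>leads\<close>
  collects the pivots of an echelon form, and its cardinality is the dimension.\<close>

definition lead_at :: "nat \<Rightarrow> (nat \<Rightarrow> 'a) \<Rightarrow> nat \<Rightarrow> bool" where
  "lead_at n u p \<longleftrightarrow> p < n \<and> u p \<noteq> \<zero> \<and> (\<forall>i. p < i \<longrightarrow> i < n \<longrightarrow> u i = \<zero>)"

definition leads :: "nat \<Rightarrow> (nat \<Rightarrow> 'a) set \<Rightarrow> nat set" where
  "leads n U = {p. \<exists>u\<in>U. lead_at n u p}"

definition low :: "nat \<Rightarrow> (nat \<Rightarrow> 'a) set \<Rightarrow> nat \<Rightarrow> (nat \<Rightarrow> 'a) set" where
  "low n U m = {u \<in> U. \<forall>i. m \<le> i \<longrightarrow> i < n \<longrightarrow> u i = \<zero>}"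

lemma leads_subset: "leads n U \<subseteq> {..<n}"
  by (auto simp: leads_def lead_at_def)

lemma finite_leads [simp]: "finite (leads n U)"
  by (rule finite_subset[OF leads_subset]) simp

lemma ex_lead:
  assumes "u \<in> V n" "u \<noteq> vz n" obtains p where "lead_at n u p"
proof -
  define S where "S = {i. i < n \<and> u i \<noteq> \<zero>}"
  have ne: "S \<noteq> {}" using assms V_eqI[OF assms(1) vz_V] by (auto simp: S_def)
  have fin: "finite S" by (simp add: S_def)
  have max: "Max S \<in> S" by (rule Max_in[OF fin ne])
  have "u i = \<zero>" if "Max S < i" "i < n" for i
  proof (rule ccontr)
    assume "u i \<noteq> \<zero>"
    then have "i \<le> Max S" using that(2) by (intro Max_ge[OF fin]) (simp add: S_def)
    then show False using that by simp
  qed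
  moreover have "\<forall>i\<in>S. i < n \<and> u i \<noteq> \<zero>" by (simp add: S_def)
  ultimately have "lead_at n u (Max S)" unfolding lead_at_def using max by blast
  then show thesis by (rule that)
qed

lemma subsp_low: assumes "subsp n U" shows "subsp n (low n U m)"
  using subspD[OF assms] by (auto simp: subsp_def low_def)

lemma low_Suc_cases: "u \<in> low n U (Suc m) \<Longrightarrow> u m = \<zero> \<Longrightarrow> u \<in> low n U m"
  unfolding low_def using le_neq_implies_less[of m] by (fastforce simp: Suc_le_eq)

lemma low_Suc_lead: "u \<in> low n U (Suc m) \<Longrightarrow> m < n \<Longrightarrow> u m \<noteq> \<zero> \<Longrightarrow> lead_at n u m"
  by (auto simp: low_def lead_at_def)

lemma low_n: "low n U n = U"
  by (auto simp: low_def)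

text \<open>The spaces \<open>low n U m\<close> filter U. Passing from m to m + 1, the coordinate m
  takes all values if m is a leading position, and only the value 0 otherwise.\<close>

lemma card_low:
  assumes U: "subsp n U" and "m \<le> n"
  shows "card (low n U m) = q ^ card (leads n U \<inter> {..<m})"
  using assms(2)
proof (induction m)
  case 0
  have "low n U 0 = {vz n}"
    using subspD[OF U] by (auto simp: low_def intro!: V_eqI[of _ n])
  then show ?case by simp
next
  case (Suc m)
  then have m: "m < n" by simp
  note L = subsp_low[OF U, of "Suc m"]
  have sub: "vlin n x (\<ominus> \<one>) y \<in> low n U m \<longleftrightarrow> x m = y m"
    if "x \<in> low n U (Suc m)" "y \<in> low n U (Suc m)" for x y
  proof -
    have *: "vlin n x (\<ominus> \<one>) y \<in> low n U (Suc m)"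
      using that by (intro subspD(3)[OF L]) auto
    have "x m = y m \<longleftrightarrow> vlin n x (\<ominus> \<one>) y m = \<zero>"
      using eq_iff_sub[OF subspD(4)[OF L that(1) m] subspD(4)[OF L that(2) m]] m by simp
    also have "\<dots> \<longleftrightarrow> vlin n x (\<ominus> \<one>) y \<in> low n U m"
      using low_Suc_cases[OF *] m by (auto simp: low_def)
    finally show ?thesis ..
  qed
  have card: "card (low n U (Suc m)) = card ((\<lambda>u. u m) ` low n U (Suc m)) * card (low n U m)"
    using sub by (intro card_kernel_image[OF L]) (auto simp: low_def)
  show ?case
  proof (cases "m \<in> leads n U")
    case True
    then obtain u where u: "u \<in> U" "lead_at n u m" by (auto simp: leads_def)
    then have uL: "u \<in> low n U (Suc m)" by (auto simp: low_def lead_at_def)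
    have um: "u m \<in> Units R" using u m subspD(4)[OF U] by (auto simp: lead_at_def field_Units)
    have "(\<lambda>u. u m) ` low n U (Suc m) = carrier R"
    proof (intro equalityI subsetI)
      fix a assume a: "a \<in> carrier R"
      have "vlin n (vz n) (a \<otimes> inv (u m)) u \<in> low n U (Suc m)"
        using a um uL by (intro subspD(3)[OF L] subspD(2)[OF L]) auto
      moreover have "vlin n (vz n) (a \<otimes> inv (u m)) u m = a"
        using a um m by (simp add: m_assoc Units_closed)
      ultimately show "a \<in> (\<lambda>u. u m) ` low n U (Suc m)" by (metis imageI)
    qed (use subspD(4)[OF L _ m] in auto)
    moreover have "leads n U \<inter> {..<Suc m} = insert m (leads n U \<inter> {..<m})" using True by auto
    ultimately show ?thesis using card Suc by simp
  next
    case False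
    have "u m = \<zero>" if "u \<in> low n U (Suc m)" for u
      using low_Suc_lead[OF that m] that False by (auto simp: leads_def low_def)
    moreover have "low n U (Suc m) \<noteq> {}" using subspD(2)[OF L] by auto
    ultimately have "(\<lambda>u. u m) ` low n U (Suc m) = {\<zero>}" by auto
    moreover have "leads n U \<inter> {..<Suc m} = leads n U \<inter> {..<m}" using False by (auto simp: less_Suc_eq)
    ultimately show ?thesis using card Suc by simp
  qed
qed

lemma card_subsp: assumes "subsp n U" shows "card U = q ^ card (leads n U)"
  using card_low[OF assms order_refl] leads_subset[of n U] by (simp add: low_n Int_absorb2)

text \<open>Vectors of U1 with all possible leading positions span it: the top entry of any u is
  cancelled by a multiple of the matching w, which moves u down in the filtration
  \<open>low\<close>.\<close>

lemma subsp_leI: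
  assumes U1: "subsp n U1" and U2: "subsp n U2"
    and w: "\<And>p. p \<in> leads n U1 \<Longrightarrow> \<exists>w\<in>U1 \<inter> U2. lead_at n w p"
  shows "U1 \<subseteq> U2"
proof -
  have "low n U1 m \<subseteq> U2" if "m \<le> n" for m
    using that
  proof (induction m)
    case 0
    have "low n U1 0 \<subseteq> {vz n}"
      using subspD[OF U1] by (auto simp: low_def intro!: V_eqI[of _ n])
    then show ?case using subspD(2)[OF U2] by auto
  next
    case (Suc m)
    then have m: "m < n" by simp
    show ?case
    proof
      fix u assume u: "u \<in> low n U1 (Suc m)"
      show "u \<in> U2"
      proof (cases "u m = \<zero>")
        case True
        then show ?thesis using low_Suc_cases[OF u] Suc by auto
      next
        case False
        have uU: "u \<in> U1" using u by (simp add: low_def)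
        have "m \<in> leads n U1" using low_Suc_lead[OF u m False] uU by (auto simp: leads_def)
        then obtain w where w: "w \<in> U1" "w \<in> U2" "lead_at n w m" using w by blast
        have wm: "w m \<in> Units R" using w m subspD(4)[OF U1] by (auto simp: lead_at_def field_Units)
        have c: "u m \<in> carrier R" "w m \<in> carrier R" using uU w m subspD(4)[OF U1] by auto
        define b where "b = u m \<otimes> inv (w m)"
        have b: "b \<in> carrier R" using wm c by (simp add: b_def)
        have bw: "b \<otimes> w m = u m" using wm c by (simp add: b_def m_assoc)
        define u' where "u' = vlin n u (\<ominus> b) w"
        have "u' \<in> U1" unfolding u'_def using b uU w by (intro subspD(3)[OF U1]) auto
        moreover have "u' m = \<zero>" using m c b bw by (simp add: u'_def l_minus r_neg)
        moreover have "u' i = \<zero>" if "m < i" "i < n" for i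
          using that u w b by (simp add: u'_def low_def lead_at_def)
        ultimately have "u' \<in> low n U1 m" by (auto simp: low_def) (metis le_neq_implies_less)
        then have "u' \<in> U2" using Suc by auto
        moreover have "u = vlin n u' b w"
        proof (rule V_eqI[of _ n])
          show "u \<in> V n" using uU subspD(1)[OF U1] by auto
          have "w \<in> V n" using w subspD(1)[OF U1] by auto
          then show "vlin n u' b w \<in> V n" using \<open>u' \<in> U1\<close> b subspD(1)[OF U1] by (intro vlin_V) auto
          fix i assume i: "i < n"
          then have "u i \<in> carrier R" "w i \<in> carrier R" using uU w subspD(4)[OF U1] by auto
          then show "u i = vlin n u' b w i" using i b by (simp add: u'_def a_assoc l_minus l_neg)
        qed
        ultimately show ?thesis using subspD(3)[OF U2] w b by simp
      qed
    qed
  qed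
  from this[of n] show ?thesis by (simp add: low_n)
qed

text \<open>Otherwise the difference would have a leading position, and there both vectors
  agree.\<close>

lemma eq_if_eq_on_leads:
  assumes U: "subsp n U" and "u \<in> U" "v \<in> U" and eq: "\<And>p. p \<in> leads n U \<Longrightarrow> u p = v p"
  shows "u = v"
proof (rule ccontr)
  assume "u \<noteq> v"
  let ?w = "vlin n u (\<ominus> \<one>) v"
  have uv: "u \<in> V n" "v \<in> V n" using assms subspD(1)[OF U] by auto
  have wU: "?w \<in> U" using assms by (intro subspD(3)[OF U]) auto
  have "?w \<noteq> vz n" using \<open>u \<noteq> v\<close> V_eq_iff_sub[OF uv] by simp
  then obtain p where p: "lead_at n ?w p" using ex_lead wU subspD(1)[OF U] by blast
  then have "u p = v p" using wU by (intro eq) (auto simp: leads_def)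
  then have "?w p = \<zero>" using p uv by (auto simp: lead_at_def V_mem sub_self)
  then show False using p by (simp add: lead_at_def)
qed

text \<open>A subspace of dimension at most k is generated by k vectors, and there are q ^ (n k)
  tuples of these. The span appears as an intersection of subspaces.\<close>

lemma subspaces_subset:
  "{U. subsp n U \<and> card U < q ^ k} \<subseteq>
     (\<lambda>\<phi>. \<Inter>{U. subsp n U \<and> \<phi> ` {..<k} \<subseteq> U}) ` ({..<k} \<rightarrow>\<^sub>E V n)"
proof
  fix U assume "U \<in> {U. subsp n U \<and> card U < q ^ k}"
  then have U: "subsp n U" and "q ^ card (leads n U) < q ^ k" using card_subsp by auto
  have k: "card (leads n U) \<le> k"
  proof (rule ccontr)
    assume "\<not> card (leads n U) \<le> k"
    then have "q ^ k \<le> q ^ card (leads n U)" using q_ge_2 by (intro power_increasing) auto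
    then show False using \<open>q ^ card (leads n U) < q ^ k\<close> by simp
  qed
  have "\<forall>p\<in>leads n U. \<exists>u. u \<in> U \<and> lead_at n u p" by (auto simp: leads_def)
  from bchoice[OF this] obtain w where w: "\<And>p. p \<in> leads n U \<Longrightarrow> w p \<in> U \<and> lead_at n (w p) p"
    by blast
  obtain h where h: "bij_betw h {..<card (leads n U)} (leads n U)"
    using ex_bij_betw_nat_finite[OF finite_leads, of n U] by (auto simp: atLeast0LessThan)
  have h': "h i \<in> leads n U" if "i < card (leads n U)" for i using h that by (auto simp: bij_betw_def)
  define \<phi> where "\<phi> = (\<lambda>i\<in>{..<k}. if i < card (leads n U) then w (h i) else vz n)"
  have \<phi>U: "\<phi> ` {..<k} \<subseteq> U" using w h' subspD(2)[OF U] by (auto simp: \<phi>_def)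
  have "U \<subseteq> U'" if "subsp n U'" "\<phi> ` {..<k} \<subseteq> U'" for U'
  proof (rule subsp_leI[OF U that(1)])
    fix p assume p: "p \<in> leads n U"
    then have "p \<in> h ` {..<card (leads n U)}" using h by (simp add: bij_betw_def)
    then obtain i where i: "i < card (leads n U)" "h i = p" by blast
    then have "\<phi> i = w p" "i < k" using k by (auto simp: \<phi>_def)
    then have "w p \<in> U'" using that(2) by (metis image_subset_iff lessThan_iff)
    then show "\<exists>w\<in>U \<inter> U'. lead_at n w p" using w[OF p] by auto
  qed
  then have "U = \<Inter>{U. subsp n U \<and> \<phi> ` {..<k} \<subseteq> U}" using U \<phi>U by blast
  moreover have "\<phi> \<in> {..<k} \<rightarrow>\<^sub>E V n"
  proof (rule PiE_I)
    show "\<phi> i \<in> V n" if "i \<in> {..<k}" for i using that \<phi>U subspD(1)[OF U] by blast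
    show "\<phi> i = undefined" if "i \<notin> {..<k}" for i using that by (simp add: \<phi>_def)
  qed
  ultimately show "U \<in> (\<lambda>\<phi>. \<Inter>{U. subsp n U \<and> \<phi> ` {..<k} \<subseteq> U}) ` ({..<k} \<rightarrow>\<^sub>E V n)" by blast
qed

lemma card_subspaces: "card {U. subsp n U \<and> card U < q ^ k} \<le> q ^ (n * k)" (is ?card)
  and finite_subspaces: "finite {U. subsp n U \<and> card U < q ^ k}" (is ?fin)
proof -
  have fin: "finite ({..<k} \<rightarrow>\<^sub>E V n)" by (intro finite_PiE) auto
  then show ?fin using finite_subset[OF subspaces_subset] by blast
  have "card {U. subsp n U \<and> card U < q ^ k} \<le> card ({..<k} \<rightarrow>\<^sub>E V n)"
    by (rule le_trans[OF card_mono[OF _ subspaces_subset] card_image_le]) (use fin in auto)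
  also have "\<dots> = q ^ (n * k)" by (simp add: card_PiE card_V power_mult)
  finally show ?card .
qed

section \<open>Matrices of small rank and the solutions of \<open>F i A = C F i\<close>\<close>

definition M :: "nat \<Rightarrow> (nat \<Rightarrow> nat \<Rightarrow> 'a) set" where "M n = {..<n} \<rightarrow>\<^sub>E V n"

lemma M_mat: "A \<in> M n \<Longrightarrow> mat n A"
  by (auto simp: M_def mat_def V_def)

lemma M_eqI: "A \<in> M n \<Longrightarrow> B \<in> M n \<Longrightarrow> (\<And>i j. i < n \<Longrightarrow> j < n \<Longrightarrow> A i j = B i j) \<Longrightarrow> A = B"
  unfolding M_def by (rule PiE_ext, assumption, assumption, rule V_eqI[of _ n]) auto

lemma finite_M [simp]: "finite (M n)"
  unfolding M_def by (intro finite_PiE) auto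

definition unit :: "nat \<Rightarrow> nat \<Rightarrow> nat \<Rightarrow> 'a" where
  "unit n j = (\<lambda>i\<in>{..<n}. if j = i then \<one> else \<zero>)"

lemma unit_V: "unit n j \<in> V n"
  unfolding unit_def by (rule restrict_V) auto

lemma mv_unit:
  assumes "mat n A" "i < n" "j < n" shows "mv n A (unit n j) i = A i j"
proof -
  have "mv n A (unit n j) i = (\<Oplus>l\<in>{..<n}. if j = l then A i l else \<zero>)"
    using assms unfolding mv_apply[OF assms(2)]
    by (intro finsum_cong') (auto simp: unit_def matD)
  also have "\<dots> = A i j"
    using assms by (intro finsum_singleton) (auto simp: matD)
  finally show ?thesis .
qed

text \<open>A matrix is fixed by its image, for which there are at most q ^ (n k) choices, and by n
  columns from this image, fewer than q ^ k choices each.\<close>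

lemma card_small_im: "card {A \<in> M n. card (im n A) < q ^ k} \<le> q ^ (2 * n * k)"
proof -
  let ?S = "{A \<in> M n. card (im n A) < q ^ k}"
  have "card ?S \<le> card (im n ` ?S) * q ^ (n * k)"
  proof (rule card_le_fibers)
    fix A assume A: "A \<in> ?S"
    have "card {B \<in> ?S. im n B = im n A} \<le> card ({..<n} \<rightarrow>\<^sub>E im n A)"
    proof (rule card_inj_on_le)
      show "inj_on (\<lambda>B. \<lambda>j\<in>{..<n}. mv n B (unit n j)) {B \<in> ?S. im n B = im n A}"
      proof (rule inj_onI)
        fix B B' assume B: "B \<in> {B \<in> ?S. im n B = im n A}" and B': "B' \<in> {B \<in> ?S. im n B = im n A}"
          and eq: "(\<lambda>j\<in>{..<n}. mv n B (unit n j)) = (\<lambda>j\<in>{..<n}. mv n B' (unit n j))"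
        have "mv n B (unit n j) = mv n B' (unit n j)" if "j < n" for j
          using fun_cong[OF eq, of j] that by simp
        then show "B = B'" using B B' mv_unit M_mat by (intro M_eqI[of _ n]) (auto, metis M_mat mv_unit)
      qed
      show "(\<lambda>B. \<lambda>j\<in>{..<n}. mv n B (unit n j)) ` {B \<in> ?S. im n B = im n A} \<subseteq> {..<n} \<rightarrow>\<^sub>E im n A"
        using unit_V by (auto simp: im_def)
      show "finite ({..<n} \<rightarrow>\<^sub>E im n A)" by (intro finite_PiE) (auto simp: im_def)
    qed
    also have "\<dots> = card (im n A) ^ n" by (simp add: card_PiE)
    also have "\<dots> \<le> (q ^ k) ^ n" using A by (intro power_mono) auto
    finally show "card {B \<in> ?S. im n B = im n A} \<le> q ^ (n * k)" by (simp add: power_mult mult.commute flip: power_mult)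
  qed simp
  also have "card (im n ` ?S) \<le> card {U. subsp n U \<and> card U < q ^ k}"
    by (rule card_mono[OF finite_subspaces]) (auto intro: subsp_im M_mat)
  also have "\<dots> \<le> q ^ (n * k)" by (rule card_subspaces)
  finally show ?thesis by (simp add: power_add[symmetric] mult_2 add_mult_distrib)
qed

definition mm :: "nat \<Rightarrow> (nat \<Rightarrow> nat \<Rightarrow> 'a) \<Rightarrow> (nat \<Rightarrow> nat \<Rightarrow> 'a) \<Rightarrow> nat \<Rightarrow> nat \<Rightarrow> 'a" where
  "mm n A B i j = (\<Oplus>l\<in>{..<n}. A i l \<otimes> B l j)"

lemma mm_closed: "mat n A \<Longrightarrow> mat n B \<Longrightarrow> mat n (mm n A B)"
  by (auto simp: mat_def mm_def intro!: finsum_closed)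

lemma mv_mm:
  assumes "mat n A" "mat n B" "x \<in> V n"
  shows "mv n A (mv n B x) = mv n (mm n A B) x"
proof (rule V_eqI[of _ n])
  show "mv n A (mv n B x) \<in> V n" "mv n (mm n A B) x \<in> V n" using assms by (auto intro!: mv_V mm_closed)
  fix i assume i: "i < n"
  have "mv n A (mv n B x) i = (\<Oplus>l\<in>{..<n}. \<Oplus>j\<in>{..<n}. A i l \<otimes> (B l j \<otimes> x j))"
    unfolding mv_apply[OF i] using assms i
    by (intro finsum_cong') (auto simp: mv_apply finsum_rdistr matD V_mem Pi_def intro!: finsum_closed)
  also have "\<dots> = (\<Oplus>j\<in>{..<n}. \<Oplus>l\<in>{..<n}. A i l \<otimes> (B l j \<otimes> x j))"
    using assms i by (intro finsum_swap) (auto simp: matD V_mem)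
  also have "\<dots> = (\<Oplus>j\<in>{..<n}. \<Oplus>l\<in>{..<n}. A i l \<otimes> B l j \<otimes> x j)"
    using assms i by (intro finsum_cong') (auto simp: matD V_mem m_assoc intro!: finsum_cong' finsum_closed)
  also have "\<dots> = mv n (mm n A B) x i"
    unfolding mv_apply[OF i] mm_def using assms i
    by (intro finsum_cong') (auto simp: finsum_ldistr matD V_mem Pi_def intro!: finsum_closed)
  finally show "mv n A (mv n B x) i = mv n (mm n A B) x i" .
qed

lemma mv_cong: "(\<And>i j. i < n \<Longrightarrow> j < n \<Longrightarrow> A i j = B i j) \<Longrightarrow> mat n B \<Longrightarrow> x \<in> V n \<Longrightarrow> mv n A x = mv n B x"
  unfolding mv_def by (intro restrict_ext finsum_cong') (auto simp: matD V_mem)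

text \<open>
  The last alternative in the definition of \<open>expands\<close> says that \<open>U'\<close> has dimension more than \<open>n / 2\<close>:
  dimensions are expressed by cardinalities throughout.
\<close>

definition sol :: "nat \<Rightarrow> nat \<Rightarrow> (nat \<Rightarrow> nat \<Rightarrow> nat \<Rightarrow> 'a) \<Rightarrow> ((nat \<Rightarrow> nat \<Rightarrow> 'a) \<times> (nat \<Rightarrow> nat \<Rightarrow> 'a)) set" where
  "sol n c F = {(A, C). A \<in> M n \<and> C \<in> M n \<and> (\<forall>i<c. \<forall>k<n. \<forall>j<n. mm n (F i) A k j = mm n C (F i) k j)}"

definition expands :: "nat \<Rightarrow> nat \<Rightarrow> (nat \<Rightarrow> nat \<Rightarrow> nat \<Rightarrow> 'a) \<Rightarrow> nat \<Rightarrow> bool" where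
  "expands n c F s \<longleftrightarrow> (\<forall>U U'. subsp n U \<longrightarrow> subsp n U' \<longrightarrow> (\<forall>i<c. \<forall>x\<in>U. mv n (F i) x \<in> U') \<longrightarrow>
     q ^ s \<le> card U \<longrightarrow> card U < card U' \<or> q ^ n < card U' * card U')"

lemma finite_sol [simp]: "finite (sol n c F)"
  by (rule finite_subset[of _ "M n \<times> M n"]) (auto simp: sol_def)

context
  fixes n c s :: nat and F :: "nat \<Rightarrow> nat \<Rightarrow> nat \<Rightarrow> 'a"
  assumes F: "\<And>i. i < c \<Longrightarrow> mat n (F i)" and F_sym: "\<And>i k l. i < c \<Longrightarrow> k < n \<Longrightarrow> l < n \<Longrightarrow> F i k l = F i l k"
    and ex: "expands n c F s"
begin

lemma expandsD:
  "subsp n U \<Longrightarrow> subsp n U' \<Longrightarrow> (\<And>i x. i < c \<Longrightarrow> x \<in> U \<Longrightarrow> mv n (F i) x \<in> U') \<Longrightarrow>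
     q ^ s \<le> card U \<Longrightarrow> card U < card U' \<or> q ^ n < card U' * card U'"
  using ex unfolding expands_def by simp

lemma sol_mv:
  assumes "(A, C) \<in> sol n c F" "i < c" "x \<in> V n"
  shows "mv n (F i) (mv n A x) = mv n C (mv n (F i) x)"
proof -
  have "mat n A" "mat n C" using assms by (auto simp: sol_def M_mat)
  then show ?thesis
    using assms F[of i] by (simp add: mv_mm) (rule mv_cong, auto simp: sol_def mm_closed)
qed

lemma sol_mv_tr:
  assumes "(A, C) \<in> sol n c F" "i < c" "x \<in> V n"
  shows "mv n (F i) (mv n (tr C) x) = mv n (tr A) (mv n (F i) x)"
proof -
  have AC: "mat n A" "mat n C" using assms by (auto simp: sol_def M_mat)
  have "mm n (F i) (tr C) k j = mm n (tr A) (F i) k j" if kj: "k < n" "j < n" for k j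
  proof -
    have "mm n (F i) (tr C) k j = mm n C (F i) j k"
      unfolding mm_def using kj F[OF assms(2)] F_sym[OF assms(2)] AC
      by (intro finsum_cong') (auto simp: matD m_comm)
    also have "\<dots> = mm n (F i) A j k" using assms kj by (auto simp: sol_def)
    also have "\<dots> = mm n (tr A) (F i) k j"
      unfolding mm_def using kj F[OF assms(2)] F_sym[OF assms(2)] AC
      by (intro finsum_cong') (auto simp: matD m_comm)
    finally show ?thesis .
  qed
  then show ?thesis
    using assms F[of i] mat_tr[OF AC(1)] mat_tr[OF AC(2)] by (simp add: mv_mm) (rule mv_cong, auto simp: mm_closed)
qed

text \<open>Every \<open>F i\<close> maps the kernel and image of A into those of C. As the
  \<open>F i\<close> are symmetric, transposing the equations exchanges the roles of A and C;
  kernels and images of transposes have the same sizes, so expansion also leads from C back to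
  A.\<close>

lemma sol_ker_im:
  assumes s: "(A, C) \<in> sol n c F"
  shows "q ^ s \<le> card (ker n A) \<Longrightarrow> card (ker n A) < card (ker n C) \<or> q ^ n < card (ker n C) * card (ker n C)"
    and "q ^ s \<le> card (im n A) \<Longrightarrow> card (im n A) < card (im n C) \<or> q ^ n < card (im n C) * card (im n C)"
    and "q ^ s \<le> card (ker n C) \<Longrightarrow> card (ker n C) < card (ker n A) \<or> q ^ n < card (ker n A) * card (ker n A)"
    and "q ^ s \<le> card (im n C) \<Longrightarrow> card (im n C) < card (im n A) \<or> q ^ n < card (im n A) * card (im n A)"
proof -
  have AC: "mat n A" "mat n C" using s by (auto simp: sol_def M_mat)
  have AC': "mat n (tr A)" "mat n (tr C)" using AC by (auto intro: mat_tr)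
  show "q ^ s \<le> card (ker n A) \<Longrightarrow> card (ker n A) < card (ker n C) \<or> q ^ n < card (ker n C) * card (ker n C)"
  proof (rule expandsD[OF subsp_ker[OF AC(1)] subsp_ker[OF AC(2)]])
    fix i x assume "i < c" "x \<in> ker n A"
    then show "mv n (F i) x \<in> ker n C" using sol_mv[OF s, of i x] F by (auto simp: ker_def mv_V mv_vz)
  qed
  show "q ^ s \<le> card (im n A) \<Longrightarrow> card (im n A) < card (im n C) \<or> q ^ n < card (im n C) * card (im n C)"
  proof (rule expandsD[OF subsp_im[OF AC(1)] subsp_im[OF AC(2)]])
    fix i x assume "i < c" "x \<in> im n A"
    then show "mv n (F i) x \<in> im n C" using sol_mv[OF s] F by (auto simp: im_def mv_V)
  qed
  have "q ^ s \<le> card (ker n (tr C)) \<Longrightarrow> card (ker n (tr C)) < card (ker n (tr A)) \<or> q ^ n < card (ker n (tr A)) * card (ker n (tr A))"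
  proof (rule expandsD[OF subsp_ker[OF AC'(2)] subsp_ker[OF AC'(1)]])
    fix i x assume "i < c" "x \<in> ker n (tr C)"
    then show "mv n (F i) x \<in> ker n (tr A)" using sol_mv_tr[OF s, of i x] F by (auto simp: ker_def mv_V mv_vz)
  qed
  then show "q ^ s \<le> card (ker n C) \<Longrightarrow> card (ker n C) < card (ker n A) \<or> q ^ n < card (ker n A) * card (ker n A)"
    using AC by (simp only: card_ker_tr)
  have "q ^ s \<le> card (im n (tr C)) \<Longrightarrow> card (im n (tr C)) < card (im n (tr A)) \<or> q ^ n < card (im n (tr A)) * card (im n (tr A))"
  proof (rule expandsD[OF subsp_im[OF AC'(2)] subsp_im[OF AC'(1)]])
    fix i x assume "i < c" "x \<in> im n (tr C)"
    then show "mv n (F i) x \<in> im n (tr A)" using sol_mv_tr[OF s] F by (auto simp: im_def mv_V)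
  qed
  then show "q ^ s \<le> card (im n C) \<Longrightarrow> card (im n C) < card (im n A) \<or> q ^ n < card (im n A) * card (im n A)"
    using AC by (simp only: card_im_tr)
qed

lemma sol_dichotomy:
  assumes s: "(A, C) \<in> sol n c F" and ker: "q ^ s \<le> card (ker n A)"
  shows "card (im n A) < q ^ s"
proof (rule ccontr)
  assume "\<not> card (im n A) < q ^ s"
  then have im: "q ^ s \<le> card (im n A)" by simp
  have prod: "card (im n A) * card (ker n A) = q ^ n" using s by (intro card_im_ker) (auto simp: sol_def M_mat)
  \<comment> \<open>Here a comes from the smaller of kernel and image of A, and b from the
    corresponding space of C. Either alternative of the third premise makes b exceed a, hence also q
    ^ s; the fourth premise is then impossible, since a * a is at most q ^ n.\<close>
  have False if "q ^ s \<le> a" "a * a \<le> q ^ n" "a < b \<or> q ^ n < b * b" "q ^ s \<le> b \<Longrightarrow> b < a \<or> q ^ n < a * a" for a b :: nat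
  proof -
    have "a < b"
    proof (rule ccontr)
      assume "\<not> a < b"
      then have "b * b \<le> a * a" by (intro mult_mono) auto
      then show False using that(2,3) \<open>\<not> a < b\<close> by linarith
    qed
    then show False using that by auto
  qed
  note contra = this
  show False
  proof (cases "card (ker n A) \<le> card (im n A)")
    case True
    then have "card (ker n A) * card (ker n A) \<le> q ^ n" using prod by (metis mult_le_mono1)
    then show False using contra[OF ker _ sol_ker_im(1)[OF s ker] sol_ker_im(3)[OF s]] by simp
  next
    case False
    then have "card (im n A) * card (im n A) \<le> q ^ n" using prod by (metis mult_le_mono2 nat_le_linear)
    then show False using contra[OF im _ sol_ker_im(2)[OF s im] sol_ker_im(4)[OF s]] by simp
  qed
qed

definition msub :: "(nat \<Rightarrow> nat \<Rightarrow> 'a) \<Rightarrow> (nat \<Rightarrow> nat \<Rightarrow> 'a) \<Rightarrow> nat \<Rightarrow> nat \<Rightarrow> 'a" where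
  "msub A B = (\<lambda>i\<in>{..<n}. vlin n (A i) (\<ominus> \<one>) (B i))"

lemma msub_M: "A \<in> M n \<Longrightarrow> B \<in> M n \<Longrightarrow> msub A B \<in> M n"
  unfolding M_def msub_def by (auto intro!: vlin_V)

lemma msub_apply: "i < n \<Longrightarrow> j < n \<Longrightarrow> msub A B i j = A i j \<oplus> \<ominus> \<one> \<otimes> B i j"
  by (simp add: msub_def)

lemma msub_inj: assumes "A \<in> M n" "A' \<in> M n" "B \<in> M n" "msub A B = msub A' B" shows "A = A'"
proof (rule M_eqI[OF assms(1,2)])
  fix i j assume ij: "i < n" "j < n"
  have c: "A i j \<in> carrier R" "A' i j \<in> carrier R" "B i j \<in> carrier R" using assms ij by (auto intro: matD[OF M_mat])
  have "A i j \<oplus> \<ominus> \<one> \<otimes> B i j = A' i j \<oplus> \<ominus> \<one> \<otimes> B i j" using assms(4) msub_apply[OF ij] by metis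
  then have "A i j \<oplus> \<ominus> \<one> \<otimes> B i j \<oplus> B i j = A' i j \<oplus> \<ominus> \<one> \<otimes> B i j \<oplus> B i j" by (rule arg_cong)
  then show "A i j = A' i j" unfolding sub_add_cancel(1)[OF c(1,3)] sub_add_cancel(1)[OF c(2,3)] .
qed

lemma sol_msub:
  assumes "(A, C) \<in> sol n c F" "(A', C') \<in> sol n c F"
  shows "(msub A A', msub C C') \<in> sol n c F"
proof -
  have Ms: "A \<in> M n" "C \<in> M n" "A' \<in> M n" "C' \<in> M n" using assms by (auto simp: sol_def)
  note mats = M_mat[OF Ms(1)] M_mat[OF Ms(2)] M_mat[OF Ms(3)] M_mat[OF Ms(4)]
  have "mm n (F i) (msub A A') k j = mm n (msub C C') (F i) k j" if i: "i < c" and kj: "k < n" "j < n" for i k j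
  proof -
    have "mm n (F i) (msub A A') k j = (\<Oplus>l\<in>{..<n}. F i k l \<otimes> A l j \<oplus> \<ominus> \<one> \<otimes> (F i k l \<otimes> A' l j))"
      unfolding mm_def using kj mats F[OF i]
      by (intro finsum_cong') (auto simp: msub_apply matD r_distr l_minus r_minus)
    also have "\<dots> = mm n (F i) A k j \<oplus> \<ominus> \<one> \<otimes> mm n (F i) A' k j"
      unfolding mm_def using kj mats F[OF i] by (intro finsum_lin) (auto simp: matD)
    also have "\<dots> = mm n C (F i) k j \<oplus> \<ominus> \<one> \<otimes> mm n C' (F i) k j"
      using assms i kj by (simp add: sol_def)
    also have "\<dots> = (\<Oplus>l\<in>{..<n}. C k l \<otimes> F i l j \<oplus> \<ominus> \<one> \<otimes> (C' k l \<otimes> F i l j))"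
      unfolding mm_def using kj mats F[OF i] by (intro finsum_lin[symmetric]) (auto simp: matD)
    also have "\<dots> = mm n (msub C C') (F i) k j"
      unfolding mm_def using kj mats F[OF i]
      by (intro finsum_cong') (auto simp: msub_apply matD l_distr l_minus)
    finally show ?thesis .
  qed
  then show ?thesis using Ms by (simp add: sol_def msub_M)
qed

lemma mv_msub:
  assumes "A \<in> M n" "B \<in> M n" "x \<in> V n"
  shows "mv n (msub A B) x = vlin n (mv n A x) (\<ominus> \<one>) (mv n B x)"
proof (rule V_eqI[of _ n])
  note m = M_mat[OF assms(1)] M_mat[OF assms(2)] M_mat[OF msub_M[OF assms(1,2)]]
  show "mv n (msub A B) x \<in> V n" "vlin n (mv n A x) (\<ominus> \<one>) (mv n B x) \<in> V n"
    using m assms by (auto intro!: mv_V vlin_V)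
  fix i assume i: "i < n"
  have "mv n (msub A B) x i = (\<Oplus>j\<in>{..<n}. A i j \<otimes> x j \<oplus> \<ominus> \<one> \<otimes> (B i j \<otimes> x j))"
    unfolding mv_apply[OF i] using m i assms by (intro finsum_cong') (auto simp: msub_apply matD V_mem l_distr l_minus)
  also have "\<dots> = mv n A x i \<oplus> \<ominus> \<one> \<otimes> mv n B x i"
    unfolding mv_apply[OF i] using m i assms by (intro finsum_lin) (auto simp: matD V_mem)
  finally show "mv n (msub A B) x i = vlin n (mv n A x) (\<ominus> \<one>) (mv n B x) i" using i by simp
qed

lemma card_ker_ge:
  assumes "mat n A" "s \<le> n" "\<And>j. j < s \<Longrightarrow> mv n A (unit n j) = vz n"
  shows "q ^ s \<le> card (ker n A)"
proof -
  have "{..<s} \<subseteq> leads n (ker n A)"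
  proof
    fix j assume "j \<in> {..<s}"
    then have "unit n j \<in> ker n A" "lead_at n (unit n j) j"
      using assms unit_V by (auto simp: ker_def lead_at_def unit_def)
    then show "j \<in> leads n (ker n A)" by (auto simp: leads_def)
  qed
  from card_mono[OF finite_leads this] have "s \<le> card (leads n (ker n A))" by simp
  then have "q ^ s \<le> q ^ card (leads n (ker n A))" using q_ge_2 by (intro power_increasing) auto
  then show ?thesis using card_subsp[OF subsp_ker[OF assms(1)]] by simp
qed

text \<open>Solutions form a group under subtraction. Those sharing the first s columns of A differ
  by an element of \<open>Low\<close>; elements of \<open>Low\<close> with the same A differ by a
  pair (0, C) with C of small image. The three counts contribute n s, 2 n s and 2 n s to the
  exponent.\<close>

lemma card_sol: assumes "s \<le> n" shows "card (sol n c F) \<le> q ^ (5 * n * s)"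
proof -
  define Low where "Low = {(A, C) \<in> sol n c F. card (im n A) < q ^ s}"
  have "card Low \<le> card (fst ` Low) * q ^ (2 * n * s)"
  proof (rule card_le_fibers)
    show "finite Low" by (rule finite_subset[of _ "sol n c F"]) (auto simp: Low_def)
    fix p assume p: "p \<in> Low"
    obtain A C where AC: "p = (A, C)" by (cases p)
    have s1: "(A, C) \<in> sol n c F" using p AC by (auto simp: Low_def)
    have "card {y \<in> Low. fst y = fst p} \<le> card {C \<in> M n. card (im n C) < q ^ s}"
    proof (rule card_inj_on_le)
      show "inj_on (\<lambda>y. msub (snd y) C) {y \<in> Low. fst y = fst p}"
      proof (rule inj_onI)
        fix y y' assume "y \<in> {y \<in> Low. fst y = fst p}" "y' \<in> {y \<in> Low. fst y = fst p}" "msub (snd y) C = msub (snd y') C"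
        then show "y = y'"
          using s1 msub_inj[of "snd y" "snd y'" C] by (intro prod_eqI) (auto simp: Low_def sol_def)
      qed
      show "(\<lambda>y. msub (snd y) C) ` {y \<in> Low. fst y = fst p} \<subseteq> {C \<in> M n. card (im n C) < q ^ s}"
      proof clarify
        fix A' C' assume "(A', C') \<in> Low" "fst (A', C') = fst p"
        then have s2: "(A, C') \<in> sol n c F" by (auto simp: Low_def AC)
        have s3: "(msub A A, msub C' C) \<in> sol n c F" by (rule sol_msub[OF s2 s1])
        have MA: "A \<in> M n" using s1 by (simp add: sol_def)
        have "mv n (msub A A) x = vz n" if "x \<in> V n" for x
          using mv_msub[OF MA MA that] V_eq_iff_sub[of "mv n A x" n "mv n A x"] mv_V[OF M_mat[OF MA] that] by simp
        then have "im n (msub A A) = (\<lambda>_. vz n) ` V n" unfolding im_def by (rule image_cong[OF refl])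
        then have one: "im n (msub A A) = {vz n}" using vz_V by blast
        have pos: "0 < card (im n (msub C' C))"
        proof -
          have "V n \<noteq> {}" using vz_V[of n] by blast
          then show ?thesis by (simp add: im_def card_gt_0_iff)
        qed
        have "card (im n (msub C' C)) < q ^ s"
        proof (rule ccontr)
          assume "\<not> card (im n (msub C' C)) < q ^ s"
          then have "q ^ s \<le> card (im n (msub C' C))" by simp
          \<comment> \<open>The first component is the zero matrix, whose image has one element;
            neither alternative of expansion is compatible with that.\<close>
          from sol_ker_im(4)[OF s3 this] show False
            unfolding one using pos q_pow_pos[of n] by simp
        qed
        then show "msub (snd (A', C')) C \<in> M n \<and> card (im n (msub (snd (A', C')) C)) < q ^ s"
          using s3 by (simp add: sol_def)
      qed
    qed simp
    also have "\<dots> \<le> q ^ (2 * n * s)" by (rule card_small_im)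
    finally show "card {y \<in> Low. fst y = fst p} \<le> q ^ (2 * n * s)" .
  qed
  also have "card (fst ` Low) \<le> card {A \<in> M n. card (im n A) < q ^ s}"
    by (rule card_mono) (auto simp: Low_def sol_def)
  also have "\<dots> \<le> q ^ (2 * n * s)" by (rule card_small_im)
  finally have Low: "card Low \<le> q ^ (4 * n * s)" by (simp add: power_add[symmetric] add_mult_distrib[symmetric])
  \<comment> \<open>The first s columns of A. Where two solutions agree in them, the difference
    kills s unit vectors, and the dichotomy makes its image small.\<close>
  define \<phi> where "\<phi> = (\<lambda>p :: (nat \<Rightarrow> nat \<Rightarrow> 'a) \<times> (nat \<Rightarrow> nat \<Rightarrow> 'a). \<lambda>j\<in>{..<s}. mv n (fst p) (unit n j))"
  have "card (sol n c F) \<le> card (\<phi> ` sol n c F) * q ^ (4 * n * s)"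
  proof (rule card_le_fibers[OF finite_sol])
    fix p assume p: "p \<in> sol n c F"
    obtain A C where AC: "p = (A, C)" by (cases p)
    have s1: "(A, C) \<in> sol n c F" using p AC by auto
    have "card {y \<in> sol n c F. \<phi> y = \<phi> p} \<le> card Low"
    proof (rule card_inj_on_le)
      show "inj_on (\<lambda>y. (msub (fst y) A, msub (snd y) C)) {y \<in> sol n c F. \<phi> y = \<phi> p}"
      proof (rule inj_onI)
        fix y y' assume "y \<in> {y \<in> sol n c F. \<phi> y = \<phi> p}" "y' \<in> {y \<in> sol n c F. \<phi> y = \<phi> p}"
          "(msub (fst y) A, msub (snd y) C) = (msub (fst y') A, msub (snd y') C)"
        then show "y = y'"
          using s1 msub_inj[of "snd y" "snd y'" C] msub_inj[of "fst y" "fst y'" A]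
          by (intro prod_eqI) (auto simp: sol_def)
      qed
      show "finite Low" by (rule finite_subset[of _ "sol n c F"]) (auto simp: Low_def)
      show "(\<lambda>y. (msub (fst y) A, msub (snd y) C)) ` {y \<in> sol n c F. \<phi> y = \<phi> p} \<subseteq> Low"
      proof clarify
        fix A' C' assume s2: "(A', C') \<in> sol n c F" and eq: "\<phi> (A', C') = \<phi> p"
        have s3: "(msub A' A, msub C' C) \<in> sol n c F" by (rule sol_msub[OF s2 s1])
        have Ms: "A \<in> M n" "A' \<in> M n" using s1 s2 by (auto simp: sol_def)
        have "q ^ s \<le> card (ker n (msub A' A))"
        proof (rule card_ker_ge[OF M_mat[OF msub_M[OF Ms(2,1)]] assms])
          fix j assume "j < s"
          then have "mv n A' (unit n j) = mv n A (unit n j)"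
            using fun_cong[OF eq, of j] by (simp add: \<phi>_def AC)
          then show "mv n (msub A' A) (unit n j) = vz n"
            using mv_msub[OF Ms(2,1) unit_V] V_eq_iff_sub[of "mv n A (unit n j)" n "mv n A (unit n j)"] mv_V[OF M_mat[OF Ms(1)] unit_V] by simp
        qed
        from sol_dichotomy[OF s3 this]
        show "(msub (fst (A', C')) A, msub (snd (A', C')) C) \<in> Low" using s3 by (simp add: Low_def)
      qed
    qed
    then show "card {y \<in> sol n c F. \<phi> y = \<phi> p} \<le> q ^ (4 * n * s)" using Low by simp
  qed
  also have "card (\<phi> ` sol n c F) \<le> card ({..<s} \<rightarrow>\<^sub>E V n)"
    by (rule card_mono) (auto simp: \<phi>_def sol_def intro!: finite_PiE mv_V M_mat unit_V)
  also have "\<dots> = q ^ (n * s)" by (simp add: card_PiE card_V power_mult)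
  finally have "card (sol n c F) \<le> q ^ (n * s) * q ^ (4 * n * s)" by simp
  also have "\<dots> = q ^ (n * s + 4 * n * s)" by (rule power_add[symmetric])
  also have "n * s + 4 * n * s = 5 * n * s" by (simp add: mult.assoc)
  finally show ?thesis .
qed

end

end

section \<open>Slices of a random polynomial\<close>

text \<open>
  Multiplied by \<open>cfac\<close>, the coefficient of \<open>slm d i k l\<close> is the value of the polarization of the
  degree \<open>d\<close> part of \<open>f\<close> at the unit vectors of the \<open>i\<close>-th block and the unit vectors \<open>k\<close>, \<open>l\<close>.
\<close>

definition sl :: "nat \<Rightarrow> nat \<Rightarrow> nat multiset" where
  "sl d i = mset (map (\<lambda>r. i * (d - 2) + r) [0..<d - 2])"

definition slm :: "nat \<Rightarrow> nat \<Rightarrow> nat \<Rightarrow> nat \<Rightarrow> nat multiset" where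
  "slm d i k l = sl d i + {#k, l#}"

definition cfac :: "nat multiset \<Rightarrow> nat" where
  "cfac m = (\<Prod>j\<in>set_mset m. fact (count m j))"

lemma slm_commute: "slm d i k l = slm d i l k"
  by (simp add: slm_def add_mset_commute)

lemma set_sl: "set_mset (sl d i) = {i * (d - 2)..<i * (d - 2) + (d - 2)}"
proof -
  have "(\<lambda>r. i * (d - 2) + r) ` {0..<d - 2} = {i * (d - 2)..<i * (d - 2) + (d - 2)}"
    by (simp add: image_add_atLeastLessThan add.commute)
  then show ?thesis by (simp add: sl_def)
qed

lemma sl_lt: assumes "x \<in># sl d i" "i < c" shows "x < c * (d - 2)"
proof -
  have "x < Suc i * (d - 2)" using assms by (simp add: set_sl)
  also have "\<dots> \<le> c * (d - 2)" using assms by (intro mult_right_mono) auto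
  finally show ?thesis .
qed

lemma size_sl [simp]: "size (sl d i) = d - 2"
  by (simp add: sl_def)

lemma sl_inj: assumes "sl d i = sl d i'" "3 \<le> d" shows "i = i'"
proof -
  have m: "i * (d - 2) \<in># sl d i" "i' * (d - 2) \<in># sl d i'"
    unfolding set_sl using assms(2) by simp_all
  have "i' * (d - 2) \<le> i * (d - 2)" using m(1) unfolding assms(1) set_sl by simp
  moreover have "i * (d - 2) \<le> i' * (d - 2)" using m(2) unfolding assms(1)[symmetric] set_sl by simp
  ultimately have "i * (d - 2) = i' * (d - 2)" by (rule le_antisym[rotated])
  then show ?thesis using assms(2) by simp
qed

text \<open>Only p and q are assumed to avoid the block variables. Comparing the numbers of block
  variables on both sides forces k and l to avoid them too.\<close>

lemma slm_eqD:
  assumes eq: "slm d i k l = slm d i' p q" and "i < c" "i' < c" "c * (d - 2) \<le> p" "c * (d - 2) \<le> q"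
  shows "sl d i = sl d i'" "{#k, l#} = {#p, q#}"
proof -
  let ?S = "\<lambda>x. x < c * (d - 2)"
  have f: "filter_mset ?S (sl d j) = sl d j" if "j < c" for j
    using sl_lt that by (auto simp: filter_mset_eq_conv)
  have "filter_mset ?S (slm d i k l) = sl d i'"
    unfolding eq using f[OF assms(3)] assms(4,5) by (simp add: slm_def)
  moreover have "filter_mset ?S (slm d i k l) = sl d i + filter_mset ?S {#k, l#}"
    by (simp only: slm_def filter_union_mset f[OF assms(2)])
  ultimately have *: "sl d i + filter_mset ?S {#k, l#} = sl d i'" by simp
  then have "size (sl d i + filter_mset ?S {#k, l#}) = size (sl d i')" by simp
  then have "filter_mset ?S {#k, l#} = {#}" unfolding size_union size_sl by simp
  with * show "sl d i = sl d i'" by simp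
  then have "sl d i' + {#k, l#} = sl d i' + {#p, q#}" using eq unfolding slm_def by simp
  then show "{#k, l#} = {#p, q#}" by (rule add_left_imp_eq)
qed

text \<open>The monomial is squarefree, so the matrix entry is the coefficient itself in every
  characteristic.\<close>

lemma cfac_main:
  assumes "i < c" "c * (d - 2) \<le> k" "c * (d - 2) \<le> l" "k \<noteq> l"
  shows "cfac (slm d i k l) = 1"
proof -
  let ?xs = "map (\<lambda>r. i * (d - 2) + r) [0..<d - 2] @ [k, l]"
  have "k \<notin># sl d i" "l \<notin># sl d i"
    using sl_lt[OF _ assms(1), of k d] sl_lt[OF _ assms(1), of l d] assms by linarith+
  then have "distinct ?xs" using assms(4) by (auto simp: distinct_map inj_on_def sl_def)
  then have "count (mset ?xs) j = (if j \<in> set ?xs then 1 else 0)" for j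
    using distinct_count_atmost_1[of ?xs] by blast
  moreover have "slm d i k l = mset ?xs" by (simp add: slm_def sl_def)
  ultimately have "fact (count (slm d i k l) j) = (1::nat)" for j by simp
  then show ?thesis unfolding cfac_def by simp
qed

section \<open>The event that a given witness shows a failure of expansion\<close>

context fin_field
begin

definition Fm :: "nat \<Rightarrow> (nat multiset \<Rightarrow> 'a) \<Rightarrow> nat \<Rightarrow> nat \<Rightarrow> nat \<Rightarrow> 'a" where
  "Fm d f i k l = add_pow R (cfac (slm d i k l)) (f (slm d i k l))"

lemma Fm_sym: "Fm d f i k l = Fm d f i l k"
  by (simp add: Fm_def slm_commute)

lemma mat_Fm: "(\<And>m. f m \<in> carrier R) \<Longrightarrow> mat n (Fm d f i)"
  by (simp add: mat_def Fm_def)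

text \<open>Erasing the coordinates in P discards the entries with both indices in P; by symmetry
  these would tie different vectors \<open>u p\<close> to the same coefficient.\<close>

definition zeroat :: "nat \<Rightarrow> nat set \<Rightarrow> (nat \<Rightarrow> 'a) \<Rightarrow> nat \<Rightarrow> 'a" where
  "zeroat n P y = (\<lambda>i\<in>{..<n}. if i \<in> P then \<zero> else y i)"

lemma subsp_zeroat:
  assumes U: "subsp n U" shows "subsp n (zeroat n P ` U)"
  unfolding subsp_def
proof (intro conjI ballI)
  show "zeroat n P ` U \<subseteq> V n"
    using subspD(4)[OF U] by (auto simp: zeroat_def intro!: restrict_V)
  have "zeroat n P (vz n) = vz n" by (auto simp: zeroat_def vz_def)
  then show "vz n \<in> zeroat n P ` U" using subspD(2)[OF U] by (metis imageI)
  fix x y a assume "x \<in> zeroat n P ` U" "y \<in> zeroat n P ` U" and a: "a \<in> carrier R"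
  then obtain x' y' where xy: "x' \<in> U" "y' \<in> U" "x = zeroat n P x'" "y = zeroat n P y'" by auto
  have "vlin n x a y = zeroat n P (vlin n x' a y')"
    using a by (auto simp: xy zeroat_def vlin_def)
  then show "vlin n x a y \<in> zeroat n P ` U" using subspD(3)[OF U xy(1,2) a] by simp
qed

text \<open>The support of \<open>random_poly\<close>, which is the uniform distribution on this
  set.\<close>

definition PS :: "nat \<Rightarrow> nat set \<Rightarrow> (nat multiset \<Rightarrow> 'a) set" where
  "PS n D = PiE_dflt (monomials n D) \<zero> (\<lambda>_. carrier R)"

text \<open>The trace left by a violating pair U, U': the vectors \<open>u p\<close> are elements of
  U with leading positions p, and W is U' with the coordinates in P erased.\<close>

definition Ev :: "nat \<Rightarrow> nat set \<Rightarrow> nat \<Rightarrow> nat \<Rightarrow> nat set \<Rightarrow> (nat \<Rightarrow> nat \<Rightarrow> 'a) \<Rightarrow> (nat \<Rightarrow> 'a) set \<Rightarrow> (nat multiset \<Rightarrow> 'a) set" where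
  "Ev n D d c P u W = {f \<in> PS n D. (\<forall>p\<in>P. lead_at n (u p) p \<and> u p \<in> V n) \<and> subsp n W \<and> leads n W \<inter> P = {} \<and>
     (\<forall>i<c. \<forall>p\<in>P. zeroat n P (mv n (Fm d f i) (u p)) \<in> W)}"

lemma PS_carrier: "f \<in> PS n D \<Longrightarrow> f m \<in> carrier R"
  by (cases "m \<in> monomials n D") (auto simp: PS_def PiE_dflt_def)

lemma finite_monomials [simp]: assumes "finite D" shows "finite (monomials n D)"
  using set_monomial_list[OF assms, of n] by (metis List.finite_set)

lemma card_PS: "finite D \<Longrightarrow> card (PS n D) = q ^ card (monomials n D)"
  unfolding PS_def by (subst card_PiE_dflt) (auto simp: fin)

lemma finite_PS: "finite D \<Longrightarrow> finite (PS n D)"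
  unfolding PS_def using fin by (intro finite_PiE_dflt) auto

context
  fixes n d c :: nat and D P :: "nat set" and u :: "nat \<Rightarrow> nat \<Rightarrow> 'a" and W :: "(nat \<Rightarrow> 'a) set"
  assumes d: "3 \<le> d" "d \<in> D" "finite D" and s: "c * (d - 2) \<le> n"
    and P: "P \<subseteq> {c * (d - 2)..<n}" and W: "subsp n W"
begin

text \<open>The rows whose entries are dependent for vectors of W: the entries at the leading
  positions of W determine them.\<close>

definition Lset :: "nat set" where "Lset = {c * (d - 2)..<n} - P - leads n W"

text \<open>The coefficients that, within the event, are determined by all others.\<close>

definition main :: "nat multiset set" where
  "main = (\<lambda>(i, p, l). slm d i p l) ` ({..<c} \<times> P \<times> Lset)"

lemma main_monomials: "main \<subseteq> monomials n D"
proof -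
  have lt: "x < n" if "x \<in># sl d i" "i < c" for x i using sl_lt[OF that] s by simp
  show ?thesis
  proof
    fix m assume "m \<in> main"
    then obtain i p l where m: "i < c" "p \<in> P" "l \<in> Lset" "m = slm d i p l" by (auto simp: main_def)
    have "p < n" "l < n" using P m by (auto simp: Lset_def)
    then have "set_mset m \<subseteq> {..<n}" using lt[OF _ m(1)] by (auto simp: m(4) slm_def)
    moreover have "size m = d" using d by (simp add: m(4) slm_def)
    ultimately show "m \<in> monomials n D" using d by (simp add: monomials_def)
  qed
qed

lemma card_main: "card main = c * card P * card Lset"
proof -
  have "inj_on (\<lambda>(i, p, l). slm d i p l) ({..<c} \<times> P \<times> Lset)"
  proof (rule inj_onI, clarsimp)
    fix i p l i' p' l' assume a: "i < c" "i' < c" "p \<in> P" "p' \<in> P" "l \<in> Lset" "l' \<in> Lset"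
      and eq: "slm d i p l = slm d i' p' l'"
    have "sl d i = sl d i'" "{#p, l#} = {#p', l'#}"
      using slm_eqD[OF eq, of c] a P by (auto simp: Lset_def)
    then show "i = i' \<and> p = p' \<and> l = l'"
      using a sl_inj d by (auto simp: add_eq_conv_ex Lset_def)
  qed
  then show ?thesis by (simp add: main_def card_image card_cartesian_product)
qed

text \<open>The free variables of a monomial in \<open>main\<close> lie in the disjoint sets P and
  \<open>Lset\<close>; knowing that one of them is not in P assigns both.\<close>

lemma not_main:
  assumes "i < c" "l \<notin> P" "slm d i l k \<in> main" shows "l \<in> Lset" "k \<in> P"
proof -
  obtain i1 p1 l1 where 1: "i1 < c" "p1 \<in> P" "l1 \<in> Lset" "slm d i l k = slm d i1 p1 l1"
    using assms(3) by (auto simp: main_def)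
  have "{#l, k#} = {#p1, l1#}" using slm_eqD(2)[OF 1(4) assms(1) 1(1)] 1 P by (auto simp: Lset_def)
  then have "l = l1 \<and> k = p1" using 1 assms(2) by (auto simp: add_eq_conv_ex)
  then show "l \<in> Lset" "k \<in> P" using 1 by auto
qed

text \<open>A triangular argument. For vectors of W the rows in \<open>Lset\<close> follow from
  those at the leading positions; going through P in increasing order, row l of the image of
  \<open>u p\<close> then yields the coefficient of \<open>slm d i p l\<close>, whose factor
  \<open>u p p\<close> is nonzero.\<close>

lemma Ev_inj: "inj_on (\<lambda>f. restrict f (monomials n D - main)) (Ev n D d c P u W)"
proof (rule inj_onI, rule ccontr)
  fix f f' assume f: "f \<in> Ev n D d c P u W" and f': "f' \<in> Ev n D d c P u W"
    and eq: "restrict f (monomials n D - main) = restrict f' (monomials n D - main)" and ne: "f \<noteq> f'"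
  have PSf: "f \<in> PS n D" "f' \<in> PS n D" using f f' by (auto simp: Ev_def)
  have off: "f m = f' m" if "m \<notin> main" for m
  proof (cases "m \<in> monomials n D")
    case True
    then show ?thesis using fun_cong[OF eq, of m] that by simp
  next
    case False
    then show ?thesis using PSf by (auto simp: PS_def PiE_dflt_def)
  qed
  note cf = PS_carrier[OF PSf(1)] PS_carrier[OF PSf(2)]
  define B where "B = {p \<in> P. \<exists>i<c. \<exists>l\<in>Lset. f (slm d i p l) \<noteq> f' (slm d i p l)}"
  have "finite P" by (rule finite_subset[OF P]) simp
  then have finB: "finite B" by (simp add: B_def)
  obtain m where "f m \<noteq> f' m" using ne by auto
  then have "m \<in> main" using off by auto
  then have neB: "B \<noteq> {}" using \<open>f m \<noteq> f' m\<close> by (auto simp: B_def main_def)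
  \<comment> \<open>With p minimal, entries in columns below p agree, and \<open>u p\<close>
    vanishes above p. Column p is the only one where f and f' can make a difference.\<close>
  define p where "p = Min B"
  have pB: "p \<in> B" unfolding p_def by (rule Min_in[OF finB neB])
  then obtain i l where il: "i < c" "l \<in> Lset" "f (slm d i p l) \<noteq> f' (slm d i p l)" by (auto simp: B_def)
  have pP: "p \<in> P" using pB by (simp add: B_def)
  have small: "f (slm d i l' k) = f' (slm d i l' k)" if "k < p" "l' \<notin> P" for k l'
  proof (cases "slm d i l' k \<in> main")
    case True
    then have "l' \<in> Lset" "k \<in> P" using not_main[OF il(1) that(2)] by auto
    moreover have "k \<notin> B" using that(1) Min_le[OF finB, of k] unfolding p_def by (meson not_le)
    ultimately show ?thesis using il(1) unfolding B_def slm_commute[of d i l' k] by blast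
  qed (rule off)
  have lead: "lead_at n (u p) p" and uV: "u p \<in> V n" using f pP by (auto simp: Ev_def)
  define y y' where "y = mv n (Fm d f i) (u p)" and "y' = mv n (Fm d f' i) (u p)"
  have term_eq: "Fm d f i l' k \<otimes> u p k = Fm d f' i l' k \<otimes> u p k"
    if "k < n" "l' \<notin> P" "k = p \<Longrightarrow> f (slm d i l' k) = f' (slm d i l' k)" for l' k
  proof (cases k p rule: linorder_cases)
    case greater
    then have "u p k = \<zero>" using lead that(1) by (simp add: lead_at_def)
    then show ?thesis using cf by (simp add: Fm_def)
  qed (use that small in \<open>simp_all add: Fm_def\<close>)
  \<comment> \<open>At the leading positions of W even column p causes no difference, because
    \<open>slm d i l' p\<close> is not in \<open>main\<close>.\<close>
  have "zeroat n P y l' = zeroat n P y' l'" if l': "l' \<in> leads n W" for l'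
  proof -
    have l'n: "l' < n" using l' leads_subset by blast
    have l'P: "l' \<notin> P" using f l' by (auto simp: Ev_def)
    have "slm d i l' p \<notin> main" using not_main(1)[OF il(1) l'P, of p] l' by (auto simp: Lset_def)
    then have "y l' = y' l'"
      unfolding y_def y'_def mv_apply[OF l'n] using term_eq[OF _ l'P] off uV cf
      by (intro finsum_cong') (auto simp: V_mem Fm_def)
    then show ?thesis using l'n by (simp add: zeroat_def)
  qed
  moreover have "zeroat n P y \<in> W" "zeroat n P y' \<in> W" using f f' pP il by (auto simp: Ev_def y_def y'_def)
  ultimately have "zeroat n P y = zeroat n P y'" by (intro eq_if_eq_on_leads[OF W]) auto
  then have "zeroat n P y l = zeroat n P y' l" by (rule fun_cong)
  moreover have ln: "l < n" "l \<notin> P" using il(2) by (auto simp: Lset_def)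
  ultimately have "y l = y' l" by (simp add: zeroat_def)
  moreover have pn: "p < n" using P pP by auto
  have split: "(\<Oplus>k\<in>{..<n}. h k) = h p \<oplus> (\<Oplus>k\<in>{..<n} - {p}. h k)" if "\<And>k. k < n \<Longrightarrow> h k \<in> carrier R" for h
  proof -
    have "{..<n} = insert p ({..<n} - {p})" using pn by auto
    then have "(\<Oplus>k\<in>{..<n}. h k) = (\<Oplus>k\<in>insert p ({..<n} - {p}). h k)" by simp
    also have "\<dots> = h p \<oplus> (\<Oplus>k\<in>{..<n} - {p}. h k)"
      using that pn by (intro finsum_insert) auto
    finally show ?thesis .
  qed
  have cl: "Fm d f i l k \<otimes> u p k \<in> carrier R" "Fm d f' i l k \<otimes> u p k \<in> carrier R" if "k < n" for k
    using that cf uV by (auto simp: Fm_def V_mem)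
  have rest: "(\<Oplus>k\<in>{..<n} - {p}. Fm d f i l k \<otimes> u p k) = (\<Oplus>k\<in>{..<n} - {p}. Fm d f' i l k \<otimes> u p k)"
    using term_eq[OF _ ln(2)] cl by (intro finsum_cong') auto
  have restc: "(\<Oplus>k\<in>{..<n} - {p}. Fm d f' i l k \<otimes> u p k) \<in> carrier R"
    using cl by (intro finsum_closed) auto
  ultimately have "Fm d f i l p \<otimes> u p p = Fm d f' i l p \<otimes> u p p"
    unfolding y_def y'_def mv_apply[OF ln(1)] using split[of "\<lambda>k. Fm d f i l k \<otimes> u p k"] split[of "\<lambda>k. Fm d f' i l k \<otimes> u p k"] cl rest restc pn
    by (simp add: add.r_cancel)
  moreover have "Fm d f i l p = f (slm d i l p)" "Fm d f' i l p = f' (slm d i l p)"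
  proof -
    have "c * (d - 2) \<le> p" "c * (d - 2) \<le> l" "l \<noteq> p" using pP P ln il(2) by (auto simp: Lset_def)
    then have "cfac (slm d i l p) = 1" by (intro cfac_main[OF il(1)])
    then show "Fm d f i l p = f (slm d i l p)" "Fm d f' i l p = f' (slm d i l p)"
      using cf by (simp_all add: Fm_def)
  qed
  moreover have "u p p \<in> carrier R" "u p p \<noteq> \<zero>" using lead uV pn by (auto simp: lead_at_def V_mem)
  ultimately have "f (slm d i l p) = f' (slm d i l p)" using cf by (simp add: m_rcancel)
  then show False using il(3) by (simp add: slm_commute)
qed

lemma card_Ev: "card (Ev n D d c P u W) \<le> q ^ (card (monomials n D) - c * card P * card Lset)"
proof -
  have "card (Ev n D d c P u W) \<le> card ((monomials n D - main) \<rightarrow>\<^sub>E carrier R)"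
  proof (rule card_inj_on_le[OF Ev_inj])
    show "(\<lambda>f. restrict f (monomials n D - main)) ` Ev n D d c P u W \<subseteq> (monomials n D - main) \<rightarrow>\<^sub>E carrier R"
      using PS_carrier by (auto simp: Ev_def)
    show "finite ((monomials n D - main) \<rightarrow>\<^sub>E carrier R)" using d fin by (intro finite_PiE) auto
  qed
  also have "\<dots> = q ^ card (monomials n D - main)" using d by (simp add: card_PiE)
  also have "card (monomials n D - main) = card (monomials n D) - c * card P * card Lset"
    using main_monomials d card_main by (subst card_Diff_subset) (auto intro: finite_subset)
  finally show ?thesis .
qed

end

end

section \<open>Union bound over all witnesses\<close>

context fin_field
begin

context
  fixes n d :: nat and D :: "nat set" and s :: nat
  defines "s \<equiv> 80 * (d - 2)"
  assumes d: "3 \<le> d" "d \<in> D" "finite D" and n: "8 * s \<le> n"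
begin

lemma s_ge: "80 \<le> s" using d by (simp add: s_def)

definition Idx :: "nat \<Rightarrow> (nat set \<times> (nat \<Rightarrow> nat \<Rightarrow> 'a) \<times> (nat \<Rightarrow> 'a) set) set" where
  "Idx k = (SIGMA P:{P. P \<subseteq> {s..<n} \<and> card P = k}. (P \<rightarrow>\<^sub>E V n) \<times> {W. subsp n W \<and> card W < q ^ (5 * k)})"

definition BadK :: "nat \<Rightarrow> (nat multiset \<Rightarrow> 'a) set" where
  "BadK k = (\<Union>(P, u, W)\<in>Idx k. Ev n D d 80 P u W)"

lemma finite_index_sets: "finite {P. P \<subseteq> {s..<n} \<and> card P = k}"
  by (rule finite_subset[of _ "Pow {s..<n}"]) auto

lemma finite_Idx: "finite (Idx k)"
  unfolding Idx_def
  by (intro finite_SigmaI finite_index_sets finite_cartesian_product finite_subspaces finite_PiE)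
     (auto intro: finite_subset)

text \<open>The exponent n pays for the set P, as 2 <= q, then k n for the vectors and 5 k n for the
  subspace.\<close>

lemma card_Idx: "card (Idx k) \<le> q ^ (n + 6 * k * n)"
proof -
  have "card (Idx k) = (\<Sum>P\<in>{P. P \<subseteq> {s..<n} \<and> card P = k}. card ((P \<rightarrow>\<^sub>E V n) \<times> {W. subsp n W \<and> card W < q ^ (5 * k)}))"
    unfolding Idx_def
    by (intro card_SigmaI finite_index_sets ballI finite_cartesian_product finite_subspaces finite_PiE)
       (auto intro: finite_subset)
  also have "\<dots> \<le> (\<Sum>P\<in>{P. P \<subseteq> {s..<n} \<and> card P = k}. q ^ (6 * k * n))"
  proof (rule sum_mono)
    fix P assume P: "P \<in> {P. P \<subseteq> {s..<n} \<and> card P = k}"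
    then have "finite P" by (auto intro: finite_subset)
    then have "card (P \<rightarrow>\<^sub>E V n) = q ^ (n * k)" using P by (simp add: card_PiE card_V power_mult)
    then have "card ((P \<rightarrow>\<^sub>E V n) \<times> {W. subsp n W \<and> card W < q ^ (5 * k)}) \<le> q ^ (n * k) * q ^ (n * (5 * k))"
      using card_subspaces[of n "5 * k"] by (simp add: card_cartesian_product)
    also have "\<dots> = q ^ (n * k + n * (5 * k))" by (rule power_add[symmetric])
    also have "n * k + n * (5 * k) = 6 * k * n" by (simp add: algebra_simps)
    finally show "card ((P \<rightarrow>\<^sub>E V n) \<times> {W. subsp n W \<and> card W < q ^ (5 * k)}) \<le> q ^ (6 * k * n)" .
  qed
  also have "\<dots> = card {P. P \<subseteq> {s..<n} \<and> card P = k} * q ^ (6 * k * n)" by simp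
  also have "card {P. P \<subseteq> {s..<n} \<and> card P = k} \<le> card (Pow {..<n})"
    by (rule card_mono) auto
  also have "card (Pow {..<n}) = 2 ^ n" by (simp add: card_Pow)
  also have "(2::nat) ^ n \<le> q ^ n" using q_ge_2 by (intro power_mono) auto
  finally show ?thesis by (simp add: power_add)
qed

text \<open>Of the n positions, at most n / 8 are lost to the blocks, n / 8 to P and 5 n / 8 to the
  leading positions of W. The remaining n / 8 rows, k columns and 80 matrices give 10 k n determined
  coefficients.\<close>

lemma card_Ev_le:
  assumes k: "8 * k \<le> n" "1 \<le> k" and x: "(P, u, W) \<in> Idx k"
  shows "card (Ev n D d 80 P u W) * q ^ (10 * k * n) \<le> q ^ card (monomials n D)"
proof -
  have P: "P \<subseteq> {s..<n}" "card P = k" and W: "subsp n W" "card W < q ^ (5 * k)"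
    using x by (auto simp: Idx_def)
  have sn: "80 * (d - 2) \<le> n" using n by (simp add: s_def)
  note hyps = d sn P(1)[unfolded s_def] W(1)
  let ?L = "{s..<n} - P - leads n W"
  have Ldef: "Lset n d 80 P W = ?L" by (simp add: Lset_def[OF hyps] s_def)
  have lw: "card (leads n W) < 5 * k"
  proof (rule ccontr)
    assume "\<not> card (leads n W) < 5 * k"
    then have "q ^ (5 * k) \<le> q ^ card (leads n W)" using q_ge_2 by (intro power_increasing) auto
    then show False using W card_subsp by simp
  qed
  have "n - s - k - card (leads n W) \<le> card ?L"
  proof -
    have "finite P" using P by (auto intro: finite_subset)
    then have "card {s..<n} - card P \<le> card ({s..<n} - P)" by (intro diff_card_le_card_Diff)
    moreover have "card ({s..<n} - P) - card (leads n W) \<le> card ?L" by (intro diff_card_le_card_Diff) simp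
    ultimately show ?thesis using P(2) by simp
  qed
  then have "n \<le> 8 * card ?L" using lw k n by linarith
  then have "10 * k * n \<le> 10 * k * (8 * card ?L)" by (intro mult_left_mono) auto
  also have "\<dots> = 80 * card P * card ?L" using P(2) by simp
  finally have ge: "10 * k * n \<le> 80 * card P * card ?L" .
  have "80 * card P * card ?L \<le> card (monomials n D)"
    using card_mono[OF finite_monomials[OF d(3)] main_monomials[OF hyps]] unfolding card_main[OF hyps] Ldef .
  then have e: "card (monomials n D) - 80 * card P * card ?L + 10 * k * n \<le> card (monomials n D)" using ge by linarith
  have "card (Ev n D d 80 P u W) * q ^ (10 * k * n) \<le> q ^ (card (monomials n D) - 80 * card P * card ?L) * q ^ (10 * k * n)"
    using card_Ev[OF hyps, of u] unfolding Ldef by (intro mult_right_mono) auto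
  also have "\<dots> = q ^ (card (monomials n D) - 80 * card P * card ?L + 10 * k * n)" by (rule power_add[symmetric])
  also have "\<dots> \<le> q ^ card (monomials n D)" using e q_ge_2 by (intro power_increasing) auto
  finally show ?thesis .
qed

text \<open>The gain 10 k n exceeds the entropy n + 6 k n of the witnesses by at least 3 n, because
  k >= 1.\<close>

lemma card_BadK:
  assumes k: "8 * k \<le> n" "1 \<le> k"
  shows "card (BadK k) * q ^ (3 * n) \<le> q ^ card (monomials n D)"
proof -
  have "card (BadK k) \<le> (\<Sum>x\<in>Idx k. card (case x of (P, u, W) \<Rightarrow> Ev n D d 80 P u W))"
    unfolding BadK_def by (rule card_UN_le[OF finite_Idx])
  then have "card (BadK k) * q ^ (10 * k * n) \<le> (\<Sum>x\<in>Idx k. card (case x of (P, u, W) \<Rightarrow> Ev n D d 80 P u W) * q ^ (10 * k * n))"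
    by (simp add: sum_distrib_right[symmetric])
  also have "\<dots> \<le> (\<Sum>x\<in>Idx k. q ^ card (monomials n D))"
    using card_Ev_le[OF k] by (intro sum_mono) auto
  also have "\<dots> \<le> q ^ (n + 6 * k * n) * q ^ card (monomials n D)"
    using card_Idx[of k] by simp
  finally have *: "card (BadK k) * q ^ (10 * k * n) \<le> q ^ (n + 6 * k * n) * q ^ card (monomials n D)" .
  have "n \<le> k * n" using k(2) by simp
  then have "3 * n + (n + 6 * k * n) \<le> 10 * k * n" by (simp add: mult.assoc)
  then have "q ^ (3 * n + (n + 6 * k * n)) \<le> q ^ (10 * k * n)" using q_ge_2 by (intro power_increasing) auto
  then have "card (BadK k) * q ^ (3 * n + (n + 6 * k * n)) \<le> card (BadK k) * q ^ (10 * k * n)"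
    by (rule mult_left_mono) simp
  with * have "card (BadK k) * q ^ (3 * n + (n + 6 * k * n)) \<le> q ^ (n + 6 * k * n) * q ^ card (monomials n D)" by (rule order_trans[rotated])
  then have "q ^ (n + 6 * k * n) * (card (BadK k) * q ^ (3 * n)) \<le> q ^ (n + 6 * k * n) * q ^ card (monomials n D)"
    unfolding power_add by (simp only: mult_ac)
  then show ?thesis unfolding mult_le_cancel1 by (rule mp[OF _ q_pow_pos])
qed

text \<open>From a violating pair, k leading positions of U outside the first s coordinates and
  vectors of U realizing them are selected; k is kept small against n and large against the
  dimension of U'.\<close>

lemma bad_subset:
  "{f \<in> PS n D. \<not> expands n 80 (Fm d f) (2 * s)} \<subseteq> (\<Union>k\<in>{k. 8 * k \<le> n \<and> 1 \<le> k}. BadK k)"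
proof
  fix f assume "f \<in> {f \<in> PS n D. \<not> expands n 80 (Fm d f) (2 * s)}"
  then have f: "f \<in> PS n D" and "\<not> expands n 80 (Fm d f) (2 * s)" by auto
  then obtain U U' where U: "subsp n U" and U': "subsp n U'"
    and maps: "\<And>i x. i < 80 \<Longrightarrow> x \<in> U \<Longrightarrow> mv n (Fm d f i) x \<in> U'"
    and big: "q ^ (2 * s) \<le> card U" and le: "card U' \<le> card U" and sq: "card U' * card U' \<le> q ^ n"
    unfolding expands_def by (auto simp: not_less)
  define a b where "a = card (leads n U)" and "b = card (leads n U')"
  have cU: "card U = q ^ a" "card U' = q ^ b" using card_subsp U U' by (auto simp: a_def b_def)
  have q1: "1 < q" using q_ge_2 by simp
  have a: "2 * s \<le> a" using big cU power_increasing_iff[OF q1] by simp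
  have ba: "b \<le> a" using le cU power_increasing_iff[OF q1] by simp
  have bn: "b + b \<le> n" using sq cU power_increasing_iff[OF q1, of "b + b" n] by (simp add: power_add)
  \<comment> \<open>At least a - s leading positions of U lie outside the first s coordinates; the
    cap n / 8 is what \<open>card_Ev_le\<close> tolerates.\<close>
  define k where "k = min (a - s) (n div 8)"
  have k: "8 * k \<le> n" "1 \<le> k" using a n s_ge by (auto simp: k_def)
  \<comment> \<open>In the uncapped case b <= a <= 2 (a - s), since a >= 2 s. In the capped case b
    <= n / 2, which is below 5 (n div 8) for n as large as assumed.\<close>
  have b5: "b < 5 * k"
  proof (cases "a - s \<le> n div 8")
    case True
    then have "k = a - s" by (simp add: k_def)
    then show ?thesis using ba a s_ge by linarith
  next
    case False
    then have "k = n div 8" by (simp add: k_def)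
    then show ?thesis using bn n s_ge by linarith
  qed
  have "card (leads n U) - card {..<s} \<le> card (leads n U - {..<s})"
    by (intro diff_card_le_card_Diff) simp
  then have "k \<le> card (leads n U - {..<s})" unfolding a_def[symmetric] k_def by simp
  then obtain P where P: "P \<subseteq> leads n U - {..<s}" "card P = k" "finite P"
    by (rule obtain_subset_with_card_n)
  have "\<forall>p\<in>P. \<exists>u. u \<in> U \<and> lead_at n u p" using P by (auto simp: leads_def)
  from bchoice[OF this] obtain u0 where u0: "\<And>p. p \<in> P \<Longrightarrow> u0 p \<in> U \<and> lead_at n (u0 p) p" by blast
  define u where "u = restrict u0 P"
  have u: "u p \<in> U" "lead_at n (u p) p" if "p \<in> P" for p using u0[OF that] that by (auto simp: u_def)
  define W where "W = zeroat n P ` U'"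
  have W: "subsp n W" unfolding W_def by (rule subsp_zeroat[OF U'])
  have "card W \<le> card U'" unfolding W_def by (rule card_image_le[OF subspD(5)[OF U']])
  also have "\<dots> < q ^ (5 * k)" using b5 cU q1 by (simp add: power_strict_increasing)
  finally have cW: "card W < q ^ (5 * k)" .
  have PS: "P \<subseteq> {s..<n}" using P leads_subset[of n U] by fastforce
  have "leads n W \<inter> P = {}" by (auto simp: W_def leads_def lead_at_def zeroat_def)
  moreover have uV: "u p \<in> V n" if "p \<in> P" for p using u[OF that] subspD(1)[OF U] by auto
  ultimately have "f \<in> Ev n D d 80 P u W"
    using f W u maps by (auto simp: Ev_def W_def)
  moreover have "u \<in> P \<rightarrow>\<^sub>E V n" using uV by (auto simp: u_def)
  then have "(P, u, W) \<in> Idx k" using PS P W cW by (simp add: Idx_def)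
  ultimately have "f \<in> BadK k" unfolding BadK_def by blast
  then show "f \<in> (\<Union>k\<in>{k. 8 * k \<le> n \<and> 1 \<le> k}. BadK k)" using k by blast
qed

text \<open>There are at most n <= 2 ^ n <= q ^ n values of k, which uses up one of the three
  factors q ^ n gained for each of them.\<close>

lemma card_bad:
  "card {f \<in> PS n D. \<not> expands n 80 (Fm d f) (2 * s)} * q ^ n \<le> card (PS n D)"
proof -
  let ?K = "{k. 8 * k \<le> n \<and> 1 \<le> k}"
  have finK: "finite ?K" by (rule finite_subset[of _ "{..n}"]) auto
  have "card {f \<in> PS n D. \<not> expands n 80 (Fm d f) (2 * s)} \<le> card (\<Union>k\<in>?K. BadK k)"
    by (rule card_mono[OF _ bad_subset], rule finite_subset[OF _ finite_PS[OF d(3), of n]])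
       (auto simp: BadK_def Ev_def)
  also have "\<dots> \<le> (\<Sum>k\<in>?K. card (BadK k))" by (rule card_UN_le[OF finK])
  finally have "card {f \<in> PS n D. \<not> expands n 80 (Fm d f) (2 * s)} * q ^ (3 * n) \<le> (\<Sum>k\<in>?K. card (BadK k) * q ^ (3 * n))"
    by (simp add: sum_distrib_right[symmetric])
  also have "\<dots> \<le> (\<Sum>k\<in>?K. q ^ card (monomials n D))" using card_BadK by (intro sum_mono) auto
  also have "\<dots> = card ?K * q ^ card (monomials n D)" by simp
  also have "card ?K \<le> card {1..n}" by (rule card_mono) auto
  also have "card {1..n} \<le> 2 ^ n" by (simp add: less_imp_le)
  also have "(2::nat) ^ n \<le> q ^ n" using q_ge_2 by (intro power_mono) auto
  finally have *: "card {f \<in> PS n D. \<not> expands n 80 (Fm d f) (2 * s)} * q ^ (3 * n) \<le> q ^ n * q ^ card (monomials n D)"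
    by simp
  have "q ^ (3 * n) = q ^ n * q ^ (2 * n)" by (simp flip: power_add)
  with * have "q ^ n * (card {f \<in> PS n D. \<not> expands n 80 (Fm d f) (2 * s)} * q ^ (2 * n)) \<le> q ^ n * q ^ card (monomials n D)"
    by (simp only: mult.left_commute)
  then have "card {f \<in> PS n D. \<not> expands n 80 (Fm d f) (2 * s)} * q ^ (2 * n) \<le> card (PS n D)"
    unfolding card_PS[OF d(3)] mult_le_cancel1 by (rule mp[OF _ q_pow_pos])
  moreover have "q ^ n \<le> q ^ (2 * n)" using q_ge_2 by (intro power_increasing) auto
  ultimately show ?thesis by (meson le_trans mult_le_mono2)
qed

text \<open>Stated for an arbitrary property Q of f that fails on expanding polynomials; the
  intended Q says that some g is answered wrongly.\<close>

lemma prob_bad: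
  assumes Q: "\<And>f. f \<in> PS n D \<Longrightarrow> expands n 80 (Fm d f) (2 * s) \<Longrightarrow> \<not> Q f"
  shows "measure_pmf.prob (random_poly R n D) {f. Q f} \<le> 1 / real q ^ n"
proof -
  let ?B = "{f \<in> PS n D. \<not> expands n 80 (Fm d f) (2 * s)}"
  have ne: "carrier R \<noteq> {}" by auto
  have rp: "random_poly R n D = pmf_of_set (PS n D)"
    unfolding random_poly_def PS_def by (rule Pi_pmf_of_set[OF finite_monomials[OF d(3)] fin ne])
  have fPS: "finite (PS n D)" by (rule finite_PS[OF d(3)])
  have pos: "0 < card (PS n D)" unfolding card_PS[OF d(3)] by (rule q_pow_pos)
  then have nePS: "PS n D \<noteq> {}" by auto
  have "measure_pmf.prob (random_poly R n D) {f. Q f} = real (card (PS n D \<inter> {f. Q f})) / real (card (PS n D))"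
    unfolding rp by (rule measure_pmf_of_set[OF nePS fPS])
  also have "\<dots> \<le> real (card ?B) / real (card (PS n D))"
    using Q fPS by (intro divide_right_mono of_nat_mono card_mono) auto
  also have "\<dots> \<le> 1 / real q ^ n"
  proof -
    have "real (card ?B) * real q ^ n \<le> real (card (PS n D))"
      using card_bad unfolding of_nat_le_iff[where 'a = real, symmetric] by simp
    then show ?thesis using pos q_ge_2 by (simp add: field_simps)
  qed
  finally show ?thesis .
qed

end

end

section \<open>Coefficients of a linear substitution\<close>

lemma finite_submsets [simp]: "finite {a. a \<subseteq># m}"
proof (induction m)
  case (add x m)
  have "a \<in> {a. a \<subseteq># m} \<union> add_mset x ` {a. a \<subseteq># m}" if "a \<subseteq># add_mset x m" for a
  proof (cases "x \<in># a")
    case True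
    then obtain b where "a = add_mset x b" by (metis insert_DiffM)
    then show ?thesis using that by auto
  next
    case False
    have "count a y \<le> count m y" for y
      using mset_subset_eq_count[OF that, of y] False by (cases "y = x") (auto simp: not_in_iff)
    then have "a \<subseteq># m" by (simp add: subseteq_mset_def)
    then show ?thesis by simp
  qed
  then have "{a. a \<subseteq># add_mset x m} \<subseteq> {a. a \<subseteq># m} \<union> add_mset x ` {a. a \<subseteq># m}" by blast
  then show ?case by (rule finite_subset) (use add in simp)
qed simp

text \<open>Weakly decreasing lists are canonical forms of monomials, suited both to decoding from
  digits and to ranking in \<open>degree_monos\<close>.\<close>

definition DL :: "nat \<Rightarrow> nat \<Rightarrow> nat list set" where
  "DL n k = {I. length I = k \<and> set I \<subseteq> {..<n} \<and> sorted_wrt (\<ge>) I}"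

lemma finite_DL [simp]: "finite (DL n k)"
  by (rule finite_subset[OF _ finite_lists_length_eq[of "{..<n}" k]]) (auto simp: DL_def)

lemma mset_inj_DL: "inj_on mset (DL n k)"
proof (rule inj_onI)
  fix I J assume "I \<in> DL n k" "J \<in> DL n k" and eq: "mset I = mset J"
  then have "sorted (rev I)" "sorted (rev J)" by (auto simp: DL_def sorted_wrt_rev)
  then have "sort (rev I) = rev I" "sort (rev I) = rev J" using eq by (auto intro!: properties_for_sort)
  then have "rev I = rev J" by simp
  then show "I = J" by simp
qed

lemma mset_image_DL: "mset ` DL n k = {m. set_mset m \<subseteq> {..<n} \<and> size m = k}"
proof (intro equalityI subsetI)
  fix m assume m: "m \<in> {m. set_mset m \<subseteq> {..<n} \<and> size m = k}"
  let ?I = "rev (sorted_list_of_multiset m)"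
  have "mset ?I = m" by simp
  moreover have "set ?I \<subseteq> {..<n}" using m by simp
  moreover have "length ?I = k"
  proof -
    have "size (mset ?I) = size m" by simp
    then show ?thesis using m by (simp only: size_mset mem_Collect_eq)
  qed
  moreover have "sorted_wrt (\<ge>) ?I" by (simp add: sorted_wrt_rev)
  ultimately have "?I \<in> DL n k" by (simp add: DL_def)
  then show "m \<in> mset ` DL n k" by (rule image_eqI[rotated]) simp
qed (auto simp: DL_def)

section \<open>The convolution product of multivariate polynomials\<close>

context cring
begin

definition conv :: "('v multiset \<Rightarrow> 'a) \<Rightarrow> ('v multiset \<Rightarrow> 'a) \<Rightarrow> 'v multiset \<Rightarrow> 'a" where
  "conv p r m = (\<Oplus>a\<in>{a. a \<subseteq># m}. p a \<otimes> r (m - a))"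

abbreviation cc :: "('v multiset \<Rightarrow> 'a) \<Rightarrow> bool" where "cc p \<equiv> \<forall>m. p m \<in> carrier R"

lemma conv_carrier: "cc p \<Longrightarrow> cc r \<Longrightarrow> conv p r m \<in> carrier R"
  unfolding conv_def by (intro finsum_closed) auto

text \<open>Complementation a -> m - a permutes the submultisets of m.\<close>

lemma conv_comm:
  fixes p r :: "'v multiset \<Rightarrow> 'a"
  assumes "cc p" "cc r" shows "conv p r = conv r p"
proof
  fix m :: "'v multiset"
  have img: "(\<lambda>a. m - a) ` {a. a \<subseteq># m} = {a. a \<subseteq># m}"
  proof (intro equalityI subsetI)
    fix a assume "a \<in> {a. a \<subseteq># m}"
    then have "a = m - (m - a)" "m - a \<in> {a. a \<subseteq># m}"
      by (auto simp: multiset_eq_iff subseteq_mset_def)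
    then show "a \<in> (\<lambda>a. m - a) ` {a. a \<subseteq># m}" by blast
  qed auto
  have inj: "inj_on (\<lambda>a. m - a) {a. a \<subseteq># m}"
    by (rule inj_on_inverseI[where g = "\<lambda>a. m - a"]) (auto simp: multiset_eq_iff subseteq_mset_def)
  have "conv p r m = (\<Oplus>a\<in>(\<lambda>a. m - a) ` {a. a \<subseteq># m}. p a \<otimes> r (m - a))"
    unfolding img conv_def ..
  also have "\<dots> = (\<Oplus>a\<in>{a. a \<subseteq># m}. p (m - a) \<otimes> r (m - (m - a)))"
    using assms by (intro finsum_reindex inj) auto
  also have "\<dots> = conv r p m"
    unfolding conv_def using assms
  proof (intro finsum_cong')
    fix a assume "a \<in> {a. a \<subseteq># m}"
    then have "m - (m - a) = a" by (auto simp: multiset_eq_iff subseteq_mset_def)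
    then show "p (m - a) \<otimes> r (m - (m - a)) = r a \<otimes> p (m - a)" using assms by (simp add: m_comm)
  qed auto
  finally show "conv p r m = conv r p m" .
qed

lemma conv_const:
  fixes r :: "'v multiset \<Rightarrow> 'a"
  assumes "k \<in> carrier R" "cc r" shows "conv (indexed_const k) r = (\<lambda>m. k \<otimes> r m)"
proof
  fix m :: "'v multiset"
  have "conv (indexed_const k) r m = (\<Oplus>a\<in>{a. a \<subseteq># m}. if {#} = a then k \<otimes> r (m - a) else \<zero>)"
    unfolding conv_def indexed_const_def using assms by (intro finsum_cong') auto
  also have "\<dots> = k \<otimes> r (m - {#})"
    using assms by (intro finsum_singleton) auto
  finally show "conv (indexed_const k) r m = k \<otimes> r m" by simp
qed

lemma conv_padd:
  fixes r :: "'v multiset \<Rightarrow> 'a"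
  assumes "cc p" "cc p'" "cc r"
  shows "conv (indexed_padd p p') r = indexed_padd (conv p r) (conv p' r)"
proof
  fix m :: "'v multiset"
  have "conv (indexed_padd p p') r m = (\<Oplus>a\<in>{a. a \<subseteq># m}. p a \<otimes> r (m - a) \<oplus> p' a \<otimes> r (m - a))"
    unfolding conv_def indexed_padd_def using assms by (intro finsum_cong') (auto simp: l_distr)
  also have "\<dots> = indexed_padd (conv p r) (conv p' r) m"
    unfolding conv_def indexed_padd_def using assms by (intro finsum_addf) auto
  finally show "conv (indexed_padd p p') r m = indexed_padd (conv p r) (conv p' r) m" .
qed

lemma cc_pmult: "cc p \<Longrightarrow> cc (indexed_pmult p i)"
  by (simp add: indexed_pmult_def)

text \<open>Only submultisets a containing i contribute, and removing one i from both m and a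
  matches them with the submultisets of m - {#i#}.\<close>

lemma conv_pmult:
  fixes r :: "'v multiset \<Rightarrow> 'a"
  assumes "cc p" "cc r"
  shows "conv (indexed_pmult p i) r = indexed_pmult (conv p r) i"
proof
  fix m :: "'v multiset"
  show "conv (indexed_pmult p i) r m = indexed_pmult (conv p r) i m"
  proof (cases "i \<in># m")
    case False
    have "conv (indexed_pmult p i) r m = (\<Oplus>a\<in>{a. a \<subseteq># m}. \<zero>)"
      unfolding conv_def using assms False
      by (intro finsum_cong') (auto simp: indexed_pmult_def dest: mset_subset_eqD)
    then show ?thesis using False by (simp add: finsum_zero indexed_pmult_def)
  next
    case True
    have sub: "add_mset i ` {a. a \<subseteq># m - {#i#}} \<subseteq> {a. a \<subseteq># m}"
      using True by (auto simp: insert_subset_eq_iff)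
    have zero: "indexed_pmult p i a \<otimes> r (m - a) = \<zero>"
      if "a \<in> {a. a \<subseteq># m} - add_mset i ` {a. a \<subseteq># m - {#i#}}" for a
    proof -
      have "i \<notin># a"
      proof
        assume "i \<in># a"
        then have "a = add_mset i (a - {#i#})" by simp
        moreover have "a - {#i#} \<subseteq># m - {#i#}" using that by (simp add: subseteq_mset_def diff_le_mono)
        ultimately show False using that by blast
      qed
      then show ?thesis using assms by (simp add: indexed_pmult_def)
    qed
    have "conv (indexed_pmult p i) r m = (\<Oplus>a\<in>add_mset i ` {a. a \<subseteq># m - {#i#}}. indexed_pmult p i a \<otimes> r (m - a))"
      unfolding conv_def using assms sub zero cc_pmult[OF assms(1)]
      by (intro add.finprod_mono_neutral_cong_right) auto
    also have "\<dots> = (\<Oplus>a\<in>{a. a \<subseteq># m - {#i#}}. indexed_pmult p i (add_mset i a) \<otimes> r (m - add_mset i a))"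
      using assms cc_pmult[OF assms(1)] by (intro finsum_reindex) (auto simp: inj_on_def)
    also have "\<dots> = conv p r (m - {#i#})"
      unfolding conv_def using assms
      by (intro finsum_cong') (auto simp: indexed_pmult_def)
    finally show ?thesis using True by (simp add: indexed_pmult_def)
  qed
qed

abbreviation pset :: "'v set \<Rightarrow> ('v multiset \<Rightarrow> 'a) set" where "pset V0 \<equiv> indexed_pset V0 (carrier R)"

lemma pset_cc: "p \<in> pset V0 \<Longrightarrow> cc p"
  using indexed_pset_in_carrier[of "carrier R"] by (auto simp: carrier_coeff_def)

lemma pset_carrier: "p \<in> pset V0 \<Longrightarrow> p m \<in> carrier R"
  using pset_cc by blast

lemma pset_support: "p \<in> pset V0 \<Longrightarrow> p m \<noteq> \<zero> \<Longrightarrow> set_mset m \<subseteq> V0"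
proof (induction arbitrary: m rule: indexed_pset.induct)
  case (indexed_padd P Q)
  then have "P m \<noteq> \<zero> \<or> Q m \<noteq> \<zero>" by (auto simp: indexed_padd_def)
  then show ?case using indexed_padd by blast
next
  case (indexed_pmult P i)
  then have "i \<in># m" "P (m - {#i#}) \<noteq> \<zero>" by (auto simp: indexed_pmult_def split: if_splits)
  then have "set_mset (m - {#i#}) \<subseteq> V0" "set_mset m = insert i (set_mset (m - {#i#}))"
    using indexed_pmult by (auto simp flip: set_mset_add_mset_insert)
  then show ?case using indexed_pmult by simp
qed (auto simp: indexed_const_def split: if_splits)

lemma pset_finite: "p \<in> pset V0 \<Longrightarrow> finite {m. p m \<noteq> \<zero>}"
proof (induction rule: indexed_pset.induct)
  case (indexed_const k)
  show ?case by (rule finite_subset[of _ "{{#}}"]) (auto simp: indexed_const_def)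
next
  case (indexed_padd P Q)
  show ?case by (rule finite_subset[of _ "{m. P m \<noteq> \<zero>} \<union> {m. Q m \<noteq> \<zero>}"])
    (use indexed_padd in \<open>auto simp: indexed_padd_def\<close>)
next
  case (indexed_pmult P i)
  show ?case
  proof (rule finite_subset[of _ "add_mset i ` {m. P m \<noteq> \<zero>}"])
    show "{m. indexed_pmult P i m \<noteq> \<zero>} \<subseteq> add_mset i ` {m. P m \<noteq> \<zero>}"
    proof
      fix m assume "m \<in> {m. indexed_pmult P i m \<noteq> \<zero>}"
      then have "i \<in># m" "P (m - {#i#}) \<noteq> \<zero>" by (auto simp: indexed_pmult_def split: if_splits)
      then have "m = add_mset i (m - {#i#})" "m - {#i#} \<in> {m. P m \<noteq> \<zero>}" by auto
      then show "m \<in> add_mset i ` {m. P m \<noteq> \<zero>}" by blast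
    qed
  qed (use indexed_pmult in auto)
qed

lemma pset_scale: "r \<in> pset V0 \<Longrightarrow> k \<in> carrier R \<Longrightarrow> (\<lambda>m. k \<otimes> r m) \<in> pset V0"
proof (induction rule: indexed_pset.induct)
  case (indexed_const k')
  have eq: "(\<lambda>m. k \<otimes> indexed_const k' m) = indexed_const (k \<otimes> k')"
    using indexed_const by (auto simp: indexed_const_def)
  show ?case unfolding eq using indexed_const by (intro indexed_pset.indexed_const) simp
next
  case (indexed_padd P Q)
  have eq: "(\<lambda>m. k \<otimes> indexed_padd P Q m) = indexed_padd (\<lambda>m. k \<otimes> P m) (\<lambda>m. k \<otimes> Q m)"
    by (rule ext) (use indexed_padd in \<open>simp add: indexed_padd_def r_distr pset_carrier\<close>)
  show ?case unfolding eq using indexed_padd by (intro indexed_pset.indexed_padd) auto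
next
  case (indexed_pmult P i)
  have eq: "(\<lambda>m. k \<otimes> indexed_pmult P i m) = indexed_pmult (\<lambda>m. k \<otimes> P m) i"
    using indexed_pmult by (auto simp: indexed_pmult_def)
  show ?case unfolding eq using indexed_pmult by (intro indexed_pset.indexed_pmult) auto
qed

text \<open>Induction on how the left factor arises from constants, sums and multiplication by a
  variable; convolution commutes with each of these.\<close>

lemma conv_closed: "p \<in> pset V0 \<Longrightarrow> r \<in> pset V0 \<Longrightarrow> conv p r \<in> pset V0"
proof (induction rule: indexed_pset.induct)
  case (indexed_const k)
  then show ?case by (simp add: conv_const pset_cc pset_scale)
next
  case (indexed_padd P Q)
  then show ?case by (simp add: conv_padd pset_cc indexed_pset.indexed_padd)
next
  case (indexed_pmult P i)
  then show ?case by (simp add: conv_pmult pset_cc indexed_pset.indexed_pmult)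
qed

text \<open>The induction runs over the left factor only, so the other two may be arbitrary
  coefficient functions with values in the carrier.\<close>

lemma conv_assoc:
  "p \<in> pset V0 \<Longrightarrow> cc r \<Longrightarrow> cc s \<Longrightarrow> conv (conv p r) s = conv p (conv r s)"
proof (induction rule: indexed_pset.induct)
  case (indexed_const k)
  have "conv (\<lambda>m. k \<otimes> r m) s = (\<lambda>m. k \<otimes> conv r s m)"
  proof
    fix m
    have "conv (\<lambda>m. k \<otimes> r m) s m = (\<Oplus>a\<in>{a. a \<subseteq># m}. k \<otimes> (r a \<otimes> s (m - a)))"
      unfolding conv_def using indexed_const by (intro finsum_cong') (auto simp: m_assoc)
    also have "\<dots> = k \<otimes> conv r s m"
      unfolding conv_def using indexed_const by (intro finsum_rdistr[symmetric]) auto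
    finally show "conv (\<lambda>m. k \<otimes> r m) s m = k \<otimes> conv r s m" .
  qed
  then show ?case using indexed_const by (simp add: conv_const conv_carrier)
next
  case (indexed_padd P Q)
  have "conv (conv (indexed_padd P Q) r) s = conv (indexed_padd (conv P r) (conv Q r)) s"
    using indexed_padd by (simp add: conv_padd pset_cc)
  also have "\<dots> = indexed_padd (conv (conv P r) s) (conv (conv Q r) s)"
    using indexed_padd by (intro conv_padd) (auto intro!: conv_carrier simp: pset_cc)
  also have "\<dots> = conv (indexed_padd P Q) (conv r s)"
    using indexed_padd by (simp add: conv_padd pset_cc conv_carrier)
  finally show ?case .
next
  case (indexed_pmult P i)
  have "conv (conv (indexed_pmult P i) r) s = conv (indexed_pmult (conv P r) i) s"
    using indexed_pmult by (simp add: conv_pmult pset_cc)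
  also have "\<dots> = indexed_pmult (conv (conv P r) s) i"
    using indexed_pmult by (intro conv_pmult) (auto intro!: conv_carrier simp: pset_cc)
  also have "\<dots> = conv (indexed_pmult P i) (conv r s)"
    using indexed_pmult by (simp add: conv_pmult pset_cc conv_carrier)
  finally show ?case .
qed

text \<open>Together with the additive monoid, this gives meaning to the finite products and sums in
  \<open>lin_subst\<close>.\<close>

lemma comm_monoid_mpoly: "comm_monoid (mpoly_ring R V0)"
proof (rule comm_monoidI)
  have mult: "x \<otimes>\<^bsub>mpoly_ring R V0\<^esub> y = conv x y" for x y
    by (simp add: mpoly_ring_def conv_def fun_eq_iff)
  have car: "carrier (mpoly_ring R V0) = pset V0" by (simp add: mpoly_ring_def)
  have one: "\<one>\<^bsub>mpoly_ring R V0\<^esub> = indexed_const \<one>" by (simp add: mpoly_ring_def)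
  show "x \<otimes>\<^bsub>mpoly_ring R V0\<^esub> y \<in> carrier (mpoly_ring R V0)"
    if "x \<in> carrier (mpoly_ring R V0)" "y \<in> carrier (mpoly_ring R V0)" for x y
    using that unfolding mult car by (rule conv_closed)
  show "\<one>\<^bsub>mpoly_ring R V0\<^esub> \<in> carrier (mpoly_ring R V0)"
    unfolding one car by (rule indexed_pset.indexed_const) simp
  show "x \<otimes>\<^bsub>mpoly_ring R V0\<^esub> y \<otimes>\<^bsub>mpoly_ring R V0\<^esub> z = x \<otimes>\<^bsub>mpoly_ring R V0\<^esub> (y \<otimes>\<^bsub>mpoly_ring R V0\<^esub> z)"
    if "x \<in> carrier (mpoly_ring R V0)" "y \<in> carrier (mpoly_ring R V0)" "z \<in> carrier (mpoly_ring R V0)" for x y z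
    using that unfolding mult car by (intro conv_assoc pset_cc)
  show "\<one>\<^bsub>mpoly_ring R V0\<^esub> \<otimes>\<^bsub>mpoly_ring R V0\<^esub> x = x" if "x \<in> carrier (mpoly_ring R V0)" for x
    using pset_cc[of x V0] that unfolding mult car one by (subst conv_const) auto
  show "x \<otimes>\<^bsub>mpoly_ring R V0\<^esub> y = y \<otimes>\<^bsub>mpoly_ring R V0\<^esub> x"
    if "x \<in> carrier (mpoly_ring R V0)" "y \<in> carrier (mpoly_ring R V0)" for x y
    using that unfolding mult car by (intro conv_comm pset_cc)
qed

lemma abelian_monoid_mpoly: "abelian_monoid (mpoly_ring R V0)"
proof (rule abelian_monoidI)
  have add: "x \<oplus>\<^bsub>mpoly_ring R V0\<^esub> y = indexed_padd x y" for x y by (simp add: mpoly_ring_def)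
  have car: "carrier (mpoly_ring R V0) = pset V0" by (simp add: mpoly_ring_def)
  have zero: "\<zero>\<^bsub>mpoly_ring R V0\<^esub> = indexed_const \<zero>" by (simp add: mpoly_ring_def)
  show "x \<oplus>\<^bsub>mpoly_ring R V0\<^esub> y \<in> carrier (mpoly_ring R V0)"
    if "x \<in> carrier (mpoly_ring R V0)" "y \<in> carrier (mpoly_ring R V0)" for x y
    using that unfolding add car by (rule indexed_pset.indexed_padd)
  show "\<zero>\<^bsub>mpoly_ring R V0\<^esub> \<in> carrier (mpoly_ring R V0)"
    unfolding zero car by (rule indexed_pset.indexed_const) simp
  show "(x \<oplus>\<^bsub>mpoly_ring R V0\<^esub> y) \<oplus>\<^bsub>mpoly_ring R V0\<^esub> z = x \<oplus>\<^bsub>mpoly_ring R V0\<^esub> (y \<oplus>\<^bsub>mpoly_ring R V0\<^esub> z)"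
    if "x \<in> carrier (mpoly_ring R V0)" "y \<in> carrier (mpoly_ring R V0)" "z \<in> carrier (mpoly_ring R V0)" for x y z
    using that unfolding add car by (simp add: indexed_padd_def a_assoc pset_carrier fun_eq_iff)
  show "\<zero>\<^bsub>mpoly_ring R V0\<^esub> \<oplus>\<^bsub>mpoly_ring R V0\<^esub> x = x" if "x \<in> carrier (mpoly_ring R V0)" for x
    using that unfolding add car zero by (simp add: indexed_padd_def indexed_const_def pset_carrier fun_eq_iff)
  show "x \<oplus>\<^bsub>mpoly_ring R V0\<^esub> y = y \<oplus>\<^bsub>mpoly_ring R V0\<^esub> x"
    if "x \<in> carrier (mpoly_ring R V0)" "y \<in> carrier (mpoly_ring R V0)" for x y
    using that unfolding add car by (simp add: indexed_padd_def a_comm pset_carrier fun_eq_iff)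
qed

lemma mpoly_simps:
  "x \<otimes>\<^bsub>mpoly_ring R V0\<^esub> y = conv x y" "carrier (mpoly_ring R V0) = pset V0"
  "\<one>\<^bsub>mpoly_ring R V0\<^esub> = indexed_const \<one>" "x \<oplus>\<^bsub>mpoly_ring R V0\<^esub> y = indexed_padd x y"
  "\<zero>\<^bsub>mpoly_ring R V0\<^esub> = indexed_const \<zero>"
  by (simp_all add: mpoly_ring_def conv_def fun_eq_iff)

lemma finsum_mpoly_apply:
  assumes "finite A" "\<And>x. x \<in> A \<Longrightarrow> g x \<in> pset V0"
  shows "finsum (mpoly_ring R V0) g A m = (\<Oplus>x\<in>A. g x m)"
  using assms
proof (induction A)
  case empty
  interpret P: abelian_monoid "mpoly_ring R V0" by (rule abelian_monoid_mpoly)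
  show ?case by (simp add: mpoly_simps indexed_const_def)
next
  case (insert x A)
  interpret P: abelian_monoid "mpoly_ring R V0" by (rule abelian_monoid_mpoly)
  have "finsum (mpoly_ring R V0) g (insert x A) = g x \<oplus>\<^bsub>mpoly_ring R V0\<^esub> finsum (mpoly_ring R V0) g A"
    using insert by (intro P.finsum_insert) (auto simp: mpoly_simps)
  moreover have "(\<Oplus>x\<in>insert x A. g x m) = g x m \<oplus> (\<Oplus>x\<in>A. g x m)"
    using insert pset_carrier[OF insert.prems] by (intro finsum_insert) auto
  ultimately show ?case using insert by (simp add: mpoly_simps indexed_padd_def)
qed

text \<open>The coefficient of \<open>m\<close> in the product of the linear forms \<open>A i\<close> for \<open>i\<close> in \<open>I\<close>, expanded along
  the first factor.\<close>

fun Wc :: "(nat \<Rightarrow> nat \<Rightarrow> 'a) \<Rightarrow> nat list \<Rightarrow> nat multiset \<Rightarrow> 'a" where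
  "Wc A [] m = (if m = {#} then \<one> else \<zero>)"
| "Wc A (i # I) m = (\<Oplus>j\<in>set_mset m. A i j \<otimes> Wc A I (m - {#j#}))"

lemma linear_form_pset:
  assumes "\<And>j. j < n \<Longrightarrow> a j \<in> carrier R" shows "linear_form R n a \<in> pset {..<n}"
proof -
  interpret P: abelian_monoid "mpoly_ring R {..<n}" by (rule abelian_monoid_mpoly)
  have "indexed_const (a j) \<in> pset {..<n} \<and> indexed_var j \<in> pset {..<n}" if "j < n" for j
    using assms that by (auto simp: indexed_var_def intro!: indexed_pset.indexed_const indexed_pset.indexed_pmult)
  then have "linear_form R n a \<in> carrier (mpoly_ring R {..<n})"
    unfolding linear_form_def Let_def by (intro P.finsum_closed) (auto simp: mpoly_simps conv_closed)
  then show ?thesis by (simp add: mpoly_simps)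
qed

lemma linear_form_apply:
  assumes a: "\<And>j. j < n \<Longrightarrow> a j \<in> carrier R"
  shows "linear_form R n a m = (\<Oplus>j\<in>{..<n}. if m = {#j#} then a j else \<zero>)"
proof -
  have c: "indexed_const (a j) \<in> pset {..<n}" "indexed_var j \<in> pset {..<n}" if "j < n" for j
    using a that by (auto simp: indexed_var_def intro!: indexed_pset.indexed_const indexed_pset.indexed_pmult)
  have "linear_form R n a m = (\<Oplus>j\<in>{..<n}. conv (indexed_const (a j)) (indexed_var j) m)"
    unfolding linear_form_def Let_def mpoly_simps
    using c by (subst finsum_mpoly_apply) (auto simp: mpoly_simps conv_closed)
  also have "\<dots> = (\<Oplus>j\<in>{..<n}. if m = {#j#} then a j else \<zero>)"
  proof (intro finsum_cong')
    fix j assume j: "j \<in> {..<n}"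
    have "indexed_var j m = (if m = {#j#} then \<one> else \<zero>)"
      by (auto simp: indexed_var_def indexed_pmult_def indexed_const_def)
         (metis diff_empty insert_DiffM)
    then show "conv (indexed_const (a j)) (indexed_var j) m = (if m = {#j#} then a j else \<zero>)"
      using j a pset_cc[OF c(2)] by (simp add: conv_const)
  qed (use a in auto)
  finally show ?thesis .
qed

text \<open>A linear form lives on single variables, so the only splittings of m that count take out
  one variable. This is the recursion of \<open>Wc\<close>.\<close>

lemma conv_linear_form:
  assumes a: "\<And>j. j < n \<Longrightarrow> a j \<in> carrier R" and p: "cc p" and m: "set_mset m \<subseteq> {..<n}"
  shows "conv (linear_form R n a) p m = (\<Oplus>j\<in>set_mset m. a j \<otimes> p (m - {#j#}))"
proof -
  have ccl: "cc (linear_form R n a)" using a by (intro pset_cc[of _ "{..<n}"] linear_form_pset)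
  have sing: "linear_form R n a {#j#} = a j" if "j < n" for j
  proof -
    have "linear_form R n a {#j#} = (\<Oplus>i\<in>{..<n}. if j = i then a i else \<zero>)"
      using a linear_form_apply[of n a] by (simp cong: if_cong)
    also have "\<dots> = a j" using a that by (intro finsum_singleton) auto
    finally show ?thesis .
  qed
  have zero: "linear_form R n a b = \<zero>" if "b \<notin> (\<lambda>j. {#j#}) ` {..<n}" for b
  proof -
    have "linear_form R n a b = (\<Oplus>j\<in>{..<n}. if b = {#j#} then a j else \<zero>)"
      by (rule linear_form_apply) (rule a)
    also have "\<dots> = (\<Oplus>j\<in>{..<n}. \<zero>)" using that by (intro finsum_cong') auto
    finally show ?thesis by (simp add: finsum_zero)
  qed
  have "conv (linear_form R n a) p m = (\<Oplus>b\<in>(\<lambda>j. {#j#}) ` set_mset m. linear_form R n a b \<otimes> p (m - b))"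
    unfolding conv_def
  proof (intro add.finprod_mono_neutral_cong_right)
    fix b assume "b \<in> {b. b \<subseteq># m} - (\<lambda>j. {#j#}) ` set_mset m"
    then have "b \<notin> (\<lambda>j. {#j#}) ` {..<n}" by (auto simp: single_subset_iff)
    then show "linear_form R n a b \<otimes> p (m - b) = \<zero>\<^bsub>R\<^esub>" using zero p by simp
  qed (use p ccl in \<open>auto simp: single_subset_iff\<close>)
  also have "\<dots> = (\<Oplus>j\<in>set_mset m. linear_form R n a {#j#} \<otimes> p (m - {#j#}))"
    using p ccl by (intro finsum_reindex) (auto simp: inj_on_def)
  also have "\<dots> = (\<Oplus>j\<in>set_mset m. a j \<otimes> p (m - {#j#}))"
    using p m a sing by (intro finsum_cong') auto
  finally show ?thesis .
qed

definition prodL :: "nat \<Rightarrow> (nat \<Rightarrow> nat \<Rightarrow> 'a) \<Rightarrow> nat list \<Rightarrow> nat multiset \<Rightarrow> 'a" where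
  "prodL n A I = foldr (\<lambda>i p. conv (linear_form R n (A i)) p) I (indexed_const \<one>)"

lemma prodL_pset:
  assumes "\<And>i j. i < n \<Longrightarrow> j < n \<Longrightarrow> A i j \<in> carrier R" "set I \<subseteq> {..<n}"
  shows "prodL n A I \<in> pset {..<n}"
  using assms(2)
proof (induction I)
  case Nil
  then show ?case by (simp add: prodL_def indexed_pset.indexed_const)
next
  case (Cons i I)
  then show ?case using assms(1) by (auto simp: prodL_def intro!: conv_closed linear_form_pset)
qed

lemma prodL_apply:
  assumes "\<And>i j. i < n \<Longrightarrow> j < n \<Longrightarrow> A i j \<in> carrier R" "set I \<subseteq> {..<n}" "set_mset m \<subseteq> {..<n}"
  shows "prodL n A I m = Wc A I m \<and> Wc A I m \<in> carrier R"
  using assms(2,3)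
proof (induction I arbitrary: m)
  case Nil
  then show ?case by (simp add: prodL_def indexed_const_def)
next
  case (Cons i I)
  have cp: "cc (prodL n A I)" using Cons assms(1) by (intro pset_cc[of _ "{..<n}"] prodL_pset) auto
  have sub: "set_mset (m - {#j#}) \<subseteq> {..<n}" for j using Cons by (meson in_diffD subset_iff)
  have IH: "prodL n A I (m - {#j#}) = Wc A I (m - {#j#}) \<and> Wc A I (m - {#j#}) \<in> carrier R" for j
    using Cons sub by simp
  have Aij: "A i j \<in> carrier R" if "j \<in># m" for j using assms(1) Cons that by auto
  have "prodL n A (i # I) m = conv (linear_form R n (A i)) (prodL n A I) m" by (simp add: prodL_def)
  also have "\<dots> = (\<Oplus>j\<in>set_mset m. A i j \<otimes> prodL n A I (m - {#j#}))"
    using assms(1) Cons cp by (intro conv_linear_form) auto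
  also have "\<dots> = Wc A (i # I) m" using IH by simp
  finally show ?case using IH Aij by (auto intro!: finsum_closed)
qed

text \<open>A further factor i raises a single exponent by one; it is split off as a product over
  all indices with one nontrivial factor.\<close>

lemma finprod_prodL:
  assumes A: "\<And>i j. i < n \<Longrightarrow> j < n \<Longrightarrow> A i j \<in> carrier R" and "set I \<subseteq> {..<n}"
  shows "finprod (mpoly_ring R {..<n}) (\<lambda>i. linear_form R n (A i) [^]\<^bsub>mpoly_ring R {..<n}\<^esub> count (mset I) i) {..<n} = prodL n A I"
  using assms(2)
proof (induction I)
  case Nil
  interpret P: comm_monoid "mpoly_ring R {..<n}" by (rule comm_monoid_mpoly)
  show ?case by (simp add: prodL_def flip: mpoly_simps(3)[of "{..<n}"])
next
  case (Cons i I)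
  interpret P: comm_monoid "mpoly_ring R {..<n}" by (rule comm_monoid_mpoly)
  let ?P = "mpoly_ring R {..<n}" and ?L = "\<lambda>i. linear_form R n (A i)"
  have L: "?L j \<in> carrier ?P" if "j < n" for j using A that by (simp add: mpoly_simps linear_form_pset)
  have i: "i < n" using Cons by simp
  have "finprod ?P (\<lambda>j. ?L j [^]\<^bsub>?P\<^esub> count (mset (i # I)) j) {..<n} =
     finprod ?P (\<lambda>j. (if i = j then ?L j else \<one>\<^bsub>?P\<^esub>) \<otimes>\<^bsub>?P\<^esub> ?L j [^]\<^bsub>?P\<^esub> count (mset I) j) {..<n}"
    using L by (intro P.finprod_cong') (auto simp: P.m_comm)
  also have "\<dots> = finprod ?P (\<lambda>j. if i = j then ?L j else \<one>\<^bsub>?P\<^esub>) {..<n} \<otimes>\<^bsub>?P\<^esub> finprod ?P (\<lambda>j. ?L j [^]\<^bsub>?P\<^esub> count (mset I) j) {..<n}"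
    using L by (intro P.finprod_multf) auto
  also have "finprod ?P (\<lambda>j. if i = j then ?L j else \<one>\<^bsub>?P\<^esub>) {..<n} = ?L i"
    using L i by (intro P.finprod_singleton) auto
  also have "finprod ?P (\<lambda>j. ?L j [^]\<^bsub>?P\<^esub> count (mset I) j) {..<n} = prodL n A I" using Cons by simp
  finally show ?case by (simp add: prodL_def mpoly_simps)
qed

text \<open>Homogeneity of a product of linear forms. The second alternative covers matrices with
  entries outside the carrier, about which nothing is assumed.\<close>

lemma Wc_length: "length I \<noteq> size m \<Longrightarrow> Wc A I m = \<zero> \<or> (\<exists>i\<in>set I. \<exists>j\<in>#m. A i j \<notin> carrier R)"
proof (induction I arbitrary: m)
  case (Cons i I)
  show ?case
  proof (cases "\<exists>i'\<in>set (i # I). \<exists>j\<in>#m. A i' j \<notin> carrier R")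
    case False
    have "Wc A I (m - {#j#}) = \<zero>" if "j \<in># m" for j
    proof -
      have "length I \<noteq> size (m - {#j#})" using Cons.prems size_Suc_Diff1[OF that] by auto
      from Cons.IH[OF this] show ?thesis using False by (auto dest: in_diffD)
    qed
    then have "Wc A (i # I) m = (\<Oplus>j\<in>set_mset m. \<zero>)"
      unfolding Wc.simps using False by (intro finsum_cong') auto
    then have "Wc A (i # I) m = \<zero>" by (simp only: finsum_zero)
    then show ?thesis by blast
  qed simp
qed auto

text \<open>The link between substitution and computation: the sum over the support of g is turned
  into one over a set of lists that depends only on n and the degree.\<close>

theorem lin_subst_apply:
  assumes g: "g \<in> polys R n D" and A: "\<And>i j. i < n \<Longrightarrow> j < n \<Longrightarrow> A i j \<in> carrier R"
    and m: "set_mset m \<subseteq> {..<n}"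
  shows "lin_subst R n g A m = (\<Oplus>I\<in>DL n (size m). g (mset I) \<otimes> Wc A I m)"
proof -
  let ?P = "mpoly_ring R {..<n}"
  have gp: "g \<in> pset {..<n}" using g by (simp add: polys_def mpoly_simps)
  note gc = pset_cc[OF gp]
  let ?S = "{m. g m \<noteq> \<zero>}"
  have S: "set_mset b \<subseteq> {..<n}" if "b \<in> ?S" for b using pset_support[OF gp] that by simp
  define ls where "ls = (\<lambda>b :: nat multiset. rev (sorted_list_of_multiset b))"
  have ls: "mset (ls b) = b" for b by (simp add: ls_def)
  have lsn: "set (ls b) \<subseteq> {..<n}" if "b \<in> ?S" for b using S[OF that] by (simp add: ls_def)
  have prod: "finprod ?P (\<lambda>i. linear_form R n (A i) [^]\<^bsub>?P\<^esub> count b i) {..<n} = prodL n A (ls b)" if "b \<in> ?S" for b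
    using finprod_prodL[OF A lsn[OF that]] by (simp add: ls)
  have pp: "prodL n A (ls b) \<in> pset {..<n}" if "b \<in> ?S" for b using prodL_pset[OF A lsn[OF that]] by simp
  have cst: "indexed_const (g b) \<in> pset {..<n}" for b using gc by (intro indexed_pset.indexed_const) auto
  have Wcc: "Wc A (ls b) m \<in> carrier R" "prodL n A (ls b) m = Wc A (ls b) m" if "b \<in> ?S" for b
    using prodL_apply[OF A lsn[OF that] m] by auto
  have "lin_subst R n g A m = (\<Oplus>b\<in>?S. conv (indexed_const (g b)) (finprod ?P (\<lambda>i. linear_form R n (A i) [^]\<^bsub>?P\<^esub> count b i) {..<n}) m)"
    unfolding lin_subst_def Let_def mpoly_simps(1)
    using pset_finite[OF gp] prod pp cst by (subst finsum_mpoly_apply) (auto intro!: conv_closed)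
  also have "\<dots> = (\<Oplus>b\<in>?S. g b \<otimes> Wc A (ls b) m)"
    using gc Wcc pset_cc[OF pp] by (intro finsum_cong') (auto simp: prod conv_const)
  also have "\<dots> = (\<Oplus>b\<in>?S \<inter> {b. size b = size m}. g b \<otimes> Wc A (ls b) m)"
  proof (intro add.finprod_mono_neutral_cong_right)
    show "finite ?S" by (rule pset_finite[OF gp])
    fix b assume b: "b \<in> ?S - ?S \<inter> {b. size b = size m}"
    then have "length (ls b) \<noteq> size m" using size_mset[of "ls b"] unfolding ls by auto
    then have "Wc A (ls b) m = \<zero>" using Wc_length[of "ls b" m A] lsn[of b] b m A by (auto simp: subset_iff)
    then show "g b \<otimes> Wc A (ls b) m = \<zero>\<^bsub>R\<^esub>" using gc by simp
  qed (use gc Wcc in auto)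
  \<comment> \<open>Monomials at which g vanishes contribute zero; adding them makes the range of
    summation independent of g.\<close>
  also have "\<dots> = (\<Oplus>b\<in>mset ` DL n (size m). g b \<otimes> Wc A (ls b) m)"
  proof (intro add.finprod_mono_neutral_cong_left)
    show "?S \<inter> {b. size b = size m} \<subseteq> mset ` DL n (size m)" unfolding mset_image_DL using S by auto
    have "Wc A (ls b) m \<in> carrier R" if "b \<in> mset ` DL n (size m)" for b
      using prodL_apply[OF A _ m, where I = "ls b"] that by (auto simp: mset_image_DL ls_def)
    then show "(\<lambda>b. g b \<otimes> Wc A (ls b) m) \<in> mset ` DL n (size m) \<rightarrow> carrier R" using gc by auto
    fix b assume "b \<in> mset ` DL n (size m) - ?S \<inter> {b. size b = size m}"
    then have "g b = \<zero>" "b \<in> mset ` DL n (size m)" by (auto simp: mset_image_DL)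
    moreover have "Wc A (ls b) m \<in> carrier R" if "b \<in> mset ` DL n (size m)" for b
      using prodL_apply[OF A _ m, where I = "ls b"] that by (auto simp: mset_image_DL ls_def)
    ultimately show "g b \<otimes> Wc A (ls b) m = \<zero>\<^bsub>R\<^esub>" by simp
  qed auto
  also have "\<dots> = (\<Oplus>I\<in>DL n (size m). g (mset I) \<otimes> Wc A (ls (mset I)) m)"
    using gc prodL_apply[OF A _ m] by (intro finsum_reindex mset_inj_DL) (auto simp: DL_def ls_def)
  also have "\<dots> = (\<Oplus>I\<in>DL n (size m). g (mset I) \<otimes> Wc A I m)"
  proof (intro finsum_cong')
    fix I assume I: "I \<in> DL n (size m)"
    have "ls (mset I) \<in> DL n (size m)" using I by (auto simp: DL_def ls_def sorted_wrt_rev)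
    then have "ls (mset I) = I" using I by (intro inj_onD[OF mset_inj_DL ls]) auto
    then show "g (mset I) \<otimes> Wc A (ls (mset I)) m = g (mset I) \<otimes> Wc A I m" by simp
  qed (use gc prodL_apply[OF A _ m] in \<open>auto simp: DL_def\<close>)
  finally show ?thesis .
qed

end

section \<open>Timed total correctness\<close>

definition timed :: "(state \<Rightarrow> bool) \<Rightarrow> com \<Rightarrow> nat \<Rightarrow> (state \<Rightarrow> bool) \<Rightarrow> bool" where
  "timed P c \<tau> Q \<longleftrightarrow> (\<forall>s. P s \<longrightarrow> (\<exists>t s'. exec c s t s' \<and> t \<le> \<tau> \<and> Q s'))"

lemma timedI: "(\<And>s. P s \<Longrightarrow> \<exists>t s'. exec c s t s' \<and> t \<le> \<tau> \<and> Q s') \<Longrightarrow> timed P c \<tau> Q"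
  by (simp add: timed_def)

lemma timedE:
  assumes "timed P c \<tau> Q" "P s"
  obtains t s' where "exec c s t s'" "t \<le> \<tau>" "Q s'"
  using assms unfolding timed_def by blast

lemma timed_Seq:
  assumes "timed P c1 \<tau>1 Q" "timed Q c2 \<tau>2 R"
  shows "timed P (Seq c1 c2) (\<tau>1 + \<tau>2) R"
proof (rule timedI)
  fix s assume "P s"
  then obtain t1 s1 where 1: "exec c1 s t1 s1" "t1 \<le> \<tau>1" "Q s1"
    using assms(1) by (auto simp: timed_def)
  then obtain t2 s2 where "exec c2 s1 t2 s2" "t2 \<le> \<tau>2" "R s2"
    using assms(2) by (auto simp: timed_def)
  with 1 show "\<exists>t s'. exec (Seq c1 c2) s t s' \<and> t \<le> \<tau>1 + \<tau>2 \<and> R s'"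
    by (meson add_mono exec.Seq)
qed

lemma timed_Assign:
  "(\<And>s. P s \<Longrightarrow> Q (s(x := (s x)(aval a s := aval b s)))) \<Longrightarrow> timed P (Assign x a b) 1 Q"
  by (rule timedI) (blast intro: exec.Assign)

lemma timed_Cond:
  assumes "timed (\<lambda>s. P s \<and> aval b s \<noteq> 0) c1 \<tau> Q" "timed (\<lambda>s. P s \<and> aval b s = 0) c2 \<tau> Q"
  shows "timed P (Cond b c1 c2) (Suc \<tau>) Q"
proof (rule timedI)
  fix s assume P: "P s"
  show "\<exists>t s'. exec (Cond b c1 c2) s t s' \<and> t \<le> Suc \<tau> \<and> Q s'"
  proof (cases "aval b s = 0")
    case True
    then obtain t s' where "exec c2 s t s'" "t \<le> \<tau>" "Q s'"
      using assms(2) P by (auto simp: timed_def)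
    then show ?thesis using True exec.CondFalse[of b s c2 t s' c1]
      by (intro exI[of _ "1 + t"] exI[of _ s']) auto
  next
    case False
    then obtain t s' where "exec c1 s t s'" "t \<le> \<tau>" "Q s'"
      using assms(1) P by (auto simp: timed_def)
    then show ?thesis using False exec.CondTrue[of b s c1 t s' c2]
      by (intro exI[of _ "1 + t"] exI[of _ s']) auto
  qed
qed

text \<open>The invariant is indexed by the number of completed rounds, and the value of the test
  counts the remaining rounds, which settles termination and running time at once.\<close>

lemma timed_While:
  fixes N :: nat
  assumes "\<And>i. i < N \<Longrightarrow> timed (P i) c \<tau> (P (Suc i))"
    and test: "\<And>i s. i \<le> N \<Longrightarrow> P i s \<Longrightarrow> aval b s = N - i"
  shows "timed (P 0) (While b c) (N * (\<tau> + 1) + 1) (P N)"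
proof -
  have "timed (P i) (While b c) ((N - i) * (\<tau> + 1) + 1) (P N)" if "i \<le> N" for i
    using that
  proof (induction i rule: inc_induct)
    case base
    show ?case
      by (rule timedI) (use test[of N] in \<open>auto intro!: exI exec.WhileFalse\<close>)
  next
    case (step i)
    show ?case
    proof (rule timedI)
      fix s assume P: "P i s"
      then obtain t s' where 1: "exec c s t s'" "t \<le> \<tau>" "P (Suc i) s'"
        using assms(1)[of i] step by (auto simp: timed_def)
      then obtain t' s'' where 2: "exec (While b c) s' t' s''"
          "t' \<le> (N - Suc i) * (\<tau> + 1) + 1" "P N s''"
        using step.IH by (auto simp: timed_def)
      have "exec (While b c) s (1 + t + t') s''"
        using test[OF _ P] step 1 2 by (intro exec.WhileTrue) auto
      moreover have "N - i = Suc (N - Suc i)" using step by simp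
      then have "1 + t + t' \<le> (N - i) * (\<tau> + 1) + 1"
        using 1 2 by (simp add: algebra_simps)
      ultimately show "\<exists>t s'. exec (While b c) s t s' \<and> t \<le> (N - i) * (\<tau> + 1) + 1 \<and> P N s'"
        using 2 by blast
    qed
  qed
  from this[of 0] show ?thesis by simp
qed


section \<open>Computable expressions\<close>

text \<open>
  The arrays \<open>nm 0, nm 1, \<dots>\<close> form a stack of local variables. Such an array stores a list as its
  length in cell \<open>0\<close> followed by the entries.
\<close>

definition nm :: "nat \<Rightarrow> vname" where
  "nm j = CHR ''#'' # replicate j CHR ''#''"

lemma nm_eq_iff [simp]: "nm i = nm j \<longleftrightarrow> i = j"
  unfolding nm_def by (metis length_replicate list.inject)

definition rep :: "(nat \<Rightarrow> nat) \<Rightarrow> nat list \<Rightarrow> bool" where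
  "rep \<sigma> l \<longleftrightarrow> \<sigma> 0 = length l \<and> (\<forall>i<length l. \<sigma> (Suc i) = l ! i)"

definition lget :: "nat list \<Rightarrow> nat \<Rightarrow> nat" where
  "lget l i = (if i < length l then l ! i else 0)"

lemma lget_singleton [simp]: "lget [a] 0 = a"
  by (simp add: lget_def)

lemma rep_singleton: "rep \<sigma> [v] \<longleftrightarrow> \<sigma> 0 = 1 \<and> \<sigma> 1 = v"
  by (simp add: rep_def)

declare add_2_eq_Suc' [simp del]

text \<open>An environment fixes the input and the variables in scope; \<open>csiz\<close> is the
  parameter in which values and times have to be polynomial.\<close>

record 'e ctx =
  cdom :: "'e set"
  cinp :: "'e \<Rightarrow> state"
  csiz :: "'e \<Rightarrow> nat"
  cvars :: "('e \<Rightarrow> nat list) list"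

text \<open>The base is at least 2, so that constants and sums are absorbed by a larger
  exponent.\<close>

definition pbd :: "'e ctx \<Rightarrow> ('e \<Rightarrow> nat) \<Rightarrow> bool" where
  "pbd \<Gamma> h \<longleftrightarrow> (\<exists>K. \<forall>e\<in>cdom \<Gamma>. h e \<le> (csiz \<Gamma> e + 2) ^ K)"

lemma pbd_mono: "pbd \<Gamma> h \<Longrightarrow> (\<And>e. e \<in> cdom \<Gamma> \<Longrightarrow> h' e \<le> h e) \<Longrightarrow> pbd \<Gamma> h'"
  unfolding pbd_def by (meson le_trans)

lemma pbd_const [intro]: "pbd \<Gamma> (\<lambda>_. k)"
proof -
  have "k \<le> (csiz \<Gamma> e + 2) ^ k" for e
  proof -
    have "k < 2 ^ k" by simp
    also have "\<dots> \<le> (csiz \<Gamma> e + 2) ^ k" by (rule power_mono) auto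
    finally show ?thesis by simp
  qed
  then show ?thesis unfolding pbd_def by blast
qed

lemma pbd_mult [intro]: "pbd \<Gamma> g \<Longrightarrow> pbd \<Gamma> h \<Longrightarrow> pbd \<Gamma> (\<lambda>e. g e * h e)"
  unfolding pbd_def by (metis mult_le_mono power_add)

lemma pbd_add [intro]: assumes "pbd \<Gamma> g" "pbd \<Gamma> h" shows "pbd \<Gamma> (\<lambda>e. g e + h e)"
proof -
  have "pbd \<Gamma> (\<lambda>e. h e + 1)" if "pbd \<Gamma> h" for h :: "_ \<Rightarrow> nat"
  proof -
    from that obtain K where K: "\<forall>e\<in>cdom \<Gamma>. h e \<le> (csiz \<Gamma> e + 2) ^ K" unfolding pbd_def by blast
    have "h e + 1 \<le> (csiz \<Gamma> e + 2) ^ Suc K" if "e \<in> cdom \<Gamma>" for e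
    proof -
      have "h e + 1 \<le> 2 * (csiz \<Gamma> e + 2) ^ K"
        using K that by (metis add_le_mono mult_2 one_le_power le_add2 one_add_one add_leD2)
      also have "\<dots> \<le> (csiz \<Gamma> e + 2) ^ Suc K" by simp
      finally show ?thesis .
    qed
    then show ?thesis unfolding pbd_def by blast
  qed
  then have "pbd \<Gamma> (\<lambda>e. (g e + 1) * (h e + 1))" using assms by (intro pbd_mult) auto
  then show ?thesis by (rule pbd_mono) simp
qed

lemma pbd_Suc [intro]: "pbd \<Gamma> g \<Longrightarrow> pbd \<Gamma> (\<lambda>e. Suc (g e))"
  using pbd_add[OF _ pbd_const[of \<Gamma> 1]] by simp

definition inputs :: "vname set" where
  "inputs = {''q'', ''n'', ''zero'', ''one'', ''add'', ''mul'', ''f'', ''g''}"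

lemma nm_notin_inputs [simp]: "nm j \<notin> inputs"
  by (auto simp: inputs_def nm_def)

lemma mem_inputs [simp]:
  "''q'' \<in> inputs" "''n'' \<in> inputs" "''zero'' \<in> inputs" "''one'' \<in> inputs"
  "''add'' \<in> inputs" "''mul'' \<in> inputs" "''f'' \<in> inputs" "''g'' \<in> inputs"
  by (auto simp: inputs_def)

definition agree :: "'e ctx \<Rightarrow> nat list \<Rightarrow> 'e \<Rightarrow> state \<Rightarrow> bool" where
  "agree \<Gamma> pos e s \<longleftrightarrow> (\<forall>x\<in>inputs. s x = cinp \<Gamma> e x) \<and>
     (\<forall>j<length (cvars \<Gamma>). rep (s (nm (pos ! j))) ((cvars \<Gamma> ! j) e))"

text \<open>
  A program for an expression leaves its value in the scalar \<open>nm k\<close> and may use all \<open>nm j\<close> with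
  \<open>j \<ge> k\<close> as scratch space. Quantifying over \<open>k\<close> and the positions of the variables makes
  computability stable under weakening of the context.
\<close>

definition eval_post :: "state \<Rightarrow> nat \<Rightarrow> nat \<Rightarrow> state \<Rightarrow> bool" where
  "eval_post s k v s' \<longleftrightarrow> (\<forall>x. x \<notin> nm ` {k..} \<longrightarrow> s' x = s x) \<and> rep (s' (nm k)) [v]"

definition realizes :: "'e ctx \<Rightarrow> nat list \<Rightarrow> nat \<Rightarrow> ('e \<Rightarrow> nat) \<Rightarrow> com \<Rightarrow> ('e \<Rightarrow> nat) \<Rightarrow> bool" where
  "realizes \<Gamma> pos k \<psi> c \<tau> \<longleftrightarrow>
     (\<forall>e\<in>cdom \<Gamma>. \<forall>s. agree \<Gamma> pos e s \<longrightarrow> timed (\<lambda>s'. s' = s) c (\<tau> e) (eval_post s k (\<psi> e)))"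

text \<open>The bound on the value is part of the notion because values become loop bounds.\<close>

definition computable :: "'e ctx \<Rightarrow> ('e \<Rightarrow> nat) \<Rightarrow> bool" where
  "computable \<Gamma> \<psi> \<longleftrightarrow> pbd \<Gamma> \<psi> \<and>
     (\<forall>pos k. length pos = length (cvars \<Gamma>) \<longrightarrow> set pos \<subseteq> {..<k} \<longrightarrow>
        (\<exists>c \<tau>. pbd \<Gamma> \<tau> \<and> realizes \<Gamma> pos k \<psi> c \<tau>))"

lemma computable_pbd: "computable \<Gamma> \<psi> \<Longrightarrow> pbd \<Gamma> \<psi>"
  by (simp add: computable_def)

lemma computableE:
  assumes "computable \<Gamma> \<psi>" "length pos = length (cvars \<Gamma>)" "set pos \<subseteq> {..<k}"
  obtains c \<tau> where "pbd \<Gamma> \<tau>" "realizes \<Gamma> pos k \<psi> c \<tau>"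
  using assms unfolding computable_def by blast

lemma realizesD:
  "realizes \<Gamma> pos k \<psi> c \<tau> \<Longrightarrow> e \<in> cdom \<Gamma> \<Longrightarrow> agree \<Gamma> pos e s \<Longrightarrow>
     timed (\<lambda>s'. s' = s) c (\<tau> e) (eval_post s k (\<psi> e))"
  unfolding realizes_def by blast

lemma agree_cong:
  assumes "agree \<Gamma> pos e s" "\<And>x. x \<notin> nm ` {k..} \<Longrightarrow> s' x = s x"
    "set pos \<subseteq> {..<k}" "length pos = length (cvars \<Gamma>)"
  shows "agree \<Gamma> pos e s'"
proof -
  have "s' (nm (pos ! j)) = s (nm (pos ! j))" if "j < length (cvars \<Gamma>)" for j
    using that assms(3,4) by (intro assms(2)) (metis atLeast_iff imageE lessThan_iff nm_eq_iff not_le nth_mem subsetD)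
  moreover have "s' x = s x" if "x \<in> inputs" for x
    using that by (intro assms(2)) auto
  ultimately show ?thesis using assms(1) by (simp add: agree_def)
qed

lemma eval_post_agree:
  "eval_post s k v s' \<Longrightarrow> agree \<Gamma> pos e s \<Longrightarrow> set pos \<subseteq> {..<k} \<Longrightarrow> length pos = length (cvars \<Gamma>) \<Longrightarrow>
    agree \<Gamma> pos e s'"
  by (rule agree_cong[where k = k and s = s]) (auto simp: eval_post_def)

text \<open>A scalar is a list of length one: the value goes to cell 1 and the length to cell
  0.\<close>

definition set_scalar :: "nat \<Rightarrow> aexp \<Rightarrow> com" where
  "set_scalar k a = Seq (Assign (nm k) (N 1) a) (Assign (nm k) (N 0) (N 1))"

lemma timed_set_scalar:
  assumes "\<And>s. P s \<Longrightarrow> Q (s(nm k := (s (nm k))(1 := aval a s, 0 := 1)))"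
  shows "timed P (set_scalar k a) 2 Q"
proof -
  have "timed P (Assign (nm k) (N 1) a) 1 (\<lambda>s'. \<exists>s. P s \<and> s' = s(nm k := (s (nm k))(1 := aval a s)))"
    by (rule timed_Assign) auto
  moreover have "timed (\<lambda>s'. \<exists>s. P s \<and> s' = s(nm k := (s (nm k))(1 := aval a s)))
     (Assign (nm k) (N 0) (N 1)) 1 Q"
    using assms by (intro timed_Assign) auto
  ultimately have "timed P (set_scalar k a) (1 + 1) Q"
    unfolding set_scalar_def by (rule timed_Seq)
  then show ?thesis by (simp add: numeral_2_eq_2)
qed

lemma computable_const: "computable \<Gamma> (\<lambda>_. v)"
  unfolding computable_def
proof (intro conjI allI impI)
  fix pos :: "nat list" and k
  show "\<exists>c \<tau>. pbd \<Gamma> \<tau> \<and> realizes \<Gamma> pos k (\<lambda>_. v) c \<tau>"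
    by (intro exI[of _ "set_scalar k (N v)"] exI[of _ "\<lambda>_. 2"])
       (auto simp: realizes_def eval_post_def rep_singleton intro!: timed_set_scalar)
qed blast

lemma computable_unop:
  assumes a: "computable \<Gamma> a" and bd: "pbd \<Gamma> (\<lambda>e. h e (a e))"
    and prog: "\<And>pos k. length pos = length (cvars \<Gamma>) \<Longrightarrow> set pos \<subseteq> {..<k} \<Longrightarrow>
       \<exists>c \<tau>. \<forall>e\<in>cdom \<Gamma>. \<forall>s. agree \<Gamma> pos e s \<longrightarrow> rep (s (nm k)) [a e] \<longrightarrow>
          timed (\<lambda>s'. s' = s) c \<tau> (eval_post s k (h e (a e)))"
  shows "computable \<Gamma> (\<lambda>e. h e (a e))"
  unfolding computable_def
proof (intro conjI allI impI bd)
  fix pos :: "nat list" and k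
  assume pos: "length pos = length (cvars \<Gamma>)" "set pos \<subseteq> {..<k}"
  obtain c1 \<tau>1 where 1: "pbd \<Gamma> \<tau>1" "realizes \<Gamma> pos k a c1 \<tau>1"
    using computableE[OF a pos] .
  obtain c \<tau> where c: "\<forall>e\<in>cdom \<Gamma>. \<forall>s. agree \<Gamma> pos e s \<longrightarrow> rep (s (nm k)) [a e] \<longrightarrow>
          timed (\<lambda>s'. s' = s) c \<tau> (eval_post s k (h e (a e)))"
    using prog[OF pos] by blast
  show "\<exists>c \<tau>. pbd \<Gamma> \<tau> \<and> realizes \<Gamma> pos k (\<lambda>e. h e (a e)) c \<tau>"
  proof (intro exI conjI)
    show "pbd \<Gamma> (\<lambda>e. \<tau>1 e + \<tau>)" using 1 by (intro pbd_add pbd_const)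
    show "realizes \<Gamma> pos k (\<lambda>e. h e (a e)) (Seq c1 c) (\<lambda>e. \<tau>1 e + \<tau>)"
      unfolding realizes_def
    proof (intro ballI allI impI)
      fix e s assume e: "e \<in> cdom \<Gamma>" and ag: "agree \<Gamma> pos e s"
      have "timed (eval_post s k (a e)) c \<tau> (eval_post s k (h e (a e)))"
      proof (rule timedI)
        fix s1 assume s1: "eval_post s k (a e) s1"
        have "agree \<Gamma> pos e s1" by (rule eval_post_agree[OF s1 ag pos(2,1)])
        then obtain t s' where "exec c s1 t s'" "t \<le> \<tau>" "eval_post s1 k (h e (a e)) s'"
          using c e s1 unfolding eval_post_def[of s] by (blast elim: timedE)
        with s1 show "\<exists>t s'. exec c s1 t s' \<and> t \<le> \<tau> \<and> eval_post s k (h e (a e)) s'"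
          by (intro exI[of _ t] exI[of _ s']) (auto simp: eval_post_def)
      qed
      with realizesD[OF 1(2) e ag]
      show "timed (\<lambda>s'. s' = s) (Seq c1 c) (\<tau>1 e + \<tau>) (eval_post s k (h e (a e)))"
        by (rule timed_Seq)
    qed
  qed
qed

text \<open>The input array cells are polynomially bounded in the size, which makes every table
  lookup computable.\<close>

definition Inp :: "'e ctx \<Rightarrow> ('e \<Rightarrow> state) \<Rightarrow> bool" where
  "Inp \<Gamma> I \<longleftrightarrow> cinp \<Gamma> = I \<and> (\<exists>K. \<forall>e\<in>cdom \<Gamma>. \<forall>x i. I e x i \<le> (csiz \<Gamma> e + 2) ^ K)"

text \<open>A list variable is available for reading if it is in scope and its entries are
  polynomially bounded.\<close>

definition AV :: "'e ctx \<Rightarrow> ('e \<Rightarrow> nat list) \<Rightarrow> bool" where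
  "AV \<Gamma> v \<longleftrightarrow> v \<in> set (cvars \<Gamma>) \<and> (\<exists>K. \<forall>e\<in>cdom \<Gamma>. \<forall>y\<in>set (v e). y \<le> (csiz \<Gamma> e + 2) ^ K)"

lemma computable_input:
  assumes "Inp \<Gamma> I" "x \<in> inputs" "computable \<Gamma> a"
  shows "computable \<Gamma> (\<lambda>e. I e x (a e))"
proof (rule computable_unop[OF assms(3)])
  show "pbd \<Gamma> (\<lambda>e. I e x (a e))" using assms(1) by (auto simp: Inp_def pbd_def)
  fix pos :: "nat list" and k
  show "\<exists>c \<tau>. \<forall>e\<in>cdom \<Gamma>. \<forall>s. agree \<Gamma> pos e s \<longrightarrow> rep (s (nm k)) [a e] \<longrightarrow>
          timed (\<lambda>s'. s' = s) c \<tau> (eval_post s k (I e x (a e)))"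
    using assms(1,2)
    by (intro exI[of _ "set_scalar k (Cell x (Cell (nm k) (N 1)))"] exI[of _ 2] ballI allI impI timed_set_scalar)
       (auto simp: eval_post_def rep_singleton agree_def Inp_def)
qed

lemma computable_lget:
  assumes "AV \<Gamma> v" "computable \<Gamma> a"
  shows "computable \<Gamma> (\<lambda>e. lget (v e) (a e))"
proof (rule computable_unop[OF assms(2)])
  show "pbd \<Gamma> (\<lambda>e. lget (v e) (a e))" using assms(1) by (fastforce simp: AV_def pbd_def lget_def)
  fix pos :: "nat list" and k
  assume pos: "length pos = length (cvars \<Gamma>)" "set pos \<subseteq> {..<k}"
  from assms(1) obtain j where j: "j < length (cvars \<Gamma>)" "cvars \<Gamma> ! j = v"
    by (auto simp: AV_def in_set_conv_nth)
  define p where "p = pos ! j"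
  have p: "p \<noteq> k" using pos j unfolding p_def by (metis lessThan_iff less_irrefl nth_mem subsetD)
  let ?c = "Cond (Minus (Cell (nm p) (N 0)) (Cell (nm k) (N 1)))
     (set_scalar k (Cell (nm p) (Plus (Cell (nm k) (N 1)) (N 1)))) (set_scalar k (N 0))"
  show "\<exists>c \<tau>. \<forall>e\<in>cdom \<Gamma>. \<forall>s. agree \<Gamma> pos e s \<longrightarrow> rep (s (nm k)) [a e] \<longrightarrow>
          timed (\<lambda>s'. s' = s) c \<tau> (eval_post s k (lget (v e) (a e)))"
  proof (intro exI[of _ ?c] exI[of _ "Suc 2"] ballI allI impI timed_Cond timed_set_scalar)
    fix e s s' assume "agree \<Gamma> pos e s" and r: "rep (s (nm k)) [a e]"
    then have r': "rep (s (nm p)) (v e)" using j by (auto simp: agree_def p_def)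
    { assume "s' = s \<and> aval (Minus (Cell (nm p) (N 0)) (Cell (nm k) (N 1))) s' \<noteq> 0"
      with r r' p show "eval_post s k (lget (v e) (a e)) (s'(nm k := (s' (nm k))
         (1 := aval (Cell (nm p) (Plus (Cell (nm k) (N 1)) (N 1))) s', 0 := 1)))"
        by (auto simp: eval_post_def rep_def lget_def) }
    { assume "s' = s \<and> aval (Minus (Cell (nm p) (N 0)) (Cell (nm k) (N 1))) s' = 0"
      with r r' p show "eval_post s k (lget (v e) (a e)) (s'(nm k := (s' (nm k))
         (1 := aval (N 0) s', 0 := 1)))"
        by (auto simp: eval_post_def rep_def lget_def) }
  qed
qed

text \<open>The second operand is evaluated one level higher on the stack, so that the value of the
  first survives.\<close>

lemma computable_binop:
  assumes a: "computable \<Gamma> a" and b: "computable \<Gamma> b"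
    and bd: "pbd \<Gamma> (\<lambda>e. h (a e) (b e))"
    and H: "\<And>x y s. aval (H x y) s = h (aval x s) (aval y s)"
  shows "computable \<Gamma> (\<lambda>e. h (a e) (b e))"
  unfolding computable_def
proof (intro conjI allI impI bd)
  fix pos :: "nat list" and k
  assume pos: "length pos = length (cvars \<Gamma>)" "set pos \<subseteq> {..<k}"
  then have pos': "set pos \<subseteq> {..<Suc k}" by auto
  obtain c1 \<tau>1 where 1: "pbd \<Gamma> \<tau>1" "realizes \<Gamma> pos k a c1 \<tau>1" using computableE[OF a pos] .
  obtain c2 \<tau>2 where 2: "pbd \<Gamma> \<tau>2" "realizes \<Gamma> pos (Suc k) b c2 \<tau>2" using computableE[OF b pos(1) pos'] .
  let ?c = "Seq c1 (Seq c2 (set_scalar k (H (Cell (nm k) (N 1)) (Cell (nm (Suc k)) (N 1)))))"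
  show "\<exists>c \<tau>. pbd \<Gamma> \<tau> \<and> realizes \<Gamma> pos k (\<lambda>e. h (a e) (b e)) c \<tau>"
  proof (intro exI conjI)
    show "pbd \<Gamma> (\<lambda>e. \<tau>1 e + (\<tau>2 e + 2))" using 1 2 by (intro pbd_add pbd_const)
    show "realizes \<Gamma> pos k (\<lambda>e. h (a e) (b e)) ?c (\<lambda>e. \<tau>1 e + (\<tau>2 e + 2))"
      unfolding realizes_def
    proof (intro ballI allI impI)
      fix e s assume e: "e \<in> cdom \<Gamma>" and ag: "agree \<Gamma> pos e s"
      let ?Q = "\<lambda>s2. (\<forall>x. x \<notin> nm ` {k..} \<longrightarrow> s2 x = s x) \<and> rep (s2 (nm k)) [a e] \<and> rep (s2 (nm (Suc k))) [b e]"
      have "timed (eval_post s k (a e)) c2 (\<tau>2 e) ?Q"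
      proof (rule timedI)
        fix s1 assume s1: "eval_post s k (a e) s1"
        have "agree \<Gamma> pos e s1" by (rule eval_post_agree[OF s1 ag pos(2,1)])
        then obtain t s' where "exec c2 s1 t s'" "t \<le> \<tau>2 e" "eval_post s1 (Suc k) (b e) s'"
          by (rule timedE[OF realizesD[OF 2(2) e] refl])
        with s1 show "\<exists>t s'. exec c2 s1 t s' \<and> t \<le> \<tau>2 e \<and> ?Q s'"
          by (intro exI[of _ t] exI[of _ s']) (auto simp: eval_post_def image_iff)
      qed
      moreover have "timed ?Q (set_scalar k (H (Cell (nm k) (N 1)) (Cell (nm (Suc k)) (N 1)))) 2
          (eval_post s k (h (a e) (b e)))"
        by (rule timed_set_scalar) (auto simp: eval_post_def rep_singleton H)
      ultimately show "timed (\<lambda>s'. s' = s) ?c (\<tau>1 e + (\<tau>2 e + 2)) (eval_post s k (h (a e) (b e)))"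
        using realizesD[OF 1(2) e ag] by (meson timed_Seq)
    qed
  qed
qed

lemma computable_add: "computable \<Gamma> a \<Longrightarrow> computable \<Gamma> b \<Longrightarrow> computable \<Gamma> (\<lambda>e. a e + b e)"
  by (rule computable_binop[where H = Plus]) (auto dest: computable_pbd)

lemma computable_diff: "computable \<Gamma> a \<Longrightarrow> computable \<Gamma> b \<Longrightarrow> computable \<Gamma> (\<lambda>e. a e - b e)"
  by (rule computable_binop[where H = Minus]) (auto dest: computable_pbd intro: pbd_mono)

lemma computable_if_nonzero:
  assumes b: "computable \<Gamma> b" and a: "computable \<Gamma> a1" "computable \<Gamma> a2"
  shows "computable \<Gamma> (\<lambda>e. if b e \<noteq> 0 then a1 e else a2 e)"
  unfolding computable_def
proof (intro conjI allI impI)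
  show "pbd \<Gamma> (\<lambda>e. if b e \<noteq> 0 then a1 e else a2 e)"
    by (rule pbd_mono[OF pbd_add[OF a[THEN computable_pbd]]]) auto
  fix pos :: "nat list" and k
  assume pos: "length pos = length (cvars \<Gamma>)" "set pos \<subseteq> {..<k}"
  obtain c0 \<tau>0 where 0: "pbd \<Gamma> \<tau>0" "realizes \<Gamma> pos k b c0 \<tau>0" using computableE[OF b pos] .
  obtain c1 \<tau>1 where 1: "pbd \<Gamma> \<tau>1" "realizes \<Gamma> pos k a1 c1 \<tau>1" using computableE[OF a(1) pos] .
  obtain c2 \<tau>2 where 2: "pbd \<Gamma> \<tau>2" "realizes \<Gamma> pos k a2 c2 \<tau>2" using computableE[OF a(2) pos] .
  let ?c = "Seq c0 (Cond (Cell (nm k) (N 1)) c1 c2)"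
  show "\<exists>c \<tau>. pbd \<Gamma> \<tau> \<and> realizes \<Gamma> pos k (\<lambda>e. if b e \<noteq> 0 then a1 e else a2 e) c \<tau>"
  proof (intro exI conjI)
    show "pbd \<Gamma> (\<lambda>e. \<tau>0 e + Suc (\<tau>1 e + \<tau>2 e))" using 0 1 2 by (intro pbd_add pbd_const pbd_Suc)
    show "realizes \<Gamma> pos k (\<lambda>e. if b e \<noteq> 0 then a1 e else a2 e) ?c (\<lambda>e. \<tau>0 e + Suc (\<tau>1 e + \<tau>2 e))"
      unfolding realizes_def
    proof (intro ballI allI impI timed_Seq timed_Cond)
      fix e s assume e: "e \<in> cdom \<Gamma>" and ag: "agree \<Gamma> pos e s"
      let ?v = "if b e \<noteq> 0 then a1 e else a2 e"
      show "timed (\<lambda>s'. s' = s) c0 (\<tau>0 e) (eval_post s k (b e))" by (rule realizesD[OF 0(2) e ag])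
      have *: "timed (\<lambda>s'. eval_post s k (b e) s' \<and> C s') c' (\<tau>1 e + \<tau>2 e) (eval_post s k ?v)"
        if r: "realizes \<Gamma> pos k a' c' \<tau>'" and v: "\<And>s'. eval_post s k (b e) s' \<Longrightarrow> C s' \<Longrightarrow> a' e = ?v" and t: "\<tau>' e \<le> \<tau>1 e + \<tau>2 e"
        for C a' c' \<tau>'
      proof (intro timedI, elim conjE)
        fix s1 assume s1: "eval_post s k (b e) s1" and C: "C s1"
        have "agree \<Gamma> pos e s1" by (rule eval_post_agree[OF s1 ag pos(2,1)])
        then obtain t s' where "exec c' s1 t s'" "t \<le> \<tau>' e" "eval_post s1 k (a' e) s'"
          by (rule timedE[OF realizesD[OF r e] refl])
        with s1 v[OF s1 C] t show "\<exists>t s'. exec c' s1 t s' \<and> t \<le> \<tau>1 e + \<tau>2 e \<and> eval_post s k ?v s'"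
          by (intro exI[of _ t] exI[of _ s']) (auto simp: eval_post_def)
      qed
      show "timed (\<lambda>s'. eval_post s k (b e) s' \<and> aval (Cell (nm k) (N 1)) s' \<noteq> 0) c1 (\<tau>1 e + \<tau>2 e) (eval_post s k ?v)"
        by (rule *[OF 1(2)]) (auto simp: eval_post_def rep_singleton)
      show "timed (\<lambda>s'. eval_post s k (b e) s' \<and> aval (Cell (nm k) (N 1)) s' = 0) c2 (\<tau>1 e + \<tau>2 e) (eval_post s k ?v)"
        by (rule *[OF 2(2)]) (auto simp: eval_post_def rep_singleton)
    qed
  qed
qed

text \<open>Binding a variable x in \<open>Y e\<close>: environments become nested pairs in which
  \<open>snd\<close> is the newest variable and \<open>fst\<close> weakens. The size does not depend
  on x, so bounds are uniform in bound variables.\<close>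

definition ext :: "'e ctx \<Rightarrow> ('e \<Rightarrow> 'x set) \<Rightarrow> ('x \<Rightarrow> nat list) \<Rightarrow> ('e \<times> 'x) ctx" where
  "ext \<Gamma> Y rp = \<lparr>cdom = {(e, x). e \<in> cdom \<Gamma> \<and> x \<in> Y e}, cinp = (\<lambda>e. cinp \<Gamma> (fst e)),
     csiz = (\<lambda>e. csiz \<Gamma> (fst e)), cvars = map (\<lambda>r e. r (fst e)) (cvars \<Gamma>) @ [\<lambda>e. rp (snd e)]\<rparr>"

lemma pbd_ext: "pbd \<Gamma> h \<Longrightarrow> pbd (ext \<Gamma> Y rp) (\<lambda>e. h (fst e))"
  by (auto simp: pbd_def ext_def)

lemma Inp_ext: "Inp \<Gamma> I \<Longrightarrow> Inp (ext \<Gamma> Y rp) (\<lambda>e. I (fst e))"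
  unfolding Inp_def ext_def by auto

lemma AV_ext: "AV \<Gamma> v \<Longrightarrow> AV (ext \<Gamma> Y rp) (\<lambda>e. v (fst e))"
  unfolding AV_def ext_def by auto

lemma AV_ext_new:
  assumes "\<exists>K. \<forall>e\<in>cdom \<Gamma>. \<forall>x\<in>Y e. \<forall>y\<in>set (rp x). y \<le> (csiz \<Gamma> e + 2) ^ K"
  shows "AV (ext \<Gamma> Y rp) (\<lambda>e. rp (snd e))"
  using assms unfolding AV_def ext_def by fastforce

lemma computable_ext:
  assumes "computable \<Gamma> a" shows "computable (ext \<Gamma> Y rp) (\<lambda>e. a (fst e))"
  unfolding computable_def
proof (intro conjI allI impI)
  show "pbd (ext \<Gamma> Y rp) (\<lambda>e. a (fst e))" using assms by (simp add: computable_def pbd_ext)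
  fix pos :: "nat list" and k
  assume pos: "length pos = length (cvars (ext \<Gamma> Y rp))" "set pos \<subseteq> {..<k}"
  define pos' where "pos' = butlast pos"
  have pos': "length pos' = length (cvars \<Gamma>)" "set pos' \<subseteq> {..<k}"
    using pos by (auto simp: pos'_def ext_def dest!: in_set_butlastD)
  obtain c \<tau> where c: "pbd \<Gamma> \<tau>" "realizes \<Gamma> pos' k a c \<tau>" using computableE[OF assms pos'] .
  have ag: "agree \<Gamma> pos' (fst e) s" if "agree (ext \<Gamma> Y rp) pos e s" for e s
    unfolding agree_def
  proof (intro conjI allI impI)
    fix j assume j: "j < length (cvars \<Gamma>)"
    then have "rep (s (nm (pos ! j))) ((cvars (ext \<Gamma> Y rp) ! j) e)"
      using that by (auto simp: agree_def ext_def)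
    then show "rep (s (nm (pos' ! j))) ((cvars \<Gamma> ! j) (fst e))"
      using j pos' by (simp add: ext_def pos'_def nth_append nth_butlast)
  qed (use that in \<open>simp add: agree_def ext_def\<close>)
  show "\<exists>c \<tau>. pbd (ext \<Gamma> Y rp) \<tau> \<and> realizes (ext \<Gamma> Y rp) pos k (\<lambda>e. a (fst e)) c \<tau>"
  proof (intro exI conjI)
    show "pbd (ext \<Gamma> Y rp) (\<lambda>e. \<tau> (fst e))" using c(1) by (rule pbd_ext)
    show "realizes (ext \<Gamma> Y rp) pos k (\<lambda>e. a (fst e)) c (\<lambda>e. \<tau> (fst e))"
      unfolding realizes_def
    proof (intro ballI allI impI)
      fix e s assume "e \<in> cdom (ext \<Gamma> Y rp)" "agree (ext \<Gamma> Y rp) pos e s"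
      then show "timed (\<lambda>s'. s' = s) c (\<tau> (fst e)) (eval_post s k (a (fst e)))"
        by (intro realizesD[OF c(2)] ag) (auto simp: ext_def)
    qed
  qed
qed

lemma nm_mem_image [simp]: "nm j \<in> nm ` {k..} \<longleftrightarrow> k \<le> j"
  by auto

lemma eval_post_outside: "eval_post s k' v s' \<Longrightarrow> k \<le> k' \<Longrightarrow> x \<notin> nm ` {k..} \<Longrightarrow> s' x = s x"
  unfolding eval_post_def by fastforce

lemma agree_ext:
  assumes "length pos = length (cvars \<Gamma>)"
  shows "agree (ext \<Gamma> Y rp) (pos @ [p]) e s \<longleftrightarrow> agree \<Gamma> pos (fst e) s \<and> rep (s (nm p)) (rp (snd e))"
  using assms by (auto simp: agree_def ext_def nth_append less_Suc_eq all_conj_distrib)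

lemma length_cvars_ext [simp]: "length (cvars (ext \<Gamma> Y rp)) = Suc (length (cvars \<Gamma>))"
  by (simp add: ext_def)

lemma mem_cdom_ext [simp]: "e \<in> cdom (ext \<Gamma> Y rp) \<longleftrightarrow> fst e \<in> cdom \<Gamma> \<and> snd e \<in> Y (fst e)"
  by (auto simp: ext_def)

lemma csiz_ext [simp]: "csiz (ext \<Gamma> Y rp) e = csiz \<Gamma> (fst e)"
  by (simp add: ext_def)

text \<open>The basic form of iteration. Every round computes all entries of a new array from the
  complete old one; as the initial array is empty, round 0 has to do the initialization.\<close>

fun aiter :: "nat \<Rightarrow> (nat \<Rightarrow> nat list \<Rightarrow> nat \<Rightarrow> nat) \<Rightarrow> nat \<Rightarrow> nat list" where
  "aiter L step 0 = []"
| "aiter L step (Suc t) = map (step t (aiter L step t)) [0..<L]"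

abbreviation sc :: "nat \<Rightarrow> nat list" where "sc i \<equiv> [i]"

lemma pbd_ext_bound:
  assumes "pbd (ext \<Gamma> Y rp) \<tau>"
  obtains \<tau>' where "pbd \<Gamma> \<tau>'" "\<And>e x. e \<in> cdom \<Gamma> \<Longrightarrow> x \<in> Y e \<Longrightarrow> \<tau> (e, x) \<le> \<tau>' e"
proof -
  from assms obtain K where K: "\<forall>e\<in>cdom (ext \<Gamma> Y rp). \<tau> e \<le> (csiz \<Gamma> (fst e) + 2) ^ K"
    by (auto simp: pbd_def ext_def)
  show thesis
  proof (rule that[of "\<lambda>e. (csiz \<Gamma> e + 2) ^ K"])
    show "pbd \<Gamma> (\<lambda>e. (csiz \<Gamma> e + 2) ^ K)" unfolding pbd_def by blast
    show "\<tau> (e, x) \<le> (csiz \<Gamma> e + 2) ^ K" if "e \<in> cdom \<Gamma>" "x \<in> Y e" for e x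
      using K[rule_format, of "(e, x)"] that by simp
  qed
qed

text \<open>The final array is consumed by \<open>body\<close>, because expressions denote numbers
  only. Hypotheses on \<open>step\<close> are confined to arrays that really occur, which is how
  size bounds on intermediate arrays become available.\<close>

lemma computable_aiter:
  fixes N L :: "'e \<Rightarrow> nat"
  assumes N: "computable \<Gamma> N" and L: "computable \<Gamma> L"
    and step: "computable
      (ext (ext (ext \<Gamma> (\<lambda>e. {..<N e}) sc)
              (\<lambda>e. {aiter (L (fst e)) (step (fst e)) (snd e)}) (\<lambda>l. l))
              (\<lambda>e. {..<L (fst (fst e))}) sc)
      (\<lambda>e. step (fst (fst (fst e))) (snd (fst (fst e))) (snd (fst e)) (snd e))"
    and body: "computable (ext \<Gamma> (\<lambda>e. {aiter (L e) (step e) (N e)}) (\<lambda>l. l)) (\<lambda>e. body (fst e) (snd e))"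
  shows "computable \<Gamma> (\<lambda>e. body e (aiter (L e) (step e) (N e)))"
  unfolding computable_def
proof (intro conjI allI impI)
  obtain \<beta> where "pbd \<Gamma> \<beta>"
    "\<And>e x. e \<in> cdom \<Gamma> \<Longrightarrow> x \<in> {aiter (L e) (step e) (N e)} \<Longrightarrow> body (fst (e, x)) (snd (e, x)) \<le> \<beta> e"
    by (rule pbd_ext_bound[OF computable_pbd[OF body]]) blast
  then show "pbd \<Gamma> (\<lambda>e. body e (aiter (L e) (step e) (N e)))"
    by (auto intro: pbd_mono)
  fix pos :: "nat list" and k
  assume pos: "length pos = length (cvars \<Gamma>)" "set pos \<subseteq> {..<k}"
  obtain cN \<tau>N where cN: "pbd \<Gamma> \<tau>N" "realizes \<Gamma> pos k N cN \<tau>N"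
    using computableE[OF N pos] .
  obtain cL \<tau>L where cL: "pbd \<Gamma> \<tau>L" "realizes \<Gamma> pos (k + 1) L cL \<tau>L"
    by (rule computableE[OF L pos(1), of "k + 1"]) (use pos(2) in auto)
  let ?\<Gamma>1 = "ext \<Gamma> (\<lambda>e. {..<N e}) sc"
  let ?\<Gamma>2 = "ext ?\<Gamma>1 (\<lambda>e. {aiter (L (fst e)) (step (fst e)) (snd e)}) (\<lambda>l. l)"
  let ?\<Gamma>3 = "ext ?\<Gamma>2 (\<lambda>e. {..<L (fst (fst e))}) sc"
  let ?\<Gamma>b = "ext \<Gamma> (\<lambda>e. {aiter (L e) (step e) (N e)}) (\<lambda>l. l)"
  obtain cs \<tau>3 where cs: "pbd ?\<Gamma>3 \<tau>3" "realizes ?\<Gamma>3 (((pos @ [k + 3]) @ [k + 2]) @ [k + 4]) (k + 6)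
      (\<lambda>e. step (fst (fst (fst e))) (snd (fst (fst e))) (snd (fst e)) (snd e)) cs \<tau>3"
    by (rule computableE[OF step, of "((pos @ [k + 3]) @ [k + 2]) @ [k + 4]" "k + 6"])
       (use pos in auto)
  obtain cb \<tau>b0 where cb: "pbd ?\<Gamma>b \<tau>b0" "realizes ?\<Gamma>b (pos @ [k + 2]) (k + 6) (\<lambda>e. body (fst e) (snd e)) cb \<tau>b0"
    by (rule computableE[OF body, of "pos @ [k + 2]" "k + 6"]) (use pos in auto)
  obtain \<tau>2 where \<tau>2: "pbd ?\<Gamma>2 \<tau>2" "\<And>e x. e \<in> cdom ?\<Gamma>2 \<Longrightarrow> x \<in> {..<L (fst (fst e))} \<Longrightarrow> \<tau>3 (e, x) \<le> \<tau>2 e"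
    using pbd_ext_bound[OF cs(1)] by blast
  obtain \<tau>1 where \<tau>1: "pbd ?\<Gamma>1 \<tau>1" "\<And>e x. e \<in> cdom ?\<Gamma>1 \<Longrightarrow> x \<in> {aiter (L (fst e)) (step (fst e)) (snd e)} \<Longrightarrow> \<tau>2 (e, x) \<le> \<tau>1 e"
    using pbd_ext_bound[OF \<tau>2(1)] by blast
  obtain \<tau>s where \<tau>s: "pbd \<Gamma> \<tau>s" "\<And>e x. e \<in> cdom \<Gamma> \<Longrightarrow> x \<in> {..<N e} \<Longrightarrow> \<tau>1 (e, x) \<le> \<tau>s e"
    using pbd_ext_bound[OF \<tau>1(1)] by blast
  obtain \<tau>b where \<tau>b: "pbd \<Gamma> \<tau>b" "\<And>e x. e \<in> cdom \<Gamma> \<Longrightarrow> x \<in> {aiter (L e) (step e) (N e)} \<Longrightarrow> \<tau>b0 (e, x) \<le> \<tau>b e"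
    using pbd_ext_bound[OF cb(1)] by blast
  \<comment> \<open>Stack layout from k on: number of rounds, length, current array, round, index,
    new array; scratch space starts at k + 6.\<close>
  let ?rd = "\<lambda>j. Cell (nm j) (Defs.N 1)"
  let ?incr = "\<lambda>j. set_scalar j (Plus (?rd j) (Defs.N 1))"
  let ?loop = "\<lambda>c. While (Minus (?rd (k + 1)) (?rd (k + 4))) (Seq c (?incr (k + 4)))"
  \<comment> \<open>A round writes to a second array, since \<open>step\<close> may read any entry
    of the old one, and copies it back afterwards.\<close>
  define c1 where "c1 = ?loop (Seq cs (Assign (nm (k + 5)) (Plus (?rd (k + 4)) (Defs.N 1)) (?rd (k + 6))))"
  define c2 where "c2 = ?loop (Assign (nm (k + 2)) (Plus (?rd (k + 4)) (Defs.N 1)) (Cell (nm (k + 5)) (Plus (?rd (k + 4)) (Defs.N 1))))"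
  define cO where "cO = Seq (Seq (set_scalar (k + 4) (Defs.N 0)) c1) (Seq (Seq (set_scalar (k + 4) (Defs.N 0)) c2)
     (Seq (Assign (nm (k + 2)) (Defs.N 0) (?rd (k + 1))) (?incr (k + 3))))"
  define c where "c = Seq cN (Seq cL (Seq (Seq (Assign (nm (k + 2)) (Defs.N 0) (Defs.N 0)) (set_scalar (k + 3) (Defs.N 0)))
     (Seq (While (Minus (?rd k) (?rd (k + 3))) cO) (Seq cb (set_scalar k (?rd (k + 6)))))))"
  define \<tau>O where "\<tau>O = (\<lambda>e. (2 + (L e * ((\<tau>s e + 1 + 2) + 1) + 1)) + ((2 + (L e * ((1 + 2) + 1) + 1)) + (1 + 2)))"
  define \<tau> where "\<tau> = (\<lambda>e. \<tau>N e + (\<tau>L e + ((1 + 2) + ((N e * (\<tau>O e + 1) + 1) + (\<tau>b e + 2)))))"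
  have "pbd \<Gamma> \<tau>O" unfolding \<tau>O_def
    by (intro pbd_add pbd_mult pbd_const \<tau>s(1) computable_pbd[OF L])
  then have "pbd \<Gamma> \<tau>" unfolding \<tau>_def
    by (intro pbd_add pbd_mult pbd_const cN(1) cL(1) \<tau>b(1) computable_pbd[OF N])
  moreover have "realizes \<Gamma> pos k (\<lambda>e. body e (aiter (L e) (step e) (N e))) c \<tau>"
    unfolding realizes_def
  proof (intro ballI allI impI)
    fix e s assume e: "e \<in> cdom \<Gamma>" and ag: "agree \<Gamma> pos e s"
    define it where "it = aiter (L e) (step e)"
    have it_len: "length (it (Suc t)) = L e" for t by (simp add: it_def)
    define fr where "fr = (\<lambda>s'. \<forall>x. x \<notin> nm ` {k..} \<longrightarrow> s' x = s x)"
    have fr_upd: "fr (s'(nm j := a))" if "fr s'" "k \<le> j" for s' j a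
      using that by (auto simp: fr_def)
    have fr_ag: "agree \<Gamma> pos e s'" if "fr s'" for s'
      using agree_cong[OF ag _ pos(2,1)] that unfolding fr_def by blast
    have fr_post: "fr s2" if "eval_post s1 (k + 6) v s2" "fr s1" for s1 v s2
      unfolding fr_def
    proof (intro allI impI)
      fix x assume "x \<notin> nm ` {k..}"
      then show "s2 x = s x"
        using that(2) eval_post_outside[OF that(1), of k x] unfolding fr_def by simp
    qed
    define B where "B = (\<lambda>s'. fr s' \<and> rep (s' (nm k)) [N e] \<and> rep (s' (nm (k + 1))) [L e])"
    define P where "P = (\<lambda>t s'. B s' \<and> rep (s' (nm (k + 2))) (it t) \<and> rep (s' (nm (k + 3))) [t])"
    define Q where "Q = (\<lambda>t i s'. P t s' \<and> rep (s' (nm (k + 4))) [i] \<and> (\<forall>j<i. s' (nm (k + 5)) (Suc j) = it (Suc t) ! j))"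
    \<comment> \<open>During copying the current array is a mixture of old and new entries, so this
      invariant mentions only the part already copied.\<close>
    define R where "R = (\<lambda>t i s'. B s' \<and> rep (s' (nm (k + 3))) [t] \<and> rep (s' (nm (k + 4))) [i] \<and>
       (\<forall>j<L e. s' (nm (k + 5)) (Suc j) = it (Suc t) ! j) \<and> (\<forall>j<i. s' (nm (k + 2)) (Suc j) = it (Suc t) ! j))"
    have step1: "timed (Q t i) (Seq (Seq cs (Assign (nm (k + 5)) (Plus (?rd (k + 4)) (Defs.N 1)) (?rd (k + 6)))) (?incr (k + 4)))
        (\<tau>s e + 1 + 2) (Q t (Suc i))" if t: "t < N e" and i: "i < L e" for t i
    proof -
      let ?e = "(((e, t), it t), i)"
      have e3: "?e \<in> cdom ?\<Gamma>3" using e t i by (simp add: it_def)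
      have "timed (Q t i) cs (\<tau>s e) (\<lambda>s'. Q t i s' \<and> rep (s' (nm (k + 6))) [step e t (it t) i])"
      proof (rule timedI)
        fix s1 assume s1: "Q t i s1"
        then have "agree \<Gamma> pos e s1" by (auto simp: Q_def P_def B_def intro: fr_ag)
        then have "agree ?\<Gamma>3 (((pos @ [k + 3]) @ [k + 2]) @ [k + 4]) ?e s1"
          using s1 pos by (simp add: agree_ext Q_def P_def del: append_assoc)
        from realizesD[OF cs(2) e3 this]
        obtain t' s2 where ex: "exec cs s1 t' s2" "t' \<le> \<tau>3 ?e"
          "eval_post s1 (k + 6) (step e t (it t) i) s2"
          by (auto elim!: timedE)
        have "\<tau>3 ?e \<le> \<tau>2 ((e, t), it t)" using e3 by (intro \<tau>2(2)) auto
        also have "\<dots> \<le> \<tau>1 (e, t)" using e3 by (intro \<tau>1(2)) auto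
        also have "\<dots> \<le> \<tau>s e" using e3 by (intro \<tau>s(2)) auto
        finally have "t' \<le> \<tau>s e" using ex(2) by simp
        moreover have same: "s2 (nm j) = s1 (nm j)" if "j < k + 6" for j
          using ex(3) that by (auto simp: eval_post_def)
        then have "Q t i s2"
          using s1 fr_post[OF ex(3)] by (simp add: Q_def P_def B_def)
        ultimately show "\<exists>t' s'. exec cs s1 t' s' \<and> t' \<le> \<tau>s e \<and> Q t i s' \<and> rep (s' (nm (k + 6))) [step e t (it t) i]"
          using ex(1,3) by (auto simp: eval_post_def)
      qed
      moreover have "timed (\<lambda>s'. Q t i s' \<and> rep (s' (nm (k + 6))) [step e t (it t) i])
         (Assign (nm (k + 5)) (Plus (?rd (k + 4)) (Defs.N 1)) (?rd (k + 6))) 1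
         (\<lambda>s'. P t s' \<and> rep (s' (nm (k + 4))) [i] \<and> (\<forall>j<Suc i. s' (nm (k + 5)) (Suc j) = it (Suc t) ! j))"
        using i by (intro timed_Assign)
          (auto simp: Q_def P_def B_def rep_singleton fr_upd it_def less_Suc_eq)
      moreover have "timed (\<lambda>s'. P t s' \<and> rep (s' (nm (k + 4))) [i] \<and> (\<forall>j<Suc i. s' (nm (k + 5)) (Suc j) = it (Suc t) ! j))
         (?incr (k + 4)) 2 (Q t (Suc i))"
        by (intro timed_set_scalar) (auto simp: Q_def P_def B_def rep_singleton fr_upd)
      ultimately show ?thesis by (meson timed_Seq)
    qed
    have loop1: "timed (Q t 0) c1 (L e * ((\<tau>s e + 1 + 2) + 1) + 1) (Q t (L e))" if t: "t < N e" for t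
      unfolding c1_def
      by (intro timed_While step1 t) (auto simp: Q_def P_def B_def rep_singleton)
    have step2: "timed (R t i) (Seq (Assign (nm (k + 2)) (Plus (?rd (k + 4)) (Defs.N 1)) (Cell (nm (k + 5)) (Plus (?rd (k + 4)) (Defs.N 1)))) (?incr (k + 4)))
        (1 + 2) (R t (Suc i))" if i: "i < L e" for t i
    proof (rule timed_Seq)
      show "timed (R t i) (Assign (nm (k + 2)) (Plus (?rd (k + 4)) (Defs.N 1)) (Cell (nm (k + 5)) (Plus (?rd (k + 4)) (Defs.N 1)))) 1
        (\<lambda>s'. R t i s' \<and> (\<forall>j<Suc i. s' (nm (k + 2)) (Suc j) = it (Suc t) ! j))"
        using i by (intro timed_Assign) (auto simp: R_def B_def rep_singleton fr_upd less_Suc_eq)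
      show "timed (\<lambda>s'. R t i s' \<and> (\<forall>j<Suc i. s' (nm (k + 2)) (Suc j) = it (Suc t) ! j)) (?incr (k + 4)) 2 (R t (Suc i))"
        by (intro timed_set_scalar) (auto simp: R_def B_def rep_singleton fr_upd)
    qed
    have loop2: "timed (R t 0) c2 (L e * ((1 + 2) + 1) + 1) (R t (L e))" for t
      unfolding c2_def
      by (intro timed_While step2) (auto simp: R_def B_def rep_singleton)
    have outer: "timed (P t) cO (\<tau>O e) (P (Suc t))" if t: "t < N e" for t
      unfolding cO_def \<tau>O_def
    proof (intro timed_Seq)
      show "timed (P t) (set_scalar (k + 4) (Defs.N 0)) 2 (Q t 0)"
        by (intro timed_set_scalar) (auto simp: Q_def P_def B_def rep_singleton fr_upd)
      show "timed (Q t 0) c1 (L e * ((\<tau>s e + 1 + 2) + 1) + 1) (Q t (L e))" by (rule loop1[OF t])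
      show "timed (Q t (L e)) (set_scalar (k + 4) (Defs.N 0)) 2 (R t 0)"
        by (intro timed_set_scalar) (auto simp: Q_def R_def P_def B_def rep_singleton fr_upd)
      show "timed (R t 0) c2 (L e * ((1 + 2) + 1) + 1) (R t (L e))" by (rule loop2)
      show "timed (R t (L e)) (Assign (nm (k + 2)) (Defs.N 0) (?rd (k + 1))) 1
         (\<lambda>s'. B s' \<and> rep (s' (nm (k + 2))) (it (Suc t)) \<and> rep (s' (nm (k + 3))) [t])"
        by (intro timed_Assign) (auto simp: R_def B_def rep_singleton fr_upd rep_def[of _ "it (Suc t)"] it_len)
      show "timed (\<lambda>s'. B s' \<and> rep (s' (nm (k + 2))) (it (Suc t)) \<and> rep (s' (nm (k + 3))) [t]) (?incr (k + 3)) 2 (P (Suc t))"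
        by (intro timed_set_scalar) (auto simp: P_def B_def rep_singleton fr_upd)
    qed
    show "timed (\<lambda>s'. s' = s) c (\<tau> e) (eval_post s k (body e (aiter (L e) (step e) (N e))))"
      unfolding c_def \<tau>_def
    proof (intro timed_Seq)
      show "timed (\<lambda>s'. s' = s) cN (\<tau>N e) (eval_post s k (N e))" by (rule realizesD[OF cN(2) e ag])
      show "timed (eval_post s k (N e)) cL (\<tau>L e) B"
      proof (rule timedI)
        fix s1 assume s1: "eval_post s k (N e) s1"
        have "agree \<Gamma> pos e s1" by (rule eval_post_agree[OF s1 ag pos(2,1)])
        from realizesD[OF cL(2) e this] obtain t' s2
          where "exec cL s1 t' s2" "t' \<le> \<tau>L e" "eval_post s1 (k + 1) (L e) s2"
          by (auto elim!: timedE)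
        then show "\<exists>t s'. exec cL s1 t s' \<and> t \<le> \<tau>L e \<and> B s'" using s1
          by (intro exI[of _ t'] exI[of _ s2]) (auto simp: B_def fr_def eval_post_def image_iff)
      qed
      show "timed B (Assign (nm (k + 2)) (Defs.N 0) (Defs.N 0)) 1 (\<lambda>s'. B s' \<and> rep (s' (nm (k + 2))) [])"
        by (intro timed_Assign) (auto simp: B_def rep_singleton fr_upd rep_def[of _ "[]"])
      show "timed (\<lambda>s'. B s' \<and> rep (s' (nm (k + 2))) []) (set_scalar (k + 3) (Defs.N 0)) 2 (P 0)"
        by (intro timed_set_scalar) (auto simp: P_def B_def rep_singleton fr_upd it_def)
      show "timed (P 0) (While (Minus (?rd k) (?rd (k + 3))) cO) (N e * (\<tau>O e + 1) + 1) (P (N e))"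
        by (intro timed_While outer) (auto simp: P_def B_def rep_singleton)
      show "timed (P (N e)) cb (\<tau>b e) (\<lambda>s'. fr s' \<and> rep (s' (nm (k + 6))) [body e (it (N e))])"
      proof (rule timedI)
        fix s1 assume s1: "P (N e) s1"
        then have "agree \<Gamma> pos e s1" by (auto simp: P_def B_def intro: fr_ag)
        then have "agree ?\<Gamma>b (pos @ [k + 2]) (e, it (N e)) s1"
          using s1 pos by (simp add: agree_ext P_def)
        from realizesD[OF cb(2) _ this] e obtain t' s2
          where "exec cb s1 t' s2" "t' \<le> \<tau>b0 (e, it (N e))" "eval_post s1 (k + 6) (body e (it (N e))) s2"
          by (auto elim!: timedE simp: it_def)
        moreover have "\<tau>b0 (e, it (N e)) \<le> \<tau>b e" using e by (intro \<tau>b(2)) (auto simp: it_def)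
        ultimately show "\<exists>t s'. exec cb s1 t s' \<and> t \<le> \<tau>b e \<and> fr s' \<and> rep (s' (nm (k + 6))) [body e (it (N e))]"
          using s1 fr_post[of s1 "body e (it (N e))" s2]
          by (intro exI[of _ t'] exI[of _ s2]) (simp add: P_def B_def eval_post_def[of s1 "k + 6"])
      qed
      show "timed (\<lambda>s'. fr s' \<and> rep (s' (nm (k + 6))) [body e (it (N e))]) (set_scalar k (?rd (k + 6))) 2
         (eval_post s k (body e (aiter (L e) (step e) (N e))))"
        by (intro timed_set_scalar) (auto simp: fr_def eval_post_def rep_singleton it_def)
    qed
  qed
  ultimately show "\<exists>c \<tau>. pbd \<Gamma> \<tau> \<and> realizes \<Gamma> pos k (\<lambda>e. body e (aiter (L e) (step e) (N e))) c \<tau>"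
    by blast
qed

text \<open>A program works unchanged in any context that contains the variables it reads, at
  whatever stack positions. This serves to rearrange nested pairs.\<close>

lemma computable_rename:
  assumes a: "computable \<Gamma> a"
    and dom: "\<And>e. e \<in> cdom \<Delta> \<Longrightarrow> h e \<in> cdom \<Gamma>"
    and inp: "\<And>e. e \<in> cdom \<Delta> \<Longrightarrow> cinp \<Delta> e = cinp \<Gamma> (h e)"
    and siz: "\<And>e. e \<in> cdom \<Delta> \<Longrightarrow> csiz \<Delta> e = csiz \<Gamma> (h e)"
    and vars: "\<And>r. r \<in> set (cvars \<Gamma>) \<Longrightarrow> \<exists>r'\<in>set (cvars \<Delta>). \<forall>e\<in>cdom \<Delta>. r (h e) = r' e"
  shows "computable \<Delta> (\<lambda>e. a (h e))"
  unfolding computable_def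
proof (intro conjI allI impI)
  have pbd: "pbd \<Delta> (\<lambda>e. \<tau> (h e))" if "pbd \<Gamma> \<tau>" for \<tau>
    using that dom siz by (fastforce simp: pbd_def)
  show "pbd \<Delta> (\<lambda>e. a (h e))" using pbd[OF computable_pbd[OF a]] .
  fix pos :: "nat list" and k
  assume pos: "length pos = length (cvars \<Delta>)" "set pos \<subseteq> {..<k}"
  have "\<forall>j<length (cvars \<Gamma>). \<exists>i<length (cvars \<Delta>). \<forall>e\<in>cdom \<Delta>. (cvars \<Gamma> ! j) (h e) = (cvars \<Delta> ! i) e"
    using vars by (metis in_set_conv_nth nth_mem)
  then obtain f where f: "\<And>j. j < length (cvars \<Gamma>) \<Longrightarrow> f j < length (cvars \<Delta>)"
    "\<And>j e. j < length (cvars \<Gamma>) \<Longrightarrow> e \<in> cdom \<Delta> \<Longrightarrow> (cvars \<Gamma> ! j) (h e) = (cvars \<Delta> ! f j) e"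
    by metis
  define pos' where "pos' = map (\<lambda>j. pos ! f j) [0..<length (cvars \<Gamma>)]"
  have pos': "length pos' = length (cvars \<Gamma>)" "set pos' \<subseteq> {..<k}"
    using pos f(1) by (auto simp: pos'_def subset_iff)
  obtain c \<tau> where c: "pbd \<Gamma> \<tau>" "realizes \<Gamma> pos' k a c \<tau>" using computableE[OF a pos'] .
  have ag: "agree \<Gamma> pos' (h e) s" if "agree \<Delta> pos e s" "e \<in> cdom \<Delta>" for e s
    using that inp f by (auto simp: agree_def pos'_def)
  have "realizes \<Delta> pos k (\<lambda>e. a (h e)) c (\<lambda>e. \<tau> (h e))"
    unfolding realizes_def
    by (intro ballI allI impI realizesD[OF c(2)] ag dom)
  with pbd[OF c(1)] show "\<exists>c \<tau>. pbd \<Delta> \<tau> \<and> realizes \<Delta> pos k (\<lambda>e. a (h e)) c \<tau>" by blast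
qed

lemma computable_cong:
  assumes "computable \<Gamma> a" "\<And>e. e \<in> cdom \<Gamma> \<Longrightarrow> b e = a e"
  shows "computable \<Gamma> b"
  using assms unfolding computable_def pbd_def realizes_def by simp

text \<open>A local definition is one round of iteration on an array of length one.\<close>

lemma computable_let:
  assumes a: "computable \<Gamma> a" and b: "computable (ext \<Gamma> (\<lambda>e. {a e}) sc) (\<lambda>e. b (fst e) (snd e))"
  shows "computable \<Gamma> (\<lambda>e. b e (a e))"
proof -
  have "computable \<Gamma> (\<lambda>e. (\<lambda>e l. b e (lget l 0)) e (aiter 1 (\<lambda>t l i. a e) 1))"
  proof (rule computable_aiter[OF computable_const computable_const])
    show "computable (ext (ext (ext \<Gamma> (\<lambda>e. {..<1}) sc) (\<lambda>e. {aiter 1 (\<lambda>t l i. a (fst e)) (snd e)}) (\<lambda>l. l)) (\<lambda>e. {..<1}) sc)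
     (\<lambda>e. a (fst (fst (fst e))))"
      by (intro computable_ext[where a = "\<lambda>e. a (fst (fst e))"] computable_ext[where a = "\<lambda>e. a (fst e)"] computable_ext a)
    have "computable (ext \<Gamma> (\<lambda>e. {aiter 1 (\<lambda>t l i. a e) 1}) (\<lambda>l. l))
       (\<lambda>e. (\<lambda>e. b (fst e) (snd e)) ((\<lambda>(e, l). (e, lget l 0)) e))"
      by (rule computable_rename[OF b]) (auto simp: ext_def)
    then show "computable (ext \<Gamma> (\<lambda>e. {aiter 1 (\<lambda>t l i. a e) 1}) (\<lambda>l. l)) (\<lambda>e. b (fst e) (lget (snd e) 0))"
      by (simp add: case_prod_beta)
  qed
  then show ?thesis by simp
qed

text \<open>Recursion can exceed polynomial size, hence the separate bound on all intermediate
  values.\<close>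

lemma computable_rec_nat:
  fixes m :: "'e \<Rightarrow> nat"
  assumes m: "computable \<Gamma> m" and a: "computable \<Gamma> a"
    and bd: "pbd (ext \<Gamma> (\<lambda>e. {..m e}) sc) (\<lambda>e. rec_nat (a (fst e)) (f (fst e)) (snd e))"
    and f: "computable (ext (ext \<Gamma> (\<lambda>e. {..<m e}) sc) (\<lambda>e. {rec_nat (a (fst e)) (f (fst e)) (snd e)}) sc)
        (\<lambda>e. f (fst (fst e)) (snd (fst e)) (snd e))"
  shows "computable \<Gamma> (\<lambda>e. rec_nat (a e) (f e) (m e))"
proof -
  \<comment> \<open>The accumulator is the sole entry of the array; in round 0, where the array is
    empty, the starting value takes its place.\<close>
  define acc where "acc = (\<lambda>e (t::nat) l. if t \<noteq> 0 then lget l 0 else a e)"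
  define stp where "stp = (\<lambda>e t l (i::nat). f e t (acc e t l))"
  have it: "acc e t (aiter 1 (stp e) t) = rec_nat (a e) (f e) t" for e t
    by (induction t) (auto simp: acc_def stp_def)
  obtain K where K: "\<And>e t. e \<in> cdom \<Gamma> \<Longrightarrow> t \<le> m e \<Longrightarrow> rec_nat (a e) (f e) t \<le> (csiz \<Gamma> e + 2) ^ K"
  proof -
    from bd obtain K where "\<forall>e\<in>cdom (ext \<Gamma> (\<lambda>e. {..m e}) sc). rec_nat (a (fst e)) (f (fst e)) (snd e) \<le> (csiz \<Gamma> (fst e) + 2) ^ K"
      by (auto simp: pbd_def)
    from this[rule_format, of "(_, _)"] show thesis by (intro that[of K]) auto
  qed
  have itb: "y \<le> (csiz \<Gamma> e + 2) ^ K" if "e \<in> cdom \<Gamma>" "t \<le> m e" "y \<in> set (aiter 1 (stp e) t)" for e t y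
    using K[OF that(1,2)] it[of e t] that(3) by (cases t) (auto simp: acc_def)
  have Nb: "\<exists>K. \<forall>e\<in>cdom \<Gamma>. \<forall>x\<in>{..<m e}. \<forall>y\<in>set [x]. y \<le> (csiz \<Gamma> e + 2) ^ K"
    using computable_pbd[OF m] unfolding pbd_def by (metis (no_types, lifting) le_trans lessThan_iff less_imp_le list.set_cases set_ConsD empty_iff empty_set)
  have "computable \<Gamma> (\<lambda>e. (\<lambda>e l. acc e (m e) l) e (aiter 1 (stp e) (m e)))"
  proof (rule computable_aiter[OF m computable_const])
    let ?\<Gamma>1 = "ext \<Gamma> (\<lambda>e. {..<m e}) sc"
    let ?\<Gamma>2 = "ext ?\<Gamma>1 (\<lambda>e. {aiter 1 (stp (fst e)) (snd e)}) (\<lambda>l. l)"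
    let ?\<Gamma>3 = "ext ?\<Gamma>2 (\<lambda>e. {..<1}) sc"
    have t: "computable ?\<Gamma>1 (\<lambda>e. lget [snd e] 0)"
      by (intro computable_lget[where v = "\<lambda>e. [snd e]"] computable_const AV_ext_new[where rp = sc] Nb)
    have "y \<le> (csiz ?\<Gamma>1 e + 2) ^ K"
      if "e \<in> cdom ?\<Gamma>1" "x \<in> {aiter 1 (stp (fst e)) (snd e)}" "y \<in> set x" for e x y
      using that itb[of "fst e" "snd e" y] by (simp del: One_nat_def)
    then have l: "computable ?\<Gamma>2 (\<lambda>e. lget (snd e) 0)"
      by (intro computable_lget[where v = "\<lambda>e. snd e"] computable_const AV_ext_new[where rp = "\<lambda>l. l"]) blast
    have acc: "computable ?\<Gamma>3 (\<lambda>e. acc (fst (fst (fst e))) (snd (fst (fst e))) (snd (fst e)))"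
      using t unfolding acc_def
      by (intro computable_if_nonzero computable_ext[where a = "\<lambda>e. snd (fst e)"] computable_ext[where a = "\<lambda>e. snd e"]
          computable_ext[where a = "\<lambda>e. a (fst (fst e))"] computable_ext[where a = "\<lambda>e. a (fst e)"]
          computable_ext a computable_ext[where a = "\<lambda>e. lget (snd e) 0"] l) simp
    have "computable (ext ?\<Gamma>3 (\<lambda>e. {acc (fst (fst (fst e))) (snd (fst (fst e))) (snd (fst e))}) sc)
       (\<lambda>e. (\<lambda>e. f (fst (fst e)) (snd (fst e)) (snd e)) ((\<lambda>e. (fst (fst (fst e)), snd e)) e))"
    proof (rule computable_rename[OF f])
      fix e assume "e \<in> cdom (ext ?\<Gamma>3 (\<lambda>e. {acc (fst (fst (fst e))) (snd (fst (fst e))) (snd (fst e))}) sc)"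
      then show "(fst (fst (fst e)), snd e) \<in> cdom (ext ?\<Gamma>1 (\<lambda>e. {rec_nat (a (fst e)) (f (fst e)) (snd e)}) sc)"
        using it[of "fst (fst (fst (fst e)))" "snd (fst (fst (fst e)))"] by simp
    qed (auto simp: ext_def)
    then have "computable (ext ?\<Gamma>3 (\<lambda>e. {acc (fst (fst (fst e))) (snd (fst (fst e))) (snd (fst e))}) sc)
       (\<lambda>e. (\<lambda>e v. f (fst (fst (fst e))) (snd (fst (fst e))) v) (fst e) (snd e))"
      by simp
    from computable_let[OF acc this]
    show "computable ?\<Gamma>3 (\<lambda>e. stp (fst (fst (fst e))) (snd (fst (fst e))) (snd (fst e)) (snd e))"
      by (simp add: stp_def)
    let ?\<Gamma>b = "ext \<Gamma> (\<lambda>e. {aiter 1 (stp e) (m e)}) (\<lambda>l. l)"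
    have "y \<le> (csiz \<Gamma> e + 2) ^ K"
      if "e \<in> cdom \<Gamma>" "x \<in> {aiter 1 (stp e) (m e)}" "y \<in> set x" for e x y
      using that itb[of e "m e" y] by (simp del: One_nat_def)
    then have "computable ?\<Gamma>b (\<lambda>e. lget (snd e) 0)"
      by (intro computable_lget[where v = "\<lambda>e. snd e"] computable_const AV_ext_new[where rp = "\<lambda>l. l"]) blast
    then show "computable ?\<Gamma>b (\<lambda>e. acc (fst e) (m (fst e)) (snd e))"
      unfolding acc_def
      by (intro computable_if_nonzero computable_ext m a)
  qed
  then show ?thesis by (simp only: it)
qed

lemma computable_var: "AV \<Gamma> (\<lambda>e. [v e]) \<Longrightarrow> computable \<Gamma> v"
  using computable_lget[OF _ computable_const, of \<Gamma> "\<lambda>e. [v e]" 0] by simp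

lemma computable_new:
  assumes "pbd (ext \<Gamma> Y sc) (\<lambda>e. snd e)"
  shows "computable (ext \<Gamma> Y sc) (\<lambda>e. snd e)"
proof (rule computable_var, rule AV_ext_new[where rp = sc])
  from assms obtain K where "\<forall>e\<in>cdom (ext \<Gamma> Y sc). snd e \<le> (csiz \<Gamma> (fst e) + 2) ^ K"
    by (auto simp: pbd_def)
  from this[rule_format, of "(_, _)"]
  show "\<exists>K. \<forall>e\<in>cdom \<Gamma>. \<forall>x\<in>Y e. \<forall>y\<in>set [x]. y \<le> (csiz \<Gamma> e + 2) ^ K"
    by (intro exI[of _ K]) auto
qed

lemma pbd_index: "pbd \<Gamma> m \<Longrightarrow> pbd (ext \<Gamma> (\<lambda>e. {..<m e}) sc) (\<lambda>e. snd e)"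
  by (rule pbd_mono[OF pbd_ext]) auto

lemma computable_index: "computable \<Gamma> m \<Longrightarrow> computable (ext \<Gamma> (\<lambda>e. {..<m e}) sc) (\<lambda>e. snd e)"
  by (intro computable_new pbd_index computable_pbd)

text \<open>The operation f is given through a closure property valid in all further extensions, so
  that callers supply it without mentioning the context created by the loop.\<close>

lemma computable_fold_index:
  fixes m :: "'e \<Rightarrow> nat"
  assumes m: "computable \<Gamma> m" and a: "computable \<Gamma> a"
    and g: "computable (ext \<Gamma> (\<lambda>e. {..<m e}) sc) (\<lambda>e. g (fst e) (snd e))"
    and bd: "pbd (ext \<Gamma> (\<lambda>e. {..m e}) sc) (\<lambda>e. rec_nat (a (fst e)) (\<lambda>t v. f (fst e) v (g (fst e) t)) (snd e))"
    and f: "\<And>Y v w. computable (ext (ext \<Gamma> (\<lambda>e. {..<m e}) sc) Y sc) v \<Longrightarrow>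
       computable (ext (ext \<Gamma> (\<lambda>e. {..<m e}) sc) Y sc) w \<Longrightarrow>
       computable (ext (ext \<Gamma> (\<lambda>e. {..<m e}) sc) Y sc) (\<lambda>e. f (fst (fst e)) (v e) (w e))"
  shows "computable \<Gamma> (\<lambda>e. rec_nat (a e) (\<lambda>t v. f e v (g e t)) (m e))"
proof (rule computable_rec_nat[OF m a bd])
  let ?Y = "\<lambda>e. {rec_nat (a (fst e)) (\<lambda>t v. f (fst e) v (g (fst e) t)) (snd e)}"
  have "computable (ext (ext \<Gamma> (\<lambda>e. {..<m e}) sc) ?Y sc) (\<lambda>e. snd e)"
  proof (rule computable_new)
    from bd obtain K where K: "\<forall>e\<in>cdom (ext \<Gamma> (\<lambda>e. {..m e}) sc).
       rec_nat (a (fst e)) (\<lambda>t v. f (fst e) v (g (fst e) t)) (snd e) \<le> (csiz \<Gamma> (fst e) + 2) ^ K"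
      by (auto simp: pbd_def)
    show "pbd (ext (ext \<Gamma> (\<lambda>e. {..<m e}) sc) ?Y sc) (\<lambda>e. snd e)"
      unfolding pbd_def
    proof (intro exI[of _ K] ballI)
      fix e assume "e \<in> cdom (ext (ext \<Gamma> (\<lambda>e. {..<m e}) sc) ?Y sc)"
      then show "snd e \<le> (csiz (ext (ext \<Gamma> (\<lambda>e. {..<m e}) sc) ?Y sc) e + 2) ^ K"
        using K[rule_format, of "fst e"] by auto
    qed
  qed
  then show "computable (ext (ext \<Gamma> (\<lambda>e. {..<m e}) sc) ?Y sc) (\<lambda>e. f (fst (fst e)) (snd e) (g (fst (fst e)) (snd (fst e))))"
    by (intro f computable_ext[where a = "\<lambda>e. g (fst e) (snd e)"] g)
qed

lemma computable_sum:
  fixes m :: "'e \<Rightarrow> nat"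
  assumes m: "computable \<Gamma> m" and g: "computable (ext \<Gamma> (\<lambda>e. {..<m e}) sc) (\<lambda>e. g (fst e) (snd e))"
  shows "computable \<Gamma> (\<lambda>e. \<Sum>i<m e. g e i)"
proof -
  have sum: "rec_nat 0 (\<lambda>t v. v + g e t) n = (\<Sum>i<n. g e i)" for e n
    by (induction n) auto
  obtain \<beta> where \<beta>: "pbd \<Gamma> \<beta>" "\<And>e x. e \<in> cdom \<Gamma> \<Longrightarrow> x \<in> {..<m e} \<Longrightarrow> g (fst (e, x)) (snd (e, x)) \<le> \<beta> e"
    using pbd_ext_bound[OF computable_pbd[OF g]] by blast
  have "(\<Sum>i<n. g e i) \<le> m e * \<beta> e" if "e \<in> cdom \<Gamma>" "n \<le> m e" for e n
  proof -
    have "(\<Sum>i<n. g e i) \<le> (\<Sum>i<n. \<beta> e)" using that \<beta>(2)[of e] by (intro sum_mono) auto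
    also have "\<dots> \<le> m e * \<beta> e" using that by simp
    finally show ?thesis .
  qed
  then have "pbd (ext \<Gamma> (\<lambda>e. {..m e}) sc) (\<lambda>e. rec_nat 0 (\<lambda>t v. v + g (fst e) t) (snd e))"
    unfolding sum
    by (intro pbd_mono[OF pbd_ext[OF pbd_mult[OF computable_pbd[OF m] \<beta>(1)]]]) auto
  then have "computable \<Gamma> (\<lambda>e. rec_nat 0 (\<lambda>t v. (\<lambda>_ v w. v + w) e v (g e t)) (m e))"
    by (intro computable_fold_index m g computable_const computable_add) auto
  then show ?thesis by (simp add: sum)
qed

section \<open>Decidable predicates and arithmetic by bounded loops\<close>

abbreviation decidable :: "'e ctx \<Rightarrow> ('e \<Rightarrow> bool) \<Rightarrow> bool" where
  "decidable \<Gamma> P \<equiv> computable \<Gamma> (\<lambda>e. of_bool (P e))"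

lemma decidable_less:
  assumes "computable \<Gamma> a" "computable \<Gamma> b" shows "decidable \<Gamma> (\<lambda>e. a e < b e)"
proof -
  have "computable \<Gamma> (\<lambda>e. 1 - (1 - (b e - a e)))"
    using assms by (intro computable_diff computable_const)
  then show ?thesis by (rule computable_cong) auto
qed

lemma decidable_eq:
  assumes "computable \<Gamma> a" "computable \<Gamma> b" shows "decidable \<Gamma> (\<lambda>e. a e = b e)"
proof -
  have "computable \<Gamma> (\<lambda>e. 1 - ((b e - a e) + (a e - b e)))"
    using assms by (intro computable_diff computable_add computable_const)
  then show ?thesis by (rule computable_cong) auto
qed

lemma decidable_not: "decidable \<Gamma> P \<Longrightarrow> decidable \<Gamma> (\<lambda>e. \<not> P e)"
  by (rule computable_cong[OF computable_diff[OF computable_const[of \<Gamma> 1]]]) auto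

lemma decidable_le:
  assumes "computable \<Gamma> a" "computable \<Gamma> b" shows "decidable \<Gamma> (\<lambda>e. a e \<le> b e)"
  using decidable_not[OF decidable_less[OF assms(2,1)]] by (simp add: not_less)

lemma computable_if:
  "decidable \<Gamma> P \<Longrightarrow> computable \<Gamma> a \<Longrightarrow> computable \<Gamma> b \<Longrightarrow> computable \<Gamma> (\<lambda>e. if P e then a e else b e)"
  by (rule computable_cong[OF computable_if_nonzero[of \<Gamma> "\<lambda>e. of_bool (P e)" a b]]) auto

lemma decidable_conj: "decidable \<Gamma> P \<Longrightarrow> decidable \<Gamma> Q \<Longrightarrow> decidable \<Gamma> (\<lambda>e. P e \<and> Q e)"
  by (rule computable_cong[OF computable_if[of \<Gamma> P "\<lambda>e. of_bool (Q e)" "\<lambda>_. 0"]]) (auto intro: computable_const)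

lemma decidable_imp: "decidable \<Gamma> P \<Longrightarrow> decidable \<Gamma> Q \<Longrightarrow> decidable \<Gamma> (\<lambda>e. P e \<longrightarrow> Q e)"
  by (rule computable_cong[OF computable_if[of \<Gamma> P "\<lambda>e. of_bool (Q e)" "\<lambda>_. 1"]]) (auto intro: computable_const)

lemma decidable_all:
  fixes m :: "'e \<Rightarrow> nat"
  assumes m: "computable \<Gamma> m" and P: "decidable (ext \<Gamma> (\<lambda>e. {..<m e}) sc) (\<lambda>e. P (fst e) (snd e))"
  shows "decidable \<Gamma> (\<lambda>e. \<forall>i<m e. P e i)"
proof -
  have "decidable \<Gamma> (\<lambda>e. (\<Sum>i<m e. of_bool (\<not> P e i)) = (0::nat))"
    by (intro decidable_eq computable_sum m decidable_not[where P = "\<lambda>e. P (fst e) (snd e)"] P computable_const)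
  then show ?thesis by (rule computable_cong) auto
qed

text \<open>The machine cannot multiply; repeated addition is affordable because the number of
  rounds is itself polynomially bounded.\<close>

lemma computable_mult:
  assumes "computable \<Gamma> a" "computable \<Gamma> b" shows "computable \<Gamma> (\<lambda>e. a e * b e)"
proof -
  have "computable \<Gamma> (\<lambda>e. \<Sum>i<a e. (\<lambda>e _. b e) e i)"
    by (intro computable_sum assms computable_ext)
  then show ?thesis by simp
qed

lemma computable_power: "computable \<Gamma> a \<Longrightarrow> computable \<Gamma> (\<lambda>e. a e ^ k)"
  by (induction k) (simp_all add: computable_const computable_mult)

text \<open>The least \<open>i < m\<close> with \<open>P i\<close>, or \<open>m\<close> if there is none.\<close>

definition search :: "nat \<Rightarrow> (nat \<Rightarrow> bool) \<Rightarrow> nat" where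
  "search m P = (\<Sum>i<m. of_bool (\<forall>j<Suc i. \<not> P j))"

lemma search_le: "search m P \<le> m"
proof -
  have "search m P \<le> (\<Sum>i<m. 1)" unfolding search_def by (intro sum_mono) auto
  then show ?thesis by simp
qed

lemma search_eq_Least:
  assumes "P i" "i < m" shows "search m P = (LEAST i. P i)"
proof -
  define l where "l = (LEAST i. P i)"
  have l: "P l" "l \<le> i" "\<And>j. j < l \<Longrightarrow> \<not> P j"
    unfolding l_def using assms(1) by (rule LeastI, rule Least_le) (rule not_less_Least)
  have "(\<forall>j<Suc i. \<not> P j) \<longleftrightarrow> i < l" for i
    using l(1,3) by (metis less_Suc_eq less_trans not_less_iff_gr_or_eq)
  then have "search m P = (\<Sum>i<m. of_bool (i < l))" by (simp add: search_def)
  also have "\<dots> = card ({..<m} \<inter> {i. i < l})" by (simp only: sum_of_bool_eq finite_lessThan of_nat_id)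
  also have "{..<m} \<inter> {i. i < l} = {..<l}" using l(2) assms(2) by auto
  finally show ?thesis by (simp add: l_def)
qed

lemma searchI: assumes "P i" "i < m" shows "P (search m P)"
  using search_eq_Least[of P, OF assms] LeastI[of P, OF assms(1)] by simp

lemma search_unique:
  assumes "P i" "i < m" "\<And>j. P j \<Longrightarrow> j < m \<Longrightarrow> j = i" shows "search m P = i"
  using search_eq_Least[of P, OF assms(1,2)] LeastI[of P, OF assms(1)] Least_le[of P, OF assms(1)]
  by (simp add: assms(2,3) le_less_trans)

lemma search_none: assumes "\<And>j. j < m \<Longrightarrow> \<not> P j" shows "search m P = m"
proof -
  have "search m P = (\<Sum>i<m. 1)" unfolding search_def using assms by (intro sum.cong) auto
  then show ?thesis by simp
qed

lemma computable_search:
  fixes m :: "'e \<Rightarrow> nat"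
  assumes m: "computable \<Gamma> m" and P: "decidable (ext \<Gamma> (\<lambda>e. {..<m e}) sc) (\<lambda>e. P (fst e) (snd e))"
  shows "computable \<Gamma> (\<lambda>e. search (m e) (P e))"
  unfolding search_def
proof (rule computable_sum[OF m], rule decidable_all[where P = "\<lambda>e j. \<not> P (fst e) j"])
  let ?\<Gamma> = "ext \<Gamma> (\<lambda>e. {..<m e}) sc"
  show "computable ?\<Gamma> (\<lambda>e. Suc (snd e))"
    using computable_add[OF computable_index[OF m] computable_const[of _ 1]] by simp
  have "computable (ext ?\<Gamma> (\<lambda>e. {..<Suc (snd e)}) sc)
     (\<lambda>e. (\<lambda>e. of_bool (P (fst e) (snd e))) ((\<lambda>e. (fst (fst e), snd e)) e))"
    by (rule computable_rename[OF P]) (auto simp: ext_def)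
  then show "decidable (ext ?\<Gamma> (\<lambda>e. {..<Suc (snd e)}) sc) (\<lambda>e. \<not> P (fst (fst e)) (snd e))"
    by (intro decidable_not) simp
qed

text \<open>The quotient is the least i with a < b (i + 1). A search below a suffices: if it fails,
  the quotient is a itself, the default of \<open>search\<close>.\<close>

lemma computable_div:
  assumes "computable \<Gamma> a" "computable \<Gamma> b" shows "computable \<Gamma> (\<lambda>e. a e div b e)"
proof -
  have "computable \<Gamma> (\<lambda>e. if 0 < b e then search (a e) (\<lambda>i. a e < b e * (i + 1)) else 0)"
    by (intro computable_if decidable_less computable_const computable_search computable_mult computable_add
       computable_ext assms computable_index)
  then show ?thesis
  proof (rule computable_cong)
    fix e show "a e div b e = (if 0 < b e then search (a e) (\<lambda>i. a e < b e * (i + 1)) else 0)"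
    proof (cases "0 < b e")
      case True
      have iff: "a e < b e * (i + 1) \<longleftrightarrow> a e div b e \<le> i" for i
        using True by (metis Suc_eq_plus1 div_less_iff_less_mult less_Suc_eq_le mult.commute)
      show ?thesis
      proof (cases "a e div b e < a e")
        case True
        have "(LEAST i. a e div b e \<le> i) = a e div b e" by (rule Least_equality) auto
        then show ?thesis
          using \<open>0 < b e\<close> iff search_eq_Least[of "\<lambda>i. a e div b e \<le> i", OF order_refl True] by (simp del: mult_Suc_right add: iff[unfolded add_Suc_right add_0_right One_nat_def])
      next
        case False
        then have "a e div b e = a e" using div_le_dividend[of "a e" "b e"] by linarith
        with \<open>0 < b e\<close> show ?thesis unfolding iff by (auto simp: search_none)
      qed
    qed simp
  qed
qed

lemma computable_mod:
  assumes "computable \<Gamma> a" "computable \<Gamma> b" shows "computable \<Gamma> (\<lambda>e. a e mod b e)"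
  unfolding modulo_nat_def by (intro computable_diff computable_mult computable_div assms)

text \<open>With a variable exponent the power b ^ s need not be polynomially bounded, whereas
  repeated division never increases a.\<close>

lemma computable_div_power:
  assumes a: "computable \<Gamma> a" and b: "computable \<Gamma> b" and s: "computable \<Gamma> s"
  shows "computable \<Gamma> (\<lambda>e. a e div b e ^ s e)"
proof -
  have rec: "rec_nat (a e) (\<lambda>t v. v div b e) n = a e div b e ^ n" for e n
    by (induction n) (auto simp: div_mult2_eq power_Suc2 simp del: power_Suc)
  have "pbd (ext \<Gamma> (\<lambda>e. {..s e}) sc) (\<lambda>e. rec_nat (a (fst e)) (\<lambda>t v. v div b (fst e)) (snd e))"
    unfolding rec by (rule pbd_mono[OF pbd_ext[OF computable_pbd[OF a]]]) auto
  then have "computable \<Gamma> (\<lambda>e. rec_nat (a e) (\<lambda>t v. (\<lambda>e v w. v div w) e v ((\<lambda>e _. b e) e t)) (s e))"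
    by (intro computable_fold_index s a computable_ext b computable_div) auto
  then show ?thesis by (simp add: rec)
qed

text \<open>The list is fixed when the program is built, so the fold is unrolled into straight code.
  This is where d being constant matters.\<close>

lemma computable_foldr:
  assumes "computable \<Gamma> z" "\<And>r a. r \<in> set rs \<Longrightarrow> computable \<Gamma> a \<Longrightarrow> computable \<Gamma> (\<lambda>e. F r e (a e))"
  shows "computable \<Gamma> (\<lambda>e. foldr (\<lambda>r. F r e) rs (z e))"
  using assms(2)
proof (induction rs)
  case (Cons r rs)
  have "computable \<Gamma> (\<lambda>e. F r e (foldr (\<lambda>r. F r e) rs (z e)))"
    by (rule Cons.prems, simp, rule Cons.IH, rule Cons.prems) auto
  then show ?case by simp
qed (simp add: assms(1))

lemma decidable_mem:
  assumes "computable \<Gamma> x" "\<forall>h\<in>set hs. computable \<Gamma> h"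
  shows "decidable \<Gamma> (\<lambda>e. x e \<in> (\<lambda>h. h e) ` set hs)"
  using assms(2)
proof (induction hs)
  case Nil
  show ?case using computable_const[of \<Gamma> 0] by simp
next
  case (Cons h hs)
  then have "computable \<Gamma> (\<lambda>e. if x e = h e then 1 else of_bool (x e \<in> (\<lambda>h. h e) ` set hs))"
    by (intro computable_if decidable_eq assms(1) computable_const) auto
  then show ?case by (rule computable_cong) auto
qed

lemma decidable_list_all:
  assumes "\<forall>h\<in>set hs. decidable \<Gamma> (P h)"
  shows "decidable \<Gamma> (\<lambda>e. \<forall>h\<in>set hs. P h e)"
  using assms
proof (induction hs)
  case Nil
  show ?case using computable_const[of \<Gamma> 1] by simp
next
  case (Cons h hs)
  then show ?case by (simp add: decidable_conj)
qed

lemma decidable_sorted_wrt: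
  assumes "\<forall>h\<in>set hs. computable \<Gamma> h"
  shows "decidable \<Gamma> (\<lambda>e. sorted_wrt (\<ge>) (map (\<lambda>h. h e) hs))"
  using assms
proof (induction hs)
  case Nil
  show ?case using computable_const[of \<Gamma> 1] by simp
next
  case (Cons h hs)
  then have "decidable \<Gamma> (\<lambda>e. (\<forall>h'\<in>set hs. h' e \<le> h e) \<and> sorted_wrt (\<ge>) (map (\<lambda>h. h e) hs))"
    by (intro decidable_conj decidable_list_all) (simp_all add: decidable_le)
  then show ?case by simp
qed


section \<open>The algorithm\<close>

definition inq :: "state \<Rightarrow> nat" where "inq \<sigma> = \<sigma> ''q'' 0"
definition inn :: "state \<Rightarrow> nat" where "inn \<sigma> = \<sigma> ''n'' 0"
definition in0 :: "state \<Rightarrow> nat" where "in0 \<sigma> = \<sigma> ''zero'' 0"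
definition in1 :: "state \<Rightarrow> nat" where "in1 \<sigma> = \<sigma> ''one'' 0"
definition fad :: "state \<Rightarrow> nat \<Rightarrow> nat \<Rightarrow> nat" where "fad \<sigma> a b = \<sigma> ''add'' (a * inq \<sigma> + b)"
definition fmu :: "state \<Rightarrow> nat \<Rightarrow> nat \<Rightarrow> nat" where "fmu \<sigma> a b = \<sigma> ''mul'' (a * inq \<sigma> + b)"
definition fsum :: "state \<Rightarrow> nat \<Rightarrow> (nat \<Rightarrow> nat) \<Rightarrow> nat" where
  "fsum \<sigma> m h = rec_nat (in0 \<sigma>) (\<lambda>t v. fad \<sigma> v (h t)) m"
definition fsb :: "state \<Rightarrow> nat \<Rightarrow> nat \<Rightarrow> nat" where "fsb \<sigma> a b = search (inq \<sigma>) (\<lambda>y. fad \<sigma> y b = a)"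
definition fdv :: "state \<Rightarrow> nat \<Rightarrow> nat \<Rightarrow> nat" where "fdv \<sigma> a b = search (inq \<sigma>) (\<lambda>y. fmu \<sigma> y b = a)"

definition dig :: "nat \<Rightarrow> nat \<Rightarrow> nat \<Rightarrow> nat" where "dig b x s = x div b ^ s mod b"
definition digs :: "nat \<Rightarrow> nat \<Rightarrow> nat \<Rightarrow> nat list" where "digs b k x = map (dig b x) [0..<k]"
abbreviation desc :: "nat list \<Rightarrow> bool" where "desc \<equiv> sorted_wrt (\<ge>)"

text \<open>The number of monomials of degree k in j variables, found by running through all digit
  strings; k is constant, so j ^ k is polynomial.\<close>

definition cnt :: "nat \<Rightarrow> nat \<Rightarrow> nat" where "cnt j k = (\<Sum>x<j ^ k. of_bool (desc (digs j k x)))"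

text \<open>The rank of a weakly decreasing list in \<open>degree_monos\<close>: monomials in
  variables below the largest one, j, come first, and removing one j leaves the rank within the
  rest.\<close>

fun idx :: "nat list \<Rightarrow> nat" where
  "idx [] = 0"
| "idx (j # J) = cnt j (Suc (length J)) + idx J"

text \<open>
  A column is coded by a pair \<open>(m, a)\<close>: column \<open>a\<close> of the matrix stored in \<open>l\<close> with row length \<open>m\<close>, or the
  unit vector \<open>a\<close> if \<open>m = 0\<close>. In \<open>per\<close> the columns carry a tag in front, and columns with equal tags
  are not distinguished, so that each summand of the permanent is counted once.
\<close>

definition ent :: "state \<Rightarrow> nat list \<Rightarrow> nat \<Rightarrow> nat \<Rightarrow> nat \<Rightarrow> nat" where
  "ent \<sigma> l m a i = (if m = 0 then (if a = i then in1 \<sigma> else in0 \<sigma>) else lget l (i * m + a))"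

fun per :: "state \<Rightarrow> nat list \<Rightarrow> nat list \<Rightarrow> (nat \<times> nat \<times> nat) list \<Rightarrow> nat" where
  "per \<sigma> l [] J = in1 \<sigma>"
| "per \<sigma> l (i # I) J =
    foldr (\<lambda>r acc. if fst (J ! r) \<in> set (map fst (take r J)) then acc
      else fad \<sigma> (fmu \<sigma> (ent \<sigma> l (fst (snd (J ! r))) (snd (snd (J ! r))) i)
                        (per \<sigma> l I (take r J @ drop (Suc r) J))) acc) [0..<length J] (in0 \<sigma>)"

text \<open>The formula of \<open>lin_subst_apply\<close>, with lists of length k coded as numbers
  below n ^ k.\<close>

definition cof :: "state \<Rightarrow> vname \<Rightarrow> nat \<Rightarrow> nat \<Rightarrow> nat list \<Rightarrow> (nat \<times> nat \<times> nat) list \<Rightarrow> nat" where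
  "cof \<sigma> x off k l J = fsum \<sigma> (inn \<sigma> ^ k) (\<lambda>c. if desc (digs (inn \<sigma>) k c)
     then fmu \<sigma> (\<sigma> x (off + idx (digs (inn \<sigma>) k c))) (per \<sigma> l (digs (inn \<sigma>) k c) J) else in0 \<sigma>)"

lemma computable_inq: "Inp \<Gamma> I \<Longrightarrow> computable \<Gamma> (\<lambda>e. inq (I e))"
  unfolding inq_def by (rule computable_input[OF _ _ computable_const]) auto

lemma computable_inn: "Inp \<Gamma> I \<Longrightarrow> computable \<Gamma> (\<lambda>e. inn (I e))"
  unfolding inn_def by (rule computable_input[OF _ _ computable_const]) auto

lemma computable_in0: "Inp \<Gamma> I \<Longrightarrow> computable \<Gamma> (\<lambda>e. in0 (I e))"
  unfolding in0_def by (rule computable_input[OF _ _ computable_const]) auto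

lemma computable_in1: "Inp \<Gamma> I \<Longrightarrow> computable \<Gamma> (\<lambda>e. in1 (I e))"
  unfolding in1_def by (rule computable_input[OF _ _ computable_const]) auto

lemma computable_fad: "Inp \<Gamma> I \<Longrightarrow> computable \<Gamma> a \<Longrightarrow> computable \<Gamma> b \<Longrightarrow> computable \<Gamma> (\<lambda>e. fad (I e) (a e) (b e))"
  unfolding fad_def
  by (rule computable_input[OF _ _ computable_add[OF computable_mult[OF _ computable_inq]]]) auto

lemma computable_fmu: "Inp \<Gamma> I \<Longrightarrow> computable \<Gamma> a \<Longrightarrow> computable \<Gamma> b \<Longrightarrow> computable \<Gamma> (\<lambda>e. fmu (I e) (a e) (b e))"
  unfolding fmu_def
  by (rule computable_input[OF _ _ computable_add[OF computable_mult[OF _ computable_inq]]]) auto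

lemma computable_fsum:
  assumes I: "Inp \<Gamma> I" and m: "computable \<Gamma> m" and h: "computable (ext \<Gamma> (\<lambda>e. {..<m e}) sc) (\<lambda>e. h (fst e) (snd e))"
  shows "computable \<Gamma> (\<lambda>e. fsum (I e) (m e) (h e))"
  unfolding fsum_def
proof (rule computable_fold_index[OF m computable_in0[OF I] h, where f = "\<lambda>e. fad (I e)"])
  obtain K where K: "\<forall>e\<in>cdom \<Gamma>. \<forall>x i. I e x i \<le> (csiz \<Gamma> e + 2) ^ K" using I by (auto simp: Inp_def)
  show "pbd (ext \<Gamma> (\<lambda>e. {..m e}) sc) (\<lambda>e. rec_nat (in0 (I (fst e))) (\<lambda>t v. fad (I (fst e)) v (h (fst e) t)) (snd e))"
    unfolding pbd_def
  proof (intro exI[of _ K] ballI)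
    fix e assume "e \<in> cdom (ext \<Gamma> (\<lambda>e. {..m e}) sc)"
    then show "rec_nat (in0 (I (fst e))) (\<lambda>t v. fad (I (fst e)) v (h (fst e) t)) (snd e) \<le> (csiz (ext \<Gamma> (\<lambda>e. {..m e}) sc) e + 2) ^ K"
      using K by (cases "snd e") (auto simp: in0_def fad_def)
  qed
qed (intro computable_fad[where I = "\<lambda>e. I (fst (fst e))"] Inp_ext[where I = "\<lambda>e. I (fst e)"] Inp_ext I; assumption)

lemma computable_fsb: "Inp \<Gamma> I \<Longrightarrow> computable \<Gamma> a \<Longrightarrow> computable \<Gamma> b \<Longrightarrow> computable \<Gamma> (\<lambda>e. fsb (I e) (a e) (b e))"
  unfolding fsb_def
  by (intro computable_search computable_inq decidable_eq computable_fad Inp_ext computable_index computable_ext)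

lemma computable_fdv: "Inp \<Gamma> I \<Longrightarrow> computable \<Gamma> a \<Longrightarrow> computable \<Gamma> b \<Longrightarrow> computable \<Gamma> (\<lambda>e. fdv (I e) (a e) (b e))"
  unfolding fdv_def
  by (intro computable_search computable_inq decidable_eq computable_fmu Inp_ext computable_index computable_ext)

lemma computable_dig:
  "computable \<Gamma> b \<Longrightarrow> computable \<Gamma> x \<Longrightarrow> computable \<Gamma> s \<Longrightarrow> computable \<Gamma> (\<lambda>e. dig (b e) (x e) (s e))"
  unfolding dig_def by (intro computable_mod computable_div_power)

lemma decidable_desc_digs:
  assumes "computable \<Gamma> b" "computable \<Gamma> x" shows "decidable \<Gamma> (\<lambda>e. desc (digs (b e) k (x e)))"
proof -
  have "decidable \<Gamma> (\<lambda>e. desc (map (\<lambda>h. h e) (map (\<lambda>s e. dig (b e) (x e) s) [0..<k])))"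
    using computable_dig[OF assms computable_const] by (intro decidable_sorted_wrt) auto
  then show ?thesis by (simp add: digs_def comp_def)
qed

lemma computable_cnt:
  assumes "computable \<Gamma> j" shows "computable \<Gamma> (\<lambda>e. cnt (j e) k)"
  unfolding cnt_def
  by (intro computable_sum computable_power assms decidable_desc_digs computable_index computable_ext)

lemma computable_idx:
  assumes "\<forall>h\<in>set hs. computable \<Gamma> h" shows "computable \<Gamma> (\<lambda>e. idx (map (\<lambda>h. h e) hs))"
  using assms
proof (induction hs)
  case (Cons h hs)
  then have "computable \<Gamma> (\<lambda>e. cnt (h e) (Suc (length hs)) + idx (map (\<lambda>h. h e) hs))"
    by (intro computable_add computable_cnt) simp_all
  then show ?case by simp
qed (simp add: computable_const)

lemma computable_idx_digs:
  assumes "computable \<Gamma> b" "computable \<Gamma> x" shows "computable \<Gamma> (\<lambda>e. idx (digs (b e) k (x e)))"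
proof -
  have "computable \<Gamma> (\<lambda>e. idx (map (\<lambda>h. h e) (map (\<lambda>s e. dig (b e) (x e) s) [0..<k])))"
    using computable_dig[OF assms computable_const] by (intro computable_idx) auto
  then show ?thesis by (simp add: digs_def comp_def)
qed

lemma computable_ent:
  "Inp \<Gamma> I \<Longrightarrow> AV \<Gamma> l \<Longrightarrow> computable \<Gamma> m \<Longrightarrow> computable \<Gamma> a \<Longrightarrow> computable \<Gamma> i \<Longrightarrow>
     computable \<Gamma> (\<lambda>e. ent (I e) (l e) (m e) (a e) (i e))"
  unfolding ent_def
  by (intro computable_if decidable_eq computable_const computable_in0 computable_in1 computable_lget computable_add computable_mult)

abbreviation eval3 :: "'e \<Rightarrow> ('e \<Rightarrow> nat) \<times> ('e \<Rightarrow> nat) \<times> ('e \<Rightarrow> nat) \<Rightarrow> nat \<times> nat \<times> nat" where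
  "eval3 e h \<equiv> (fst h e, fst (snd h) e, snd (snd h) e)"

text \<open>The recursion of \<open>per\<close> is unrolled over fixed lists of expressions; only
  the values of rows and columns depend on the input.\<close>

lemma computable_per:
  assumes I: "Inp \<Gamma> I" and l: "AV \<Gamma> l"
    and "\<forall>h\<in>set Is. computable \<Gamma> h"
    and "\<forall>h\<in>set Js. computable \<Gamma> (fst h) \<and> computable \<Gamma> (fst (snd h)) \<and> computable \<Gamma> (snd (snd h))"
  shows "computable \<Gamma> (\<lambda>e. per (I e) (l e) (map (\<lambda>h. h e) Is) (map (eval3 e) Js))"
  using assms(3,4)
proof (induction Is arbitrary: Js)
  case Nil
  then show ?case by (simp add: computable_in1[OF I])
next
  case (Cons i Is)
  let ?C = "\<lambda>r e. fst (Js ! r) e \<in> (\<lambda>h. h e) ` set (map fst (take r Js))"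
  let ?P = "\<lambda>r e. per (I e) (l e) (map (\<lambda>h. h e) Is) (map (eval3 e) (take r Js @ drop (Suc r) Js))"
  have "computable \<Gamma> (\<lambda>e. foldr (\<lambda>r acc. if ?C r e then acc else fad (I e) (fmu (I e)
      (ent (I e) (l e) (fst (snd (Js ! r)) e) (snd (snd (Js ! r)) e) (i e)) (?P r e)) acc) [0..<length Js] (in0 (I e)))"
  proof (rule computable_foldr[OF computable_in0[OF I]], goal_cases)
    case (1 r a)
    then have r: "r < length Js" by simp
    have mem: "h \<in> set Js" if "h \<in> set (take r Js) \<or> h \<in> set (drop (Suc r) Js)" for h
      using that by (auto dest: in_set_takeD in_set_dropD)
    have Jr: "computable \<Gamma> (fst (Js ! r))" "computable \<Gamma> (fst (snd (Js ! r)))" "computable \<Gamma> (snd (snd (Js ! r)))"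
      using Cons.prems(2) r by auto
    have "decidable \<Gamma> (?C r)"
      using Cons.prems(2) mem by (intro decidable_mem Jr) auto
    moreover have "computable \<Gamma> (?P r)"
      using Cons.prems mem by (intro Cons.IH) auto
    moreover have "computable \<Gamma> i" using Cons.prems by simp
    ultimately show ?case
      using Jr 1 by (intro computable_if computable_fad computable_fmu computable_ent I l)
  qed
  moreover have "per (I e) (l e) (map (\<lambda>h. h e) (i # Is)) (map (eval3 e) Js) =
     foldr (\<lambda>r acc. if ?C r e then acc else fad (I e) (fmu (I e)
      (ent (I e) (l e) (fst (snd (Js ! r)) e) (snd (snd (Js ! r)) e) (i e)) (?P r e)) acc) [0..<length Js] (in0 (I e))" for e
    by (auto simp: take_map drop_map image_image comp_def intro!: foldr_cong)
  ultimately show ?case by simp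
qed

lemma computable_cof:
  assumes I: "Inp \<Gamma> I" and l: "AV \<Gamma> l" and x: "x \<in> inputs" and off: "computable \<Gamma> off"
    and J: "\<forall>h\<in>set Js. computable \<Gamma> (fst h) \<and> computable \<Gamma> (fst (snd h)) \<and> computable \<Gamma> (snd (snd h))"
  shows "computable \<Gamma> (\<lambda>e. cof (I e) x (off e) k (l e) (map (eval3 e) Js))"
  unfolding cof_def
proof (rule computable_fsum[OF I computable_power[OF computable_inn[OF I]]])
  let ?\<Gamma> = "ext \<Gamma> (\<lambda>e. {..<inn (I e) ^ k}) sc"
  note I' = Inp_ext[OF I, of "\<lambda>e. {..<inn (I e) ^ k}" sc]
  have c: "computable ?\<Gamma> (\<lambda>e. snd e)" by (intro computable_index computable_power computable_inn I)
  have n: "computable ?\<Gamma> (\<lambda>e. inn (I (fst e)))" by (rule computable_inn[OF I'])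
  have "computable ?\<Gamma> (\<lambda>e. per (I (fst e)) (l (fst e)) (map (\<lambda>h. h e) (map (\<lambda>s e. dig (inn (I (fst e))) (snd e) s) [0..<k]))
      (map (eval3 e) (map (\<lambda>h. (\<lambda>e. fst h (fst e), \<lambda>e. fst (snd h) (fst e), \<lambda>e. snd (snd h) (fst e))) Js)))"
  proof (rule computable_per[OF I' AV_ext[OF l]])
    show "\<forall>h\<in>set (map (\<lambda>s e. dig (inn (I (fst e))) (snd e) s) [0..<k]). computable ?\<Gamma> h"
      using computable_dig[OF n c computable_const] by auto
    show "\<forall>h\<in>set (map (\<lambda>h. (\<lambda>e. fst h (fst e), \<lambda>e. fst (snd h) (fst e), \<lambda>e. snd (snd h) (fst e))) Js).
       computable ?\<Gamma> (fst h) \<and> computable ?\<Gamma> (fst (snd h)) \<and> computable ?\<Gamma> (snd (snd h))"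
      using J by (simp add: computable_ext)
  qed
  then have p: "computable ?\<Gamma> (\<lambda>e. per (I (fst e)) (l (fst e)) (digs (inn (I (fst e))) k (snd e)) (map (eval3 (fst e)) Js))"
    by (simp add: digs_def comp_def)
  show "computable ?\<Gamma> (\<lambda>e. if desc (digs (inn (I (fst e))) k (snd e))
     then fmu (I (fst e)) (I (fst e) x (off (fst e) + idx (digs (inn (I (fst e))) k (snd e))))
       (per (I (fst e)) (l (fst e)) (digs (inn (I (fst e))) k (snd e)) (map (eval3 (fst e)) Js)) else in0 (I (fst e)))"
    by (rule computable_if[OF decidable_desc_digs[OF n c] computable_fmu[OF I' computable_input[OF I' x
        computable_add[OF computable_ext[OF off] computable_idx_digs[OF n c]]] p] computable_in0[OF I']])
qed

text \<open>Tabulating a function is a single round of iteration that ignores the old array.\<close>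

lemma computable_tab:
  assumes L: "computable \<Gamma> L" and g: "computable (ext \<Gamma> (\<lambda>e. {..<L e}) sc) (\<lambda>e. g (fst e) (snd e))"
    and body: "AV (ext \<Gamma> (\<lambda>e. {map (g e) [0..<L e]}) (\<lambda>l. l)) (\<lambda>e. snd e) \<Longrightarrow>
       computable (ext \<Gamma> (\<lambda>e. {map (g e) [0..<L e]}) (\<lambda>l. l)) (\<lambda>e. body (fst e) (snd e))"
  shows "computable \<Gamma> (\<lambda>e. body e (map (g e) [0..<L e]))"
proof -
  have "computable \<Gamma> (\<lambda>e. body e (aiter (L e) (\<lambda>t l. g e) 1))"
  proof (rule computable_aiter[OF computable_const L])
    have "computable (ext (ext (ext \<Gamma> (\<lambda>e. {..<1}) sc) (\<lambda>e. {aiter (L (fst e)) (\<lambda>t l. g (fst e)) (snd e)}) (\<lambda>l. l))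
        (\<lambda>e. {..<L (fst (fst e))}) sc)
      (\<lambda>e. (\<lambda>e. g (fst e) (snd e)) ((\<lambda>e. (fst (fst (fst e)), snd e)) e))"
      by (rule computable_rename[OF g]) (auto simp: ext_def)
    then show "computable (ext (ext (ext \<Gamma> (\<lambda>e. {..<1}) sc) (\<lambda>e. {aiter (L (fst e)) (\<lambda>t l. g (fst e)) (snd e)}) (\<lambda>l. l))
        (\<lambda>e. {..<L (fst (fst e))}) sc) (\<lambda>e. g (fst (fst (fst e))) (snd e))" by simp
    obtain K where K: "\<forall>e\<in>cdom (ext \<Gamma> (\<lambda>e. {..<L e}) sc). g (fst e) (snd e) \<le> (csiz \<Gamma> (fst e) + 2) ^ K"
      using computable_pbd[OF g] by (auto simp: pbd_def)
    have bd: "y \<le> (csiz \<Gamma> e + 2) ^ K" if "e \<in> cdom \<Gamma>" "x \<in> {map (g e) [0..<L e]}" "y \<in> set x" for e x y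
      using that K[rule_format, of "(e, _)"] by auto
    have "AV (ext \<Gamma> (\<lambda>e. {map (g e) [0..<L e]}) (\<lambda>l. l)) (\<lambda>e. snd e)"
      by (rule AV_ext_new[where rp = "\<lambda>l. l"]) (use bd in blast)
    then show "computable (ext \<Gamma> (\<lambda>e. {aiter (L e) (\<lambda>t l. g e) 1}) (\<lambda>l. l)) (\<lambda>e. body (fst e) (snd e))"
      using body by simp
  qed
  then show ?thesis by simp
qed

text \<open>Coefficients are stored by increasing degree; this is where those of degree k
  begin.\<close>

definition offs :: "nat list \<Rightarrow> state \<Rightarrow> nat \<Rightarrow> nat" where
  "offs ks \<sigma> k = (\<Sum>k'\<leftarrow>filter (\<lambda>k'. k' < k) ks. cnt (inn \<sigma>) k')"

text \<open>All d columns carry different tags, so equal columns are distinguished and the value is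
  the polarization, factorials included. With m = 0 the block consists of unit vectors, as needed
  for f; otherwise it consists of guessed columns, as needed for g.\<close>

definition slice :: "nat \<Rightarrow> nat list \<Rightarrow> state \<Rightarrow> vname \<Rightarrow> nat \<Rightarrow> nat list \<Rightarrow> nat \<Rightarrow> nat \<Rightarrow> nat \<Rightarrow> nat" where
  "slice d ks \<sigma> x m l i u v = cof \<sigma> x (offs ks \<sigma> d) d l
     (map (\<lambda>r. (r, m, i * (d - 2) + r)) [0..<d - 2] @ [(d - 2, 0, u), (d - 1, 0, v)])"

text \<open>
  The unknowns \<open>A\<close> and \<open>C\<close> are stored row by row, \<open>A\<close> first, in a vector of length \<open>dimz\<close>; equation \<open>t\<close>
  is entry \<open>(t div n mod n, t mod n)\<close> of \<open>G i A = C F i\<close> with \<open>i = t div n\<^sup>2\<close>. Elimination keeps a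
  square matrix \<open>Z\<close> whose nonzero rows, recognised by their diagonal entry \<open>1\<close>, are a basis of the solutions
  of the equations treated so far. The first \<open>n s\<close> digits of \<open>\<gamma>\<close> are the guessed columns, the remaining
  ones the coordinates of the solution.
\<close>

definition dimz :: "state \<Rightarrow> nat" where "dimz \<sigma> = 2 * (inn \<sigma> * inn \<sigma>)"

definition ell :: "nat \<Rightarrow> nat \<Rightarrow> nat list \<Rightarrow> state \<Rightarrow> nat list \<Rightarrow> nat list \<Rightarrow> nat \<Rightarrow> nat \<Rightarrow> nat" where
  "ell d c ks \<sigma> l Z b t = fsb \<sigma>
     (fsum \<sigma> (inn \<sigma>) (\<lambda>u. fmu \<sigma>
        (slice d ks \<sigma> ''g'' (c * (d - 2)) l (t div (inn \<sigma> * inn \<sigma>)) (t div inn \<sigma> mod inn \<sigma>) u)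
        (lget Z (b + (u * inn \<sigma> + t mod inn \<sigma>)))))
     (fsum \<sigma> (inn \<sigma>) (\<lambda>u. fmu \<sigma>
        (lget Z (b + (inn \<sigma> * inn \<sigma> + (t div inn \<sigma> mod inn \<sigma> * inn \<sigma> + u))))
        (slice d ks \<sigma> ''f'' 0 l (t div (inn \<sigma> * inn \<sigma>)) u (t mod inn \<sigma>))))"

text \<open>If all rows satisfy the equation, the search ends at \<open>dimz\<close>, which signals
  that no pivot exists.\<close>

definition piv :: "nat \<Rightarrow> nat \<Rightarrow> nat list \<Rightarrow> state \<Rightarrow> nat list \<Rightarrow> nat list \<Rightarrow> nat \<Rightarrow> nat" where
  "piv d c ks \<sigma> l Z t = search (dimz \<sigma>) (\<lambda>p. ell d c ks \<sigma> l Z (p * dimz \<sigma>) t \<noteq> in0 \<sigma>)"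

definition stepZ :: "nat \<Rightarrow> nat \<Rightarrow> nat list \<Rightarrow> state \<Rightarrow> nat list \<Rightarrow> nat \<Rightarrow> nat list \<Rightarrow> nat \<Rightarrow> nat" where
  "stepZ d c ks \<sigma> l t Z x =
    (if t = 0 then (if x div dimz \<sigma> = x mod dimz \<sigma> then in1 \<sigma> else in0 \<sigma>)
     else if piv d c ks \<sigma> l Z (t - 1) < dimz \<sigma> then
       fsb \<sigma> (lget Z x)
         (fmu \<sigma> (fdv \<sigma> (ell d c ks \<sigma> l Z (x div dimz \<sigma> * dimz \<sigma>) (t - 1))
                          (ell d c ks \<sigma> l Z (piv d c ks \<sigma> l Z (t - 1) * dimz \<sigma>) (t - 1)))
                (lget Z (piv d c ks \<sigma> l Z (t - 1) * dimz \<sigma> + x mod dimz \<sigma>)))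
     else lget Z x)"

definition guess :: "nat \<Rightarrow> state \<Rightarrow> nat \<Rightarrow> nat list" where
  "guess s \<sigma> \<gamma> = map (\<lambda>u. dig (inq \<sigma>) \<gamma> u) [0..<inn \<sigma> * s]"

definition elimZ :: "nat \<Rightarrow> nat \<Rightarrow> nat list \<Rightarrow> state \<Rightarrow> nat list \<Rightarrow> nat list" where
  "elimZ d c ks \<sigma> l = aiter (dimz \<sigma> * dimz \<sigma>) (stepZ d c ks \<sigma> l) (c * (inn \<sigma> * inn \<sigma>) + 1)"

text \<open>The inner sum ranks row r among the basis rows, so the coordinates occupy consecutive
  digits of the code and few solutions mean small codes.\<close>

definition solz :: "nat \<Rightarrow> state \<Rightarrow> nat \<Rightarrow> nat list \<Rightarrow> nat \<Rightarrow> nat" where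
  "solz s \<sigma> \<gamma> Z u = fsum \<sigma> (dimz \<sigma>) (\<lambda>r. if lget Z (r * dimz \<sigma> + r) = in0 \<sigma> then in0 \<sigma>
     else fmu \<sigma> (dig (inq \<sigma>) \<gamma> (inn \<sigma> * s + (\<Sum>r'<r. of_bool (lget Z (r' * dimz \<sigma> + r') \<noteq> in0 \<sigma>))))
                 (lget Z (r * dimz \<sigma> + u)))"

definition cand :: "nat \<Rightarrow> nat \<Rightarrow> nat list \<Rightarrow> state \<Rightarrow> nat \<Rightarrow> nat list" where
  "cand d c ks \<sigma> \<gamma> =
     map (solz (c * (d - 2)) \<sigma> \<gamma> (elimZ d c ks \<sigma> (guess (c * (d - 2)) \<sigma> \<gamma>))) [0..<dimz \<sigma>]"

text \<open>For the true A the second unknown C is the transposed inverse. The candidate thus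
  carries its own certificate of invertibility, and two matrix products verify it.\<close>

definition chk_inv :: "state \<Rightarrow> nat list \<Rightarrow> bool" where
  "chk_inv \<sigma> z \<longleftrightarrow> (\<forall>i<inn \<sigma>. \<forall>j<inn \<sigma>.
      fsum \<sigma> (inn \<sigma>) (\<lambda>k. fmu \<sigma> (lget z (i * inn \<sigma> + k)) (lget z (inn \<sigma> * inn \<sigma> + (j * inn \<sigma> + k))))
        = (if i = j then in1 \<sigma> else in0 \<sigma>) \<and>
      fsum \<sigma> (inn \<sigma>) (\<lambda>k. fmu \<sigma> (lget z (inn \<sigma> * inn \<sigma> + (k * inn \<sigma> + i))) (lget z (k * inn \<sigma> + j)))
        = (if i = j then in1 \<sigma> else in0 \<sigma>))"

text \<open>Here the tag of a column is its index, so repeated columns are identified and the exact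
  coefficient of the substitution results, without factorials.\<close>

definition chk_deg :: "nat list \<Rightarrow> state \<Rightarrow> nat list \<Rightarrow> nat \<Rightarrow> bool" where
  "chk_deg ks \<sigma> z k \<longleftrightarrow> (\<forall>x<inn \<sigma> ^ k. desc (digs (inn \<sigma>) k x) \<longrightarrow>
     \<sigma> ''f'' (offs ks \<sigma> k + idx (digs (inn \<sigma>) k x)) =
     cof \<sigma> ''g'' (offs ks \<sigma> k) k z (map (\<lambda>a. (a, inn \<sigma>, a)) (digs (inn \<sigma>) k x)))"

definition accept :: "nat list \<Rightarrow> state \<Rightarrow> nat list \<Rightarrow> bool" where
  "accept ks \<sigma> z \<longleftrightarrow> chk_inv \<sigma> z \<and> (\<forall>k\<in>set ks. chk_deg ks \<sigma> z k)"

text \<open>The first accepted code; the bound itself is returned when there is none and means that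
  the answer is negative.\<close>

definition result :: "nat \<Rightarrow> nat \<Rightarrow> nat list \<Rightarrow> nat \<Rightarrow> state \<Rightarrow> nat" where
  "result d c ks K \<sigma> = search ((inq \<sigma> ^ inn \<sigma>) ^ K) (\<lambda>\<gamma>. accept ks \<sigma> (cand d c ks \<sigma> \<gamma>))"

lemma computable_offs: "Inp \<Gamma> I \<Longrightarrow> computable \<Gamma> (\<lambda>e. offs ks (I e) k)"
  unfolding offs_def
proof (induction "filter (\<lambda>k'. k' < k) ks")
  case Nil
  then show ?case by (simp flip: Nil.hyps add: computable_const)
next
  case (Cons a x)
  have "computable \<Gamma> (\<lambda>e. \<Sum>k'\<leftarrow>ks'. cnt (inn (I e)) k')" for ks'
    by (induction ks') (simp_all add: computable_const computable_add computable_cnt computable_inn Cons.prems)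
  then show ?case .
qed

lemma computable_slice:
  assumes I: "Inp \<Gamma> I" and l: "AV \<Gamma> l" and x: "x \<in> inputs"
    and i: "computable \<Gamma> i" and u: "computable \<Gamma> u" and v: "computable \<Gamma> v"
  shows "computable \<Gamma> (\<lambda>e. slice d ks (I e) x m (l e) (i e) (u e) (v e))"
proof -
  let ?Js = "map (\<lambda>r. (\<lambda>_. r, \<lambda>_. m, \<lambda>e. i e * (d - 2) + r)) [0..<d - 2] @ [(\<lambda>_. d - 2, \<lambda>_. 0, u), (\<lambda>_. d - 1, \<lambda>_. 0, v)]"
  have "computable \<Gamma> (\<lambda>e. cof (I e) x (offs ks (I e) d) d (l e) (map (eval3 e) ?Js))"
    by (rule computable_cof[OF I l x computable_offs[OF I]])
       (simp add: ball_Un u v computable_const computable_add computable_mult i)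
  then show ?thesis by (simp add: slice_def comp_def)
qed

lemma computable_dimz: "Inp \<Gamma> I \<Longrightarrow> computable \<Gamma> (\<lambda>e. dimz (I e))"
  unfolding dimz_def by (intro computable_mult computable_const computable_inn)

lemma computable_ell:
  assumes I: "Inp \<Gamma> I" and l: "AV \<Gamma> l" and Z: "AV \<Gamma> Z" and b: "computable \<Gamma> b" and t: "computable \<Gamma> t"
  shows "computable \<Gamma> (\<lambda>e. ell d c ks (I e) (l e) (Z e) (b e) (t e))"
  unfolding ell_def
proof (intro computable_fsb computable_fsum I computable_inn)
  let ?\<Gamma> = "ext \<Gamma> (\<lambda>e. {..<inn (I e)}) sc"
  note I' = Inp_ext[OF I, of "\<lambda>e. {..<inn (I e)}" sc]
    and l' = AV_ext[OF l, of "\<lambda>e. {..<inn (I e)}" sc]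
    and Z' = AV_ext[OF Z, of "\<lambda>e. {..<inn (I e)}" sc]
    and b' = computable_ext[OF b, of "\<lambda>e. {..<inn (I e)}" sc]
    and t' = computable_ext[OF t, of "\<lambda>e. {..<inn (I e)}" sc]
    and u' = computable_index[OF computable_inn[OF I]]
  show "computable ?\<Gamma> (\<lambda>e. fmu (I (fst e))
        (slice d ks (I (fst e)) ''g'' (c * (d - 2)) (l (fst e)) (t (fst e) div (inn (I (fst e)) * inn (I (fst e)))) (t (fst e) div inn (I (fst e)) mod inn (I (fst e))) (snd e))
        (lget (Z (fst e)) (b (fst e) + (snd e * inn (I (fst e)) + t (fst e) mod inn (I (fst e))))))"
    by (intro computable_fmu computable_slice computable_lget computable_add computable_mult computable_div computable_mod
        computable_inn I' l' Z' b' t' u') simp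
  show "computable ?\<Gamma> (\<lambda>e. fmu (I (fst e))
        (lget (Z (fst e)) (b (fst e) + (inn (I (fst e)) * inn (I (fst e)) + (t (fst e) div inn (I (fst e)) mod inn (I (fst e)) * inn (I (fst e)) + snd e))))
        (slice d ks (I (fst e)) ''f'' 0 (l (fst e)) (t (fst e) div (inn (I (fst e)) * inn (I (fst e)))) (snd e) (t (fst e) mod inn (I (fst e)))))"
    by (intro computable_fmu computable_slice computable_lget computable_add computable_mult computable_div computable_mod
        computable_inn I' l' Z' b' t' u') simp
qed

lemma computable_piv:
  assumes I: "Inp \<Gamma> I" and l: "AV \<Gamma> l" and Z: "AV \<Gamma> Z" and t: "computable \<Gamma> t"
  shows "computable \<Gamma> (\<lambda>e. piv d c ks (I e) (l e) (Z e) (t e))"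
  unfolding piv_def
proof (intro computable_search computable_dimz I decidable_not decidable_eq)
  let ?Y = "\<lambda>e. {..<dimz (I e)}"
  note I' = Inp_ext[OF I, of ?Y sc] and l' = AV_ext[OF l, of ?Y sc] and Z' = AV_ext[OF Z, of ?Y sc]
    and t' = computable_ext[OF t, of ?Y sc] and u' = computable_index[OF computable_dimz[OF I]]
  show "computable (ext \<Gamma> ?Y sc) (\<lambda>e. ell d c ks (I (fst e)) (l (fst e)) (Z (fst e)) (snd e * dimz (I (fst e))) (t (fst e)))"
    by (intro computable_ell computable_mult computable_dimz I' l' Z' t' u')
  show "computable (ext \<Gamma> ?Y sc) (\<lambda>e. in0 (I (fst e)))" by (rule computable_in0[OF I'])
qed

lemma computable_stepZ:
  assumes I: "Inp \<Gamma> I" and l: "AV \<Gamma> l" and Z: "AV \<Gamma> Z" and t: "computable \<Gamma> t" and x: "computable \<Gamma> x"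
  shows "computable \<Gamma> (\<lambda>e. stepZ d c ks (I e) (l e) (t e) (Z e) (x e))"
proof -
  note t1 = computable_diff[OF t computable_const[of \<Gamma> 1]]
  show ?thesis
    unfolding stepZ_def
    by (intro computable_if decidable_eq decidable_less t computable_const computable_div computable_mod computable_dimz
        computable_in0 computable_in1 computable_piv t1 computable_fsb computable_fmu computable_fdv computable_ell
        computable_lget computable_add computable_mult I l Z x)
qed

text \<open>All new entries are input cells or results of a search below q. The bound does not
  presuppose that the tables describe a field, as computability is claimed for every valid
  input.\<close>

lemma stepZ_le:
  assumes "\<And>x i. \<sigma> x i \<le> B" "\<And>y. y \<in> set Z \<Longrightarrow> y \<le> B"
  shows "stepZ d c ks \<sigma> l t Z x \<le> B"
proof -
  have "fsb \<sigma> a b \<le> B" for a b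
    using search_le[of "inq \<sigma>"] assms(1)[of "''q''" 0] unfolding fsb_def inq_def by (metis le_trans)
  moreover have "lget Z i \<le> B" for i
    using assms(2) assms(1)[of "''q''" 0] by (auto simp: lget_def)
  ultimately show ?thesis
    using assms(1) by (simp add: stepZ_def in0_def in1_def)
qed

lemma aiter_stepZ_le:
  assumes "\<And>x i. \<sigma> x i \<le> B" "y \<in> set (aiter L (stepZ d c ks \<sigma> l) t)"
  shows "y \<le> B"
  using assms(2)
proof (induction t arbitrary: y)
  case (Suc t)
  then show ?case using stepZ_le[OF assms(1) Suc.IH] by auto
qed simp

lemma computable_solz:
  assumes I: "Inp \<Gamma> I" and Z: "AV \<Gamma> Z" and g: "computable \<Gamma> g" and u: "computable \<Gamma> u"
  shows "computable \<Gamma> (\<lambda>e. solz s (I e) (g e) (Z e) (u e))"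
  unfolding solz_def
proof (rule computable_fsum[OF I computable_dimz[OF I]])
  let ?Y = "\<lambda>e. {..<dimz (I e)}"
  let ?\<Gamma> = "ext \<Gamma> ?Y sc"
  note I' = Inp_ext[OF I, of ?Y sc] and Z' = AV_ext[OF Z, of ?Y sc]
    and g' = computable_ext[OF g, of ?Y sc] and u' = computable_ext[OF u, of ?Y sc] and r = computable_index[OF computable_dimz[OF I]]
  have "computable ?\<Gamma> (\<lambda>e. \<Sum>r'<snd e. of_bool (lget (Z (fst e)) (r' * dimz (I (fst e)) + r') \<noteq> in0 (I (fst e))))"
  proof (rule computable_sum[OF r])
    let ?Y' = "\<lambda>e::_ \<times> nat. {..<snd e}"
    note I'' = Inp_ext[OF I', of ?Y' sc] and Z'' = AV_ext[OF Z', of ?Y' sc] and r' = computable_index[OF r]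
    show "computable (ext ?\<Gamma> ?Y' sc) (\<lambda>e. of_bool (lget (Z (fst (fst e))) (snd e * dimz (I (fst (fst e))) + snd e) \<noteq> in0 (I (fst (fst e)))))"
      by (intro decidable_not decidable_eq computable_lget computable_add computable_mult computable_dimz computable_in0 I'' Z'' r')
  qed
  then show "computable ?\<Gamma> (\<lambda>e. if lget (Z (fst e)) (snd e * dimz (I (fst e)) + snd e) = in0 (I (fst e)) then in0 (I (fst e))
     else fmu (I (fst e)) (dig (inq (I (fst e))) (g (fst e)) (inn (I (fst e)) * s + (\<Sum>r'<snd e. of_bool (lget (Z (fst e)) (r' * dimz (I (fst e)) + r') \<noteq> in0 (I (fst e))))))
                 (lget (Z (fst e)) (snd e * dimz (I (fst e)) + u (fst e))))"
    by (intro computable_if decidable_eq computable_lget computable_add computable_mult computable_dimz computable_in0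
       computable_fmu computable_dig computable_inq computable_inn computable_const I' Z' g' u' r)
qed

text \<open>Candidates are lists, so they are handed to a continuation \<open>body\<close>. Its
  context has gained three arrays: the guessed columns, the eliminated system and the
  candidate.\<close>

lemma computable_cand:
  fixes body :: "'e \<Rightarrow> nat list \<Rightarrow> nat"
  assumes I: "Inp \<Gamma> I" and g: "computable \<Gamma> g"
    and body: "\<And>(\<Delta> :: ((('e \<times> nat list) \<times> nat list) \<times> nat list) ctx). Inp \<Delta> (\<lambda>e. I (fst (fst (fst e)))) \<Longrightarrow> AV \<Delta> (\<lambda>e. snd e) \<Longrightarrow>
        (\<And>a. computable \<Gamma> a \<Longrightarrow> computable \<Delta> (\<lambda>e. a (fst (fst (fst e))))) \<Longrightarrow>
        computable \<Delta> (\<lambda>e. body (fst (fst (fst e))) (snd e))"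
  shows "computable \<Gamma> (\<lambda>e. body e (cand d c ks (I e) (g e)))"
proof -
  let ?s = "c * (d - 2)"
  have "computable \<Gamma> (\<lambda>e. (\<lambda>e l. body e (map (solz ?s (I e) (g e) (elimZ d c ks (I e) l)) [0..<dimz (I e)])) e
     (map (\<lambda>u. dig (inq (I e)) (g e) u) [0..<inn (I e) * ?s]))"
  proof (rule computable_tab[where body = "\<lambda>e l. body e (map (solz ?s (I e) (g e) (elimZ d c ks (I e) l)) [0..<dimz (I e)])"
      and g = "\<lambda>e u. dig (inq (I e)) (g e) u" and L = "\<lambda>e. inn (I e) * ?s"])
    show "computable \<Gamma> (\<lambda>e. inn (I e) * ?s)" by (intro computable_mult computable_inn computable_const I)
    let ?Y = "\<lambda>e. {..<inn (I e) * ?s}"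
    show "computable (ext \<Gamma> ?Y sc) (\<lambda>e. dig (inq (I (fst e))) (g (fst e)) (snd e))"
      by (intro computable_dig computable_inq Inp_ext I computable_ext[OF g] computable_index computable_mult computable_inn computable_const)
    let ?\<Gamma>1 = "ext \<Gamma> (\<lambda>e. {map (\<lambda>u. dig (inq (I e)) (g e) u) [0..<inn (I e) * ?s]}) (\<lambda>l. l)"
    assume l1: "AV ?\<Gamma>1 (\<lambda>e. snd e)"
    have I1: "Inp ?\<Gamma>1 (\<lambda>e. I (fst e))" by (rule Inp_ext[OF I])
    have "computable ?\<Gamma>1 (\<lambda>e. (\<lambda>e Z. body (fst e) (map (solz ?s (I (fst e)) (g (fst e)) Z) [0..<dimz (I (fst e))])) e
        (aiter (dimz (I (fst e)) * dimz (I (fst e))) (stepZ d c ks (I (fst e)) (snd e)) (c * (inn (I (fst e)) * inn (I (fst e))) + 1)))"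
    proof (rule computable_aiter[where body = "\<lambda>e Z. body (fst e) (map (solz ?s (I (fst e)) (g (fst e)) Z) [0..<dimz (I (fst e))])"
        and step = "\<lambda>e. stepZ d c ks (I (fst e)) (snd e)" and L = "\<lambda>e. dimz (I (fst e)) * dimz (I (fst e))"
        and N = "\<lambda>e. c * (inn (I (fst e)) * inn (I (fst e))) + 1"])
      show N: "computable ?\<Gamma>1 (\<lambda>e. c * (inn (I (fst e)) * inn (I (fst e))) + 1)"
        by (intro computable_add computable_mult computable_inn computable_const I1)
      show L: "computable ?\<Gamma>1 (\<lambda>e. dimz (I (fst e)) * dimz (I (fst e)))"
        by (intro computable_mult computable_dimz I1)
      obtain K where K: "\<forall>e\<in>cdom ?\<Gamma>1. \<forall>x i. I (fst e) x i \<le> (csiz ?\<Gamma>1 e + 2) ^ K" using I1 unfolding Inp_def by blast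
      let ?Y1 = "\<lambda>e. {..<c * (inn (I (fst e)) * inn (I (fst e))) + 1}"
      let ?\<Gamma>2 = "ext ?\<Gamma>1 ?Y1 sc"
      let ?it = "\<lambda>e. aiter (dimz (I (fst e)) * dimz (I (fst e))) (stepZ d c ks (I (fst e)) (snd e))"
      let ?\<Gamma>3 = "ext ?\<Gamma>2 (\<lambda>e. {?it (fst e) (snd e)}) (\<lambda>l. l)"
      let ?\<Gamma>4 = "ext ?\<Gamma>3 (\<lambda>e. {..<dimz (I (fst (fst (fst e)))) * dimz (I (fst (fst (fst e))))}) sc"
      have b2: "y \<le> (csiz ?\<Gamma>2 e + 2) ^ K" if "e \<in> cdom ?\<Gamma>2" "x \<in> {?it (fst e) (snd e)}" "y \<in> set x" for e x y
        using K that by (intro aiter_stepZ_le[of "I (fst (fst e))" _ y]) auto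
      have Z3: "AV ?\<Gamma>3 (\<lambda>e. snd e)"
        by (rule AV_ext_new[where rp = "\<lambda>l. l"]) (use b2 in blast)
      have t2: "computable ?\<Gamma>2 (\<lambda>e. snd e)" by (rule computable_index[OF N])
      have I3: "Inp ?\<Gamma>3 (\<lambda>e. I (fst (fst (fst e))))"
        by (rule Inp_ext[OF Inp_ext[OF I1]])
      have x4: "computable ?\<Gamma>4 (\<lambda>e. snd e)"
        by (intro computable_index computable_mult computable_dimz I3)
      show "computable ?\<Gamma>4 (\<lambda>e. stepZ d c ks (I (fst (fst (fst (fst e))))) (snd (fst (fst (fst e)))) (snd (fst (fst e))) (snd (fst e)) (snd e))"
        by (rule computable_stepZ[OF Inp_ext[OF I3] AV_ext[OF AV_ext[OF AV_ext[OF l1]]] AV_ext[OF Z3] computable_ext[OF computable_ext[OF t2]] x4])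
      let ?\<Gamma>b = "ext ?\<Gamma>1 (\<lambda>e. {?it e (c * (inn (I (fst e)) * inn (I (fst e))) + 1)}) (\<lambda>l. l)"
      have bb: "y \<le> (csiz ?\<Gamma>1 e + 2) ^ K" if "e \<in> cdom ?\<Gamma>1" "x \<in> {?it e (c * (inn (I (fst e)) * inn (I (fst e))) + 1)}" "y \<in> set x" for e x y
        using that(2,3) K[rule_format, OF that(1)] aiter_stepZ_le[of "I (fst e)" "(csiz ?\<Gamma>1 e + 2) ^ K" y] by blast
      have Zb: "AV ?\<Gamma>b (\<lambda>e. snd e)"
        by (rule AV_ext_new[where rp = "\<lambda>l. l"]) (use bb in blast)
      have Ib: "Inp ?\<Gamma>b (\<lambda>e. I (fst (fst e)))" by (rule Inp_ext[OF I1])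
      have gb: "computable ?\<Gamma>b (\<lambda>e. g (fst (fst e)))" by (rule computable_ext[OF computable_ext[OF g]])
      show "computable ?\<Gamma>b (\<lambda>e. body (fst (fst e)) (map (solz ?s (I (fst (fst e))) (g (fst (fst e))) (snd e)) [0..<dimz (I (fst (fst e)))]))"
      proof (rule computable_tab[where body = "\<lambda>e. body (fst (fst e))" and L = "\<lambda>e. dimz (I (fst (fst e)))"
          and g = "\<lambda>e. solz ?s (I (fst (fst e))) (g (fst (fst e))) (snd e)"])
        show L': "computable ?\<Gamma>b (\<lambda>e. dimz (I (fst (fst e))))" by (rule computable_dimz[OF Ib])
        show "computable (ext ?\<Gamma>b (\<lambda>e. {..<dimz (I (fst (fst e)))}) sc) (\<lambda>e. solz ?s (I (fst (fst (fst e)))) (g (fst (fst (fst e)))) (snd (fst e)) (snd e))"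
          by (rule computable_solz[OF Inp_ext[OF Ib] AV_ext[OF Zb] computable_ext[OF gb] computable_index[OF L']])
      qed (rule body[OF Inp_ext[OF Ib]], assumption, (rule computable_ext)+)
    qed
    then show "computable ?\<Gamma>1 (\<lambda>e. body (fst e) (map (solz ?s (I (fst e)) (g (fst e)) (elimZ d c ks (I (fst e)) (snd e))) [0..<dimz (I (fst e))]))"
      by (simp add: elimZ_def)
  qed
  then show ?thesis by (simp add: cand_def guess_def)
qed

lemma decidable_chk_inv:
  assumes I: "Inp \<Gamma> I" and z: "AV \<Gamma> z"
  shows "decidable \<Gamma> (\<lambda>e. chk_inv (I e) (z e))"
  unfolding chk_inv_def
proof (rule decidable_all[OF computable_inn[OF I]])
  let ?Y1 = "\<lambda>e. {..<inn (I e)}"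
  note I1 = Inp_ext[OF I, of ?Y1 sc] and z1 = AV_ext[OF z, of ?Y1 sc] and i1 = computable_index[OF computable_inn[OF I]]
  note n1 = computable_inn[OF I1]
  let ?\<Gamma>1 = "ext \<Gamma> ?Y1 sc"
  show "decidable ?\<Gamma>1 (\<lambda>e. \<forall>j<inn (I (fst e)).
      fsum (I (fst e)) (inn (I (fst e))) (\<lambda>k. fmu (I (fst e)) (lget (z (fst e)) (snd e * inn (I (fst e)) + k)) (lget (z (fst e)) (inn (I (fst e)) * inn (I (fst e)) + (j * inn (I (fst e)) + k))))
        = (if snd e = j then in1 (I (fst e)) else in0 (I (fst e))) \<and>
      fsum (I (fst e)) (inn (I (fst e))) (\<lambda>k. fmu (I (fst e)) (lget (z (fst e)) (inn (I (fst e)) * inn (I (fst e)) + (k * inn (I (fst e)) + snd e))) (lget (z (fst e)) (k * inn (I (fst e)) + j)))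
        = (if snd e = j then in1 (I (fst e)) else in0 (I (fst e))))"
  proof (rule decidable_all[OF n1], goal_cases)
    case 1
    let ?Y2 = "\<lambda>e. {..<inn (I (fst e))}"
    note I2 = Inp_ext[OF I1, of ?Y2 sc] and z2 = AV_ext[OF z1, of ?Y2 sc] and i2 = computable_ext[OF i1, of ?Y2 sc] and j2 = computable_index[OF n1]
    note n2 = computable_inn[OF I2]
    let ?Y3 = "\<lambda>e. {..<inn (I (fst (fst e)))}"
    note I3 = Inp_ext[OF I2, of ?Y3 sc] and z3 = AV_ext[OF z2, of ?Y3 sc] and i3 = computable_ext[OF i2, of ?Y3 sc]
      and j3 = computable_ext[OF j2, of ?Y3 sc] and k3 = computable_index[OF n2]
    note n3 = computable_inn[OF I3]
    show ?case
      by (intro decidable_conj decidable_eq computable_fsum[OF I2 n2] computable_fmu[OF I3] computable_lget[OF z3]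
         computable_add computable_mult n3 i3 j3 k3 computable_if i2 j2 computable_in0[OF I2] computable_in1[OF I2])
  qed
qed

lemma decidable_chk_deg:
  assumes I: "Inp \<Gamma> I" and z: "AV \<Gamma> z"
  shows "decidable \<Gamma> (\<lambda>e. chk_deg ks (I e) (z e) k)"
  unfolding chk_deg_def
proof (rule decidable_all[OF computable_power[OF computable_inn[OF I]]])
  let ?Y1 = "\<lambda>e. {..<inn (I e) ^ k}"
  let ?\<Gamma>1 = "ext \<Gamma> ?Y1 sc"
  note I1 = Inp_ext[OF I, of ?Y1 sc] and z1 = AV_ext[OF z, of ?Y1 sc] and i1 = computable_index[OF computable_power[OF computable_inn[OF I], of k]]
  note n1 = computable_inn[OF I1] and o1 = computable_offs[OF I1]
  let ?Js = "map (\<lambda>s. (\<lambda>e. dig (inn (I (fst e))) (snd e) s, \<lambda>e. inn (I (fst e)), \<lambda>e. dig (inn (I (fst e))) (snd e) s)) [0..<k]"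
  have "computable ?\<Gamma>1 (\<lambda>e. cof (I (fst e)) ''g'' (offs ks (I (fst e)) k) k (z (fst e)) (map (eval3 e) ?Js))"
    by (rule computable_cof[OF I1 z1 _ o1]) (simp_all add: computable_dig n1 i1 computable_const)
  then have c: "computable ?\<Gamma>1 (\<lambda>e. cof (I (fst e)) ''g'' (offs ks (I (fst e)) k) k (z (fst e)) (map (\<lambda>a. (a, inn (I (fst e)), a)) (digs (inn (I (fst e))) k (snd e))))"
    by (simp add: digs_def comp_def)
  show "decidable ?\<Gamma>1 (\<lambda>e. desc (digs (inn (I (fst e))) k (snd e)) \<longrightarrow>
     I (fst e) ''f'' (offs ks (I (fst e)) k + idx (digs (inn (I (fst e))) k (snd e))) =
     cof (I (fst e)) ''g'' (offs ks (I (fst e)) k) k (z (fst e)) (map (\<lambda>a. (a, inn (I (fst e)), a)) (digs (inn (I (fst e))) k (snd e))))"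
    by (rule decidable_imp[OF decidable_desc_digs[OF n1 i1] decidable_eq[OF computable_input[OF I1 _ computable_add[OF o1 computable_idx_digs[OF n1 i1]]] c]]) simp
qed

lemma decidable_accept:
  assumes I: "Inp \<Gamma> I" and z: "AV \<Gamma> z"
  shows "decidable \<Gamma> (\<lambda>e. accept ks (I e) (z e))"
  unfolding accept_def
  by (intro decidable_conj decidable_chk_inv decidable_list_all ballI decidable_chk_deg I z)

lemma computable_result:
  assumes I: "Inp \<Gamma> I" and P: "computable \<Gamma> (\<lambda>e. inq (I e) ^ inn (I e))"
  shows "computable \<Gamma> (\<lambda>e. result d c ks K (I e))"
  unfolding result_def
proof (rule computable_search[OF computable_power[OF P]])
  let ?Y = "\<lambda>e. {..<(inq (I e) ^ inn (I e)) ^ K}"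
  note I1 = Inp_ext[OF I, of ?Y sc]
  show "decidable (ext \<Gamma> ?Y sc) (\<lambda>e. accept ks (I (fst e)) (cand d c ks (I (fst e)) (snd e)))"
    by (rule computable_cand[OF I1 computable_index[OF computable_power[OF P]],
          where body = "\<lambda>e z. of_bool (accept ks (I (fst e)) z)"])
       (rule decidable_accept)
qed

lemma computable_entry:
  assumes I: "Inp \<Gamma> I" and P: "computable \<Gamma> (\<lambda>e. inq (I e) ^ inn (I e))" and u: "computable \<Gamma> u"
  shows "computable \<Gamma> (\<lambda>e. lget (cand d c ks (I e) (result d c ks K (I e))) (u e))"
  by (rule computable_cand[OF I computable_result[OF I P], where body = "\<lambda>e z. lget z (u e)"])
     (intro computable_lget, assumption, use u in blast)

text \<open>The program evaluates the answer and the output length, fills the output array in a loop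
  and writes the answer last. The output names are neither inputs nor stack variables, so
  evaluations leave them alone.\<close>

lemma program_exists:
  assumes emp: "cvars \<Gamma> = []" and inp: "cinp \<Gamma> = (\<lambda>\<sigma>. \<sigma>)"
    and r: "computable \<Gamma> r" and L: "computable \<Gamma> L"
    and a: "computable (ext \<Gamma> (\<lambda>e. {..<L e}) sc) (\<lambda>e. a (fst e) (snd e))"
  obtains c K where "\<And>\<sigma>. \<sigma> \<in> cdom \<Gamma> \<Longrightarrow> \<exists>t s. exec c \<sigma> t s \<and> t \<le> (csiz \<Gamma> \<sigma> + 2) ^ K \<and>
      s ''iso'' 0 = r \<sigma> \<and> (\<forall>u<L \<sigma>. s ''A'' u = a \<sigma> u)"
proof -
  obtain cr \<tau>r where cr: "pbd \<Gamma> \<tau>r" "realizes \<Gamma> [] 0 r cr \<tau>r"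
    by (rule computableE[OF r, of "[]" 0]) (simp_all add: emp)
  obtain cL \<tau>L where cL: "pbd \<Gamma> \<tau>L" "realizes \<Gamma> [] 1 L cL \<tau>L"
    by (rule computableE[OF L, of "[]" 1]) (simp_all add: emp)
  let ?\<Gamma>1 = "ext \<Gamma> (\<lambda>e. {..<L e}) sc"
  obtain ca \<tau>a0 where ca: "pbd ?\<Gamma>1 \<tau>a0" "realizes ?\<Gamma>1 ([] @ [2]) 3 (\<lambda>e. a (fst e) (snd e)) ca \<tau>a0"
    by (rule computableE[OF a, of "[] @ [2]" 3]) (simp_all add: emp)
  obtain \<tau>a where \<tau>a: "pbd \<Gamma> \<tau>a" "\<And>e x. e \<in> cdom \<Gamma> \<Longrightarrow> x \<in> {..<L e} \<Longrightarrow> \<tau>a0 (e, x) \<le> \<tau>a e"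
    using pbd_ext_bound[OF ca(1)] by blast
  let ?rd = "\<lambda>j. Cell (nm j) (N 1)"
  let ?incr = "set_scalar 2 (Plus (?rd 2) (N 1))"
  let ?body = "Seq (Seq ca (Assign ''A'' (?rd 2) (?rd 3))) ?incr"
  define c where "c = Seq cr (Seq cL (Seq (set_scalar 2 (N 0))
    (Seq (While (Minus (?rd 1) (?rd 2)) ?body) (Assign ''iso'' (N 0) (?rd 0)))))"
  define \<tau> where "\<tau> = (\<lambda>e. \<tau>r e + (\<tau>L e + (2 + ((L e * ((\<tau>a e + 1 + 2) + 1) + 1) + 1))))"
  have "pbd \<Gamma> \<tau>" unfolding \<tau>_def
    by (intro pbd_add pbd_mult pbd_const cr(1) cL(1) \<tau>a(1) computable_pbd[OF L])
  then obtain K where K: "\<forall>e\<in>cdom \<Gamma>. \<tau> e \<le> (csiz \<Gamma> e + 2) ^ K" by (auto simp: pbd_def)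
  have A_nm [simp]: "nm j \<noteq> ''A''" "nm j \<noteq> ''iso''" "''A'' \<noteq> nm j" "''iso'' \<noteq> nm j" for j
    by (auto simp: nm_def)
  have A_in [simp]: "''A'' \<notin> inputs" "''iso'' \<notin> inputs" by (auto simp: inputs_def)
  show thesis
  proof (rule that)
    fix \<sigma> assume \<sigma>: "\<sigma> \<in> cdom \<Gamma>"
    define B where "B = (\<lambda>s. (\<forall>x\<in>inputs. s x = \<sigma> x) \<and> rep (s (nm 0)) [r \<sigma>] \<and> rep (s (nm 1)) [L \<sigma>])"
    define Q where "Q = (\<lambda>i s. B s \<and> rep (s (nm 2)) [i] \<and> (\<forall>u<i. s ''A'' u = a \<sigma> u))"
    have agB: "agree \<Gamma> [] \<sigma> s" if "\<forall>x\<in>inputs. s x = \<sigma> x" for s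
      using that by (simp add: agree_def emp inp)
    have step: "timed (Q i) ?body (\<tau>a \<sigma> + 1 + 2) (Q (Suc i))" if i: "i < L \<sigma>" for i
    proof (intro timed_Seq)
      show "timed (Q i) ca (\<tau>a \<sigma>) (\<lambda>s. Q i s \<and> rep (s (nm 3)) [a \<sigma> i])"
      proof (rule timedI)
        fix s1 assume s1: "Q i s1"
        then have "agree ?\<Gamma>1 ([] @ [2]) (\<sigma>, i) s1"
          by (subst agree_ext) (simp_all add: emp Q_def B_def agB)
        from realizesD[OF ca(2) _ this] obtain t s2 where ex: "exec ca s1 t s2" "t \<le> \<tau>a0 (\<sigma>, i)" "eval_post s1 3 (a \<sigma> i) s2"
          using \<sigma> i by (auto elim!: timedE)
        have "s2 x = s1 x" if "x \<in> inputs \<union> {nm 0, nm 1, nm 2, ''A''}" for x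
        proof -
          have "x \<notin> nm ` {3..}" using that A_nm by auto
          then show ?thesis using ex(3) by (simp add: eval_post_def)
        qed
        then have "Q i s2" using s1 by (auto simp: Q_def B_def)
        then show "\<exists>t s'. exec ca s1 t s' \<and> t \<le> \<tau>a \<sigma> \<and> Q i s' \<and> rep (s' (nm 3)) [a \<sigma> i]"
          using ex \<tau>a(2)[OF \<sigma>, of i] i unfolding eval_post_def by (meson le_trans lessThan_iff)
      qed
      show "timed (\<lambda>s. Q i s \<and> rep (s (nm 3)) [a \<sigma> i]) (Assign ''A'' (?rd 2) (?rd 3)) 1
          (\<lambda>s. Q i s \<and> (\<forall>u<Suc i. s ''A'' u = a \<sigma> u))"
        by (intro timed_Assign) (auto simp: Q_def B_def rep_singleton less_Suc_eq)
      show "timed (\<lambda>s. Q i s \<and> (\<forall>u<Suc i. s ''A'' u = a \<sigma> u)) ?incr 2 (Q (Suc i))"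
        by (intro timed_set_scalar) (auto simp: Q_def B_def rep_singleton)
    qed
    have "timed (\<lambda>s. s = \<sigma>) c (\<tau> \<sigma>) (\<lambda>s. s ''iso'' 0 = r \<sigma> \<and> (\<forall>u<L \<sigma>. s ''A'' u = a \<sigma> u))"
      unfolding c_def \<tau>_def
    proof (intro timed_Seq)
      show "timed (\<lambda>s. s = \<sigma>) cr (\<tau>r \<sigma>) (eval_post \<sigma> 0 (r \<sigma>))"
        by (rule realizesD[OF cr(2) \<sigma> agB]) simp
      show "timed (eval_post \<sigma> 0 (r \<sigma>)) cL (\<tau>L \<sigma>) B"
      proof (rule timedI)
        fix s1 assume s1: "eval_post \<sigma> 0 (r \<sigma>) s1"
        have same1: "s1 x = \<sigma> x" if "x \<in> inputs" for x
          using s1 that unfolding eval_post_def by (metis imageE nm_notin_inputs)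
        then obtain t s2 where ex: "exec cL s1 t s2" "t \<le> \<tau>L \<sigma>" "eval_post s1 1 (L \<sigma>) s2"
          using realizesD[OF cL(2) \<sigma> agB, of s1] by (auto elim!: timedE)
        have "s2 x = s1 x" if "x \<in> inputs" for x
          using ex(3) that unfolding eval_post_def by (metis imageE nm_notin_inputs)
        moreover have "s2 (nm 0) = s1 (nm 0)" using ex(3) by (simp add: eval_post_def)
        ultimately have "B s2" using s1 ex(3) same1 by (simp add: B_def eval_post_def)
        with ex show "\<exists>t s'. exec cL s1 t s' \<and> t \<le> \<tau>L \<sigma> \<and> B s'" by blast
      qed
      show "timed B (set_scalar 2 (N 0)) 2 (Q 0)"
        by (intro timed_set_scalar) (auto simp: Q_def B_def rep_singleton)
      show "timed (Q 0) (While (Minus (?rd 1) (?rd 2)) ?body) (L \<sigma> * (\<tau>a \<sigma> + 1 + 2 + 1) + 1) (Q (L \<sigma>))"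
        by (intro timed_While step) (auto simp: Q_def B_def rep_singleton)
      show "timed (Q (L \<sigma>)) (Assign ''iso'' (N 0) (?rd 0)) 1 (\<lambda>s. s ''iso'' 0 = r \<sigma> \<and> (\<forall>u<L \<sigma>. s ''A'' u = a \<sigma> u))"
        by (intro timed_Assign) (auto simp: Q_def B_def rep_singleton)
    qed
    then obtain t s where "exec c \<sigma> t s" "t \<le> \<tau> \<sigma>" "s ''iso'' 0 = r \<sigma>" "\<forall>u<L \<sigma>. s ''A'' u = a \<sigma> u"
      by (auto elim!: timedE)
    with K \<sigma> show "\<exists>t s. exec c \<sigma> t s \<and> t \<le> (csiz \<Gamma> \<sigma> + 2) ^ K \<and>
      s ''iso'' 0 = r \<sigma> \<and> (\<forall>u<L \<sigma>. s ''A'' u = a \<sigma> u)"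
      by (meson le_trans)
  qed
qed

definition valid_input :: "state \<Rightarrow> bool" where
  "valid_input \<sigma> \<longleftrightarrow> 2 \<le> inq \<sigma> \<and> 1 \<le> inn \<sigma> \<and> (\<forall>x i. \<sigma> x i \<le> inq \<sigma> ^ inn \<sigma>)"

text \<open>Taking q ^ n as the size makes the number (q ^ n) ^ K of codes polynomial, and with it
  the whole search.\<close>

theorem algorithm_program:
  obtains c K' where "\<And>\<sigma>. valid_input \<sigma> \<Longrightarrow> \<exists>t s. exec c \<sigma> t s \<and> t \<le> (inq \<sigma> ^ inn \<sigma>) ^ K' \<and>
      s ''iso'' 0 = of_bool (result d cc ks K \<sigma> < (inq \<sigma> ^ inn \<sigma>) ^ K) \<and>
      (\<forall>u<inn \<sigma> * inn \<sigma>. s ''A'' u = lget (cand d cc ks \<sigma> (result d cc ks K \<sigma>)) u)"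
proof -
  define \<Gamma> :: "state ctx" where
    "\<Gamma> = \<lparr>cdom = Collect valid_input, cinp = (\<lambda>\<sigma>. \<sigma>), csiz = (\<lambda>\<sigma>. inq \<sigma> ^ inn \<sigma>), cvars = []\<rparr>"
  have I: "Inp \<Gamma> (\<lambda>\<sigma>. \<sigma>)"
    unfolding Inp_def
    by (auto simp: \<Gamma>_def valid_input_def intro!: exI[of _ 1] le_SucI trans_le_add1)
  \<comment> \<open>The power q ^ n has a variable exponent and is computed by recursion; its
    intermediate values stay below the size.\<close>
  have rec: "rec_nat 1 (\<lambda>t v. v * inq \<sigma>) n = inq \<sigma> ^ n" for \<sigma> n
    by (induction n) auto
  have "inq \<sigma> ^ n \<le> (inq \<sigma> ^ inn \<sigma> + 2) ^ 1" if "valid_input \<sigma>" "n \<le> inn \<sigma>" for \<sigma> n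
  proof -
    have "inq \<sigma> ^ n \<le> inq \<sigma> ^ inn \<sigma>" using that by (intro power_increasing) (auto simp: valid_input_def)
    then show ?thesis by simp
  qed
  then have "pbd (ext \<Gamma> (\<lambda>\<sigma>. {..inn \<sigma>}) sc) (\<lambda>e. rec_nat 1 (\<lambda>t v. v * inq (fst e)) (snd e))"
    unfolding rec pbd_def by (intro exI[of _ 1]) (auto simp: \<Gamma>_def)
  then have "computable \<Gamma> (\<lambda>\<sigma>. rec_nat 1 (\<lambda>t v. (\<lambda>e v w. v * w) \<sigma> v ((\<lambda>\<sigma> t. inq \<sigma>) \<sigma> t)) (inn \<sigma>))"
    by (intro computable_fold_index[where f = "\<lambda>e v w. v * w"] computable_inn[OF I] computable_const
      computable_ext[OF computable_inq[OF I]] computable_mult) auto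
  then have P: "computable \<Gamma> (\<lambda>\<sigma>. inq \<sigma> ^ inn \<sigma>)" by (simp only: rec)
  have nn: "computable \<Gamma> (\<lambda>\<sigma>. inn \<sigma> * inn \<sigma>)" by (intro computable_mult computable_inn[OF I])
  have r: "computable \<Gamma> (\<lambda>\<sigma>. of_bool (result d cc ks K \<sigma> < (inq \<sigma> ^ inn \<sigma>) ^ K))"
    by (intro decidable_less computable_result[OF I P] computable_power[OF P])
  have a: "computable (ext \<Gamma> (\<lambda>\<sigma>. {..<inn \<sigma> * inn \<sigma>}) sc)
      (\<lambda>e. lget (cand d cc ks (fst e) (result d cc ks K (fst e))) (snd e))"
    by (rule computable_entry[OF Inp_ext[OF I] computable_ext[OF P] computable_index[OF nn]])
  obtain c K0 where c: "\<And>\<sigma>. \<sigma> \<in> cdom \<Gamma> \<Longrightarrow> \<exists>t s. exec c \<sigma> t s \<and> t \<le> (csiz \<Gamma> \<sigma> + 2) ^ K0 \<and>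
      s ''iso'' 0 = of_bool (result d cc ks K \<sigma> < (inq \<sigma> ^ inn \<sigma>) ^ K) \<and>
      (\<forall>u<inn \<sigma> * inn \<sigma>. s ''A'' u = lget (cand d cc ks \<sigma> (result d cc ks K \<sigma>)) u)"
    by (rule program_exists[OF _ _ r nn a]) (auto simp: \<Gamma>_def)
  show thesis
  proof (rule that[of c "2 * K0"])
    fix \<sigma> assume v: "valid_input \<sigma>"
    have "2 ^ 1 \<le> inq \<sigma> ^ inn \<sigma>"
      using v unfolding valid_input_def by (intro order_trans[OF power_mono[of 2 "inq \<sigma>" 1] power_increasing]) auto
    \<comment> \<open>For x >= 2 one has x + 2 <= x ^ 2; this turns the base of \<open>pbd\<close>
      into a pure power of q ^ n.\<close>
    then have "inq \<sigma> ^ inn \<sigma> + 2 \<le> (inq \<sigma> ^ inn \<sigma>) ^ 2"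
      by (simp add: power2_eq_square) (metis add_le_mono le_trans mult_2 mult_le_mono1 order_refl)
    then have "(inq \<sigma> ^ inn \<sigma> + 2) ^ K0 \<le> (inq \<sigma> ^ inn \<sigma>) ^ (2 * K0)"
      by (simp only: power_mult power_mono)
    with c[of \<sigma>] v show "\<exists>t s. exec c \<sigma> t s \<and> t \<le> (inq \<sigma> ^ inn \<sigma>) ^ (2 * K0) \<and>
      s ''iso'' 0 = of_bool (result d cc ks K \<sigma> < (inq \<sigma> ^ inn \<sigma>) ^ K) \<and>
      (\<forall>u<inn \<sigma> * inn \<sigma>. s ''A'' u = lget (cand d cc ks \<sigma> (result d cc ks K \<sigma>)) u)"
      by (fastforce simp: \<Gamma>_def)
  qed
qed

section \<open>Digits and the enumeration of monomials\<close>

lemma dig_lt: "0 < b \<Longrightarrow> dig b x s < b"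
  by (simp add: dig_def)

lemma dig_eqD:
  assumes "0 < b" "x < b ^ k" "y < b ^ k" "\<And>s. s < k \<Longrightarrow> dig b x s = dig b y s"
  shows "x = y"
  using assms(2-)
proof (induction k arbitrary: x y)
  case (Suc k)
  have "x div b = y div b"
  proof (rule Suc.IH)
    show "x div b < b ^ k" "y div b < b ^ k"
      using Suc.prems assms(1) by (auto simp: less_mult_imp_div_less mult.commute)
    show "dig b (x div b) s = dig b (y div b) s" if "s < k" for s
      using Suc.prems(3)[of "Suc s"] that by (simp add: dig_def div_mult2_eq)
  qed
  moreover have "x mod b = y mod b" using Suc.prems(3)[of 0] by (simp add: dig_def)
  ultimately show ?case by (metis div_mult_mod_eq)
qed simp

lemma ex_digits:
  assumes "0 < b" "\<And>s. s < k \<Longrightarrow> a s < b"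
  obtains x where "x < b ^ k" "\<And>s. s < k \<Longrightarrow> dig b x s = a s"
  using assms(2)
proof (induction k arbitrary: a thesis)
  case 0
  then show ?case by (metis less_nat_zero_code power_0 zero_less_one)
next
  case (Suc k)
  obtain y where y: "y < b ^ k" "\<And>s. s < k \<Longrightarrow> dig b y s = a (Suc s)"
    by (rule Suc.IH[of "\<lambda>s. a (Suc s)"]) (use Suc.prems(2) in auto)
  have a0: "a 0 < b" using Suc.prems by simp
  show ?case
  proof (rule Suc.prems(1)[of "y * b + a 0"])
    have "y * b + a 0 < (y + 1) * b" using a0 by simp
    also have "\<dots> \<le> b ^ k * b" using y by (intro mult_right_mono) auto
    finally show "y * b + a 0 < b ^ Suc k" by (simp add: mult.commute)
    show "dig b (y * b + a 0) s = a s" if "s < Suc k" for s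
    proof (cases s)
      case 0
      then show ?thesis using a0 by (simp add: dig_def)
    next
      case (Suc s')
      have "(y * b + a 0) div b = y" using a0 by simp
      then show ?thesis using y(2)[of s'] that Suc by (simp add: dig_def div_mult2_eq)
    qed
  qed
qed

lemma length_digs [simp]: "length (digs b k x) = k"
  by (simp add: digs_def)

lemma nth_digs: "s < k \<Longrightarrow> digs b k x ! s = dig b x s"
  by (simp add: digs_def)

lemma inj_digs: "0 < b \<Longrightarrow> inj_on (digs b k) {..<b ^ k}"
proof (rule inj_onI)
  fix x y assume "0 < b" "x \<in> {..<b ^ k}" "y \<in> {..<b ^ k}" and eq: "digs b k x = digs b k y"
  moreover have "dig b x s = dig b y s" if "s < k" for s
    using arg_cong[OF eq, of "\<lambda>l. l ! s"] that by (simp add: nth_digs)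
  ultimately show "x = y" by (intro dig_eqD[of b x k y]) auto
qed

lemma set_digs: "0 < b \<Longrightarrow> set (digs b k x) \<subseteq> {..<b}"
  by (auto simp: digs_def dig_lt)

lemma image_digs: assumes "0 < b" shows "digs b k ` {..<b ^ k} = {I. length I = k \<and> set I \<subseteq> {..<b}}"
proof (intro equalityI subsetI)
  fix I assume I: "I \<in> {I. length I = k \<and> set I \<subseteq> {..<b}}"
  have "I ! s < b" if "s < k" for s
  proof -
    have "I ! s \<in> set I" using I that by simp
    then show ?thesis using I by auto
  qed
  then obtain x where x: "x < b ^ k" "\<And>s. s < k \<Longrightarrow> dig b x s = I ! s"
    using ex_digits[OF assms, of k "\<lambda>s. I ! s"] by blast
  then have "digs b k x = I" using I by (intro nth_equalityI) (auto simp: nth_digs)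
  then show "I \<in> digs b k ` {..<b ^ k}" using x by blast
qed (use set_digs[OF assms] in auto)

lemma image_digs_desc:
  assumes "0 < b" shows "digs b k ` {x. x < b ^ k \<and> desc (digs b k x)} = DL b k"
proof (intro equalityI subsetI)
  fix I assume I: "I \<in> DL b k"
  then have "I \<in> digs b k ` {..<b ^ k}" unfolding image_digs[OF assms] by (auto simp: DL_def)
  then show "I \<in> digs b k ` {x. x < b ^ k \<and> desc (digs b k x)}" using I by (auto simp: DL_def)
qed (use set_digs[OF assms] in \<open>auto simp: DL_def\<close>)

text \<open>Digit strings that are weakly decreasing correspond to elements of \<open>DL\<close>,
  hence to monomials. With no variables there are no digits, and that case is treated apart.\<close>

lemma cnt_eq: "cnt j k = length (degree_monos j k)"
proof -
  have len: "length (degree_monos j k) = card (DL j k)"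
  proof -
    have "length (degree_monos j k) = card (mset ` DL j k)"
      unfolding mset_image_DL set_degree_monos[symmetric] by (simp add: distinct_card distinct_degree_monos)
    then show ?thesis by (simp add: card_image mset_inj_DL)
  qed
  show ?thesis
  proof (cases "j = 0")
    case True
    then show ?thesis by (cases k) (auto simp: cnt_def digs_def)
  next
    case False
    have "cnt j k = card ({..<j ^ k} \<inter> {x. desc (digs j k x)})" by (simp add: cnt_def)
    also have "{..<j ^ k} \<inter> {x. desc (digs j k x)} = {x. x < j ^ k \<and> desc (digs j k x)}" by auto
    also have "card \<dots> = card (digs j k ` {x. x < j ^ k \<and> desc (digs j k x)})"
      using inj_digs[of j k] False by (intro card_image[symmetric]) (auto intro: inj_on_subset)
    finally show ?thesis using image_digs_desc[of j k] False len by simp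
  qed
qed

text \<open>The enumeration goes by increasing exponent of the last variable: first the monomials
  without it, then those from which one copy can be removed.\<close>

lemma degree_monos_Suc_Suc:
  "degree_monos (Suc n) (Suc k) = degree_monos n (Suc k) @ map (add_mset n) (degree_monos (Suc n) k)"
proof -
  let ?h = "\<lambda>k e. map (\<lambda>m. m + replicate_mset e n) (degree_monos n (k - e))"
  have "degree_monos (Suc n) (Suc k) = concat (map (?h (Suc k)) (0 # map Suc [0..<Suc k]))"
  proof -
    have "[0..<Suc (Suc k)] = 0 # map Suc [0..<Suc k]"
      unfolding map_Suc_upt by (rule upt_conv_Cons) simp
    then show ?thesis by (simp only: degree_monos.simps)
  qed
  also have "\<dots> = degree_monos n (Suc k) @ concat (map (map (add_mset n) \<circ> ?h k) [0..<Suc k])"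
    by (simp del: upt_Suc add: comp_def)
  also have "concat (map (map (add_mset n) \<circ> ?h k) [0..<Suc k]) = map (add_mset n) (degree_monos (Suc n) k)"
    by (simp only: degree_monos.simps map_concat map_map)
  finally show ?thesis .
qed

lemma degree_monos_prefix: "m \<le> n \<Longrightarrow> \<exists>xs. degree_monos n k = degree_monos m k @ xs"
proof (induction n rule: dec_induct)
  case (step n)
  then obtain xs where "degree_monos n k = degree_monos m k @ xs" by blast
  then show ?case
  proof (cases k)
    case 0
    have "degree_monos (Suc n) 0 = degree_monos n 0" by (simp add: comp_def)
    then show ?thesis using 0 \<open>degree_monos n k = degree_monos m k @ xs\<close> by simp
  next
    case (Suc k')
    then show ?thesis using \<open>degree_monos n k = degree_monos m k @ xs\<close> by (simp add: degree_monos_Suc_Suc del: degree_monos.simps)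
  qed
qed simp

text \<open>By the prefix property the rank does not depend on n, so n may be lowered to one more
  than the largest variable j; the recursion of the enumeration then splits off one j.\<close>

lemma idx_nth:
  "J \<in> DL n k \<Longrightarrow> idx J < length (degree_monos n k) \<and> degree_monos n k ! idx J = mset J"
proof (induction J arbitrary: n k)
  case Nil
  have "degree_monos n 0 = [{#}]" for n by (induction n) (auto simp: comp_def)
  then show ?case using Nil by (simp add: DL_def)
next
  case (Cons j J)
  define k' where "k' = length J"
  have k: "k = Suc k'" and jn: "j < n" using Cons.prems by (auto simp: DL_def k'_def)
  have "J \<in> DL (Suc j) k'" using Cons.prems by (auto simp: DL_def k'_def less_Suc_eq_le)
  from Cons.IH[OF this] have IH: "idx J < length (degree_monos (Suc j) k')" "degree_monos (Suc j) k' ! idx J = mset J" by auto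
  obtain xs where xs: "degree_monos n k = degree_monos (Suc j) k @ xs"
    using degree_monos_prefix[of "Suc j" n k] jn by auto
  have dm: "degree_monos n k = (degree_monos j k @ map (add_mset j) (degree_monos (Suc j) k')) @ xs"
    unfolding xs unfolding k by (simp only: degree_monos_Suc_Suc)
  have "idx (j # J) = length (degree_monos j k) + idx J" by (simp add: cnt_eq k k'_def del: degree_monos.simps)
  then show ?case unfolding dm using IH by (simp add: nth_append del: degree_monos.simps)
qed

lemma concat_nth:
  fixes k :: nat
  assumes "sorted_wrt (<) ks" "k \<in> set ks" "i < length (h k)"
  shows "(\<Sum>k'\<leftarrow>filter (\<lambda>k'. k' < k) ks. length (h k')) + i < length (concat (map h ks)) \<and>
     concat (map h ks) ! ((\<Sum>k'\<leftarrow>filter (\<lambda>k'. k' < k) ks. length (h k')) + i) = h k ! i"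
  using assms
proof (induction ks)
  case (Cons k0 ks)
  show ?case
  proof (cases "k = k0")
    case True
    have none: "filter (\<lambda>k'. k' < k) (k0 # ks) = []"
      using Cons.prems True by (auto simp: filter_empty_conv)
    show ?thesis unfolding none using True Cons.prems by (simp add: nth_append)
  next
    case False
    then have "k \<in> set ks" "k0 < k" using Cons.prems by auto
    then show ?thesis using Cons by (simp add: nth_append)
  qed
qed simp

lemma nth_concat_table:
  assumes "a < m" "b < q"
  shows "concat (map (\<lambda>a. map (h a) [0..<q]) [0..<m]) ! (a * q + b) = h a b \<and>
     length (concat (map (\<lambda>a. map (h a) [0..<q]) [0..<m])) = m * q"
  using assms
proof (induction m)
  case (Suc m)
  have len: "length (concat (map (\<lambda>a. map (h a) [0..<q]) [0..<m])) = m * q"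
    by (induction m) auto
  show ?case
  proof (cases "a = m")
    case True
    then show ?thesis using len Suc.prems by (simp add: nth_append)
  next
    case False
    then have "a < m" using Suc.prems by simp
    moreover have "a * q + b < m * q"
    proof -
      have "a * q + b < Suc a * q" using Suc.prems by simp
      also have "\<dots> \<le> m * q" using \<open>a < m\<close> by (intro mult_right_mono) auto
      finally show ?thesis .
    qed
    ultimately show ?thesis using Suc len by (simp add: nth_append)
  qed
qed simp

text \<open>Only the factorial of the multiplicity of j changes.\<close>

lemma cfac_step: assumes "j \<in># M" shows "cfac M = count M j * cfac (M - {#j#})"
proof -
  let ?N = "M - {#j#}"
  have sub: "set_mset ?N \<subseteq> set_mset M" by (auto dest: in_diffD)
  have "cfac ?N = (\<Prod>i\<in>set_mset M. fact (count ?N i))"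
    unfolding cfac_def by (rule prod.mono_neutral_left) (use sub in \<open>auto simp: not_in_iff\<close>)
  also have "\<dots> = fact (count ?N j) * (\<Prod>i\<in>set_mset M - {j}. fact (count ?N i))"
    using assms by (intro prod.remove) auto
  also have "(\<Prod>i\<in>set_mset M - {j}. fact (count ?N i)) = (\<Prod>i\<in>set_mset M - {j}. (fact (count M i) :: nat))"
    by (intro prod.cong) auto
  finally have N: "cfac ?N = fact (count ?N j) * (\<Prod>i\<in>set_mset M - {j}. fact (count M i))" .
  have "cfac M = fact (count M j) * (\<Prod>i\<in>set_mset M - {j}. fact (count M i))"
    unfolding cfac_def using assms by (intro prod.remove) auto
  moreover have "(fact (count M j) :: nat) = count M j * fact (count ?N j)"
    using assms fact_reduce[of "count M j", where 'a = nat] by simp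
  ultimately show ?thesis using N by simp
qed

section \<open>Multiplicities of columns and multilinearity of \<open>Wc\<close>\<close>

context cring
begin

lemma add_pow_finsum:
  assumes "finite A" "\<And>x. x \<in> A \<Longrightarrow> h x \<in> carrier R"
  shows "[(k::nat)] \<cdot> (\<Oplus>x\<in>A. h x) = (\<Oplus>x\<in>A. [k] \<cdot> h x)"
  using assms
proof (induction A)
  case empty
  then show ?case by simp
next
  case (insert x A)
  have "(\<Oplus>x\<in>insert x A. h x) = h x \<oplus> (\<Oplus>x\<in>A. h x)" using insert by (intro finsum_insert) auto
  then have "[k] \<cdot> (\<Oplus>x\<in>insert x A. h x) = [k] \<cdot> h x \<oplus> [k] \<cdot> (\<Oplus>x\<in>A. h x)"
    using insert by (simp add: add.nat_pow_distrib Pi_def)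
  also have "\<dots> = [k] \<cdot> h x \<oplus> (\<Oplus>x\<in>A. [k] \<cdot> h x)" using insert by simp
  also have "\<dots> = (\<Oplus>x\<in>insert x A. [k] \<cdot> h x)"
    using insert by (intro finsum_insert[symmetric]) auto
  finally show ?case .
qed

lemma finsum_group:
  assumes "finite S" "\<And>r. r \<in> S \<Longrightarrow> h (c r) \<in> carrier R"
  shows "(\<Oplus>r\<in>S. h (c r)) = (\<Oplus>j\<in>c ` S. [card {r \<in> S. c r = j}] \<cdot> h j)"
proof -
  have U: "(\<Union>j\<in>c ` S. {r \<in> S. c r = j}) = S" by auto
  have "(\<Oplus>r\<in>S. h (c r)) = (\<Oplus>r\<in>(\<Union>j\<in>c ` S. {r \<in> S. c r = j}). h (c r))" unfolding U ..
  also have "\<dots> = (\<Oplus>j\<in>c ` S. \<Oplus>r\<in>{r \<in> S. c r = j}. h (c r))"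
    using assms by (intro add.finprod_UN_disjoint) (auto simp: pairwise_def disjnt_def)
  also have "\<dots> = (\<Oplus>j\<in>c ` S. [card {r \<in> S. c r = j}] \<cdot> h j)"
  proof (rule finsum_cong')
    fix j assume "j \<in> c ` S"
    then have hj: "h j \<in> carrier R" using assms by auto
    have "(\<Oplus>r\<in>{r \<in> S. c r = j}. h (c r)) = (\<Oplus>r\<in>{r \<in> S. c r = j}. h j)"
      using hj by (intro finsum_cong') auto
    also have "\<dots> = [card {r \<in> S. c r = j}] \<cdot> h j" using hj by (rule add.finprod_const)
    finally show "(\<Oplus>r\<in>{r \<in> S. c r = j}. h (c r)) = [card {r \<in> S. c r = j}] \<cdot> h j" .
  qed (use assms in auto)
  finally show ?thesis .
qed

lemma Wc_closed: "(\<And>i j. i \<in> set I \<Longrightarrow> j \<in># m \<Longrightarrow> A i j \<in> carrier R) \<Longrightarrow> Wc A I m \<in> carrier R"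
proof (induction I arbitrary: m)
  case (Cons i I)
  have "A i j \<otimes> Wc A I (m - {#j#}) \<in> carrier R" if "j \<in># m" for j
    using Cons that by (intro m_closed Cons.IH) (auto dest: in_diffD)
  then show ?case by (auto intro!: finsum_closed)
qed simp

lemma Wc_cong:
  assumes "\<And>i j. i \<in> set I \<Longrightarrow> j \<in># m \<Longrightarrow> A i j = B i j" "\<And>i j. i \<in> set I \<Longrightarrow> j \<in># m \<Longrightarrow> B i j \<in> carrier R"
  shows "Wc A I m = Wc B I m"
  using assms
proof (induction I arbitrary: m)
  case (Cons i I)
  show ?case unfolding Wc.simps
  proof (rule finsum_cong')
    fix j assume j: "j \<in> set_mset m"
    have "Wc A I (m - {#j#}) = Wc B I (m - {#j#})" using Cons.prems by (intro Cons.IH) (auto dest: in_diffD)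
    then show "A i j \<otimes> Wc A I (m - {#j#}) = B i j \<otimes> Wc B I (m - {#j#})" using Cons.prems j by simp
  next
    show "(\<lambda>j. B i j \<otimes> Wc B I (m - {#j#})) \<in> set_mset m \<rightarrow> carrier R"
      using Cons.prems by (auto intro!: m_closed Wc_closed dest: in_diffD)
  qed simp
qed simp

text \<open>In the expansion along a row, a column value j is picked by as many indices r as its
  multiplicity. By \<open>cfac_step\<close> these multiplicities accumulate to \<open>cfac\<close>
  of the multiset of columns.\<close>

lemma Wc_cols:
  assumes "finite S" "card S = length I" "\<And>i r. i \<in> set I \<Longrightarrow> r \<in> S \<Longrightarrow> A i (c r) \<in> carrier R"
  shows "Wc (\<lambda>i r. A i (c r)) I (mset_set S) =
     [cfac (image_mset c (mset_set S))] \<cdot> Wc A I (image_mset c (mset_set S))"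
  using assms
proof (induction I arbitrary: S)
  case Nil
  then show ?case by (simp add: cfac_def)
next
  case (Cons i I)
  define M where "M = image_mset c (mset_set S)"
  have setM: "set_mset M = c ` S" using Cons.prems(1) by (simp add: M_def)
  define h where "h = (\<lambda>j. [cfac (M - {#j#})] \<cdot> (A i j \<otimes> Wc A I (M - {#j#})))"
  have A: "A i' j \<in> carrier R" if "i' \<in> set (i # I)" "j \<in># M" for i' j
    using that Cons.prems(3) by (auto simp: setM)
  have W: "Wc A I (M - {#j#}) \<in> carrier R" for j
    using A by (intro Wc_closed) (auto dest: in_diffD)
  have hc: "h j \<in> carrier R" if "j \<in># M" for j using A[OF _ that] W by (simp add: h_def)
  have "Wc (\<lambda>i r. A i (c r)) (i # I) (mset_set S) = (\<Oplus>r\<in>S. A i (c r) \<otimes> Wc (\<lambda>i r. A i (c r)) I (mset_set S - {#r#}))"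
    using Cons.prems(1) by simp
  also have "\<dots> = (\<Oplus>r\<in>S. h (c r))"
  proof (rule finsum_cong')
    fix r assume r: "r \<in> S"
    have eq: "mset_set S - {#r#} = mset_set (S - {r})" using Cons.prems(1) r by (simp add: mset_set_Diff)
    have im: "image_mset c (mset_set (S - {r})) = M - {#c r#}"
      unfolding eq[symmetric] M_def using Cons.prems(1) r by (subst image_mset_Diff) auto
    have "Wc (\<lambda>i r. A i (c r)) I (mset_set S - {#r#}) = [cfac (M - {#c r#})] \<cdot> Wc A I (M - {#c r#})"
      unfolding eq im[symmetric] using Cons.prems r by (intro Cons.IH) auto
    then show "A i (c r) \<otimes> Wc (\<lambda>i r. A i (c r)) I (mset_set S - {#r#}) = h (c r)"
      using Cons.prems(3) r W by (simp add: h_def add_pow_rdistr)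
  qed (use hc setM in auto)
  also have "\<dots> = (\<Oplus>j\<in>c ` S. [card {r \<in> S. c r = j}] \<cdot> h j)"
    using hc setM Cons.prems(1) by (intro finsum_group) auto
  also have "\<dots> = (\<Oplus>j\<in>set_mset M. [cfac M] \<cdot> (A i j \<otimes> Wc A I (M - {#j#})))"
    unfolding setM[symmetric]
  proof (rule finsum_cong')
    fix j assume j: "j \<in> set_mset M"
    have "count M j = card {r \<in> S. c r = j}"
      unfolding M_def count_image_mset using Cons.prems(1)
      by (auto simp: vimage_def Int_def intro!: arg_cong[where f = card] sum.cong)
    then have "[card {r \<in> S. c r = j}] \<cdot> h j = [count M j] \<cdot> ([cfac (M - {#j#})] \<cdot> (A i j \<otimes> Wc A I (M - {#j#})))"
      by (simp add: h_def)
    also have "\<dots> = [cfac M] \<cdot> (A i j \<otimes> Wc A I (M - {#j#}))"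
      unfolding cfac_step[OF j] using A[OF _ j] W by (simp add: add.nat_pow_pow mult.commute)
    finally show "[card {r \<in> S. c r = j}] \<cdot> h j = [cfac M] \<cdot> (A i j \<otimes> Wc A I (M - {#j#}))" .
  qed (use A W in auto)
  also have "\<dots> = [cfac M] \<cdot> Wc A (i # I) M"
    unfolding Wc.simps using A W by (intro add_pow_finsum[symmetric]) auto
  finally show ?case by (simp only: M_def)
qed

lemma Wc_unit: "Wc (\<lambda>i j. if i = j then \<one> else \<zero>) I m = (if mset I = m then \<one> else \<zero>)"
proof (induction I arbitrary: m)
  case Nil
  then show ?case by auto
next
  case (Cons i I)
  have "Wc (\<lambda>i j. if i = j then \<one> else \<zero>) (i # I) m =
    (\<Oplus>j\<in>set_mset m. if i = j then (if mset I = m - {#j#} then \<one> else \<zero>) else \<zero>)"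
    unfolding Wc.simps Cons.IH by (intro finsum_cong') auto
  also have "\<dots> = (if mset (i # I) = m then \<one> else \<zero>)"
  proof (cases "i \<in># m")
    case True
    then have "(\<Oplus>j\<in>set_mset m. if i = j then (if mset I = m - {#j#} then \<one> else \<zero>) else \<zero>) = (if mset I = m - {#i#} then \<one> else \<zero>)"
      by (intro finsum_singleton) auto
    moreover have "mset I = m - {#i#} \<longleftrightarrow> mset (i # I) = m" using True by auto
    ultimately show ?thesis by simp
  next
    case False
    then have "(\<Oplus>j\<in>set_mset m. if i = j then (if mset I = m - {#j#} then \<one> else \<zero>) else \<zero>) = (\<Oplus>j\<in>set_mset m. \<zero>)"
      by (intro finsum_cong') auto
    then show ?thesis using False by (auto simp: finsum_zero)
  qed
  finally show ?case .
qed

definition colupd :: "(nat \<Rightarrow> nat \<Rightarrow> 'a) \<Rightarrow> nat \<Rightarrow> (nat \<Rightarrow> 'a) \<Rightarrow> nat \<Rightarrow> nat \<Rightarrow> 'a" where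
  "colupd A r w i j = (if j = r then w i else A i j)"

abbreviation uvec :: "nat \<Rightarrow> nat \<Rightarrow> 'a" where "uvec k \<equiv> \<lambda>i. if k = i then \<one> else \<zero>"

lemma Wc_colupd_notin: "r \<notin># m \<Longrightarrow> (\<And>i j. i \<in> set I \<Longrightarrow> j \<in># m \<Longrightarrow> A i j \<in> carrier R) \<Longrightarrow> Wc (colupd A r w) I m = Wc A I m"
  by (rule Wc_cong) (auto simp: colupd_def)

text \<open>Each summand of the expansion uses column r exactly once: either in the current row,
  after which the rest no longer involves w, or in a later one, covered by induction.\<close>

lemma Wc_lin_col:
  assumes "set I \<subseteq> {..<n}" "length I = size m" "count m r = 1"
    "\<And>i. i < n \<Longrightarrow> w i \<in> carrier R" "\<And>i j. i < n \<Longrightarrow> j \<in># m \<Longrightarrow> j \<noteq> r \<Longrightarrow> A i j \<in> carrier R"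
  shows "Wc (colupd A r w) I m = (\<Oplus>k\<in>{..<n}. w k \<otimes> Wc (colupd A r (uvec k)) I m)"
  using assms
proof (induction I arbitrary: m)
  case Nil
  then show ?case by auto
next
  case (Cons i I)
  have i: "i < n" using Cons.prems by simp
  have clw: "Wc (colupd A r w') I (m - {#j#}) \<in> carrier R"
    if w': "\<And>i. i < n \<Longrightarrow> w' i \<in> carrier R" for w' j
  proof (rule Wc_closed)
    fix i' j' assume "i' \<in> set I" "j' \<in># m - {#j#}"
    then have "i' < n" "j' \<in># m" using Cons.prems(1) by (auto dest: in_diffD)
    then show "colupd A r w' i' j' \<in> carrier R" using w' Cons.prems(5) by (simp add: colupd_def)
  qed
  have clu: "Wc (colupd A r (uvec k)) I (m - {#j#}) \<in> carrier R" for k j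
    by (rule clw) simp
  have clA: "colupd A r w' i j \<in> carrier R" if "j \<in># m" "\<And>i. i < n \<Longrightarrow> w' i \<in> carrier R" for j w'
    using that Cons.prems(5) i by (simp add: colupd_def)
  have clAu: "colupd A r (uvec k) i j \<in> carrier R" if "j \<in># m" for j k
    using that by (rule clA) simp
  have step: "colupd A r w i j \<otimes> Wc (colupd A r w) I (m - {#j#}) =
      (\<Oplus>k\<in>{..<n}. w k \<otimes> (colupd A r (uvec k) i j \<otimes> Wc (colupd A r (uvec k)) I (m - {#j#})))" if j: "j \<in># m" for j
  proof (cases "j = r")
    case True
    have rn: "r \<notin># m - {#r#}" using Cons.prems(3) by (simp add: not_in_iff)
    have eq: "Wc (colupd A r w') I (m - {#r#}) = Wc A I (m - {#r#})" for w'
    proof (rule Wc_colupd_notin[OF rn])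
      fix i' j' assume "i' \<in> set I" "j' \<in># m - {#r#}"
      then have "i' < n" "j' \<in># m" "j' \<noteq> r" using Cons.prems(1) rn by (auto dest: in_diffD)
      then show "A i' j' \<in> carrier R" using Cons.prems(5) by simp
    qed
    have cA: "Wc A I (m - {#r#}) \<in> carrier R" using clw[of w r] Cons.prems(4) unfolding eq by auto
    have "(\<Oplus>k\<in>{..<n}. w k \<otimes> (colupd A r (uvec k) i j \<otimes> Wc (colupd A r (uvec k)) I (m - {#j#}))) =
       (\<Oplus>k\<in>{..<n}. if i = k then w k \<otimes> Wc A I (m - {#r#}) else \<zero>)"
      unfolding True eq using cA Cons.prems(4) by (intro finsum_cong') (auto simp: colupd_def)
    also have "\<dots> = w i \<otimes> Wc A I (m - {#r#})"
      using cA Cons.prems(4) i by (intro finsum_singleton) auto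
    finally show ?thesis unfolding True eq by (simp add: colupd_def)
  next
    case False
    have IH: "Wc (colupd A r w) I (m - {#j#}) = (\<Oplus>k\<in>{..<n}. w k \<otimes> Wc (colupd A r (uvec k)) I (m - {#j#}))"
    proof (rule Cons.IH)
      show "length I = size (m - {#j#})" using Cons.prems(2) size_Suc_Diff1[OF j] by auto
      show "count (m - {#j#}) r = 1" using Cons.prems(3) False by simp
    qed (use Cons.prems in \<open>auto dest: in_diffD\<close>)
    have Aj: "A i j \<in> carrier R" using Cons.prems(5)[OF i j False] .
    have "colupd A r w i j \<otimes> Wc (colupd A r w) I (m - {#j#}) = (\<Oplus>k\<in>{..<n}. A i j \<otimes> (w k \<otimes> Wc (colupd A r (uvec k)) I (m - {#j#})))"
      unfolding IH using False Aj clu Cons.prems(4) by (simp add: colupd_def finsum_rdistr Pi_def)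
    also have "\<dots> = (\<Oplus>k\<in>{..<n}. w k \<otimes> (colupd A r (uvec k) i j \<otimes> Wc (colupd A r (uvec k)) I (m - {#j#})))"
      using False Aj clu Cons.prems(4) by (intro finsum_cong') (auto simp: colupd_def m_lcomm)
    finally show ?thesis .
  qed
  have "Wc (colupd A r w) (i # I) m = (\<Oplus>j\<in>set_mset m. \<Oplus>k\<in>{..<n}. w k \<otimes> (colupd A r (uvec k) i j \<otimes> Wc (colupd A r (uvec k)) I (m - {#j#})))"
    unfolding Wc.simps using step clAu clu Cons.prems(4) by (intro finsum_cong') (auto intro!: finsum_closed)
  also have "\<dots> = (\<Oplus>k\<in>{..<n}. \<Oplus>j\<in>set_mset m. w k \<otimes> (colupd A r (uvec k) i j \<otimes> Wc (colupd A r (uvec k)) I (m - {#j#})))"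
    using clAu clu Cons.prems(4) by (intro finsum_swap) auto
  also have "\<dots> = (\<Oplus>k\<in>{..<n}. w k \<otimes> Wc (colupd A r (uvec k)) (i # I) m)"
    unfolding Wc.simps using clAu clu Cons.prems(4)
    by (intro finsum_cong') (auto simp: finsum_rdistr Pi_def intro!: finsum_closed)
  finally show ?case .
qed

end

section \<open>Correctness of the algorithm\<close>

lemma index_bound: "a < m \<Longrightarrow> b < k \<Longrightarrow> a * k + b < m * (k :: nat)"
proof -
  assume "a < m" "b < k"
  then have "a * k + b < Suc a * k" by simp
  also have "\<dots> \<le> m * k" using \<open>a < m\<close> by (intro mult_right_mono) auto
  finally show ?thesis .
qed

context cring
begin

lemma lin_subst_support:
  assumes g: "g \<in> polys R n D" and A: "\<And>i j. i < n \<Longrightarrow> j < n \<Longrightarrow> A i j \<in> carrier R"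
    and m: "\<not> set_mset m \<subseteq> {..<n}"
  shows "lin_subst R n g A m = \<zero>"
proof -
  let ?P = "mpoly_ring R {..<n}"
  interpret P: abelian_monoid ?P by (rule abelian_monoid_mpoly)
  have gp: "g \<in> pset {..<n}" using g by (simp add: polys_def mpoly_simps)
  note gc = pset_cc[OF gp]
  have "indexed_const (g b) \<otimes>\<^bsub>?P\<^esub> (\<Otimes>\<^bsub>?P\<^esub>i\<in>{..<n}. linear_form R n (A i) [^]\<^bsub>?P\<^esub> count b i) \<in> carrier ?P"
    if b: "g b \<noteq> \<zero>" for b
  proof -
    let ?I = "rev (sorted_list_of_multiset b)"
    have I: "set ?I \<subseteq> {..<n}" using pset_support[OF gp b] by simp
    have eq: "(\<Otimes>\<^bsub>?P\<^esub>i\<in>{..<n}. linear_form R n (A i) [^]\<^bsub>?P\<^esub> count b i) = prodL n A ?I"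
      using finprod_prodL[OF A I] by simp
    have pI: "prodL n A ?I \<in> pset {..<n}" using prodL_pset[OF A I] by simp
    have cst: "indexed_const (g b) \<in> pset {..<n}" using gc by (intro indexed_pset.indexed_const) auto
    show ?thesis unfolding eq unfolding mpoly_simps by (rule conv_closed[OF cst pI])
  qed
  then have "lin_subst R n g A \<in> carrier ?P"
    unfolding lin_subst_def Let_def by (intro P.finsum_closed) auto
  then show ?thesis using pset_support[of "lin_subst R n g A" "{..<n}" m] m by (auto simp: mpoly_simps)
qed

end

lemma (in fin_field) polys_PS: "f \<in> polys R n D \<Longrightarrow> f \<in> PS n D"
proof -
  assume f: "f \<in> polys R n D"
  then have p: "f \<in> pset {..<n}" by (simp add: polys_def mpoly_simps)
  have "f m = \<zero>" if "m \<notin> monomials n D" for m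
    using that f pset_support[OF p, of m] by (auto simp: monomials_def polys_def)
  then show "f \<in> PS n D" using pset_carrier[OF p] by (auto simp: PS_def PiE_dflt_def)
qed

text \<open>f ranges over \<open>PS\<close>, where random polynomials live, and field elements are
  the numbers below q, as in the input tables.\<close>

locale iso_input = fin_field F for F :: "nat ring" (structure) +
  fixes n :: nat and D :: "nat set" and f g :: "nat multiset \<Rightarrow> nat"
  assumes carr: "carrier F = {..<q}" and n: "1 \<le> n" and finD: "finite D"
    and f: "f \<in> PS n D" and g: "g \<in> polys F n D"
begin

abbreviation \<sigma> :: state where "\<sigma> \<equiv> input_state F q n D f g"
abbreviation ks :: "nat list" where "ks \<equiv> sorted_list_of_set D"

lemma in_vals [simp]: "inq \<sigma> = q" "inn \<sigma> = n" "in0 \<sigma> = \<zero>" "in1 \<sigma> = \<one>"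
  by (simp_all add: inq_def inn_def in0_def in1_def input_state_def scalar_def)

lemma carr_lt: "a \<in> carrier F \<longleftrightarrow> a < q" using carr by auto

lemma fad_eq [simp]: "a \<in> carrier F \<Longrightarrow> b \<in> carrier F \<Longrightarrow> fad \<sigma> a b = a \<oplus> b"
  unfolding fad_def in_vals using nth_concat_table[of a q b q "\<lambda>a b. a \<oplus> b"] index_bound[of a q b q]
  by (simp add: input_state_def array_def carr_lt)

lemma fmu_eq [simp]: "a \<in> carrier F \<Longrightarrow> b \<in> carrier F \<Longrightarrow> fmu \<sigma> a b = a \<otimes> b"
  unfolding fmu_def in_vals using nth_concat_table[of a q b q "\<lambda>a b. a \<otimes> b"] index_bound[of a q b q]
  by (simp add: input_state_def array_def carr_lt)

lemma fsum_eq: "(\<And>t. t < m \<Longrightarrow> h t \<in> carrier F) \<Longrightarrow> fsum \<sigma> m h = (\<Oplus>t\<in>{..<m}. h t)"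
proof (induction m)
  case 0
  then show ?case by (simp add: fsum_def)
next
  case (Suc m)
  have "fsum \<sigma> (Suc m) h = fad \<sigma> (fsum \<sigma> m h) (h m)" by (simp add: fsum_def)
  also have "\<dots> = (\<Oplus>t\<in>{..<m}. h t) \<oplus> h m" using Suc by (simp add: Pi_def)
  also have "\<dots> = (\<Oplus>t\<in>{..<Suc m}. h t)"
    unfolding lessThan_Suc using Suc.prems by (subst finsum_insert) (auto simp: a_comm Pi_def)
  finally show ?case .
qed

lemma fsb_eq [simp]:
  assumes "a \<in> carrier F" "b \<in> carrier F" shows "fsb \<sigma> a b = a \<ominus> b"
  unfolding fsb_def in_vals
proof (rule search_unique)
  show "fad \<sigma> (a \<ominus> b) b = a" using assms by (simp add: minus_eq a_assoc l_neg)
  show "a \<ominus> b < q" using assms carr_lt[of "a \<ominus> b"] by simp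
  fix j assume "fad \<sigma> j b = a" "j < q"
  then have "j \<in> carrier F" "j \<oplus> b = a" using assms by (auto simp: carr_lt)
  then show "j = a \<ominus> b" using assms by (auto simp: minus_eq a_assoc r_neg)
qed

lemma fdv_eq [simp]:
  assumes "a \<in> carrier F" "b \<in> carrier F" "b \<noteq> \<zero>" shows "fdv \<sigma> a b = a \<otimes> inv b"
  unfolding fdv_def in_vals
proof (rule search_unique)
  have u: "inv b \<in> carrier F" "inv b \<otimes> b = \<one>" "b \<otimes> inv b = \<one>" using assms by (auto simp: field_Units)
  show "fmu \<sigma> (a \<otimes> inv b) b = a" using assms u by (simp add: m_assoc)
  show "a \<otimes> inv b < q" using assms u carr_lt[of "a \<otimes> inv b"] by simp
  fix j assume "fmu \<sigma> j b = a" "j < q"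
  then have "j \<in> carrier F" "j \<otimes> b = a" using assms by (auto simp: carr_lt)
  then show "j = a \<otimes> inv b" using assms u by (auto simp: m_assoc)
qed

lemma valid: "valid_input \<sigma>"
proof -
  have q: "2 \<le> q" by (rule q_ge_2)
  have qn: "q \<le> q ^ n" using q n self_le_power[of q n] by simp
  have "n < 2 ^ n" by simp
  also have "(2::nat) ^ n \<le> q ^ n" using q by (intro power_mono) auto
  finally have nn: "n \<le> q ^ n" by simp
  have c: "a \<le> q ^ n" if "a \<in> carrier F" for a using that qn by (simp add: carr_lt)
  have gP: "g \<in> PS n D" using g by (rule polys_PS)
  have arr: "array xs i \<le> q ^ n" if "set xs \<subseteq> carrier F" for xs i
    using that c by (simp add: array_def) (metis nth_mem subsetD)
  have 1: "set [a \<oplus> b. a \<leftarrow> [0..<q], b \<leftarrow> [0..<q]] \<subseteq> carrier F" "set [a \<otimes> b. a \<leftarrow> [0..<q], b \<leftarrow> [0..<q]] \<subseteq> carrier F"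
    by (auto simp: carr_lt[symmetric])
  have 2: "set (map f xs) \<subseteq> carrier F" "set (map g xs) \<subseteq> carrier F" for xs
    using PS_carrier[OF f] PS_carrier[OF gP] by auto
  have "\<sigma> x i \<le> q ^ n" for x i
    unfolding input_state_def fun_upd_apply
    using arr[OF 1(1)] arr[OF 1(2)] arr[OF 2(1)] arr[OF 2(2)] c[of \<zero>] c[of \<one>] qn nn by (simp add: scalar_def)
  then show ?thesis using q n by (simp add: valid_input_def)
qed

lemma coeff_lookup:
  assumes "k \<in> D" "J \<in> DL n k"
  shows "\<sigma> ''f'' (offs ks \<sigma> k + idx J) = f (mset J)" "\<sigma> ''g'' (offs ks \<sigma> k + idx J) = g (mset J)"
proof -
  have i: "idx J < length (degree_monos n k)" "degree_monos n k ! idx J = mset J" using idx_nth[OF assms(2)] by auto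
  have "sorted_wrt (<) ks" by simp
  moreover have "k \<in> set ks" using assms finD by simp
  ultimately have "offs ks \<sigma> k + idx J < length (monomial_list n D) \<and> monomial_list n D ! (offs ks \<sigma> k + idx J) = mset J"
    using concat_nth[of ks k "idx J" "degree_monos n"] i unfolding offs_def in_vals cnt_eq monomial_list_def by simp
  then show "\<sigma> ''f'' (offs ks \<sigma> k + idx J) = f (mset J)" "\<sigma> ''g'' (offs ks \<sigma> k + idx J) = g (mset J)"
    by (simp_all add: input_state_def array_def)
qed

text \<open>Skipping entries already seen leaves one summand for each value; the tail from k on
  accounts for the values not occurring before k.\<close>

lemma foldr_first_occurrences:
  assumes "\<And>r. r < length T \<Longrightarrow> h r = hh (T ! r)" "\<And>j. j \<in> set T \<Longrightarrow> hh j \<in> carrier F" "k \<le> length T"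
  shows "foldr (\<lambda>r acc. if T ! r \<in> set (take r T) then acc else fad \<sigma> (h r) acc) [k..<length T] \<zero> =
    (\<Oplus>j\<in>set T - set (take k T). hh j)"
  using assms(3)
proof (induction k rule: inc_induct)
  case base
  then show ?case by simp
next
  case (step k)
  have tk: "set (take (Suc k) T) = insert (T ! k) (set (take k T))" using step by (simp add: take_Suc_conv_app_nth)
  have Tk: "T ! k \<in> set T" using step by simp
  have cl: "(\<Oplus>j\<in>S. hh j) \<in> carrier F" if "S \<subseteq> set T" for S using that assms(2) by (intro finsum_closed) auto
  show ?case
  proof (cases "T ! k \<in> set (take k T)")
    case True
    then show ?thesis using step tk by (simp add: upt_conv_Cons insert_absorb)
  next
    case False
    then have "set T - set (take k T) = insert (T ! k) (set T - set (take (Suc k) T))" unfolding tk using Tk by auto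
    moreover have "(\<Oplus>j\<in>insert (T ! k) (set T - set (take (Suc k) T)). hh j) =
        hh (T ! k) \<oplus> (\<Oplus>j\<in>set T - set (take (Suc k) T). hh j)"
      using tk assms(2) Tk by (intro finsum_insert) auto
    ultimately show ?thesis using step False cl[of "set T - set (take (Suc k) T)"] assms(1)[of k] assms(2)[OF Tk]
      by (simp add: upt_conv_Cons)
  qed
qed

text \<open>Tags act as column indices of a matrix A; columns with equal tags must have equal
  entries, which is implicit in the second assumption.\<close>

lemma per_eq:
  assumes "length I = length J"
    "\<And>i x. i \<in> set I \<Longrightarrow> x \<in> set J \<Longrightarrow> ent \<sigma> l (fst (snd x)) (snd (snd x)) i = A i (fst x)"
    "\<And>i x. i \<in> set I \<Longrightarrow> x \<in> set J \<Longrightarrow> A i (fst x) \<in> carrier F"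
  shows "per \<sigma> l I J = Wc A I (mset (map fst J))"
  using assms
proof (induction I arbitrary: J)
  case Nil
  then show ?case by simp
next
  case (Cons i I)
  define T where "T = map fst J"
  have len: "length J = length T" by (simp add: T_def)
  define hh where "hh = (\<lambda>j. A i j \<otimes> Wc A I (mset T - {#j#}))"
  define h where "h = (\<lambda>r. fmu \<sigma> (ent \<sigma> l (fst (snd (J ! r))) (snd (snd (J ! r))) i) (per \<sigma> l I (take r J @ drop (Suc r) J)))"
  have W: "Wc A I (mset T - {#j#}) \<in> carrier F" for j
    using Cons.prems(3) by (intro Wc_closed) (auto simp: T_def dest!: in_diffD)
  have hhc: "hh j \<in> carrier F" if "j \<in> set T" for j
    using that W Cons.prems(3)[of i] by (auto simp: hh_def T_def)
  have h: "h r = hh (T ! r)" if r: "r < length T" for r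
  proof -
    have rJ: "r < length J" "J ! r \<in> set J" using r by (auto simp: T_def)
    have sub: "set (take r J @ drop (Suc r) J) \<subseteq> set J" by (auto dest: in_set_takeD in_set_dropD)
    have J: "J = take r J @ J ! r # drop (Suc r) J" using rJ by (simp add: id_take_nth_drop)
    have "mset T = mset (map fst (take r J @ J ! r # drop (Suc r) J))" unfolding T_def by (subst J) (rule refl)
    then have ms: "mset (map fst (take r J @ drop (Suc r) J)) = mset T - {#T ! r#}" using rJ by (simp add: T_def)
    have "per \<sigma> l I (take r J @ drop (Suc r) J) = Wc A I (mset (map fst (take r J @ drop (Suc r) J)))"
    proof (rule Cons.IH)
      show "length I = length (take r J @ drop (Suc r) J)" using Cons.prems(1) rJ by simp
    qed (use sub Cons.prems in auto)
    then have "per \<sigma> l I (take r J @ drop (Suc r) J) = Wc A I (mset T - {#T ! r#})" unfolding ms .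
    then show ?thesis using Cons.prems(2)[of i, OF _ rJ(2)] Cons.prems(3)[of i, OF _ rJ(2)] W rJ
      by (simp add: h_def hh_def T_def)
  qed
  have "per \<sigma> l (i # I) J = foldr (\<lambda>r acc. if T ! r \<in> set (take r T) then acc else fad \<sigma> (h r) acc) [0..<length T] \<zero>"
    unfolding per.simps h_def[symmetric] len in_vals by (rule foldr_cong) (auto simp: T_def take_map h_def)
  also have "\<dots> = (\<Oplus>j\<in>set T. hh j)"
    using foldr_first_occurrences[of T h hh 0] h hhc by simp
  finally show ?case by (simp add: hh_def T_def)
qed

lemma cof_eq:
  assumes J: "length J = k"
    and p: "\<And>I. I \<in> DL n k \<Longrightarrow> \<sigma> x (off + idx I) = p (mset I)" "\<And>m. p m \<in> carrier F"
    and e: "\<And>i x. i < n \<Longrightarrow> x \<in> set J \<Longrightarrow> ent \<sigma> l (fst (snd x)) (snd (snd x)) i = A i (fst x)"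
    and A: "\<And>i x. i < n \<Longrightarrow> x \<in> set J \<Longrightarrow> A i (fst x) \<in> carrier F"
  shows "cof \<sigma> x off k l J = (\<Oplus>I\<in>DL n k. p (mset I) \<otimes> Wc A I (mset (map fst J)))"
proof -
  let ?X = "{x. x < n ^ k \<and> desc (digs n k x)}"
  define h where "h = (\<lambda>I. p (mset I) \<otimes> Wc A I (mset (map fst J)))"
  have n0: "0 < n" using n by simp
  have img: "digs n k ` ?X = DL n k" by (rule image_digs_desc[OF n0])
  have dl: "digs n k x \<in> DL n k" if "x \<in> ?X" for x unfolding img[symmetric] using that by (rule imageI)
  have Wcl: "Wc A I (mset (map fst J)) \<in> carrier F" if "I \<in> DL n k" for I
    using that A by (intro Wc_closed) (auto simp: DL_def)
  have hc: "h I \<in> carrier F" if "I \<in> DL n k" for I using Wcl[OF that] p(2) by (simp add: h_def)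
  have tm: "fmu \<sigma> (\<sigma> x (off + idx (digs n k c))) (per \<sigma> l (digs n k c) J) = h (digs n k c)" if c: "c \<in> ?X" for c
  proof -
    note I = dl[OF c]
    have "per \<sigma> l (digs n k c) J = Wc A (digs n k c) (mset (map fst J))"
      using I e A J by (intro per_eq) (auto simp: DL_def)
    then show ?thesis using p(1)[OF I] p(2) Wcl[OF I] by (simp add: h_def)
  qed
  have "cof \<sigma> x off k l J = (\<Oplus>c\<in>{..<n ^ k}. if c \<in> ?X then h (digs n k c) else \<zero>)"
  proof -
    have "cof \<sigma> x off k l J = fsum \<sigma> (n ^ k) (\<lambda>c. if desc (digs n k c) then fmu \<sigma> (\<sigma> x (off + idx (digs n k c))) (per \<sigma> l (digs n k c) J) else \<zero>)"
      by (simp only: cof_def in_vals)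
    also have "\<dots> = (\<Oplus>c\<in>{..<n ^ k}. if desc (digs n k c) then fmu \<sigma> (\<sigma> x (off + idx (digs n k c))) (per \<sigma> l (digs n k c) J) else \<zero>)"
      using tm hc dl by (intro fsum_eq) auto
    also have "\<dots> = (\<Oplus>c\<in>{..<n ^ k}. if c \<in> ?X then h (digs n k c) else \<zero>)"
      using tm hc dl by (intro finsum_cong') auto
    finally show ?thesis .
  qed
  also have "\<dots> = (\<Oplus>c\<in>?X. h (digs n k c))"
    using hc dl by (intro add.finprod_mono_neutral_cong_right) auto
  also have "\<dots> = (\<Oplus>I\<in>digs n k ` ?X. h I)"
    using hc inj_on_subset[OF inj_digs[OF n0], of ?X k] unfolding img[symmetric] by (intro finsum_reindex[symmetric]) auto
  finally show ?thesis unfolding img h_def .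
qed

end

section \<open>Behaviour of the matrices and the linear system under substitution\<close>

context fin_field
begin

abbreviation idm :: "nat \<Rightarrow> nat \<Rightarrow> 'a" where "idm \<equiv> \<lambda>i j. if i = j then \<one> else \<zero>"

lemma mm_cong:
  assumes "mat n A" "mat n B" "\<And>i j. i < n \<Longrightarrow> j < n \<Longrightarrow> A' i j = A i j" "\<And>i j. i < n \<Longrightarrow> j < n \<Longrightarrow> B' i j = B i j"
    "i < n" "j < n"
  shows "mm n A' B' i j = mm n A B i j"
  unfolding mm_def using assms by (intro finsum_cong') (auto simp: matD)

lemma mm_assoc:
  assumes "mat n A" "mat n B" "mat n C" "i < n" "j < n"
  shows "mm n (mm n A B) C i j = mm n A (mm n B C) i j"
proof -
  define x where "x = (\<lambda>l\<in>{..<n}. C l j)"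
  have x: "x \<in> V n" unfolding x_def using assms by (intro restrict_V) (simp add: matD)
  have col: "mm n B' C k j = mv n B' x k" if "k < n" "mat n B'" for B' k
    unfolding mm_def mv_apply[OF that(1)] x_def using that assms by (intro finsum_cong') (auto simp: matD)
  have "mm n (mm n A B) C i j = mv n (mm n A B) x i" using assms by (intro col mm_closed)
  also have "\<dots> = mv n A (mv n B x) i" using mv_mm[OF assms(1,2) x] by simp
  also have "\<dots> = mm n A (mm n B C) i j"
    unfolding mv_apply[OF assms(4)] unfolding mm_def[of n A]
    using assms mm_closed[OF assms(2,3)] by (intro finsum_cong') (auto simp: col[symmetric] matD)
  finally show ?thesis .
qed

lemma mat_idm [simp]: "mat n idm" by (simp add: mat_def)

lemma mm_idm: assumes "mat n A" "i < n" "j < n" shows "mm n idm A i j = A i j" "mm n A idm i j = A i j"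
proof -
  have "mm n idm A i j = (\<Oplus>l\<in>{..<n}. if i = l then A l j else \<zero>)"
    unfolding mm_def using assms by (intro finsum_cong') (auto simp: matD)
  also have "\<dots> = A i j" using assms by (intro finsum_singleton) (auto simp: matD)
  finally show "mm n idm A i j = A i j" .
  have "mm n A idm i j = (\<Oplus>l\<in>{..<n}. if j = l then A i l else \<zero>)"
    unfolding mm_def using assms by (intro finsum_cong') (auto simp: matD)
  also have "\<dots> = A i j" using assms by (intro finsum_singleton) (auto simp: matD)
  finally show "mm n A idm i j = A i j" .
qed

lemma mm_tr: assumes "mat n A" "mat n B" "i < n" "j < n" shows "mm n (tr A) (tr B) i j = mm n B A j i"
  unfolding mm_def using assms by (intro finsum_cong') (auto simp: matD m_comm)

text \<open>With \<open>B\<close> the inverse of \<open>A\<close>, the map \<open>(A1, C1) \<mapsto> (B A1, A\<^sup>T C1)\<close> carries solutions of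
  \<open>G i A1 = C1 F i\<close> to solutions of \<open>F i A2 = C2 F i\<close>.\<close>

lemma card_sol_transformed:
  assumes A: "mat n A" and B: "mat n B" and AB: "\<And>i j. i < n \<Longrightarrow> j < n \<Longrightarrow> mm n A B i j = idm i j"
    and G: "\<And>i. i < c \<Longrightarrow> mat n (G i)" and F: "\<And>i. i < c \<Longrightarrow> mat n (F i)"
    and FG: "\<And>i k j. i < c \<Longrightarrow> k < n \<Longrightarrow> j < n \<Longrightarrow> F i k j = mm n (tr A) (mm n (G i) A) k j"
  shows "card {(A1, C1). A1 \<in> M n \<and> C1 \<in> M n \<and> (\<forall>i<c. \<forall>k<n. \<forall>j<n. mm n (G i) A1 k j = mm n C1 (F i) k j)}
    \<le> card (sol n c F)" (is "card ?S \<le> _")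
proof -
  define rs where "rs = (\<lambda>Y. \<lambda>i\<in>{..<n}. \<lambda>j\<in>{..<n}. Y i j :: 'a)"
  have rs_M: "rs Y \<in> M n" if "mat n Y" for Y
    using that unfolding rs_def M_def by (auto intro!: restrict_V simp: matD)
  have rs_ap: "rs Y i j = Y i j" if "i < n" "j < n" for Y i j using that by (simp add: rs_def)
  note trA = mat_tr[OF A]
  have BAtr: "mm n (tr B) (tr A) i j = idm i j" if "i < n" "j < n" for i j
    using mm_tr[OF B A that] AB[OF that(2,1)] by auto
  define \<phi> where "\<phi> = (\<lambda>(A1, C1). (rs (mm n B A1), rs (mm n (tr A) C1)))"
  have inj: "inj_on \<phi> ?S"
  proof (rule inj_onI)
    fix p p' assume "p \<in> ?S" "p' \<in> ?S" and eq: "\<phi> p = \<phi> p'"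
    then obtain A1 C1 A2 C2 where p: "p = (A1, C1)" "p' = (A2, C2)" and m: "A1 \<in> M n" "C1 \<in> M n" "A2 \<in> M n" "C2 \<in> M n"
      by auto
    have 1: "mm n B A1 i j = mm n B A2 i j" "mm n (tr A) C1 i j = mm n (tr A) C2 i j" if "i < n" "j < n" for i j
    proof -
      have "rs (mm n B A1) i j = rs (mm n B A2) i j" "rs (mm n (tr A) C1) i j = rs (mm n (tr A) C2) i j"
        using eq unfolding p \<phi>_def by simp_all
      then show "mm n B A1 i j = mm n B A2 i j" "mm n (tr A) C1 i j = mm n (tr A) C2 i j" using that by (simp_all add: rs_ap)
    qed
    have canc: "Y i j = mm n P (mm n Q Y) i j"
      if "mat n P" "mat n Q" "mat n Y" "\<And>i j. i < n \<Longrightarrow> j < n \<Longrightarrow> mm n P Q i j = idm i j" "i < n" "j < n" for P Q Y i j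
    proof -
      have "mm n P (mm n Q Y) i j = mm n (mm n P Q) Y i j" using that by (simp add: mm_assoc)
      also have "\<dots> = mm n idm Y i j" using that by (intro mm_cong) auto
      finally show ?thesis using that by (simp add: mm_idm)
    qed
    have "A1 = A2"
    proof (rule M_eqI[OF m(1,3)])
      fix i j assume ij: "i < n" "j < n"
      have "A1 i j = mm n A (mm n B A1) i j" using canc[OF A B M_mat[OF m(1)] AB ij] .
      also have "\<dots> = mm n A (mm n B A2) i j" by (rule mm_cong[OF A mm_closed[OF B M_mat[OF m(3)]]]) (use 1 ij in auto)
      also have "\<dots> = A2 i j" using canc[OF A B M_mat[OF m(3)] AB ij] by simp
      finally show "A1 i j = A2 i j" .
    qed
    moreover have "C1 = C2"
    proof (rule M_eqI[OF m(2,4)])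
      fix i j assume ij: "i < n" "j < n"
      have "C1 i j = mm n (tr B) (mm n (tr A) C1) i j" using canc[OF mat_tr[OF B] trA M_mat[OF m(2)] BAtr ij] .
      also have "\<dots> = mm n (tr B) (mm n (tr A) C2) i j"
        by (rule mm_cong[OF mat_tr[OF B] mm_closed[OF trA M_mat[OF m(4)]]]) (use 1 ij in auto)
      also have "\<dots> = C2 i j" using canc[OF mat_tr[OF B] trA M_mat[OF m(4)] BAtr ij] by simp
      finally show "C1 i j = C2 i j" .
    qed
    ultimately show "p = p'" using p by simp
  qed
  have img: "\<phi> ` ?S \<subseteq> sol n c F"
  proof (rule image_subsetI)
    fix p assume "p \<in> ?S"
    then obtain A1 C1 where p: "p = (A1, C1)" and m: "A1 \<in> M n" "C1 \<in> M n"
      and e: "\<And>i k j. i < c \<Longrightarrow> k < n \<Longrightarrow> j < n \<Longrightarrow> mm n (G i) A1 k j = mm n C1 (F i) k j"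
      by auto
    note mA = M_mat[OF m(1)] and mC = M_mat[OF m(2)]
    note BA1 = mm_closed[OF B mA] and AC1 = mm_closed[OF trA mC]
    have "mm n (F i) (rs (mm n B A1)) k j = mm n (rs (mm n (tr A) C1)) (F i) k j" if i: "i < c" and kj: "k < n" "j < n" for i k j
    proof -
      note GA = mm_closed[OF G[OF i] A]
      have "mm n (F i) (rs (mm n B A1)) k j = mm n (mm n (tr A) (mm n (G i) A)) (mm n B A1) k j"
        using mm_closed[OF trA GA] BA1 kj FG[OF i] by (intro mm_cong) (auto simp: rs_ap)
      also have "\<dots> = mm n (tr A) (mm n (mm n (G i) A) (mm n B A1)) k j" using trA GA BA1 kj by (rule mm_assoc)
      also have "\<dots> = mm n (tr A) (mm n C1 (F i)) k j"
      proof (rule mm_cong[OF trA mm_closed[OF mC F[OF i]] _ _ kj])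
        fix a b assume ab: "a < n" "b < n"
        have inn1: "mm n A (mm n B A1) a' b' = A1 a' b'" if "a' < n" "b' < n" for a' b'
        proof -
          have "mm n A (mm n B A1) a' b' = mm n (mm n A B) A1 a' b'" using that A B mA by (simp add: mm_assoc)
          also have "\<dots> = mm n idm A1 a' b'" using that AB mA by (intro mm_cong) auto
          finally show ?thesis using that mA by (simp add: mm_idm)
        qed
        have "mm n (mm n (G i) A) (mm n B A1) a b = mm n (G i) (mm n A (mm n B A1)) a b"
          using G[OF i] A BA1 ab by (rule mm_assoc)
        also have "\<dots> = mm n (G i) A1 a b" using G[OF i] mA inn1 ab by (intro mm_cong) auto
        finally show "mm n (mm n (G i) A) (mm n B A1) a b = mm n C1 (F i) a b" using e[OF i ab] by simp
      qed simp
      also have "\<dots> = mm n (mm n (tr A) C1) (F i) k j" using trA mC F[OF i] kj by (rule mm_assoc[symmetric])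
      also have "\<dots> = mm n (rs (mm n (tr A) C1)) (F i) k j"
        using AC1 F[OF i] kj by (intro mm_cong[symmetric]) (auto simp: rs_ap)
      finally show ?thesis .
    qed
    then show "\<phi> p \<in> sol n c F" using rs_M[OF BA1] rs_M[OF AC1] by (simp add: p \<phi>_def sol_def)
  qed
  show ?thesis using inj img by (rule card_inj_on_le) simp
qed

text \<open>The polarization of the degree d part of p, evaluated at the d columns of B: a sum of
  permanents in which all columns are distinguished.\<close>

definition SL :: "nat \<Rightarrow> nat \<Rightarrow> (nat multiset \<Rightarrow> 'a) \<Rightarrow> (nat \<Rightarrow> nat \<Rightarrow> 'a) \<Rightarrow> 'a" where
  "SL n d p B = (\<Oplus>I\<in>DL n d. p (mset I) \<otimes> Wc B I (mset_set {..<d}))"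

lemma Wc_DL_closed:
  assumes "I \<in> DL n d" "\<And>i r. i < n \<Longrightarrow> r < d \<Longrightarrow> B i r \<in> carrier R"
  shows "Wc B I (mset_set {..<d}) \<in> carrier R"
  using assms by (intro Wc_closed) (auto simp: DL_def)

lemma SL_closed:
  assumes "\<And>m. p m \<in> carrier R" "\<And>i r. i < n \<Longrightarrow> r < d \<Longrightarrow> B i r \<in> carrier R"
  shows "SL n d p B \<in> carrier R"
  unfolding SL_def using assms Wc_DL_closed[of _ n d B] by (intro finsum_closed) auto

lemma SL_cong:
  assumes "\<And>m. p m \<in> carrier R" "\<And>i r. i < n \<Longrightarrow> r < d \<Longrightarrow> B i r \<in> carrier R"
    "\<And>i r. i < n \<Longrightarrow> r < d \<Longrightarrow> B' i r = B i r"
  shows "SL n d p B' = SL n d p B"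
  unfolding SL_def
proof (rule finsum_cong')
  fix I assume I: "I \<in> DL n d"
  have "Wc B' I (mset_set {..<d}) = Wc B I (mset_set {..<d})" using assms I by (intro Wc_cong) (auto simp: DL_def)
  then show "p (mset I) \<otimes> Wc B' I (mset_set {..<d}) = p (mset I) \<otimes> Wc B I (mset_set {..<d})" by simp
qed (use assms(1) Wc_DL_closed[OF _ assms(2)] in auto)

lemma SL_lin_col:
  assumes p: "\<And>m. p m \<in> carrier R" and r: "r < d" and w: "\<And>i. i < n \<Longrightarrow> w i \<in> carrier R"
    and B: "\<And>i j. i < n \<Longrightarrow> j < d \<Longrightarrow> j \<noteq> r \<Longrightarrow> B i j \<in> carrier R"
  shows "SL n d p (colupd B r w) = (\<Oplus>k\<in>{..<n}. w k \<otimes> SL n d p (colupd B r (uvec k)))"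
proof -
  let ?S = "mset_set {..<d}"
  have W: "Wc (colupd B r (uvec k)) I ?S \<in> carrier R" if "I \<in> DL n d" for I k
    using B by (intro Wc_DL_closed[OF that]) (auto simp: colupd_def)
  have "SL n d p (colupd B r w) = (\<Oplus>I\<in>DL n d. \<Oplus>k\<in>{..<n}. w k \<otimes> (p (mset I) \<otimes> Wc (colupd B r (uvec k)) I ?S))"
    unfolding SL_def
  proof (rule finsum_cong')
    fix I assume I: "I \<in> DL n d"
    have "Wc (colupd B r w) I ?S = (\<Oplus>k\<in>{..<n}. w k \<otimes> Wc (colupd B r (uvec k)) I ?S)"
      using I r w B by (intro Wc_lin_col) (auto simp: DL_def)
    then have "p (mset I) \<otimes> Wc (colupd B r w) I ?S = (\<Oplus>k\<in>{..<n}. p (mset I) \<otimes> (w k \<otimes> Wc (colupd B r (uvec k)) I ?S))"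
      using W[OF I] w p by (simp add: finsum_rdistr Pi_def)
    also have "\<dots> = (\<Oplus>k\<in>{..<n}. w k \<otimes> (p (mset I) \<otimes> Wc (colupd B r (uvec k)) I ?S))"
      using W[OF I] w p by (intro finsum_cong') (auto simp: m_lcomm)
    finally show "p (mset I) \<otimes> Wc (colupd B r w) I ?S = (\<Oplus>k\<in>{..<n}. w k \<otimes> (p (mset I) \<otimes> Wc (colupd B r (uvec k)) I ?S))" .
  qed (use W w p in \<open>auto intro!: finsum_closed\<close>)
  also have "\<dots> = (\<Oplus>k\<in>{..<n}. \<Oplus>I\<in>DL n d. w k \<otimes> (p (mset I) \<otimes> Wc (colupd B r (uvec k)) I ?S))"
    using W w p by (intro finsum_swap) auto
  also have "\<dots> = (\<Oplus>k\<in>{..<n}. w k \<otimes> SL n d p (colupd B r (uvec k)))"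
    unfolding SL_def using W w p by (intro finsum_cong') (auto simp: finsum_rdistr Pi_def intro!: finsum_closed)
  finally show ?thesis .
qed

definition slc :: "nat \<Rightarrow> nat \<Rightarrow> nat \<Rightarrow> nat \<Rightarrow> nat \<Rightarrow> nat" where
  "slc d i u v r = (if r < d - 2 then i * (d - 2) + r else if r = d - 2 then u else v)"

lemma image_slc: assumes "3 \<le> d" shows "image_mset (slc d i u v) (mset_set {..<d}) = slm d i u v"
proof -
  have "{..<d} = set ([0..<d - 2] @ [d - 2, d - 1])" using assms by auto
  then have "mset_set {..<d} = mset ([0..<d - 2] @ [d - 2, d - 1])" using assms by (subst mset_set_set[symmetric]) auto
  moreover have "image_mset (slc d i u v) (mset [0..<d - 2]) = sl d i"
    unfolding sl_def mset_map by (intro image_mset_cong) (auto simp: slc_def)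
  moreover have "d - 1 \<noteq> d - 2" "\<not> d - 1 < d - 2" using assms by linarith+
  ultimately show ?thesis by (simp add: slm_def slc_def)
qed

lemma SL_slc:
  assumes d: "3 \<le> d" and p: "\<And>m. p m \<in> carrier R" and A: "\<And>k r. k < n \<Longrightarrow> r < n \<Longrightarrow> A k r \<in> carrier R"
    and lt: "\<And>r. r < d \<Longrightarrow> slc d i u v r < n"
  shows "SL n d p (\<lambda>k r. A k (slc d i u v r)) =
    [cfac (slm d i u v)] \<cdot> (\<Oplus>I\<in>DL n d. p (mset I) \<otimes> Wc A I (slm d i u v))"
proof -
  let ?m = "slm d i u v"
  have "\<forall>j\<in>#?m. j < n" unfolding image_slc[OF d, symmetric] using lt by auto
  then have W: "Wc A I ?m \<in> carrier R" if "I \<in> DL n d" for I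
    using that A by (intro Wc_closed) (auto simp: DL_def)
  have "SL n d p (\<lambda>k r. A k (slc d i u v r)) = (\<Oplus>I\<in>DL n d. [cfac ?m] \<cdot> (p (mset I) \<otimes> Wc A I ?m))"
    unfolding SL_def
  proof (rule finsum_cong')
    fix I assume I: "I \<in> DL n d"
    have "Wc (\<lambda>k r. A k (slc d i u v r)) I (mset_set {..<d}) = [cfac ?m] \<cdot> Wc A I ?m"
      unfolding image_slc[OF d, symmetric] using I A lt by (intro Wc_cols) (auto simp: DL_def)
    then show "p (mset I) \<otimes> Wc (\<lambda>k r. A k (slc d i u v r)) I (mset_set {..<d}) = [cfac ?m] \<cdot> (p (mset I) \<otimes> Wc A I ?m)"
      using W[OF I] p by (simp add: add_pow_rdistr)
  qed (use W p in auto)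
  also have "\<dots> = [cfac ?m] \<cdot> (\<Oplus>I\<in>DL n d. p (mset I) \<otimes> Wc A I ?m)"
    using W p by (intro add_pow_finsum[symmetric]) auto
  finally show ?thesis .
qed

text \<open>At unit vectors all but one of the summands of the polarization vanish.\<close>

lemma SL_unit:
  assumes d: "3 \<le> d" and p: "\<And>m. p m \<in> carrier R" and lt: "\<And>r. r < d \<Longrightarrow> slc d i u v r < n"
  shows "SL n d p (\<lambda>k r. idm k (slc d i u v r)) = Fm d p i u v"
proof -
  let ?m = "slm d i u v"
  have "?m \<in> mset ` DL n d" unfolding mset_image_DL image_slc[OF d, symmetric] using lt by auto
  then obtain J where J: "J \<in> DL n d" "mset J = ?m" by auto
  have "(\<Oplus>I\<in>DL n d. p (mset I) \<otimes> Wc idm I ?m) = (\<Oplus>I\<in>DL n d. if J = I then p (mset I) else \<zero>)"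
    unfolding Wc_unit using p J inj_onD[OF mset_inj_DL, of J _ n d] by (intro finsum_cong') auto
  also have "\<dots> = p ?m" using J p by (subst finsum_singleton) auto
  finally have "(\<Oplus>I\<in>DL n d. p (mset I) \<otimes> Wc idm I ?m) = p ?m" .
  then show ?thesis using SL_slc[OF d p _ lt, of idm] unfolding Fm_def by simp
qed

text \<open>Polarizing after the substitution A amounts to evaluating the polarization of g at
  columns of A; the same factor \<open>cfac\<close> appears on both sides.\<close>

lemma SL_lin_subst:
  assumes d: "3 \<le> d" and g: "g \<in> polys R n D" and A: "mat n A" and lt: "\<And>r. r < d \<Longrightarrow> slc d i u v r < n"
  shows "SL n d g (\<lambda>k r. A k (slc d i u v r)) = Fm d (lin_subst R n g A) i u v"
proof -
  have gc: "g m \<in> carrier R" for m using PS_carrier[OF polys_PS[OF g]] .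
  have sz: "size (slm d i u v) = d" using d by (simp add: slm_def)
  have "set_mset (slm d i u v) \<subseteq> {..<n}" unfolding image_slc[OF d, symmetric] using lt by auto
  then have "lin_subst R n g A (slm d i u v) = (\<Oplus>I\<in>DL n d. g (mset I) \<otimes> Wc A I (slm d i u v))"
    using lin_subst_apply[OF g, of A "slm d i u v"] A by (simp add: sz matD)
  then show ?thesis using SL_slc[OF d gc _ lt, of A] A by (simp add: Fm_def matD)
qed

text \<open>The columns of the i-th block are kept, and two free arguments run through unit vectors:
  the matrix \<open>G i\<close> of the linear system.\<close>

definition Gm :: "nat \<Rightarrow> nat \<Rightarrow> (nat multiset \<Rightarrow> 'a) \<Rightarrow> (nat \<Rightarrow> nat \<Rightarrow> 'a) \<Rightarrow> nat \<Rightarrow> nat \<Rightarrow> nat \<Rightarrow> 'a" where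
  "Gm n d g A i u v = SL n d g (colupd (colupd (\<lambda>k r. A k (i * (d - 2) + r)) (d - 2) (uvec u)) (d - 1) (uvec v))"

lemma Gm_closed:
  assumes g: "\<And>m. g m \<in> carrier R" and A: "\<And>k r. k < n \<Longrightarrow> r < c * (d - 2) \<Longrightarrow> A k r \<in> carrier R" and i: "i < c"
  shows "Gm n d g A i u v \<in> carrier R"
  unfolding Gm_def
  by (rule SL_closed[OF g]) (use A i index_bound[of i c _ "d - 2"] in \<open>auto simp: colupd_def\<close>)

text \<open>The congruence F = A^T G A. The polarization at columns of A is expanded into unit
  vectors in its last two arguments by linearity.\<close>

lemma Fm_lin_subst:
  assumes d: "3 \<le> d" and g: "g \<in> polys R n D" and A: "mat n A" and c: "c * (d - 2) \<le> n" and i: "i < c"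
    and u: "u < n" and v: "v < n"
  shows "Fm d (lin_subst R n g A) i u v = mm n (tr A) (mm n (Gm n d g A i) A) u v"
proof -
  have gc: "g m \<in> carrier R" for m using PS_carrier[OF polys_PS[OF g]] .
  have ib: "i * (d - 2) + r < n" if "r < d - 2" for r using index_bound[OF i that] c by simp
  have lt: "slc d i u v r < n" for r using ib u v by (auto simp: slc_def)
  define B where "B = (\<lambda>k r. A k (i * (d - 2) + r))"
  have Bc: "B k r \<in> carrier R" if "k < n" "r < d - 2" for k r using that ib A by (auto simp: B_def matD)
  have Gc: "Gm n d g A i k l \<in> carrier R" for k l
    using c A i by (intro Gm_closed[OF gc, of _ c]) (auto simp: matD)
  \<comment> \<open>Linearity is stated for the outermost column update, so the two updates have to
    be interchanged before the second expansion.\<close>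
  have sw: "colupd (colupd B (d - 2) x) (d - 1) y = colupd (colupd B (d - 1) y) (d - 2) x" for x y
    using d by (intro ext) (auto simp: colupd_def)
  have "Fm d (lin_subst R n g A) i u v = SL n d g (\<lambda>k r. A k (slc d i u v r))"
    by (rule SL_lin_subst[OF d g A lt, symmetric])
  also have "\<dots> = SL n d g (colupd (colupd B (d - 1) (\<lambda>k. A k v)) (d - 2) (\<lambda>k. A k u))"
    using lt A by (intro SL_cong[symmetric] gc) (auto simp: colupd_def B_def slc_def matD)
  also have "\<dots> = (\<Oplus>k\<in>{..<n}. A k u \<otimes> SL n d g (colupd (colupd B (d - 1) (\<lambda>k. A k v)) (d - 2) (uvec k)))"
    using d A u v Bc by (intro SL_lin_col gc) (auto simp: colupd_def matD)
  also have "\<dots> = (\<Oplus>k\<in>{..<n}. A k u \<otimes> (\<Oplus>l\<in>{..<n}. A l v \<otimes> Gm n d g A i k l))"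
  proof (rule finsum_cong')
    fix k assume "k \<in> {..<n}"
    have "SL n d g (colupd (colupd B (d - 1) (\<lambda>k. A k v)) (d - 2) (uvec k)) = (\<Oplus>l\<in>{..<n}. A l v \<otimes> Gm n d g A i k l)"
      unfolding sw[symmetric] Gm_def B_def[symmetric]
      using d A u v Bc by (intro SL_lin_col gc) (auto simp: colupd_def matD)
    then show "A k u \<otimes> SL n d g (colupd (colupd B (d - 1) (\<lambda>k. A k v)) (d - 2) (uvec k)) = A k u \<otimes> (\<Oplus>l\<in>{..<n}. A l v \<otimes> Gm n d g A i k l)"
      by simp
  qed (use A Gc u v in \<open>auto intro!: finsum_closed m_closed simp: matD\<close>)
  also have "\<dots> = mm n (tr A) (mm n (Gm n d g A i) A) u v"
  proof -
    have "mm n (Gm n d g A i) A k v = (\<Oplus>l\<in>{..<n}. A l v \<otimes> Gm n d g A i k l)" for k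
      unfolding mm_def using A Gc v by (intro finsum_cong') (auto simp: matD m_comm)
    then show ?thesis by (simp add: mm_def[of n "tr A"])
  qed
  finally show ?thesis .
qed

end

section \<open>Elimination for a sequence of linear functionals\<close>

context fin_field
begin

definition lc :: "nat \<Rightarrow> nat set \<Rightarrow> (nat \<Rightarrow> 'a) \<Rightarrow> (nat \<Rightarrow> nat \<Rightarrow> 'a) \<Rightarrow> nat \<Rightarrow> 'a" where
  "lc nn S a Z = (\<lambda>x\<in>{..<nn}. \<Oplus>r\<in>S. a r \<otimes> Z r x)"

definition lin_fn :: "nat \<Rightarrow> ((nat \<Rightarrow> 'a) \<Rightarrow> 'a) \<Rightarrow> bool" where
  "lin_fn nn l \<longleftrightarrow> (\<forall>x\<in>V nn. l x \<in> carrier R) \<and>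
     (\<forall>x\<in>V nn. \<forall>y\<in>V nn. \<forall>a\<in>carrier R. l (vlin nn x a y) = l x \<oplus> a \<otimes> l y)"

lemma lc_V: "(\<And>r. r \<in> S \<Longrightarrow> a r \<in> carrier R) \<Longrightarrow> (\<And>r. r \<in> S \<Longrightarrow> Z r \<in> V nn) \<Longrightarrow> lc nn S a Z \<in> V nn"
  unfolding lc_def by (intro restrict_V finsum_closed) (auto intro!: m_closed intro: V_mem)

lemma lin_fn_vz: assumes "lin_fn nn l" shows "l (vz nn) = \<zero>"
proof -
  have c: "l (vz nn) \<in> carrier R" using assms by (auto simp: lin_fn_def)
  have "l (vlin nn (vz nn) \<one> (vz nn)) = l (vz nn) \<oplus> \<one> \<otimes> l (vz nn)"
    using assms unfolding lin_fn_def by (meson one_closed vz_V)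
  then have "l (vz nn) = l (vz nn) \<oplus> l (vz nn)" using c by (simp add: vlin_vz)
  then show ?thesis using c by (metis add.r_cancel_one')
qed

lemma lin_fn_lc:
  assumes l: "lin_fn nn l" and "finite S" "\<And>r. r \<in> S \<Longrightarrow> a r \<in> carrier R" "\<And>r. r \<in> S \<Longrightarrow> Z r \<in> V nn"
  shows "l (lc nn S a Z) = (\<Oplus>r\<in>S. a r \<otimes> l (Z r))"
  using assms(2-)
proof (induction S)
  case empty
  have "lc nn {} a Z = vz nn" by (simp add: lc_def vz_def)
  then show ?case using lin_fn_vz[OF l] by simp
next
  case (insert r S)
  have lcV: "lc nn S a Z \<in> V nn" using insert by (intro lc_V) auto
  have Zl: "l (Z r') \<in> carrier R" if "r' \<in> insert r S" for r' using insert that l by (auto simp: lin_fn_def)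
  have "lc nn (insert r S) a Z = vlin nn (lc nn S a Z) (a r) (Z r)"
  proof (rule V_eqI[of _ nn])
    show "lc nn (insert r S) a Z \<in> V nn" using insert by (intro lc_V) auto
    show "vlin nn (lc nn S a Z) (a r) (Z r) \<in> V nn" using insert lcV by (intro vlin_V) auto
    fix x assume x: "x < nn"
    have "(\<Oplus>r'\<in>insert r S. a r' \<otimes> Z r' x) = a r \<otimes> Z r x \<oplus> (\<Oplus>r'\<in>S. a r' \<otimes> Z r' x)"
      using insert x by (intro finsum_insert) (auto intro!: m_closed intro: V_mem)
    also have "\<dots> = (\<Oplus>r'\<in>S. a r' \<otimes> Z r' x) \<oplus> a r \<otimes> Z r x"
      using insert x by (intro a_comm finsum_closed) (auto intro!: m_closed intro: V_mem)
    finally show "lc nn (insert r S) a Z x = vlin nn (lc nn S a Z) (a r) (Z r) x" using x by (simp add: lc_def)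
  qed
  then have "l (lc nn (insert r S) a Z) = l (lc nn S a Z) \<oplus> a r \<otimes> l (Z r)"
    using l lcV insert.prems by (simp add: lin_fn_def)
  also have "\<dots> = a r \<otimes> l (Z r) \<oplus> (\<Oplus>r\<in>S. a r \<otimes> l (Z r))"
    using insert Zl by (auto simp: Pi_def intro!: a_comm m_closed finsum_closed)
  also have "\<dots> = (\<Oplus>r\<in>insert r S. a r \<otimes> l (Z r))"
    using insert Zl by (intro finsum_insert[symmetric]) auto
  finally show ?case .
qed

text \<open>The rows of \<open>Z\<close> with index in \<open>S\<close> form a basis of the common kernel of the functionals
  \<open>L 0, \<dots>, L (t - 1)\<close>, and the coordinates of a vector with respect to it are its entries at \<open>S\<close>.\<close>

definition kernel_basis :: "nat \<Rightarrow> (nat \<Rightarrow> (nat \<Rightarrow> 'a) \<Rightarrow> 'a) \<Rightarrow> nat \<Rightarrow> nat set \<Rightarrow> (nat \<Rightarrow> nat \<Rightarrow> 'a) \<Rightarrow> bool" where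
  "kernel_basis nn L t S Z \<longleftrightarrow> S \<subseteq> {..<nn} \<and> (\<forall>r<nn. Z r \<in> V nn) \<and> (\<forall>r<nn. r \<notin> S \<longrightarrow> Z r = vz nn) \<and>
     (\<forall>r\<in>S. \<forall>r'\<in>S. Z r r' = (if r = r' then \<one> else \<zero>)) \<and> (\<forall>r<nn. \<forall>t'<t. L t' (Z r) = \<zero>) \<and>
     (\<forall>z\<in>V nn. (\<forall>t'<t. L t' z = \<zero>) \<longrightarrow> z = lc nn S z Z)"

lemma kernel_basisD:
  assumes "kernel_basis nn L t S Z"
  shows "S \<subseteq> {..<nn}" "finite S" "\<And>r. r < nn \<Longrightarrow> Z r \<in> V nn" "\<And>r. r < nn \<Longrightarrow> r \<notin> S \<Longrightarrow> Z r = vz nn"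
    "\<And>r r'. r \<in> S \<Longrightarrow> r' \<in> S \<Longrightarrow> Z r r' = (if r = r' then \<one> else \<zero>)"
    "\<And>r t'. r < nn \<Longrightarrow> t' < t \<Longrightarrow> L t' (Z r) = \<zero>"
    "\<And>z. z \<in> V nn \<Longrightarrow> (\<And>t'. t' < t \<Longrightarrow> L t' z = \<zero>) \<Longrightarrow> z = lc nn S z Z"
    "\<And>r. r \<in> S \<Longrightarrow> Z r \<in> V nn" "\<And>r. r \<in> S \<Longrightarrow> r < nn"
  using assms finite_subset[of S "{..<nn}"] unfolding kernel_basis_def by auto

lemma kernel_basis_0:
  assumes "\<And>r x. r < nn \<Longrightarrow> x < nn \<Longrightarrow> Z r x = (if r = x then \<one> else \<zero>)" "\<And>r. r < nn \<Longrightarrow> Z r \<in> V nn"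
  shows "kernel_basis nn L 0 {..<nn} Z"
proof -
  have "z = lc nn {..<nn} z Z" if z: "z \<in> V nn" for z
  proof (rule V_eqI[OF z])
    show "lc nn {..<nn} z Z \<in> V nn" using z assms(2) by (intro lc_V) (auto simp: V_mem)
    fix x assume x: "x < nn"
    have "(\<Oplus>r\<in>{..<nn}. z r \<otimes> Z r x) = (\<Oplus>r\<in>{..<nn}. if x = r then z r else \<zero>)"
      using z assms(1) x by (intro finsum_cong') (auto simp: V_mem)
    also have "\<dots> = z x" using z x by (subst finsum_singleton) (auto simp: V_mem)
    finally show "z x = lc nn {..<nn} z Z x" using x by (simp add: lc_def)
  qed
  then show ?thesis using assms by (auto simp: kernel_basis_def)
qed

lemma kernel_basis_skip:
  assumes "kernel_basis nn L t S Z" "\<And>r. r < nn \<Longrightarrow> L t (Z r) = \<zero>"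
  shows "kernel_basis nn L (Suc t) S Z"
  using assms unfolding kernel_basis_def by (auto simp: less_Suc_eq)

text \<open>Row p is subtracted from all rows so as to make the new functional vanish on them. It
  annihilates itself in the process, so that p leaves S and the matrix keeps its format.\<close>

lemma kernel_basis_pivot:
  assumes K: "kernel_basis nn L t S Z" and lin: "\<And>t'. t' \<le> t \<Longrightarrow> lin_fn nn (L t')"
    and p: "p < nn" "L t (Z p) \<noteq> \<zero>"
    and Z': "\<And>r. r < nn \<Longrightarrow> Z' r = vlin nn (Z r) (\<ominus> (L t (Z r) \<otimes> inv (L t (Z p)))) (Z p)"
  shows "kernel_basis nn L (Suc t) (S - {p}) Z'"
proof -
  note D = kernel_basisD[OF K]
  define l where "l = L t"
  have l: "lin_fn nn l" using lin by (simp add: l_def)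
  have lZ: "l (Z r) \<in> carrier R" if "r < nn" for r using l D(3)[OF that] by (auto simp: lin_fn_def)
  define u where "u = inv (l (Z p))"
  have u: "u \<in> carrier R" "l (Z p) \<otimes> u = \<one>" "u \<otimes> l (Z p) = \<one>"
    using lZ[OF p(1)] p(2) by (auto simp: u_def l_def field_Units)
  define c where "c = (\<lambda>r. \<ominus> (l (Z r) \<otimes> u))"
  have c: "c r \<in> carrier R" if "r < nn" for r using lZ[OF that] u by (simp add: c_def)
  have Z'': "Z' r = vlin nn (Z r) (c r) (Z p)" if "r < nn" for r
    using Z'[OF that] by (simp add: c_def u_def l_def)
  have Z'V: "Z' r \<in> V nn" if "r < nn" for r using Z''[OF that] D(3) c that p by (simp add: vlin_V)
  have pS: "p \<in> S"
  proof (rule ccontr)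
    assume "p \<notin> S"
    then have "Z p = vz nn" by (rule D(4)[OF p(1)])
    then show False using p(2) lin_fn_vz[OF l] by (simp add: l_def)
  qed
  have Z'p: "Z' p = vz nn"
  proof (rule V_eqI[OF Z'V[OF p(1)] vz_V])
    fix x assume x: "x < nn"
    have zc: "Z p x \<in> carrier R" using D(3)[OF p(1)] x by (rule V_mem)
    have "c p = \<ominus> \<one>" using u by (simp add: c_def)
    then show "Z' p x = vz nn x" using Z''[OF p(1)] x zc by (simp add: l_minus r_neg)
  qed
  have L0: "L t' (Z' r) = \<zero>" if r: "r < nn" and t': "t' < Suc t" for r t'
  proof -
    have li: "L t' (Z' r) = L t' (Z r) \<oplus> c r \<otimes> L t' (Z p)"
      using lin[of t'] t' D(3) r p c[OF r] by (simp add: Z'' lin_fn_def)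
    show ?thesis
    proof (cases "t' < t")
      case True
      then show ?thesis using li D(6) r p c[OF r] by simp
    next
      case False
      then have "t' = t" using t' by simp
      then have "L t' (Z' r) = l (Z r) \<oplus> c r \<otimes> l (Z p)" using li by (simp add: l_def)
      also have "\<dots> = \<zero>" using lZ[OF r] lZ[OF p(1)] u by (simp add: c_def l_minus m_assoc r_neg)
      finally show ?thesis .
    qed
  qed
  have repr: "z = lc nn (S - {p}) z Z'" if z: "z \<in> V nn" and sol: "\<And>t'. t' < Suc t \<Longrightarrow> L t' z = \<zero>" for z
  proof (rule V_eqI[OF z])
    have zc: "z r \<in> carrier R" if "r < nn" for r using z that by (rule V_mem)
    show "lc nn (S - {p}) z Z' \<in> V nn" using Z'V D(9) zc by (intro lc_V) auto
    have zl: "z = lc nn S z Z" using D(7)[OF z] sol by simp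
    have "l z = (\<Oplus>r\<in>S. z r \<otimes> l (Z r))"
      using lin_fn_lc[OF l D(2), of z Z] D(8,9) zc unfolding zl[symmetric] by simp
    then have s0: "(\<Oplus>r\<in>S. z r \<otimes> l (Z r)) = \<zero>" using sol[of t] by (simp add: l_def)
    fix x assume x: "x < nn"
    have Zc: "Z r x \<in> carrier R" "Z' r x \<in> carrier R" if "r < nn" for r using V_mem[OF D(3)[OF that] x] V_mem[OF Z'V[OF that] x] by simp_all
    have "(\<Oplus>r\<in>S - {p}. z r \<otimes> Z' r x) = (\<Oplus>r\<in>S. z r \<otimes> Z' r x)"
      using D(2,9) Zc zc Z'p x pS by (intro add.finprod_mono_neutral_cong_left) auto
    \<comment> \<open>The corrections add up to a multiple of the sum of z r l (Z r), which is l z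
      and hence zero: the coordinates of z stay the same.\<close>
    also have "\<dots> = (\<Oplus>r\<in>S. z r \<otimes> Z r x \<oplus> (\<ominus> (u \<otimes> Z p x)) \<otimes> (z r \<otimes> l (Z r)))"
    proof (rule finsum_cong')
      fix r assume "r \<in> S"
      then have r: "r < nn" by (rule D(9))
      have "Z' r x = Z r x \<oplus> c r \<otimes> Z p x" using Z''[OF r] x by simp
      moreover have "z r \<otimes> (c r \<otimes> Z p x) = (\<ominus> (u \<otimes> Z p x)) \<otimes> (z r \<otimes> l (Z r))"
        using zc[OF r] lZ[OF r] u(1) Zc(1)[OF p(1)] by (simp add: c_def l_minus r_minus m_ac)
      ultimately show "z r \<otimes> Z' r x = z r \<otimes> Z r x \<oplus> (\<ominus> (u \<otimes> Z p x)) \<otimes> (z r \<otimes> l (Z r))"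
        using zc[OF r] Zc(1)[OF r] Zc(1)[OF p(1)] c[OF r] by (simp add: r_distr)
    qed (use zc Zc lZ D(9) u p in auto)
    also have "\<dots> = (\<Oplus>r\<in>S. z r \<otimes> Z r x) \<oplus> (\<ominus> (u \<otimes> Z p x)) \<otimes> (\<Oplus>r\<in>S. z r \<otimes> l (Z r))"
      using zc Zc lZ D(2,9) u p by (intro finsum_lin) auto
    also have "\<dots> = (\<Oplus>r\<in>S. z r \<otimes> Z r x)"
      unfolding s0 using zc Zc D(9) u p by (simp add: Pi_def)
    also have "\<dots> = lc nn S z Z x" using x by (simp add: lc_def)
    also have "\<dots> = z x" using zl by simp
    finally show "z x = lc nn (S - {p}) z Z' x" using x by (simp add: lc_def)
  qed
  have dlt: "Z' r r' = (if r = r' then \<one> else \<zero>)" if "r \<in> S - {p}" "r' \<in> S - {p}" for r r'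
  proof -
    have "r < nn" "r' < nn" using that D(9) by auto
    then have "Z' r r' = Z r r' \<oplus> c r \<otimes> Z p r'" using Z'' by simp
    \<comment> \<open>Row p vanishes at the other positions of S, so its subtraction preserves the
      identity pattern there.\<close>
    moreover have "Z p r' = \<zero>" using D(5)[OF pS, of r'] that by auto
    ultimately show ?thesis using D(5)[of r r'] c[OF \<open>r < nn\<close>] that by auto
  qed
  have out: "Z' r = vz nn" if r: "r < nn" "r \<notin> S - {p}" for r
  proof (cases "r = p")
    case False
    then have Zr: "Z r = vz nn" using r D(4) by simp
    then have "c r = \<zero>" using lin_fn_vz[OF l] u by (simp add: c_def)
    then show ?thesis using Zr D(3)[OF p(1)] unfolding Z''[OF r(1)] by (intro V_eqI[of _ nn]) (auto simp: vlin_V V_mem)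
  qed (use Z'p in simp)
  show ?thesis unfolding kernel_basis_def
    using D(1) Z'V out dlt L0 repr by (intro conjI allI ballI impI) auto
qed

text \<open>Entries at S can be prescribed freely within the kernel. Read backwards, a bound on the
  number of solutions bounds the number of coordinates to be guessed.\<close>

lemma card_kernel_basis:
  assumes K: "kernel_basis nn L t S Z" and lin: "\<And>t'. t' < t \<Longrightarrow> lin_fn nn (L t')"
  shows "q ^ card S \<le> card {z \<in> V nn. \<forall>t'<t. L t' z = \<zero>}"
proof -
  note D = kernel_basisD[OF K]
  let ?A = "S \<rightarrow>\<^sub>E carrier R"
  have at: "lc nn S a Z r = a r" if a: "a \<in> ?A" and r: "r \<in> S" for a r
  proof -
    have "(\<Oplus>r'\<in>S. a r' \<otimes> Z r' r) = (\<Oplus>r'\<in>S. if r = r' then a r' else \<zero>)"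
      using PiE_mem[OF a] r D(5) by (intro finsum_cong') auto
    also have "\<dots> = a r" using PiE_mem[OF a] r D(2) by (intro finsum_singleton) auto
    finally show ?thesis using D(9)[OF r] by (simp add: lc_def)
  qed
  have "card ?A \<le> card {z \<in> V nn. \<forall>t'<t. L t' z = \<zero>}"
  proof (rule card_inj_on_le[where f = "\<lambda>a. lc nn S a Z"])
    show "inj_on (\<lambda>a. lc nn S a Z) ?A"
    proof (rule inj_onI)
      fix a b assume a: "a \<in> ?A" and b: "b \<in> ?A" and eq: "lc nn S a Z = lc nn S b Z"
      show "a = b" using a b by (rule PiE_ext) (use at[OF a] at[OF b] eq in simp)
    qed
    show "(\<lambda>a. lc nn S a Z) ` ?A \<subseteq> {z \<in> V nn. \<forall>t'<t. L t' z = \<zero>}"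
    proof (rule image_subsetI, rule CollectI, intro conjI allI impI)
      fix a assume a: "a \<in> ?A"
      show "lc nn S a Z \<in> V nn" using a D(8) by (intro lc_V) auto
      fix t' assume t': "t' < t"
      have "L t' (lc nn S a Z) = (\<Oplus>r\<in>S. a r \<otimes> L t' (Z r))"
        using a D(8) by (intro lin_fn_lc lin[OF t'] D(2)) auto
      also have "\<dots> = (\<Oplus>r\<in>S. \<zero>)" using PiE_mem[OF a] D(6,9) t' by (intro finsum_cong') auto
      finally show "L t' (lc nn S a Z) = \<zero>" by (simp add: finsum_zero)
    qed
  qed simp
  then show ?thesis using D(2) by (simp add: card_PiE)
qed

end

section \<open>The acceptance test and the slices computed by the program\<close>

context iso_input
begin

lemma gc: "g m \<in> carrier F" using PS_carrier[OF polys_PS[OF g]] .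
lemma fc: "f m \<in> carrier F" using PS_carrier[OF f] .

definition Az :: "nat list \<Rightarrow> nat \<Rightarrow> nat \<Rightarrow> nat" where "Az z i j = lget z (i * n + j)"
definition Cz :: "nat list \<Rightarrow> nat \<Rightarrow> nat \<Rightarrow> nat" where "Cz z i j = lget z (n * n + (i * n + j))"

lemma chk_deg_iff:
  assumes k: "k \<in> D" and A: "mat n (Az z)"
  shows "chk_deg ks \<sigma> z k \<longleftrightarrow> (\<forall>m. set_mset m \<subseteq> {..<n} \<and> size m = k \<longrightarrow> f m = lin_subst F n g (Az z) m)"
proof -
  have n0: "0 < n" using n by simp
  have cof: "cof \<sigma> ''g'' (offs ks \<sigma> k) k z (map (\<lambda>a. (a, n, a)) I) = lin_subst F n g (Az z) (mset I)" if I: "I \<in> DL n k" for I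
  proof -
    have "cof \<sigma> ''g'' (offs ks \<sigma> k) k z (map (\<lambda>a. (a, n, a)) I) =
        (\<Oplus>I'\<in>DL n k. g (mset I') \<otimes> Wc (Az z) I' (mset (map fst (map (\<lambda>a. (a, n, a)) I))))"
      using I n0 A by (intro cof_eq coeff_lookup(2)[OF k] gc) (auto simp: DL_def ent_def Az_def mat_def)
    also have "\<dots> = (\<Oplus>I'\<in>DL n (size (mset I)). g (mset I') \<otimes> Wc (Az z) I' (mset I))"
      using I by (simp add: comp_def DL_def)
    also have "\<dots> = lin_subst F n g (Az z) (mset I)"
      using I A by (intro lin_subst_apply[OF g, symmetric]) (auto simp: DL_def matD)
    finally show ?thesis .
  qed
  have "chk_deg ks \<sigma> z k \<longleftrightarrow> (\<forall>I\<in>digs n k ` {x. x < n ^ k \<and> desc (digs n k x)}.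
      \<sigma> ''f'' (offs ks \<sigma> k + idx I) = cof \<sigma> ''g'' (offs ks \<sigma> k) k z (map (\<lambda>a. (a, n, a)) I))"
    unfolding chk_deg_def in_vals by blast
  also have "\<dots> \<longleftrightarrow> (\<forall>I\<in>DL n k. f (mset I) = lin_subst F n g (Az z) (mset I))"
    unfolding image_digs_desc[OF n0] using cof coeff_lookup(1)[OF k] by simp
  also have "\<dots> \<longleftrightarrow> (\<forall>m\<in>mset ` DL n k. f m = lin_subst F n g (Az z) m)" by simp
  finally show ?thesis unfolding mset_image_DL by simp
qed

text \<open>Coefficients not compared by the program vanish on both sides, because substitution
  preserves degrees and the set of variables.\<close>

lemma lin_subst_outside:
  assumes A: "mat n A" and "\<not> (set_mset m \<subseteq> {..<n} \<and> size m \<in> D)" shows "f m = lin_subst F n g A m"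
proof -
  have f0: "f m = \<zero>" using assms(2) f by (auto simp: PS_def PiE_dflt_def monomials_def)
  show ?thesis
  proof (cases "set_mset m \<subseteq> {..<n}")
    case False
    then show ?thesis using f0 lin_subst_support[OF g _ False] A by (simp add: matD)
  next
    case True
    have W: "Wc A I m \<in> carrier F" if "I \<in> DL n (size m)" for I
      using that True A by (intro Wc_closed) (auto simp: DL_def matD subset_iff)
    have "g (mset I) = \<zero>" if "I \<in> DL n (size m)" for I
      using that assms(2) True g by (auto simp: DL_def polys_def)
    moreover have "lin_subst F n g A m = (\<Oplus>I\<in>DL n (size m). g (mset I) \<otimes> Wc A I m)"
      by (rule lin_subst_apply[OF g _ True]) (simp add: matD[OF A])
    moreover have "(\<Oplus>I\<in>DL n (size m). g (mset I) \<otimes> Wc A I m) = (\<Oplus>I\<in>DL n (size m). \<zero>)"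
      by (rule finsum_cong') (use W calculation(1) in simp_all)
    ultimately show ?thesis using f0 by (simp add: finsum_zero)
  qed
qed

lemma accept_iff:
  assumes A: "mat n (Az z)" and C: "mat n (Cz z)"
  shows "accept ks \<sigma> z \<longleftrightarrow> (\<forall>i<n. \<forall>j<n. mm n (Az z) (tr (Cz z)) i j = idm i j \<and> mm n (tr (Cz z)) (Az z) i j = idm i j) \<and>
     f = lin_subst F n g (Az z)"
proof -
  have "chk_inv \<sigma> z \<longleftrightarrow> (\<forall>i<n. \<forall>j<n. mm n (Az z) (tr (Cz z)) i j = idm i j \<and> mm n (tr (Cz z)) (Az z) i j = idm i j)"
  proof -
    have "fsum \<sigma> n (\<lambda>k. fmu \<sigma> (Az z i k) (Cz z j k)) = mm n (Az z) (tr (Cz z)) i j"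
      "fsum \<sigma> n (\<lambda>k. fmu \<sigma> (Cz z k i) (Az z k j)) = mm n (tr (Cz z)) (Az z) i j" if "i < n" "j < n" for i j
      unfolding mm_def using that A C by (simp_all add: fsum_eq matD cong: finsum_cong)
    then show ?thesis unfolding chk_inv_def in_vals Cz_def[symmetric] unfolding Az_def[symmetric] by simp
  qed
  moreover have "(\<forall>k\<in>set ks. chk_deg ks \<sigma> z k) \<longleftrightarrow> f = lin_subst F n g (Az z)"
  proof
    assume "\<forall>k\<in>set ks. chk_deg ks \<sigma> z k"
    then have "f m = lin_subst F n g (Az z) m" if "set_mset m \<subseteq> {..<n}" "size m \<in> D" for m
      using chk_deg_iff[OF _ A, of "size m"] that finD by simp
    then show "f = lin_subst F n g (Az z)" using lin_subst_outside[OF A] by blast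
  next
    assume eq: "f = lin_subst F n g (Az z)"
    show "\<forall>k\<in>set ks. chk_deg ks \<sigma> z k" using chk_deg_iff[OF _ A] finD eq[symmetric] by simp
  qed
  ultimately show ?thesis unfolding accept_def by blast
qed

lemma accept_GL:
  assumes "mat n (Az z)" "mat n (Cz z)" "accept ks \<sigma> z"
  shows "Az z \<in> GL n F" "f = lin_subst F n g (Az z)"
proof -
  show "f = lin_subst F n g (Az z)" using assms accept_iff by blast
  have "mm n (Az z) (tr (Cz z)) i j = idm i j" "mm n (tr (Cz z)) (Az z) i j = idm i j" if "i < n" "j < n" for i j
    using assms accept_iff that by blast+
  then show "Az z \<in> GL n F" using assms(1,2) unfolding GL_def mm_def mat_def
    by (intro CollectI conjI exI[of _ "tr (Cz z)"]) auto
qed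

lemma slice_f:
  assumes d: "3 \<le> d" "d \<in> D" "c * (d - 2) \<le> n" and i: "i < c" and u: "u < n" and v: "v < n"
  shows "slice d ks \<sigma> ''f'' 0 l i u v = Fm d f i u v"
proof -
  let ?J = "map (\<lambda>r. (r, 0::nat, i * (d - 2) + r)) [0..<d - 2] @ [(d - 2, 0, u), (d - 1, 0, v)]"
  have ib: "i * (d - 2) + r < n" if "r < d - 2" for r using index_bound[OF i that] d by simp
  have lt: "slc d i u v r < n" for r using ib u v by (auto simp: slc_def)
  have d2: "\<not> d - 1 < d - 2" "d - 1 \<noteq> d - 2" "{..<d} = set ([0..<d - 2] @ [d - 2, d - 1])" using d by auto
  have ms: "mset (map fst ?J) = mset_set {..<d}"
    unfolding d2(3) using d2 by (subst mset_set_set) (auto simp: comp_def)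
  have "slice d ks \<sigma> ''f'' 0 l i u v = (\<Oplus>I\<in>DL n d. f (mset I) \<otimes> Wc (\<lambda>k r. idm k (slc d i u v r)) I (mset (map fst ?J)))"
    unfolding slice_def
  proof (rule cof_eq)
    fix k x assume k: "k < n" and x: "x \<in> set ?J"
    then consider r where "r < d - 2" "x = (r, 0, i * (d - 2) + r)" | "x = (d - 2, 0, u)" | "x = (d - 1, 0, v)" by auto
    then show "ent \<sigma> l (fst (snd x)) (snd (snd x)) k = idm k (slc d i u v (fst x))"
    proof cases
      case 1
      then show ?thesis by (simp add: slc_def ent_def eq_commute[of k])
    next
      case 2
      then show ?thesis by (simp add: slc_def ent_def eq_commute[of k])
    next
      case 3
      then show ?thesis using d2(1,2) by (simp add: slc_def ent_def eq_commute[of k])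
    qed
  qed (use d coeff_lookup(1)[OF d(2)] fc in auto)
  also have "\<dots> = Fm d f i u v" unfolding ms using SL_unit[OF d(1) fc lt] by (simp add: SL_def)
  finally show ?thesis .
qed

lemma slice_g:
  assumes d: "3 \<le> d" "d \<in> D" and i: "i < c"
    and l: "\<And>k r. k < n \<Longrightarrow> r < c * (d - 2) \<Longrightarrow> lget l (k * (c * (d - 2)) + r) = A k r"
    and A: "\<And>k r. k < n \<Longrightarrow> r < c * (d - 2) \<Longrightarrow> A k r \<in> carrier F"
  shows "slice d ks \<sigma> ''g'' (c * (d - 2)) l i u v = Gm n d g A i u v"
proof -
  let ?J = "map (\<lambda>r. (r, c * (d - 2), i * (d - 2) + r)) [0..<d - 2] @ [(d - 2, 0, u), (d - 1, 0, v)]"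
  let ?B = "colupd (colupd (\<lambda>k r. A k (i * (d - 2) + r)) (d - 2) (uvec u)) (d - 1) (uvec v)"
  have ib: "i * (d - 2) + r < c * (d - 2)" if "r < d - 2" for r using index_bound[OF i that] .
  \<comment> \<open>The row length must be nonzero, since row length 0 would mark the block columns
    as unit vectors.\<close>
  have d2: "d - 1 \<noteq> d - 2" "d - 2 \<noteq> d - 1" "{..<d} = set ([0..<d - 2] @ [d - 2, d - 1])" "c * (d - 2) \<noteq> 0" using d i by auto
  have ms: "mset (map fst ?J) = mset_set {..<d}"
    unfolding d2(3) using d2 by (subst mset_set_set) (auto simp: comp_def)
  have "slice d ks \<sigma> ''g'' (c * (d - 2)) l i u v = (\<Oplus>I\<in>DL n d. g (mset I) \<otimes> Wc ?B I (mset (map fst ?J)))"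
    unfolding slice_def
  proof (intro cof_eq coeff_lookup(2)[OF d(2)] gc)
    fix k x assume k: "k < n" and x: "x \<in> set ?J"
    then consider r where "r < d - 2" "x = (r, c * (d - 2), i * (d - 2) + r)" | "x = (d - 2, 0, u)" | "x = (d - 1, 0, v)" by auto
    then have "ent \<sigma> l (fst (snd x)) (snd (snd x)) k = ?B k (fst x) \<and> ?B k (fst x) \<in> carrier F"
    proof cases
      case 1
      moreover have "r \<noteq> d - 1" "r \<noteq> d - 2" using 1(1) by linarith+
      ultimately show ?thesis using d2(4) l[OF k ib[OF 1(1)]] A[OF k ib[OF 1(1)]] by (simp add: colupd_def ent_def del: One_nat_def)
    next
      case 2
      then show ?thesis using d2(2) by (simp add: colupd_def ent_def)
    next
      case 3
      then show ?thesis by (simp add: colupd_def ent_def)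
    qed
    then show "ent \<sigma> l (fst (snd x)) (snd (snd x)) k = ?B k (fst x)" "?B k (fst x) \<in> carrier F" by simp_all
  qed (use d in auto)
  then show ?thesis unfolding ms Gm_def SL_def .
qed

end

lemma div_index: "j < k \<Longrightarrow> (i * k + j) div k = (i :: nat)" "j < k \<Longrightarrow> (i * k + j) mod k = j"
  by simp_all

lemma lget_map: "x < k \<Longrightarrow> lget (map h [0..<k]) x = h x"
  by (simp add: lget_def)

lemma rank_less:
  assumes "finite S" "r \<in> S" "r < (r' :: nat)" shows "card (S \<inter> {..<r}) < card (S \<inter> {..<r'})"
  by (rule psubset_card_mono) (use assms in auto)

lemma rank_inj:
  assumes "finite S" "r \<in> S" "r' \<in> S" "card (S \<inter> {..<r}) = card (S \<inter> {..<(r' :: nat)})" shows "r = r'"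
  using rank_less[of S r r'] rank_less[of S r' r] assms by (cases r r' rule: linorder_cases) auto

lemma rank_bound: assumes "finite S" "r \<in> S" shows "card (S \<inter> {..<(r :: nat)}) < card S"
  by (rule psubset_card_mono) (use assms in auto)

section \<open>The elimination as carried out on arrays\<close>

context iso_input
begin

definition dm :: nat where "dm = 2 * (n * n)"

lemma dimz_eq [simp]: "dimz \<sigma> = dm" by (simp add: dimz_def dm_def)

lemma idx_dm: "u < n \<Longrightarrow> v < n \<Longrightarrow> u * n + v < dm" "u < n \<Longrightarrow> v < n \<Longrightarrow> n * n + (u * n + v) < dm"
  using index_bound[of u n v n] by (auto simp: dm_def)

definition rowv :: "nat list \<Rightarrow> nat \<Rightarrow> nat \<Rightarrow> nat" where
  "rowv Z r = (if r < dm then \<lambda>x\<in>{..<dm}. lget Z (r * dm + x) else vz dm)"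

lemma rowv_carrier: "rowv Z r \<in> V dm \<Longrightarrow> r < dm \<Longrightarrow> x < dm \<Longrightarrow> lget Z (r * dm + x) \<in> carrier F"
  using V_mem[of "rowv Z r" dm x] by (simp add: rowv_def)

context
  fixes d c :: nat and l :: "nat list"
  assumes d: "3 \<le> d" "d \<in> D" "c * (d - 2) \<le> n"
    and l: "\<And>k r. k < n \<Longrightarrow> r < c * (d - 2) \<Longrightarrow> lget l (k * (c * (d - 2)) + r) \<in> carrier F"
begin

definition Gs :: "nat \<Rightarrow> nat \<Rightarrow> nat \<Rightarrow> nat" where
  "Gs = Gm n d g (\<lambda>k r. lget l (k * (c * (d - 2)) + r))"

text \<open>The defect of equation t at the vector y of unknowns.\<close>

definition Lq :: "nat \<Rightarrow> (nat \<Rightarrow> nat) \<Rightarrow> nat" where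
  "Lq t y = (\<Oplus>u\<in>{..<n}. Gs (t div (n * n)) (t div n mod n) u \<otimes> y (u * n + t mod n)) \<ominus>
     (\<Oplus>u\<in>{..<n}. y (n * n + (t div n mod n * n + u)) \<otimes> Fm d f (t div (n * n)) u (t mod n))"

lemma Gs_eq: "Gs i u v = Gm n d g (\<lambda>k r. lget l (k * (c * (d - 2)) + r)) i u v"
  by (simp add: Gs_def)

lemma Lq_eq: "Lq t y = (\<Oplus>u\<in>{..<n}. Gs (t div (n * n)) (t div n mod n) u \<otimes> y (u * n + t mod n)) \<ominus>
     (\<Oplus>u\<in>{..<n}. y (n * n + (t div n mod n * n + u)) \<otimes> Fm d f (t div (n * n)) u (t mod n))"
  by (simp add: Lq_def)

lemma Gs_closed: "i < c \<Longrightarrow> Gs i u v \<in> carrier F"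
  unfolding Gs_def using l by (intro Gm_closed[OF gc, where c = c]) auto

lemma Fs_closed: "Fm d f i u v \<in> carrier F"
  using fc by (simp add: Fm_def)

lemma t_bounds: assumes "t < c * (n * n)" shows "t div (n * n) < c" "t div n mod n < n" "t mod n < n"
  using assms n by (simp_all add: less_mult_imp_div_less)

lemma Lq_closed: assumes "t < c * (n * n)" "y \<in> V dm" shows "Lq t y \<in> carrier F"
  unfolding Lq_def using t_bounds[OF assms(1)] assms(2)
  by (intro minus_closed finsum_closed) (auto intro!: m_closed Gs_closed Fs_closed V_mem[OF assms(2)] idx_dm)

lemma lin_fn_Lq: assumes t: "t < c * (n * n)" shows "lin_fn dm (Lq t)"
  unfolding lin_fn_def
proof (intro conjI ballI)
  show "Lq t x \<in> carrier F" if "x \<in> V dm" for x using t that by (rule Lq_closed)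
  fix x y a assume x: "x \<in> V dm" and y: "y \<in> V dm" and a: "a \<in> carrier F"
  note tb = t_bounds[OF t]
  define P where "P = (\<lambda>y. \<Oplus>u\<in>{..<n}. Gs (t div (n * n)) (t div n mod n) u \<otimes> y (u * n + t mod n))"
  define Q where "Q = (\<lambda>y. \<Oplus>u\<in>{..<n}. y (n * n + (t div n mod n * n + u)) \<otimes> Fm d f (t div (n * n)) u (t mod n))"
  have L: "Lq t y = P y \<ominus> Q y" for y by (simp add: Lq_def P_def Q_def)
  have i1: "u * n + t mod n < dm" "n * n + (t div n mod n * n + u) < dm" if "u < n" for u using idx_dm(1)[OF that tb(3)] idx_dm(2)[OF tb(2) that] by simp_all
  have c1: "z (u * n + t mod n) \<in> carrier F" "z (n * n + (t div n mod n * n + u)) \<in> carrier F" if "z \<in> V dm" "u < n" for z u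
    using V_mem[OF that(1)] i1[OF that(2)] by auto
  note G = Gs_closed[OF tb(1)]
  have PQ: "P z \<in> carrier F" "Q z \<in> carrier F" if "z \<in> V dm" for z
    unfolding P_def Q_def using c1[OF that] G Fs_closed by (auto intro!: finsum_closed m_closed)
  have "P (vlin dm x a y) = P x \<oplus> a \<otimes> P y"
  proof -
    have "P (vlin dm x a y) = (\<Oplus>u\<in>{..<n}. Gs (t div (n * n)) (t div n mod n) u \<otimes> x (u * n + t mod n) \<oplus>
        a \<otimes> (Gs (t div (n * n)) (t div n mod n) u \<otimes> y (u * n + t mod n)))"
      unfolding P_def using i1 c1[OF x] c1[OF y] a G by (intro finsum_cong') (auto simp: r_distr m_lcomm)
    also have "\<dots> = P x \<oplus> a \<otimes> P y" unfolding P_def using c1[OF x] c1[OF y] a G by (intro finsum_lin) auto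
    finally show ?thesis .
  qed
  moreover have "Q (vlin dm x a y) = Q x \<oplus> a \<otimes> Q y"
  proof -
    have "Q (vlin dm x a y) = (\<Oplus>u\<in>{..<n}. x (n * n + (t div n mod n * n + u)) \<otimes> Fm d f (t div (n * n)) u (t mod n) \<oplus>
        a \<otimes> (y (n * n + (t div n mod n * n + u)) \<otimes> Fm d f (t div (n * n)) u (t mod n)))"
      unfolding Q_def using i1 c1[OF x] c1[OF y] a Fs_closed by (intro finsum_cong') (auto simp: l_distr m_assoc)
    also have "\<dots> = Q x \<oplus> a \<otimes> Q y" unfolding Q_def using c1[OF x] c1[OF y] a Fs_closed by (intro finsum_lin) auto
    finally show ?thesis .
  qed
  ultimately show "Lq t (vlin dm x a y) = Lq t x \<oplus> a \<otimes> Lq t y"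
    unfolding L using PQ[OF x] PQ[OF y] a by (simp add: minus_eq r_distr r_minus minus_add a_ac)
qed

lemma ell_eq:
  assumes t: "t < c * (n * n)" and Z: "rowv Z r \<in> V dm" and r: "r < dm"
  shows "ell d c ks \<sigma> l Z (r * dm) t = Lq t (rowv Z r)"
proof -
  note tb = t_bounds[OF t]
  have zc: "lget Z (r * dm + x) \<in> carrier F" if "x < dm" for x using Z r that by (rule rowv_carrier)
  have i1: "u * n + t mod n < dm" "n * n + (t div n mod n * n + u) < dm" if "u < n" for u using idx_dm(1)[OF that tb(3)] idx_dm(2)[OF tb(2) that] by simp_all
  have sg: "slice d ks \<sigma> ''g'' (c * (d - 2)) l (t div (n * n)) (t div n mod n) u = Gs (t div (n * n)) (t div n mod n) u" for u
    unfolding Gs_def using l by (intro slice_g d tb) auto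
  have sf: "slice d ks \<sigma> ''f'' 0 l (t div (n * n)) u (t mod n) = Fm d f (t div (n * n)) u (t mod n)" if "u < n" for u
    using d that tb by (intro slice_f[where c = c]) auto
  have 1: "fsum \<sigma> n (\<lambda>u. fmu \<sigma> (Gs (t div (n * n)) (t div n mod n) u) (lget Z (r * dm + (u * n + t mod n)))) =
      (\<Oplus>u\<in>{..<n}. Gs (t div (n * n)) (t div n mod n) u \<otimes> rowv Z r (u * n + t mod n))" (is "?s1 = ?t1")
  proof -
    have "?s1 = (\<Oplus>u\<in>{..<n}. fmu \<sigma> (Gs (t div (n * n)) (t div n mod n) u) (lget Z (r * dm + (u * n + t mod n))))"
      using zc i1 Gs_closed[OF tb(1)] by (intro fsum_eq) auto
    also have "\<dots> = ?t1" using zc i1 r Gs_closed[OF tb(1)] by (intro finsum_cong') (auto simp: rowv_def)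
    finally show ?thesis .
  qed
  have 2: "fsum \<sigma> n (\<lambda>u. fmu \<sigma> (lget Z (r * dm + (n * n + (t div n mod n * n + u)))) (slice d ks \<sigma> ''f'' 0 l (t div (n * n)) u (t mod n))) =
      (\<Oplus>u\<in>{..<n}. rowv Z r (n * n + (t div n mod n * n + u)) \<otimes> Fm d f (t div (n * n)) u (t mod n))" (is "?s2 = ?t2")
  proof -
    have "?s2 = (\<Oplus>u\<in>{..<n}. fmu \<sigma> (lget Z (r * dm + (n * n + (t div n mod n * n + u)))) (slice d ks \<sigma> ''f'' 0 l (t div (n * n)) u (t mod n)))"
      using zc i1 Fs_closed sf by (intro fsum_eq) auto
    also have "\<dots> = ?t2" using zc i1 r Fs_closed sf by (intro finsum_cong') (auto simp: rowv_def)
    finally show ?thesis .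
  qed
  have "?t1 \<in> carrier F" "?t2 \<in> carrier F"
    using zc i1 r Gs_closed[OF tb(1)] Fs_closed by (auto intro!: finsum_closed m_closed simp: rowv_def)
  then show ?thesis unfolding ell_def in_vals sg 1 2 Lq_def by simp
qed

text \<open>Round 0 only installs the identity matrix; hence t equations are treated after t + 1
  rounds.\<close>

lemma elim_kernel_basis:
  "t \<le> c * (n * n) \<Longrightarrow> \<exists>S. kernel_basis dm Lq t S (rowv (aiter (dm * dm) (stepZ d c ks \<sigma> l) (Suc t)))"
proof (induction t)
  case 0
  have e: "lget (aiter (dm * dm) (stepZ d c ks \<sigma> l) (Suc 0)) (r * dm + x) = (if r = x then \<one> else \<zero>)"
    if "r < dm" "x < dm" for r x
    unfolding aiter.simps using index_bound[OF that] that(2) by (simp add: lget_map stepZ_def div_index)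
  define Z where "Z = aiter (dm * dm) (stepZ d c ks \<sigma> l) (Suc 0)"
  have row: "rowv Z r = (\<lambda>x\<in>{..<dm}. if r = x then \<one> else \<zero>)" if "r < dm" for r
    using that e[folded Z_def] by (auto simp: rowv_def)
  have "kernel_basis dm Lq 0 {..<dm} (rowv Z)"
    by (rule kernel_basis_0) (auto simp: row intro!: restrict_V)
  then have "kernel_basis dm Lq 0 {..<dm} (rowv (aiter (dm * dm) (stepZ d c ks \<sigma> l) (Suc 0)))"
    by (simp only: Z_def)
  then show ?case by blast
next
  case (Suc t)
  define Z where "Z = aiter (dm * dm) (stepZ d c ks \<sigma> l) (Suc t)"
  define Z' where "Z' = aiter (dm * dm) (stepZ d c ks \<sigma> l) (Suc (Suc t))"
  obtain S where K: "kernel_basis dm Lq t S (rowv Z)" using Suc by (auto simp: Z_def)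
  have t: "t < c * (n * n)" using Suc.prems by simp
  note D = kernel_basisD[OF K]
  have zc: "lget Z (r * dm + x) \<in> carrier F" if "r < dm" "x < dm" for r x
    using D(3)[OF that(1)] that by (rule rowv_carrier)
  have ell: "ell d c ks \<sigma> l Z (r * dm) t = Lq t (rowv Z r)" if "r < dm" for r
    using t D(3)[OF that] that by (rule ell_eq)
  have Z': "lget Z' (r * dm + x) = stepZ d c ks \<sigma> l (Suc t) Z (r * dm + x)" if "r < dm" "x < dm" for r x
    using index_bound[OF that] unfolding Z'_def aiter.simps(2)[of _ _ "Suc t"] Z_def[symmetric] by (rule lget_map)
  define p where "p = piv d c ks \<sigma> l Z t"
  have p: "p = search dm (\<lambda>p. ell d c ks \<sigma> l Z (p * dm) t \<noteq> \<zero>)" by (simp only: p_def piv_def dimz_eq in_vals)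
  show ?case
  proof (cases "\<exists>r<dm. Lq t (rowv Z r) \<noteq> \<zero>")
    case True
    then obtain r0 where "r0 < dm" "ell d c ks \<sigma> l Z (r0 * dm) t \<noteq> \<zero>" using ell by auto
    then have "ell d c ks \<sigma> l Z (p * dm) t \<noteq> \<zero>" "p < dm"
      unfolding p using searchI[of "\<lambda>p. ell d c ks \<sigma> l Z (p * dm) t \<noteq> \<zero>" r0 dm]
        search_eq_Least[of "\<lambda>p. ell d c ks \<sigma> l Z (p * dm) t \<noteq> \<zero>" r0 dm] Least_le[of "\<lambda>p. ell d c ks \<sigma> l Z (p * dm) t \<noteq> \<zero>" r0]
      by (auto simp: not_less)
    then have pp: "p < dm" "Lq t (rowv Z p) \<noteq> \<zero>" using ell by auto
    have lc: "Lq t (rowv Z r) \<in> carrier F" if "r < dm" for r using t D(3)[OF that] by (rule Lq_closed)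
    have iv: "inv (Lq t (rowv Z p)) \<in> carrier F" using lc[OF pp(1)] pp(2) by (simp add: field_Units)
    have "rowv Z' r = vlin dm (rowv Z r) (\<ominus> (Lq t (rowv Z r) \<otimes> inv (Lq t (rowv Z p)))) (rowv Z p)" if r: "r < dm" for r
    proof -
      have "lget Z' (r * dm + x) = lget Z (r * dm + x) \<oplus> \<ominus> (Lq t (rowv Z r) \<otimes> inv (Lq t (rowv Z p))) \<otimes> lget Z (p * dm + x)" if x: "x < dm" for x
      proof -
        have "lget Z' (r * dm + x) = fsb \<sigma> (lget Z (r * dm + x)) (fmu \<sigma> (fdv \<sigma> (ell d c ks \<sigma> l Z (r * dm) t) (ell d c ks \<sigma> l Z (p * dm) t)) (lget Z (p * dm + x)))"
          unfolding Z'[OF r x] stepZ_def dimz_eq div_index[OF x] diff_Suc_1 p_def[symmetric] using pp(1) by simp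
        also have "\<dots> = lget Z (r * dm + x) \<ominus> (Lq t (rowv Z r) \<otimes> inv (Lq t (rowv Z p))) \<otimes> lget Z (p * dm + x)"
          unfolding ell[OF r] ell[OF pp(1)] using zc[OF r x] zc[OF pp(1) x] lc[OF r] lc[OF pp(1)] iv pp(2) by simp
        also have "\<dots> = lget Z (r * dm + x) \<oplus> \<ominus> (Lq t (rowv Z r) \<otimes> inv (Lq t (rowv Z p))) \<otimes> lget Z (p * dm + x)"
          using zc[OF pp(1) x] lc[OF r] iv by (simp add: minus_eq l_minus)
        finally show ?thesis .
      qed
      then show ?thesis using r pp(1) by (auto simp: rowv_def vlin_def)
    qed
    then have "kernel_basis dm Lq (Suc t) (S - {p}) (rowv Z')"
      using t by (intro kernel_basis_pivot[where L = Lq and t = t and Z = "rowv Z" and Z' = "rowv Z'" and S = S and p = p, OF K _ pp]) (auto intro!: lin_fn_Lq)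
    then show ?thesis unfolding Z'_def by blast
  next
    case False
    then have z: "Lq t (rowv Z r) = \<zero>" if "r < dm" for r using that by auto
    have "p = dm" unfolding p using ell z by (intro search_none) auto
    then have "lget Z' (r * dm + x) = lget Z (r * dm + x)" if "r < dm" "x < dm" for r x
      unfolding Z'[OF that] stepZ_def dimz_eq diff_Suc_1 p_def[symmetric] by simp
    then have eq: "rowv Z' = rowv Z" by (intro ext) (simp add: rowv_def)
    have "kernel_basis dm Lq (Suc t) S (rowv Z')" unfolding eq by (rule kernel_basis_skip[where L = Lq and t = t and Z = "rowv Z" and S = S, OF K]) (rule z)
    then show ?thesis unfolding Z'_def by blast
  qed
qed

lemma elimZ_kernel_basis: "\<exists>S. kernel_basis dm Lq (c * (n * n)) S (rowv (elimZ d c ks \<sigma> l))"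
  using elim_kernel_basis[of "c * (n * n)"] by (simp add: elimZ_def)

text \<open>The diagonal entry tells basis rows, where it is 1, from the zero rows.\<close>

lemma solz_terms:
  assumes K: "kernel_basis dm Lq T S (rowv Z)" and r: "r < dm"
  shows "lget Z (r * dm + r) = \<zero> \<longleftrightarrow> r \<notin> S"
proof -
  note D = kernel_basisD[OF K]
  have "lget Z (r * dm + r) = rowv Z r r" using r by (simp add: rowv_def)
  then show ?thesis using D(4)[OF r] D(5)[of r r] r by auto
qed

lemma solz_eq:
  assumes K: "kernel_basis dm Lq T S (rowv Z)" and u: "u < dm"
  shows "solz s \<sigma> \<gamma> Z u = (\<Oplus>r\<in>S. dig q \<gamma> (n * s + card (S \<inter> {..<r})) \<otimes> rowv Z r u)"
    "solz s \<sigma> \<gamma> Z u \<in> carrier F"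
proof -
  note D = kernel_basisD[OF K]
  have dg: "dig q \<gamma> m \<in> carrier F" for m unfolding carr_lt using q_ge_2 by (intro dig_lt) simp
  have rank: "(\<Sum>r'<r. of_bool (lget Z (r' * dm + r') \<noteq> \<zero>)) = card (S \<inter> {..<r})" if "r < dm" for r
  proof -
    have "(\<Sum>r'<r. of_bool (lget Z (r' * dm + r') \<noteq> \<zero>)) = (\<Sum>r'<r. of_bool (r' \<in> S) :: nat)"
      using that solz_terms[OF K] by (intro sum.cong) auto
    also have "\<dots> = card (S \<inter> {..<r})" by (simp add: sum.If_cases of_bool_def Int_commute)
    finally show ?thesis .
  qed
  have zc: "lget Z (r * dm + u) \<in> carrier F" if "r < dm" for r using D(3)[OF that] that u by (rule rowv_carrier)
  define h where "h = (\<lambda>r. if r \<in> S then dig q \<gamma> (n * s + card (S \<inter> {..<r})) \<otimes> rowv Z r u else \<zero>)"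
  have h: "(if lget Z (r * dm + r) = \<zero> then \<zero> else fmu \<sigma> (dig q \<gamma> (n * s + (\<Sum>r'<r. of_bool (lget Z (r' * dm + r') \<noteq> \<zero>)))) (lget Z (r * dm + u))) = h r" if r: "r < dm" for r
    unfolding rank[OF r] solz_terms[OF K r] using dg zc[OF r] u r by (simp add: h_def rowv_def)
  have hc: "h r \<in> carrier F" if "r < dm" for r using dg zc[OF that] u that by (simp add: h_def rowv_def)
  have "solz s \<sigma> \<gamma> Z u = (\<Oplus>r\<in>{..<dm}. if lget Z (r * dm + r) = \<zero> then \<zero> else fmu \<sigma> (dig q \<gamma> (n * s + (\<Sum>r'<r. of_bool (lget Z (r' * dm + r') \<noteq> \<zero>)))) (lget Z (r * dm + u)))"
    unfolding solz_def dimz_eq in_vals by (rule fsum_eq) (simp only: h hc)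
  also have "\<dots> = (\<Oplus>r\<in>{..<dm}. h r)" by (rule finsum_cong') (use h hc in auto)
  finally have eq: "solz s \<sigma> \<gamma> Z u = (\<Oplus>r\<in>{..<dm}. h r)" .
  then show "solz s \<sigma> \<gamma> Z u \<in> carrier F" using hc by (auto intro!: finsum_closed)
  show "solz s \<sigma> \<gamma> Z u = (\<Oplus>r\<in>S. dig q \<gamma> (n * s + card (S \<inter> {..<r})) \<otimes> rowv Z r u)"
    unfolding eq using D(1) hc by (intro add.finprod_mono_neutral_cong_right) (auto simp: h_def)
qed

lemma solz_solution:
  assumes K: "kernel_basis dm Lq T S (rowv Z)" and z: "z \<in> V dm" "\<And>t. t < T \<Longrightarrow> Lq t z = \<zero>"
    and \<gamma>: "\<And>r. r \<in> S \<Longrightarrow> dig q \<gamma> (n * s + card (S \<inter> {..<r})) = z r" and u: "u < dm"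
  shows "solz s \<sigma> \<gamma> Z u = z u"
proof -
  note D = kernel_basisD[OF K]
  have "solz s \<sigma> \<gamma> Z u = (\<Oplus>r\<in>S. z r \<otimes> rowv Z r u)"
    unfolding solz_eq(1)[OF K u] using \<gamma> V_mem[OF z(1)] V_mem[OF D(8) u] D(9) by (intro finsum_cong') auto
  also have "\<dots> = lc dm S z (rowv Z) u" using u by (simp add: lc_def)
  also have "\<dots> = z u" using D(7)[OF z] by simp
  finally show ?thesis .
qed

lemma card_solutions:
  "card {z \<in> V dm. \<forall>t<c * (n * n). Lq t z = \<zero>} \<le>
    card {(A1, C1). A1 \<in> M n \<and> C1 \<in> M n \<and> (\<forall>i<c. \<forall>k<n. \<forall>j<n. mm n (Gs i) A1 k j = mm n C1 (Fm d f i) k j)}"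
    (is "card ?A \<le> card ?B")
proof (rule card_inj_on_le)
  define \<phi> where "\<phi> = (\<lambda>z :: nat \<Rightarrow> nat. (\<lambda>i\<in>{..<n}. \<lambda>j\<in>{..<n}. z (i * n + j), \<lambda>i\<in>{..<n}. \<lambda>j\<in>{..<n}. z (n * n + (i * n + j))))"
  show "finite ?B" by (rule finite_subset[of _ "M n \<times> M n"]) auto
  show "inj_on \<phi> ?A"
  proof (rule inj_onI)
    fix x y assume x: "x \<in> ?A" and y: "y \<in> ?A" and eq: "\<phi> x = \<phi> y"
    have e1: "x (i * n + j) = y (i * n + j)" "x (n * n + (i * n + j)) = y (n * n + (i * n + j))" if "i < n" "j < n" for i j
    proof -
      have "fst (\<phi> x) i j = fst (\<phi> y) i j" "snd (\<phi> x) i j = snd (\<phi> y) i j" using eq by simp_all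
      then show "x (i * n + j) = y (i * n + j)" "x (n * n + (i * n + j)) = y (n * n + (i * n + j))" using that by (simp_all add: \<phi>_def)
    qed
    have n0: "0 < n" using n by simp
    show "x = y"
    proof (rule V_eqI[of _ dm])
      fix u assume u: "u < dm"
      show "x u = y u"
      proof (cases "u < n * n")
        case True
        then have "u div n < n" "u mod n < n" using n0 by (simp_all add: less_mult_imp_div_less)
        from e1(1)[OF this] show ?thesis by simp
      next
        case False
        then have "u - n * n < n * n" using u by (simp add: dm_def)
        then have "(u - n * n) div n < n" "(u - n * n) mod n < n" using n0 by (simp_all add: less_mult_imp_div_less)
        from e1(2)[OF this] show ?thesis using False by simp
      qed
    qed (use x y in auto)
  qed
  show "\<phi> ` ?A \<subseteq> ?B"
  proof (rule image_subsetI)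
    fix z assume z: "z \<in> ?A"
    have zc: "z x \<in> carrier F" if "x < dm" for x using z that V_mem[of z dm x] by simp
    define A1 where "A1 = (\<lambda>i\<in>{..<n}. \<lambda>j\<in>{..<n}. z (i * n + j))"
    define C1 where "C1 = (\<lambda>i\<in>{..<n}. \<lambda>j\<in>{..<n}. z (n * n + (i * n + j)))"
    have M: "A1 \<in> M n" "C1 \<in> M n" unfolding A1_def C1_def M_def using zc idx_dm by (auto intro!: restrict_V)
    have "mm n (Gs i) A1 k j = mm n C1 (Fm d f i) k j" if i: "i < c" and k: "k < n" and j: "j < n" for i k j
    proof -
      \<comment> \<open>Equations are numbered by matrix, row and column, in this order.\<close>
      define t where "t = (i * n + k) * n + j"
      have tm: "t mod n = j" "t div n = i * n + k" using j by (simp_all add: t_def)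
      then have "t div n mod n = k" "t div n div n = i" using k by simp_all
      then have td: "t div n mod n = k" "t div (n * n) = i" by (simp_all add: div_mult2_eq)
      have "t < (c * n) * n" unfolding t_def using index_bound[OF index_bound[OF i k] j] .
      then have tc: "t < c * (n * n)" by (simp add: mult.assoc)
      have "Lq t z = \<zero>" using z tc by simp
      moreover have "Lq t z = mm n (Gs i) A1 k j \<ominus> mm n C1 (Fm d f i) k j"
      proof -
        have "(\<Oplus>u\<in>{..<n}. Gs i k u \<otimes> z (u * n + j)) = mm n (Gs i) A1 k j"
          unfolding mm_def using Gs_closed[OF i] zc idx_dm j by (intro finsum_cong') (auto simp: A1_def)
        moreover have "(\<Oplus>u\<in>{..<n}. z (n * n + (k * n + u)) \<otimes> Fm d f i u j) = mm n C1 (Fm d f i) k j"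
          unfolding mm_def using Fs_closed zc idx_dm k by (intro finsum_cong') (auto simp: C1_def)
        ultimately show ?thesis unfolding Lq_def td tm(1) by simp
      qed
      moreover have "mm n (Gs i) A1 k j \<in> carrier F" "mm n C1 (Fm d f i) k j \<in> carrier F"
        using matD[OF mm_closed[OF _ M_mat[OF M(1)]] k j, of "Gs i"] matD[OF mm_closed[OF M_mat[OF M(2)]] k j, of "Fm d f i"]
          Gs_closed[OF i] Fs_closed by (auto simp: mat_def)
      ultimately show ?thesis using r_right_minus_eq by simp
    qed
    then show "\<phi> z \<in> ?B" using M by (simp add: \<phi>_def A1_def C1_def)
  qed
qed

end

end

lemma search_less: assumes "search m P < m" shows "P (search m P)"
  using assms search_none[of m P] searchI[of P _ m] by (metis less_irrefl)

lemma (in fin_field) lin_subst_cong: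
  assumes g: "g \<in> polys R n D" and A: "mat n A" and eq: "\<And>i j. i < n \<Longrightarrow> j < n \<Longrightarrow> A' i j = A i j"
  shows "lin_subst R n g A' = lin_subst R n g A"
proof
  fix m
  have A': "mat n A'" using A eq by (simp add: mat_def)
  show "lin_subst R n g A' m = lin_subst R n g A m"
  proof (cases "set_mset m \<subseteq> {..<n}")
    case True
    have gc: "g m \<in> carrier R" for m using PS_carrier[OF polys_PS[OF g]] .
    have W: "Wc A' I m = Wc A I m" "Wc A I m \<in> carrier R" if "I \<in> DL n (size m)" for I
      using that True A eq by (auto intro!: Wc_cong Wc_closed simp: DL_def subset_iff matD)
    have "(\<Oplus>I\<in>DL n (size m). g (mset I) \<otimes> Wc A' I m) = (\<Oplus>I\<in>DL n (size m). g (mset I) \<otimes> Wc A I m)"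
      using W gc by (intro finsum_cong') auto
    moreover have "lin_subst R n g A' m = (\<Oplus>I\<in>DL n (size m). g (mset I) \<otimes> Wc A' I m)"
      by (rule lin_subst_apply[OF g _ True]) (rule matD[OF A'])
    moreover have "lin_subst R n g A m = (\<Oplus>I\<in>DL n (size m). g (mset I) \<otimes> Wc A I m)"
      by (rule lin_subst_apply[OF g _ True]) (rule matD[OF A])
    ultimately show ?thesis by simp
  next
    case False
    have "lin_subst R n g A' m = \<zero>" by (rule lin_subst_support[OF g _ False]) (rule matD[OF A'])
    moreover have "lin_subst R n g A m = \<zero>" by (rule lin_subst_support[OF g _ False]) (rule matD[OF A])
    ultimately show ?thesis by simp
  qed
qed

text \<open>Only the block columns enter, so guessing the first \<open>c * (d - 2)\<close> columns
  determines the whole system.\<close>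

lemma (in fin_field) Gm_cong:
  assumes g: "\<And>m. g m \<in> carrier R" and A: "\<And>k r. k < n \<Longrightarrow> r < c * (d - 2) \<Longrightarrow> A k r \<in> carrier R" and i: "i < c"
    and eq: "\<And>k r. k < n \<Longrightarrow> r < c * (d - 2) \<Longrightarrow> A' k r = A k r"
  shows "Gm n d g A' i u v = Gm n d g A i u v"
proof -
  have ib: "i * (d - 2) + r < c * (d - 2)" if "r < d" "r \<noteq> d - 2" "r \<noteq> d - 1" for r
  proof -
    have "r < d - 2" using that by linarith
    then show ?thesis using index_bound[OF i] by blast
  qed
  show ?thesis unfolding Gm_def
    by (rule SL_cong[OF g]) (use A eq ib in \<open>auto simp: colupd_def\<close>)
qed

section \<open>Soundness and completeness of the search\<close>

context iso_input
begin

lemma lget_guess: "x < n * s \<Longrightarrow> lget (guess s \<sigma> \<gamma>) x = dig q \<gamma> x"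
  unfolding guess_def in_vals by (rule lget_map)

lemma dig_carrier: "dig q \<gamma> x \<in> carrier F"
  unfolding carr_lt using q_ge_2 by (intro dig_lt) simp

lemma cand_carrier:
  assumes "3 \<le> d" "d \<in> D" "c * (d - 2) \<le> n" "u < dm"
  shows "lget (cand d c ks \<sigma> \<gamma>) u \<in> carrier F"
proof -
  let ?l = "guess (c * (d - 2)) \<sigma> \<gamma>"
  have l: "lget ?l (k * (c * (d - 2)) + r) \<in> carrier F" if "k < n" "r < c * (d - 2)" for k r
    using lget_guess[OF index_bound[OF that]] dig_carrier by simp
  obtain S where "kernel_basis dm (Lq d c ?l) (c * (n * n)) S (rowv (elimZ d c ks \<sigma> ?l))"
    using elimZ_kernel_basis[OF assms(1-3) l] by blast
  from solz_eq(2)[OF assms(1-3) l this assms(4)] show ?thesis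
    unfolding cand_def dimz_eq using assms(4) by (simp add: lget_map)
qed

lemma mat_cand:
  assumes "3 \<le> d" "d \<in> D" "c * (d - 2) \<le> n"
  shows "mat n (Az (cand d c ks \<sigma> \<gamma>))" "mat n (Cz (cand d c ks \<sigma> \<gamma>))"
  unfolding mat_def Az_def Cz_def using cand_carrier[OF assms] idx_dm by auto

lemma result_sound:
  assumes d: "3 \<le> d" "d \<in> D" "c * (d - 2) \<le> n" and r: "result d c ks K \<sigma> < (q ^ n) ^ K"
  shows "Az (cand d c ks \<sigma> (result d c ks K \<sigma>)) \<in> GL n F"
    "f = lin_subst F n g (Az (cand d c ks \<sigma> (result d c ks K \<sigma>)))"
proof -
  have "accept ks \<sigma> (cand d c ks \<sigma> (result d c ks K \<sigma>))"
    using r search_less[of "(q ^ n) ^ K" "\<lambda>\<gamma>. accept ks \<sigma> (cand d c ks \<sigma> \<gamma>)"] by (simp add: result_def)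
  then show "Az (cand d c ks \<sigma> (result d c ks K \<sigma>)) \<in> GL n F"
    "f = lin_subst F n g (Az (cand d c ks \<sigma> (result d c ks K \<sigma>)))"
    using accept_GL[OF mat_cand[OF d]] by blast+
qed

text \<open>An isomorphism A with inverse B gives a code below the bound: guess the first s columns
  of A; then the pair (A, B^T) solves the system, and expansion leaves it at most 10 n s
  coordinates. Together with the n s guessed entries this is 11 n s digits. The search may stop
  earlier, at another accepted candidate.\<close>

lemma result_complete:
  assumes d: "3 \<le> d" "d \<in> D" and s: "s = 80 * (d - 2)" "2 * s \<le> n"
    and ex: "expands n 80 (Fm d f) (2 * s)" and iso: "poly_iso F n f g"
  shows "result d 80 ks (11 * s) \<sigma> < (q ^ n) ^ (11 * s)"
proof -
  obtain A where AGL: "A \<in> GL n F" and fA: "f = lin_subst F n g A" using iso by (auto simp: poly_iso_def)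
  obtain B where A: "mat n A" and B: "mat n B"
    and AB: "\<And>i j. i < n \<Longrightarrow> j < n \<Longrightarrow> mm n A B i j = idm i j"
    and BA: "\<And>i j. i < n \<Longrightarrow> j < n \<Longrightarrow> mm n B A i j = idm i j"
    using AGL unfolding GL_def mat_def mm_def by auto
  have cn: "80 * (d - 2) \<le> n" and sn: "s \<le> n" using s by auto
  have s0: "0 < s" and n0: "0 < n" using d s n by auto
  define l where "l = map (\<lambda>u. A (u div s) (u mod s)) [0..<n * s]"
  have lA: "lget l (k * (80 * (d - 2)) + r) = A k r" if "k < n" "r < 80 * (d - 2)" for k r
    unfolding l_def s(1)[symmetric] using index_bound[OF that] that(2) by (subst lget_map) (auto simp: s(1))
  have Ac: "A k r \<in> carrier F" if "k < n" "r < 80 * (d - 2)" for k r using A that cn by (simp add: matD)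
  have lc: "lget l (k * (80 * (d - 2)) + r) \<in> carrier F" if "k < n" "r < 80 * (d - 2)" for k r
    using lA[OF that] Ac[OF that] by simp
  note ctx = d cn lc
  let ?Z = "elimZ d 80 ks \<sigma> l" and ?L = "Lq d 80 l" and ?T = "80 * (n * n)"
  obtain S where K: "kernel_basis dm ?L ?T S (rowv ?Z)" using elimZ_kernel_basis[OF ctx] by blast
  note KD = kernel_basisD[OF K]
  \<comment> \<open>B is stored transposed, as the unknown C: from F = A^T G A follows G A = B^T
    F.\<close>
  define z where "z = (\<lambda>u\<in>{..<dm}. if u < n * n then A (u div n) (u mod n) else B ((u - n * n) mod n) ((u - n * n) div n))"
  have zA: "z (i * n + j) = A i j" and zB: "z (n * n + (i * n + j)) = B j i" if "i < n" "j < n" for i j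
    using index_bound[OF that] idx_dm[OF that] that(2) by (simp_all add: z_def)
  have zV: "z \<in> V dm" unfolding z_def
  proof (rule restrict_V)
    fix u assume u: "u < dm"
    show "(if u < n * n then A (u div n) (u mod n) else B ((u - n * n) mod n) ((u - n * n) div n)) \<in> carrier F"
    proof (cases "u < n * n")
      case True
      then show ?thesis using n0 A by (simp add: less_mult_imp_div_less matD)
    next
      case False
      then have "u - n * n < n * n" using u by (simp add: dm_def)
      then show ?thesis using False n0 B by (simp add: less_mult_imp_div_less matD)
    qed
  qed
  have G: "mat n (Gs d 80 l i)" if "i < 80" for i using Gs_closed[OF ctx that] by (simp add: mat_def)
  have Fmat: "mat n (Fm d f i)" for i using fc by (rule mat_Fm)
  have FG: "Fm d f i k j = mm n (tr A) (mm n (Gs d 80 l i) A) k j" if i: "i < 80" and kj: "k < n" "j < n" for i k j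
  proof -
    have "Fm d f i k j = mm n (tr A) (mm n (Gm n d g A i) A) k j"
      using Fm_lin_subst[OF d(1) g A cn i kj] fA by simp
    also have "\<dots> = mm n (tr A) (mm n (Gs d 80 l i) A) k j"
    proof (rule mm_cong[OF mat_tr[OF A] mm_closed[OF G[OF i] A] _ _ kj])
      fix a b assume ab: "a < n" "b < n"
      have "Gm n d g A i u v = Gs d 80 l i u v" for u v
      proof -
        have "Gs d 80 l i u v = Gm n d g (\<lambda>k r. lget l (k * (80 * (d - 2)) + r)) i u v" by (rule Gs_eq[OF ctx])
        also have "\<dots> = Gm n d g A i u v" by (rule Gm_cong[OF gc, where c = 80]) (use Ac lA i in auto)
        finally show ?thesis ..
      qed
      then show "mm n (Gm n d g A i) A a b = mm n (Gs d 80 l i) A a b" by (simp add: mm_def)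
    qed simp
    finally show ?thesis .
  qed
  have sol: "?L t z = \<zero>" if t: "t < ?T" for t
  proof -
    note tb = t_bounds[OF ctx t]
    let ?i = "t div (n * n)" and ?k = "t div n mod n" and ?j = "t mod n"
    have GA: "mat n (mm n (Gs d 80 l ?i) A)" using G[OF tb(1)] A by (rule mm_closed)
    have "mm n (tr B) (Fm d f ?i) ?k ?j = mm n (tr B) (mm n (tr A) (mm n (Gs d 80 l ?i) A)) ?k ?j"
      using mm_closed[OF mat_tr[OF A] GA] FG[OF tb(1)] tb by (intro mm_cong mat_tr[OF B]) auto
    also have "\<dots> = mm n (mm n (tr B) (tr A)) (mm n (Gs d 80 l ?i) A) ?k ?j"
      using mm_assoc[OF mat_tr[OF B] mat_tr[OF A] GA tb(2,3)] by simp
    also have "\<dots> = mm n idm (mm n (Gs d 80 l ?i) A) ?k ?j"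
    proof (rule mm_cong[OF mat_idm GA _ _ tb(2,3)])
      show "mm n (tr B) (tr A) i j = idm i j" if "i < n" "j < n" for i j
        using mm_tr[OF B A that] AB[OF that(2,1)] by auto
    qed simp
    also have "\<dots> = mm n (Gs d 80 l ?i) A ?k ?j" using mm_idm(1)[OF GA tb(2,3)] .
    finally have eq: "mm n (tr B) (Fm d f ?i) ?k ?j = mm n (Gs d 80 l ?i) A ?k ?j" .
    have "(\<Oplus>u\<in>{..<n}. Gs d 80 l ?i ?k u \<otimes> z (u * n + ?j)) = mm n (Gs d 80 l ?i) A ?k ?j"
      unfolding mm_def using tb zA A G[OF tb(1)] by (intro finsum_cong') (auto simp: matD)
    moreover have "(\<Oplus>u\<in>{..<n}. z (n * n + (?k * n + u)) \<otimes> Fm d f ?i u ?j) = mm n (tr B) (Fm d f ?i) ?k ?j"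
      unfolding mm_def using tb zB matD[OF B] matD[OF Fmat] by (intro finsum_cong') auto
    moreover have "mm n (Gs d 80 l ?i) A ?k ?j \<in> carrier F" using matD[OF GA tb(2,3)] .
    moreover have "?L t z = (\<Oplus>u\<in>{..<n}. Gs d 80 l ?i ?k u \<otimes> z (u * n + ?j)) \<ominus>
        (\<Oplus>u\<in>{..<n}. z (n * n + (?k * n + u)) \<otimes> Fm d f ?i u ?j)" by (rule Lq_eq[OF ctx])
    ultimately show ?thesis unfolding eq by (simp add: minus_eq r_neg)
  qed
  \<comment> \<open>Free coordinates are bounded through the number of solutions, which is
    transferred to the system of f alone and estimated with expansion parameter 2 s.\<close>
  have cardS: "card S \<le> 5 * n * (2 * s)"
  proof -
    have "q ^ card S \<le> card {z \<in> V dm. \<forall>t<?T. ?L t z = \<zero>}"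
      by (rule card_kernel_basis[where L = ?L, OF K]) (rule lin_fn_Lq[OF ctx])
    also have "\<dots> \<le> card {(A1, C1). A1 \<in> M n \<and> C1 \<in> M n \<and> (\<forall>i<80. \<forall>k<n. \<forall>j<n. mm n (Gs d 80 l i) A1 k j = mm n C1 (Fm d f i) k j)}"
      by (rule card_solutions[OF ctx])
    also have "\<dots> \<le> card (sol n 80 (Fm d f))"
      by (rule card_sol_transformed[OF A B AB G Fmat FG])
    also have "\<dots> \<le> q ^ (5 * n * (2 * s))"
      using Fmat Fm_sym ex s(2) by (intro card_sol) auto
    finally show ?thesis using q_ge_2 by (simp add: power_increasing_iff)
  qed
  \<comment> \<open>The intended digits: the guessed columns row by row, then the entry of z at the
    basis row of the given rank. The default 0 merely keeps every digit below q.\<close>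
  define a where "a = (\<lambda>m. if m < n * s then A (m div s) (m mod s)
    else if \<exists>r\<in>S. card (S \<inter> {..<r}) = m - n * s then z (THE r. r \<in> S \<and> card (S \<inter> {..<r}) = m - n * s) else 0)"
  have the: "(THE r. r \<in> S \<and> card (S \<inter> {..<r}) = card (S \<inter> {..<r'})) = r'" if "r' \<in> S" for r'
    using that rank_inj[OF KD(2)] by (intro the_equality) auto
  have aq: "a m < q" for m
  proof -
    have "a m \<in> carrier F \<or> a m = 0"
    proof (cases "m < n * s")
      case True
      then have "m div s < n" "m mod s < n" using s0 sn by (simp_all add: less_mult_imp_div_less order.strict_trans2[OF mod_less_divisor])
      then show ?thesis using True A by (simp add: a_def matD)
    next
      case False
      show ?thesis
      proof (cases "\<exists>r\<in>S. card (S \<inter> {..<r}) = m - n * s")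
        case True
        then obtain r where r: "r \<in> S" "m - n * s = card (S \<inter> {..<r})" by auto
        then have "a m = z r" using False the[OF r(1)] by (auto simp: a_def)
        then show ?thesis using V_mem[OF zV KD(9)[OF r(1)]] by simp
      next
        case False
        then show ?thesis using \<open>\<not> m < n * s\<close> by (simp add: a_def)
      qed
    qed
    then show ?thesis using q_ge_2 by (auto simp: carr_lt)
  qed
  have aS: "a (n * s + card (S \<inter> {..<r})) = z r" if "r \<in> S" for r
    using that the[OF that] by (auto simp: a_def)
  have q0: "0 < q" using q_ge_2 by simp
  obtain \<gamma> where \<gamma>: "\<gamma> < q ^ (n * s + card S)" "\<And>m. m < n * s + card S \<Longrightarrow> dig q \<gamma> m = a m"
    using ex_digits[OF q0, of "n * s + card S" a] aq by blast
  have gl: "guess s \<sigma> \<gamma> = l"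
    unfolding guess_def l_def in_vals using \<gamma>(2) by (intro map_cong) (auto simp: a_def)
  have cz: "lget (cand d 80 ks \<sigma> \<gamma>) u = z u" if u: "u < dm" for u
  proof -
    have "solz s \<sigma> \<gamma> ?Z u = z u"
    proof (rule solz_solution[OF ctx K zV sol _ u])
      show "dig q \<gamma> (n * s + card (S \<inter> {..<r})) = z r" if "r \<in> S" for r
        using \<gamma>(2)[of "n * s + card (S \<inter> {..<r})"] rank_bound[OF KD(2) that] aS[OF that] by simp
    qed
    then show ?thesis unfolding cand_def s(1)[symmetric] gl dimz_eq using u by (simp add: lget_map)
  qed
  let ?z = "cand d 80 ks \<sigma> \<gamma>"
  have Azz: "Az ?z i j = A i j" and Czz: "Cz ?z i j = B j i" if "i < n" "j < n" for i j
    unfolding Az_def Cz_def using cz idx_dm[OF that] zA[OF that] zB[OF that] by simp_all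
  have "accept ks \<sigma> ?z"
    unfolding accept_iff[OF mat_cand[OF d cn]]
  proof (intro conjI allI impI)
    fix i j assume ij: "i < n" "j < n"
    have "mm n (Az ?z) (tr (Cz ?z)) i j = mm n A B i j" using A B ij Azz Czz by (intro mm_cong) auto
    then show "mm n (Az ?z) (tr (Cz ?z)) i j = idm i j" using AB[OF ij] by simp
    have "mm n (tr (Cz ?z)) (Az ?z) i j = mm n B A i j" using A B ij Azz Czz by (intro mm_cong) auto
    then show "mm n (tr (Cz ?z)) (Az ?z) i j = idm i j" using BA[OF ij] by simp
  next
    show "f = lin_subst F n g (Az ?z)" using lin_subst_cong[OF g A, of "Az ?z"] Azz fA by simp
  qed
  moreover have "\<gamma> < (q ^ n) ^ (11 * s)"
  proof -
    have "n * s + card S \<le> n * (11 * s)" using cardS by (simp add: algebra_simps)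
    then have "q ^ (n * s + card S) \<le> q ^ (n * (11 * s))" using q0 by (intro power_increasing) auto
    then show ?thesis using \<gamma>(1) by (simp add: power_mult)
  qed
  ultimately show ?thesis
    unfolding result_def in_vals
    using search_eq_Least[of "\<lambda>\<gamma>. accept ks \<sigma> (cand d 80 ks \<sigma> \<gamma>)" \<gamma> "(q ^ n) ^ (11 * s)"]
      Least_le[of "\<lambda>\<gamma>. accept ks \<sigma> (cand d 80 ks \<sigma> \<gamma>)" \<gamma>] by simp
qed

end

text \<open>The program depends on d and D only. It halts in time on all inputs; wrong answers for n
  >= 8 s occur only when f fails to expand, a condition that does not involve g.\<close>

theorem theorem1p1:
  fixes d :: nat and D :: "nat set"
  assumes "d \<ge> 3"
    and "D = {..d} \<or> D = {d}"
  shows "\<exists>(c :: com) (T :: nat \<Rightarrow> real) (e :: nat \<Rightarrow> real).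
    T \<in> O(\<lambda>n. real n) \<and> e \<in> \<Omega>(\<lambda>n. real n) \<and> (\<forall>n. e n \<ge> 0) \<and>
    (\<forall>(n :: nat) (q :: nat) (F :: nat ring).
       n \<ge> 1 \<and> field F \<and> carrier F = {..<q} \<longrightarrow>
         (\<forall>f\<in>polys F n D. \<forall>g\<in>polys F n D. halts_within c F q n D f g (real q powr T n)) \<and>
         measure_pmf.prob (random_poly F n D)
             {f. \<exists>g\<in>polys F n D. \<not> answers_correctly c F q n D f g}
           \<le> 1 / real q powr e n)"
proof -
  define s where "s = 80 * (d - 2)"
  have finD: "finite D" and dD: "d \<in> D" using assms by auto
  obtain c K' where prog: "\<And>\<sigma>. valid_input \<sigma> \<Longrightarrow> \<exists>t s'. exec c \<sigma> t s' \<and> t \<le> (inq \<sigma> ^ inn \<sigma>) ^ K' \<and>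
      s' ''iso'' 0 = of_bool (result d 80 (sorted_list_of_set D) (11 * s) \<sigma> < (inq \<sigma> ^ inn \<sigma>) ^ (11 * s)) \<and>
      (\<forall>u<inn \<sigma> * inn \<sigma>. s' ''A'' u = lget (cand d 80 (sorted_list_of_set D) \<sigma> (result d 80 (sorted_list_of_set D) (11 * s) \<sigma>)) u)"
    using algorithm_program[of d 80 "sorted_list_of_set D" "11 * s"] by blast
  define T :: "nat \<Rightarrow> real" where "T = (\<lambda>n. real K' * real n)"
  \<comment> \<open>For n below 8 s nothing is known about expansion; exponent 0 makes the claimed
    bound 1, and finitely many n do not affect the growth rate.\<close>
  define e :: "nat \<Rightarrow> real" where "e = (\<lambda>n. if 8 * s \<le> n then real n else 0)"
  have "T \<in> O(\<lambda>n. real n)" unfolding T_def by simp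
  moreover have "e \<in> \<Omega>(\<lambda>n. real n)"
  proof -
    have "eventually (\<lambda>n. e n = real n) at_top"
      using eventually_ge_at_top[of "8 * s"] by eventually_elim (simp add: e_def)
    then show ?thesis by (subst landau_omega.big.in_cong) auto
  qed
  moreover have "\<forall>n. e n \<ge> 0" by (simp add: e_def)
  moreover have "(\<forall>f\<in>polys F n D. \<forall>g\<in>polys F n D. halts_within c F q n D f g (real q powr T n)) \<and>
      measure_pmf.prob (random_poly F n D) {f. \<exists>g\<in>polys F n D. \<not> answers_correctly c F q n D f g} \<le> 1 / real q powr e n"
    if n: "n \<ge> 1" and F: "field F" and carr: "carrier F = {..<q}" for n q :: nat and F :: "nat ring"
  proof
    interpret fin_field F using F carr by (simp add: fin_field_def fin_field_axioms_def)
    have q: "card (carrier F) = q" using carr by simp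
    have q0: "0 < real q" using q_ge_2 unfolding q by simp
    have inp: "iso_input F n D f g" if "f \<in> PS n D" "g \<in> polys F n D" for f g
      using that n finD carr q by unfold_locales simp_all
    show "\<forall>f\<in>polys F n D. \<forall>g\<in>polys F n D. halts_within c F q n D f g (real q powr T n)"
    proof (intro ballI)
      fix f g assume f: "f \<in> polys F n D" and g: "g \<in> polys F n D"
      interpret I: iso_input F n D f g using polys_PS[OF f] g by (rule inp)
      obtain t s' where "exec c I.\<sigma> t s'" "t \<le> (q ^ n) ^ K'" using prog[OF I.valid] unfolding I.in_vals unfolding q by blast
      moreover have "real ((q ^ n) ^ K') = real q powr T n"
        using q0 by (simp add: T_def powr_realpow[symmetric] powr_powr mult.commute)
      ultimately show "halts_within c F q n D f g (real q powr T n)"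
        unfolding halts_within_def q by (metis of_nat_le_iff)
    qed
    show "measure_pmf.prob (random_poly F n D) {f. \<exists>g\<in>polys F n D. \<not> answers_correctly c F q n D f g} \<le> 1 / real q powr e n"
    proof (cases "8 * s \<le> n")
      case False
      then show ?thesis using q0 by (simp add: e_def)
    next
      case True
      have "measure_pmf.prob (random_poly F n D) {f. \<exists>g\<in>polys F n D. \<not> answers_correctly c F q n D f g} \<le> 1 / real (card (carrier F)) ^ n"
      proof (rule prob_bad[where d = d])
        fix f assume f: "f \<in> PS n D" and ex: "expands n 80 (Fm d f) (2 * (80 * (d - 2)))"
        have "answers_correctly c F q n D f g" if g: "g \<in> polys F n D" for g
        proof -
          interpret I: iso_input F n D f g using f g by (rule inp)
          let ?r = "result d 80 I.ks (11 * s) I.\<sigma>"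
          obtain t s' where x: "exec c I.\<sigma> t s'" "s' ''iso'' 0 = of_bool (?r < (q ^ n) ^ (11 * s))"
              "\<And>u. u < n * n \<Longrightarrow> s' ''A'' u = lget (cand d 80 I.ks I.\<sigma> ?r) u"
            using prog[OF I.valid] unfolding I.in_vals unfolding q by blast
          let ?A = "I.Az (cand d 80 I.ks I.\<sigma> ?r)"
          have sn: "80 * (d - 2) \<le> n" "2 * s \<le> n" using True by (auto simp: s_def)
          have sound: "?A \<in> GL n F" "f = lin_subst F n g ?A" if "?r < (q ^ n) ^ (11 * s)"
            using I.result_sound[OF assms(1) dD sn(1)] that unfolding q by blast+
          have complete: "?r < (q ^ n) ^ (11 * s)" if "poly_iso F n f g"
            using I.result_complete[OF assms(1) dD s_def sn(2) _ that] ex unfolding q s_def by blast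
          have iso: "output_iso s' \<longleftrightarrow> poly_iso F n f g"
            unfolding output_iso_def x(2) using sound complete by (auto simp: poly_iso_def)
          \<comment> \<open>The output array is known only at indices below n, so membership in
            \<open>GL\<close> and the substitution are transferred by congruence.\<close>
          have outA: "output_matrix n s' i j = ?A i j" if "i < n" "j < n" for i j
            using x(3) index_bound[OF that] by (simp add: output_matrix_def I.Az_def)
          have "output_matrix n s' \<in> GL n F \<and> f = lin_subst F n g (output_matrix n s')" if iso: "poly_iso F n f g"
          proof
            note A = sound[OF complete[OF iso]]
            have mA: "mat n ?A" using A(1) by (auto simp: GL_def mat_def)
            obtain B where B: "mat n B" "\<And>i j. i < n \<Longrightarrow> j < n \<Longrightarrow> mm n ?A B i j = idm i j \<and> mm n B ?A i j = idm i j"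
              using A(1) unfolding GL_def mat_def mm_def by auto
            have "mm n (output_matrix n s') B i j = idm i j" "mm n B (output_matrix n s') i j = idm i j" if ij: "i < n" "j < n" for i j
              using mm_cong[OF mA B(1) outA _ ij, of B] mm_cong[OF B(1) mA _ outA ij, of B] B(2)[OF ij] by simp_all
            moreover have "mat n (output_matrix n s')" using mA outA by (simp add: mat_def)
            ultimately show "output_matrix n s' \<in> GL n F"
              using B(1) unfolding GL_def mat_def mm_def by (intro CollectI conjI exI[of _ B]) auto
            show "f = lin_subst F n g (output_matrix n s')" using A(2) lin_subst_cong[OF g mA outA] by simp
          qed
          then show ?thesis unfolding answers_correctly_def using x(1) iso unfolding q by blast
        qed
        then show "\<not> (\<exists>g\<in>polys F n D. \<not> answers_correctly c F q n D f g)" by blast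
      qed (use True assms finD dD in \<open>auto simp: s_def\<close>)
      then show ?thesis using True q0 unfolding q by (simp add: e_def powr_realpow)
    qed
  qed
  ultimately show ?thesis by blast
qed

end
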